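(* Let $\alpha,\beta,\gamma\in\mathbb{R}$ satisfy $\alpha>-\frac12$, $\gamma>-1$ and $\alpha+\beta+\gamma>-\frac32$, and let $\theta>0$. Let $X$ be the continuous modification of $$X_t=\int_0^t s^{\alpha}\int_s^t u^{\beta}(u-s)^{\gamma}\,du\,dW_s,\qquad t\ge 0,$$ where $W$ is a Wiener process, let $Z$ be the solution of $Z_t=\theta\int_0^t Z_s\,ds+X_t$, $t\ge0$, and let $$\hat\theta_T=\frac{Z_T^2}{2\int_0^T Z_s^2\,ds},\qquad \eta_\infty=\int_0^\infty e^{-\theta s}X_s\,ds.$$ 1. If $\gamma\in(-1,-\frac12)$, then $$\frac{e^{\theta T}}{T^{\alpha+\beta}}\bigl(\hat\theta_T-\theta\bigr)\xrightarrow{d}\frac{2\sigma}{\theta^{\gamma+3/2}\sqrt{\mathsf{E}\eta_\infty^2}}\,\mathcal{C}(1)\quad\text{as }T\to\infty,$$ where $\sigma=\sigma(\gamma)=\sqrt{\dfrac{\Gamma(\gamma+1)\Gamma(-2\gamma-1)\Gamma(2\gamma+2)}{\Gamma(-\gamma)}}$. 2. If $\gamma=-\frac12$, then $$\frac{e^{\theta T}}{T^{\alpha+\beta}\sqrt{\log T}}\bigl(\hat\theta_T-\theta\bigr)\xrightarrow{d}\frac{2}{\theta\sqrt{\mathsf{E}\eta_\infty^2}}\,\mathcal{C}(1)\quad\text{as }T\to\infty.$$ 3. If $\gamma>-\frac12$, then $$\frac{e^{\theta T}}{T^{\alpha+\beta+\gamma+1/2}}\bigl(\hat\theta_T-\theta\bigr)\xrightarrow{d}\frac{2\varsigma}{\theta\sqrt{\mathsf{E}\eta_\infty^2}}\,\mathcal{C}(1)\quad\text{as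 }T\to\infty,$$ where $\varsigma=\varsigma(\alpha,\gamma)=\sqrt{\dfrac{\Gamma(2\alpha+1)\Gamma(2\gamma+1)}{\Gamma(2\alpha+2\gamma+2)}}$.
   Context: $W=\{W_t,\ t\ge0\}$ is a standard Wiener process, and the outer integral defining $X_t$ is the Wiener integral of the deterministic kernel $K(t,s)=s^\alpha\int_s^t u^\beta(u-s)^\gamma\,du$, $0<s<t$ (with $X_0=0$). Under the stated conditions on $\alpha,\beta,\gamma$ the process $X$ is well defined and has a modification whose paths are (locally) Hölder continuous of every order less than $\lambda=\min(\alpha+\beta+\gamma+\frac32,\ \gamma+\frac32,\ 1)>0$ (known fact); this modification is used. The solution is $Z_t=e^{\theta t}\int_0^t e^{-\theta s}\,dX_s$ (pathwise Riemann–Stieltjes integral). The random variable $\eta_\infty$ is well defined as the a.s. and $L_2(\Omega)$ limit of $\int_0^t e^{-\theta s}X_s\,ds$ as $t\to\infty$. $\xrightarrow{d}$ denotes convergence in distribution, and $\mathcal{C}(1)$ is the standard Cauchy distribution with density $\frac{1}{\pi(1+x^2)}$, $x\in\mathbb{R}$; $k\,\mathcal{C}(1)$ denotes the law of $k$ times a standard Cauchy random variable. $\Gamma$ is the gamma function. *)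

theory Defs
  imports "HOL-Probability.Probability"
begin

text \<open>Processes are indexed by real times; only times \<open>t \<ge> 0\<close> are constrained.\<close>

definition standard_wiener :: "'a measure \<Rightarrow> (real \<Rightarrow> 'a \<Rightarrow> real) \<Rightarrow> bool" where
  "standard_wiener M W \<longleftrightarrow>
     prob_space M \<and>
     (\<forall>t\<ge>0. W t \<in> borel_measurable M) \<and>
     (AE \<omega> in M. W 0 \<omega> = 0) \<and>
     (\<forall>s t. 0 \<le> s \<and> s < t \<longrightarrow>
        distributed M lborel (\<lambda>\<omega>. W t \<omega> - W s \<omega>) (normal_density 0 (sqrt (t - s)))) \<and>
     (\<forall>\<tau> :: nat \<Rightarrow> real. \<forall>n :: nat. 0 \<le> \<tau> 0 \<and> strict_mono \<tau> \<longrightarrow>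
        prob_space.indep_vars M (\<lambda>_. borel) (\<lambda>i \<omega>. W (\<tau> (Suc i)) \<omega> - W (\<tau> i) \<omega>) {..<n}) \<and>
     (AE \<omega> in M. continuous_on {0..} (\<lambda>t. W t \<omega>))"

definition step_fun :: "nat \<Rightarrow> (nat \<Rightarrow> real) \<Rightarrow> (nat \<Rightarrow> real) \<Rightarrow> real \<Rightarrow> real" where
  "step_fun N \<tau> c s = (\<Sum>i<N. c i * indicator {\<tau> i<..\<tau> (Suc i)} s)"

definition step_wiener_integral ::
  "(real \<Rightarrow> 'a \<Rightarrow> real) \<Rightarrow> nat \<Rightarrow> (nat \<Rightarrow> real) \<Rightarrow> (nat \<Rightarrow> real) \<Rightarrow> 'a \<Rightarrow> real" where
  "step_wiener_integral W N \<tau> c \<omega> = (\<Sum>i<N. c i * (W (\<tau> (Suc i)) \<omega> - W (\<tau> i) \<omega>))"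

text \<open>
  \<open>has_wiener_integral M W t f Y\<close>: the random variable \<open>Y\<close> is a version of the Wiener integral of
  the deterministic function \<open>f\<close> over \<open>[0, t]\<close>, i.e. the mean-square limit of the integrals of
  step functions converging to \<open>f\<close> in \<open>L\<^sub>2[0, t]\<close>. By the Ito isometry this determines \<open>Y\<close> up to
  almost sure equality and does not depend on the approximating sequence. It is a relation
  because the integral is only an equivalence class. Square integrability of \<open>f\<close> is implied.
\<close>
definition has_wiener_integral ::
  "'a measure \<Rightarrow> (real \<Rightarrow> 'a \<Rightarrow> real) \<Rightarrow> real \<Rightarrow> (real \<Rightarrow> real) \<Rightarrow> ('a \<Rightarrow> real) \<Rightarrow> bool" where
  "has_wiener_integral M W t f Y \<longleftrightarrow>
     set_borel_measurable lborel {0..t} f \<and>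
     Y \<in> borel_measurable M \<and>
     (\<exists>(N :: nat \<Rightarrow> nat) (\<tau> :: nat \<Rightarrow> nat \<Rightarrow> real) (c :: nat \<Rightarrow> nat \<Rightarrow> real).
        (\<forall>n. mono (\<tau> n) \<and> range (\<tau> n) \<subseteq> {0..t}) \<and>
        (\<lambda>n. \<integral>\<^sup>+ s \<in> {0..t}. ennreal ((f s - step_fun (N n) (\<tau> n) (c n) s)\<^sup>2) \<partial>lborel)
          \<longlonglongrightarrow> 0 \<and>
        (\<lambda>n. \<integral>\<^sup>+ \<omega>. ennreal ((Y \<omega> - step_wiener_integral W (N n) (\<tau> n) (c n) \<omega>)\<^sup>2) \<partial>M)
          \<longlonglongrightarrow> 0)"

definition volterra_kernel :: "real \<Rightarrow> real \<Rightarrow> real \<Rightarrow> real \<Rightarrow> real \<Rightarrow> real" where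
  "volterra_kernel \<alpha> \<beta> \<gamma> t s =
     s powr \<alpha> * (LBINT u:{s..t}. u powr \<beta> * (u - s) powr \<gamma>)"

text \<open>
  Since \<open>X t\<close> may be any version of the Wiener integral for each \<open>t\<close>, the first conjunct says that
  \<open>X\<close> is a modification of the Volterra process, and the last one selects the continuous modification.
\<close>
definition continuous_volterra_process ::
  "'a measure \<Rightarrow> (real \<Rightarrow> 'a \<Rightarrow> real) \<Rightarrow> real \<Rightarrow> real \<Rightarrow> real \<Rightarrow> (real \<Rightarrow> 'a \<Rightarrow> real) \<Rightarrow> bool" where
  "continuous_volterra_process M W \<alpha> \<beta> \<gamma> X \<longleftrightarrow>
     (\<forall>t\<ge>0. has_wiener_integral M W t (volterra_kernel \<alpha> \<beta> \<gamma> t) (X t)) \<and>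
     (\<forall>\<omega>\<in>space M. X 0 \<omega> = 0) \<and>
     (\<forall>\<omega>\<in>space M. continuous_on {0..} (\<lambda>t. X t \<omega>))"

text \<open>
  Pathwise solution of \<open>Z\<^sub>t = \<theta> \<integral>\<^sub>0\<^sup>t Z\<^sub>s ds + X\<^sub>t\<close>. Local integrability is needed because the
  Bochner integral of a non-integrable function is 0; with it the solution is unique on
  \<open>t \<ge> 0\<close> by Gronwall's inequality.
\<close>
definition langevin_solution ::
  "'a measure \<Rightarrow> real \<Rightarrow> (real \<Rightarrow> 'a \<Rightarrow> real) \<Rightarrow> (real \<Rightarrow> 'a \<Rightarrow> real) \<Rightarrow> bool" where
  "langevin_solution M \<theta> X Z \<longleftrightarrow>
     (\<forall>\<omega>\<in>space M. \<forall>t\<ge>0.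
        set_integrable lborel {0..t} (\<lambda>s. Z s \<omega>) \<and>
        Z t \<omega> = \<theta> * (LBINT s:{0..t}. Z s \<omega>) + X t \<omega>)"

definition theta_hat :: "(real \<Rightarrow> 'a \<Rightarrow> real) \<Rightarrow> real \<Rightarrow> 'a \<Rightarrow> real" where
  "theta_hat Z T \<omega> = (Z T \<omega>)\<^sup>2 / (2 * (LBINT s:{0..T}. (Z s \<omega>)\<^sup>2))"

definition eta_infinity :: "real \<Rightarrow> (real \<Rightarrow> 'a \<Rightarrow> real) \<Rightarrow> 'a \<Rightarrow> real" where
  "eta_infinity \<theta> X \<omega> = Lim at_top (\<lambda>t. LBINT s:{0..t}. exp (- \<theta> * s) * X s \<omega>)"

definition cauchy_law :: "real \<Rightarrow> real measure" where
  "cauchy_law k =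
     distr (density lborel (\<lambda>x. ennreal (1 / (pi * (1 + x\<^sup>2))))) borel (\<lambda>x. k * x)"

text \<open>Convergence in distribution along a continuous parameter \<open>T \<longlongrightarrow> \<infinity>\<close>; \<open>weak_conv_m\<close> covers
  sequences only.\<close>
definition conv_in_distr_at_top ::
  "'a measure \<Rightarrow> (real \<Rightarrow> 'a \<Rightarrow> real) \<Rightarrow> real measure \<Rightarrow> bool" where
  "conv_in_distr_at_top M Y L \<longleftrightarrow>
     (\<forall>\<tau>. filterlim \<tau> at_top sequentially \<longrightarrow>
        weak_conv_m (\<lambda>n. distr M borel (Y (\<tau> n))) L)"

definition sigma_const :: "real \<Rightarrow> real" where
  "sigma_const \<gamma> =
     sqrt (Gamma (\<gamma> + 1) * Gamma (- 2 * \<gamma> - 1) * Gamma (2 * \<gamma> + 2) / Gamma (- \<gamma>))"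

definition varsigma_const :: "real \<Rightarrow> real \<Rightarrow> real" where
  "varsigma_const \<alpha> \<gamma> =
     sqrt (Gamma (2 * \<alpha> + 1) * Gamma (2 * \<gamma> + 1) / Gamma (2 * \<alpha> + 2 * \<gamma> + 2))"

end

(*
Integration by parts gives Z(T) = theta e^(theta T) eta(T) + X(T), where eta(T) is the integral of
e^(-theta s) X(s) over [0, T], and eta(T) -> eta_inf almost surely. Since X grows slower than every
exponential, a pathwise expansion of numerator and denominator of the estimator yields
  e^(theta T) (theta_hat(T) - theta) = 2 U(T) / eta_inf + exponentially small terms,
  U(T) = e^(-theta T) * integral of e^(theta s) dX(s) over [0, T].
The pair (U(T), eta_inf) is centred jointly normal. Its covariances are double integrals of
(ab)^beta R(a,b) against exponential weights, where R(a,b) is the integral of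
r^(2 alpha) (a-r)^gamma (b-r)^gamma over 0 < r < min(a,b). The weight e^(-theta(T-a)) e^(-theta(T-b))
concentrates the variance of U(T) near a = b = T, so its order is governed by the behaviour of R near
the diagonal: homogeneity turns R(a,b) into a one-variable profile that at zero distance is finite,
logarithmic or of order |a-b|^(2 gamma + 1) according to the sign of gamma + 1/2. The normalised
covariance of U(T) and eta_inf tends to 0. Hence after removing the projection on eta_inf the ratio
is exactly Cauchy with a convergent scale, and characteristic functions converge.
*)

theory Submission
  imports Defs "HOL-Real_Asymp.Real_Asymp"
begin

section \<open>Centred normal variables and the Cauchy law\<close>

text \<open>The integral against dX is never formed. Integration by parts turns U(T) into the mean
  of X(T) - X(T - v) over an exponential lag v, and theta eta_inf is the mean of X over an
  exponential time; every covariance is thus an average of covariances of increments. As the kernel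
  of X increases in t, these are integrals of one nonnegative density over rectangles, and all
  exchanges are instances of Tonelli in \<open>ennreal\<close>. Extended values are essential: for
  \<gamma> \<le> -1/2 the density is infinite on the diagonal. The growth of X is read off its
  second moment alone, a power of t by self-similarity. This makes exp(-\<delta> s) (1 + X(s)^2)
  integrable on almost every path, which controls all integrals, but bounds the single value
  X(\<tau> n) only along a subsequence. Hence the estimator is compared with its limiting ratio
  through subsequences of subsequences, at the level of characteristic functions. Normality is
  encoded by characteristic functions: this admits variance 0 and survives almost sure limits, by
  which U(T) and eta_inf arise from finitely many values of X.\<close>

definition centered_normal :: "'a measure \<Rightarrow> real \<Rightarrow> ('a \<Rightarrow> real) \<Rightarrow> bool" where
  "centered_normal M v Y \<longleftrightarrow> Y \<in> borel_measurable M \<and> 0 \<le> v \<and>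
     (\<forall>u. char (distr M borel Y) u = complex_of_real (exp (- (v * u\<^sup>2 / 2))))"

lemma char_distr:
  assumes "Y \<in> borel_measurable M"
  shows "char (distr M borel Y) u = (CLINT \<omega>|M. iexp (u * Y \<omega>))"
  using assms by (simp add: char_def integral_distr)

text \<open>The chord of the unit circle is no longer than the arc.\<close>

lemma norm_iexp_diff_le: "cmod (iexp a - iexp b) \<le> \<bar>a - b\<bar>"
proof -
  have "cmod (iexp a - iexp b) = cmod (iexp b * (iexp (a - b) - 1))"
    by (simp add: algebra_simps exp_diff)
  also have "\<dots> = cmod (iexp (a - b) - 1)" by (simp add: norm_mult)
  also have "\<dots> \<le> \<bar>a - b\<bar>"
    using iexp_approx1[of "a - b" 0] by simp
  finally show ?thesis .
qed

lemma normal_density_distr: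
  assumes "\<sigma> > 0"
  shows "distr std_normal_distribution borel (\<lambda>x. \<sigma> * x) = density lborel (normal_density 0 \<sigma>)"
proof -
  interpret prob_space std_normal_distribution
    by (rule prob_space_normal_density) simp
  have "distributed std_normal_distribution lborel (\<lambda>x. x) (normal_density 0 1)"
    by (auto simp: distributed_def distr_id2)
  from normal_density_affine[OF this, of \<sigma> 0] assms
  have "distributed std_normal_distribution lborel (\<lambda>x. \<sigma> * x) (normal_density 0 \<sigma>)" by simp
  then show ?thesis by (simp add: distributed_def cong: distr_cong)
qed

lemma char_normal:
  assumes "\<sigma> > 0"
  shows "char (density lborel (normal_density 0 \<sigma>)) u = complex_of_real (exp (- (\<sigma>\<^sup>2 * u\<^sup>2 / 2)))"
proof -
  have "char (density lborel (normal_density 0 \<sigma>)) u = (CLINT x|std_normal_distribution. iexp (u * (\<sigma> * x)))"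
    by (subst normal_density_distr[OF assms, symmetric], subst char_distr) auto
  also have "\<dots> = char std_normal_distribution (u * \<sigma>)" by (simp add: char_def mult.assoc)
  also have "\<dots> = complex_of_real (exp (- (\<sigma>\<^sup>2 * u\<^sup>2 / 2)))"
    by (simp add: char_std_normal_distribution power_mult_distrib mult.commute)
  finally show ?thesis .
qed

context prob_space begin

lemma centered_normal_law:
  assumes "centered_normal M v Y" "v > 0"
  shows "distributed M lborel Y (normal_density 0 (sqrt v))"
proof -
  have [measurable]: "Y \<in> borel_measurable M" using assms by (simp add: centered_normal_def)
  have "distr M borel Y = density lborel (normal_density 0 (sqrt v))"
  proof (rule Levy_uniqueness)
    show "real_distribution (distr M borel Y)" by (rule real_distribution_distr) simp
    have "prob_space (density lborel (normal_density 0 (sqrt v)))"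
      using assms by (intro prob_space_normal_density) simp
    then show "real_distribution (density lborel (normal_density 0 (sqrt v)))"
      by (intro real_distribution.intro real_distribution_axioms.intro) auto
    show "char (distr M borel Y) = char (density lborel (normal_density 0 (sqrt v)))"
      using assms by (auto simp: centered_normal_def char_normal)
  qed
  then show ?thesis by (simp add: distributed_def cong: distr_cong)
qed

text \<open>The characteristic function is constantly 1, so the law is that of the constant
  0.\<close>

lemma centered_normal_0:
  assumes "centered_normal M 0 Y"
  shows "AE \<omega> in M. Y \<omega> = 0"
proof -
  have [measurable]: "Y \<in> borel_measurable M" using assms by (simp add: centered_normal_def)
  have eq: "distr M borel Y = distr M borel (\<lambda>_. 0)"
  proof (rule Levy_uniqueness)
    show "char (distr M borel Y) = char (distr M borel (\<lambda>_. 0))"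
    proof
      fix u
      have "char (distr M borel (\<lambda>_. 0)) u = 1"
        by (subst char_distr) (auto simp: prob_space)
      then show "char (distr M borel Y) u = char (distr M borel (\<lambda>_. 0)) u"
        using assms by (simp add: centered_normal_def)
    qed
  qed (intro real_distribution_distr; measurable)+
  have "AE x in distr M borel Y. x = 0"
    unfolding eq by (subst AE_distr_iff) auto
  then show ?thesis by (subst (asm) AE_distr_iff) auto
qed

lemma centered_normal_moment:
  assumes "centered_normal M v Y"
  shows "integrable M (\<lambda>\<omega>. (Y \<omega>)\<^sup>2)" "(\<integral>\<omega>. (Y \<omega>)\<^sup>2 \<partial>M) = v"
proof -
  have [measurable]: "Y \<in> borel_measurable M" and v: "v \<ge> 0"
    using assms by (simp_all add: centered_normal_def)
  have "integrable M (\<lambda>\<omega>. (Y \<omega>)\<^sup>2) \<and> (\<integral>\<omega>. (Y \<omega>)\<^sup>2 \<partial>M) = v"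
  \<comment> \<open>A normal density exists only for positive variance; the degenerate case is
    settled almost surely.\<close>
  proof (cases "v = 0")
    case True
    then have ae: "AE \<omega> in M. (Y \<omega>)\<^sup>2 = 0" using centered_normal_0 assms by auto
    have "integrable M (\<lambda>\<omega>. (Y \<omega>)\<^sup>2) = integrable M (\<lambda>\<omega>. 0::real)"
      using ae by (intro integrable_cong_AE) auto
    moreover have "(\<integral>\<omega>. (Y \<omega>)\<^sup>2 \<partial>M) = (\<integral>\<omega>. 0 \<partial>M)"
      using ae by (intro integral_cong_AE) auto
    ultimately show ?thesis using True by simp
  next
    case False
    then have pos: "v > 0" using v by simp
    have D: "distributed M lborel Y (normal_density 0 (sqrt v))"
      using centered_normal_law assms pos by blast
    have i: "integrable lborel (\<lambda>x. normal_density 0 (sqrt v) x * x\<^sup>2)"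
      using integrable_normal_moment[of "sqrt v" 0 2] pos by simp
    have e: "(\<integral>x. normal_density 0 (sqrt v) x * x\<^sup>2 \<partial>lborel) = v"
      using integral_normal_moment_even[of "sqrt v" 0 1] pos by (simp add: fact_numeral)
    show ?thesis
      using distributed_integrable[OF D, of "\<lambda>x. x\<^sup>2"] distributed_integral[OF D, of "\<lambda>x. x\<^sup>2"] i e by simp
  qed
  then show "integrable M (\<lambda>\<omega>. (Y \<omega>)\<^sup>2)" "(\<integral>\<omega>. (Y \<omega>)\<^sup>2 \<partial>M) = v" by auto
qed

text \<open>Convergence of the variances is extracted from that of the variables. By dominated
  convergence exp(-v_n u^2/2) tends to the characteristic function of the limit at every u; the
  latter is positive at some u \<noteq> 0, and there the logarithm recovers the limit of
  v_n.\<close>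

lemma centered_normal_AE_limit:
  assumes Yn: "\<And>n. centered_normal M (v n) (Yn n)"
    and [measurable]: "Y \<in> borel_measurable M"
    and lim: "AE \<omega> in M. (\<lambda>n. Yn n \<omega>) \<longlonglongrightarrow> Y \<omega>"
  shows "\<exists>w. centered_normal M w Y"
proof -
  have [measurable]: "Yn n \<in> borel_measurable M" for n
    using Yn by (simp add: centered_normal_def)
  have v0: "v n \<ge> 0" for n using Yn by (simp add: centered_normal_def)
  interpret D: real_distribution "distr M borel Y" by (rule real_distribution_distr) simp
  have conv: "(\<lambda>n. complex_of_real (exp (- (v n * u\<^sup>2 / 2)))) \<longlonglongrightarrow> char (distr M borel Y) u" for u
  proof -
    have "(\<lambda>n. CLINT \<omega>|M. iexp (u * Yn n \<omega>)) \<longlonglongrightarrow> (CLINT \<omega>|M. iexp (u * Y \<omega>))"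
    proof (rule integral_dominated_convergence[where w="\<lambda>_. 1"])
      show "AE \<omega> in M. (\<lambda>n. iexp (u * Yn n \<omega>)) \<longlonglongrightarrow> iexp (u * Y \<omega>)"
        using lim by eventually_elim (intro tendsto_intros)
    qed auto
    moreover have "(CLINT \<omega>|M. iexp (u * Yn n \<omega>)) = complex_of_real (exp (- (v n * u\<^sup>2 / 2)))" for n
      using Yn[of n] unfolding centered_normal_def by (subst char_distr[symmetric]) auto
    ultimately show ?thesis by (simp add: char_distr)
  qed
  have re: "(\<lambda>n. exp (- (v n * u\<^sup>2 / 2))) \<longlonglongrightarrow> Re (char (distr M borel Y) u)" for u
    using tendsto_Re[OF conv[of u]] by simp
  \<comment> \<open>Continuity at 0 with value 1 rules out the limit 0 that would arise from v_n
    tending to infinity.\<close>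
  have "isCont (\<lambda>u. Re (char (distr M borel Y) u)) 0"
    using D.isCont_char[of 0] by (intro isCont_Re) auto
  then have "((\<lambda>u. Re (char (distr M borel Y) u)) \<longlongrightarrow> 1) (at 0)"
    using D.char_zero by (simp add: isCont_def)
  then have "eventually (\<lambda>u. Re (char (distr M borel Y) u) > 0) (at 0)"
    by (rule order_tendstoD) simp
  then have "eventually (\<lambda>u. Re (char (distr M borel Y) u) > 0 \<and> u \<noteq> 0) (at 0)"
    using eventually_neq_at_within[of 0] by eventually_elim auto
  then obtain u where u: "Re (char (distr M borel Y) u) > 0" "u \<noteq> 0"
    using eventually_happens[of _ "at (0::real)"] by auto
  \<comment> \<open>Inverts \<open>exp (- (w * u\<^sup>2 / 2))\<close> at the chosen u.\<close>
  define w where "w = - 2 * ln (Re (char (distr M borel Y) u)) / u\<^sup>2"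
  have "(\<lambda>n. ln (exp (- (v n * u\<^sup>2 / 2)))) \<longlonglongrightarrow> ln (Re (char (distr M borel Y) u))"
    using u by (intro tendsto_ln re) auto
  then have "(\<lambda>n. - (v n * u\<^sup>2 / 2)) \<longlonglongrightarrow> ln (Re (char (distr M borel Y) u))" by simp
  then have "(\<lambda>n. (- 2 / u\<^sup>2) * - (v n * u\<^sup>2 / 2)) \<longlonglongrightarrow> (- 2 / u\<^sup>2) * ln (Re (char (distr M borel Y) u))"
    by (rule tendsto_mult_left)
  then have vw: "v \<longlonglongrightarrow> w" using u(2) by (simp add: w_def)
  have "w \<ge> 0" by (rule LIMSEQ_le_const[OF vw]) (use v0 in auto)
  moreover have "char (distr M borel Y) t = complex_of_real (exp (- (w * t\<^sup>2 / 2)))" for t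
    by (rule LIMSEQ_unique[OF conv]) (intro tendsto_intros vw, simp)
  ultimately have "centered_normal M w Y" by (simp add: centered_normal_def)
  then show ?thesis ..
qed

end

section \<open>The quotient of two independent normal variables\<close>

lemma nn_integral_abs_normal:
  fixes q :: real
  assumes "q > 0"
  shows "(\<integral>\<^sup>+y. ennreal (\<bar>y\<bar> * exp (- (q * y\<^sup>2 / 2))) \<partial>lborel) = ennreal (2 / q)"
proof -
  define s where "s = 1 / sqrt q"
  have s: "s > 0" "s\<^sup>2 = 1 / q" using assms by (auto simp: s_def power_divide)
  have eq: "\<bar>y\<bar> * exp (- (q * y\<^sup>2 / 2)) = sqrt (2 * pi * s\<^sup>2) * (normal_density 0 s y * \<bar>y\<bar>)" for y
    using s assms by (simp add: normal_density_def field_simps)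
  have "has_bochner_integral lborel (\<lambda>x. normal_density 0 s x * \<bar>x\<bar>) (s * sqrt (2 / pi))"
    using normal_moment_abs_odd[OF s(1), of 0 0] by simp
  then have "has_bochner_integral lborel (\<lambda>x. sqrt (2 * pi * s\<^sup>2) * (normal_density 0 s x * \<bar>x\<bar>))
      (sqrt (2 * pi * s\<^sup>2) * (s * sqrt (2 / pi)))"
    by (rule has_bochner_integral_mult_right)
  moreover have "sqrt (2 * pi * s\<^sup>2) * (s * sqrt (2 / pi)) = 2 / q"
  proof -
    have "sqrt (2 * pi * s\<^sup>2) * (s * sqrt (2 / pi)) = s\<^sup>2 * (sqrt (2 * pi) * sqrt (2 / pi))"
      using s(1) by (simp add: real_sqrt_mult power2_eq_square)
    also have "sqrt (2 * pi) * sqrt (2 / pi) = sqrt (2 * pi * (2 / pi))"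
      by (simp only: real_sqrt_mult)
    also have "2 * pi * (2 / pi) = (2::real)\<^sup>2" by (simp add: power2_eq_square)
    finally show ?thesis by (simp add: s)
  qed
  ultimately have "has_bochner_integral lborel (\<lambda>y. \<bar>y\<bar> * exp (- (q * y\<^sup>2 / 2))) (2 / q)"
    by (simp add: eq)
  then show ?thesis
    by (subst nn_integral_eq_integral) (auto simp: has_bochner_integral_iff)
qed

text \<open>Substitution x = z / k; the density is left in the form in which it comes out of the
  quotient of normal variables.\<close>

lemma emeasure_cauchy_law:
  assumes "k > 0" and [measurable]: "A \<in> sets borel"
  shows "emeasure (cauchy_law k) A = (\<integral>\<^sup>+z. ennreal (1 / (pi * (k * (1 + (z / k)\<^sup>2)))) * indicator A z \<partial>lborel)"
proof -
  have "emeasure (cauchy_law k) A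
      = (\<integral>\<^sup>+x. ennreal (1 / (pi * (1 + x\<^sup>2))) * indicator A (k * x) \<partial>lborel)"
    unfolding cauchy_law_def
    by (subst nn_integral_indicator[symmetric], simp, subst nn_integral_distr, simp, simp, subst nn_integral_density)
       (auto intro!: nn_integral_cong split: split_indicator)
  also have "\<dots> = ennreal \<bar>1 / k\<bar> * (\<integral>\<^sup>+z. ennreal (1 / (pi * (1 + (0 + (1 / k) * z)\<^sup>2))) * indicator A (k * (0 + (1 / k) * z)) \<partial>lborel)"
    using assms by (intro nn_integral_real_affine) auto
  also have "\<dots> = (\<integral>\<^sup>+z. ennreal (1 / (pi * (k * (1 + (z / k)\<^sup>2)))) * indicator A z \<partial>lborel)"
  proof -
    have "ennreal \<bar>1 / k\<bar> * ennreal (1 / (pi * (1 + (0 + (1 / k) * z)\<^sup>2))) = ennreal (1 / (pi * (k * (1 + (z / k)\<^sup>2))))" for z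
      using assms(1) by (subst ennreal_mult[symmetric]) (auto simp: mult_ac)
    then show ?thesis
      using assms(1)
      by (subst nn_integral_cmult[symmetric], measurable)
         (intro nn_integral_cong, simp add: mult.assoc[symmetric])
  qed
  finally show ?thesis .
qed

text \<open>For fixed y the substitution x = y z produces the Jacobian |y|. After exchanging the
  integrations, the inner integral over y is that of |y| exp(-q y^2/2) with q = z^2/v + 1/w, namely
  2/q, which is the Cauchy shape in z.\<close>

lemma distr_normal_ratio:
  assumes v: "v > 0" and w: "w > 0"
  shows "distr (density lborel (normal_density 0 (sqrt v)) \<Otimes>\<^sub>M density lborel (normal_density 0 (sqrt w)))
    borel (\<lambda>(x, y). x / y) = cauchy_law (sqrt (v / w))" (is "distr (?N \<Otimes>\<^sub>M ?N') borel _ = _")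
proof (rule measure_eqI)
  show "sets (distr (?N \<Otimes>\<^sub>M ?N') borel (\<lambda>(x, y). x / y)) = sets (cauchy_law (sqrt (v / w)))"
    by (simp add: cauchy_law_def)
  fix A assume "A \<in> sets (distr (?N \<Otimes>\<^sub>M ?N') borel (\<lambda>(x, y). x / y))"
  then have [measurable]: "A \<in> sets borel" by simp
  have pN: "prob_space ?N" "prob_space ?N'"
    using v w by (auto intro!: prob_space_normal_density)
  interpret N: prob_space ?N by fact
  interpret N': prob_space ?N' by fact
  interpret P: pair_sigma_finite ?N ?N' ..
  \<comment> \<open>Product of the normalising constants 1 / sqrt (2 pi v) and 1 / sqrt (2 pi
    w).\<close>
  define c where "c = 1 / (2 * pi * sqrt (v * w))"
  have c0: "c \<ge> 0" using v w by (simp add: c_def)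
  have "emeasure (distr (?N \<Otimes>\<^sub>M ?N') borel (\<lambda>(x, y). x / y)) A
      = (\<integral>\<^sup>+p. indicator A (fst p / snd p) \<partial>(?N \<Otimes>\<^sub>M ?N'))"
    by (subst nn_integral_indicator[symmetric], simp, subst nn_integral_distr)
       (auto simp: case_prod_beta)
  also have "\<dots> = (\<integral>\<^sup>+y. \<integral>\<^sup>+x. indicator A (x / y) \<partial>?N \<partial>?N')"
    by (subst P.nn_integral_snd[symmetric]) auto
  also have "\<dots> = (\<integral>\<^sup>+y. ennreal (normal_density 0 (sqrt w) y)
        * (\<integral>\<^sup>+x. ennreal (normal_density 0 (sqrt v) x) * indicator A (x / y) \<partial>lborel) \<partial>lborel)"
    by (simp add: nn_integral_density)
  also have "\<dots> = (\<integral>\<^sup>+y. ennreal (normal_density 0 (sqrt w) y)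
        * (ennreal \<bar>y\<bar> * (\<integral>\<^sup>+z. ennreal (normal_density 0 (sqrt v) (0 + y * z)) * indicator A ((0 + y * z) / y) \<partial>lborel)) \<partial>lborel)"
  \<comment> \<open>The scaling x = y z requires y \<noteq> 0, which holds outside a null
    set.\<close>
  proof (rule nn_integral_cong_AE)
    have "AE y in lborel. y \<noteq> (0::real)" by (rule AE_lborel_singleton)
    then show "AE y in lborel. ennreal (normal_density 0 (sqrt w) y)
        * (\<integral>\<^sup>+x. ennreal (normal_density 0 (sqrt v) x) * indicator A (x / y) \<partial>lborel) =
      ennreal (normal_density 0 (sqrt w) y)
        * (ennreal \<bar>y\<bar> * (\<integral>\<^sup>+z. ennreal (normal_density 0 (sqrt v) (0 + y * z)) * indicator A ((0 + y * z) / y) \<partial>lborel))"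
    proof eventually_elim
      case (elim y)
      show ?case
        by (subst nn_integral_real_affine[where c=y and t=0 and f="\<lambda>x. ennreal (normal_density 0 (sqrt v) x) * indicator A (x / y)"])
           (use elim in auto)
    qed
  qed
  also have "\<dots> = (\<integral>\<^sup>+y. \<integral>\<^sup>+z. ennreal c * (ennreal (\<bar>y\<bar> * exp (- ((z\<^sup>2 / v + 1 / w) * y\<^sup>2 / 2))) * indicator A z) \<partial>lborel \<partial>lborel)"
  proof (rule nn_integral_cong_AE)
    have "AE y in lborel. y \<noteq> (0::real)" by (rule AE_lborel_singleton)
    then show "AE y in lborel. ennreal (normal_density 0 (sqrt w) y)
        * (ennreal \<bar>y\<bar> * (\<integral>\<^sup>+z. ennreal (normal_density 0 (sqrt v) (0 + y * z)) * indicator A ((0 + y * z) / y) \<partial>lborel))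
      = (\<integral>\<^sup>+z. ennreal c * (ennreal (\<bar>y\<bar> * exp (- ((z\<^sup>2 / v + 1 / w) * y\<^sup>2 / 2))) * indicator A z) \<partial>lborel)"
    proof eventually_elim
      case (elim y)
      have "normal_density 0 (sqrt w) y * (\<bar>y\<bar> * normal_density 0 (sqrt v) (y * z))
          = c * (\<bar>y\<bar> * exp (- ((z\<^sup>2 / v + 1 / w) * y\<^sup>2 / 2)))" for z
      proof -
        have "exp (- y\<^sup>2 / (2 * w)) * exp (- (y * z)\<^sup>2 / (2 * v)) = exp (- ((z\<^sup>2 / v + 1 / w) * y\<^sup>2 / 2))"
          using v w by (subst exp_add[symmetric]) (simp add: field_simps)
        moreover have "1 / sqrt (2 * pi * w) * (1 / sqrt (2 * pi * v)) = c"
        proof -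
          have "sqrt (2 * pi * w) * sqrt (2 * pi * v) = sqrt ((2 * pi)\<^sup>2 * (v * w))"
            by (subst real_sqrt_mult[symmetric]) (simp add: power2_eq_square mult_ac)
          also have "\<dots> = 2 * pi * sqrt (v * w)" by (simp add: real_sqrt_mult)
          finally show ?thesis by (simp add: c_def)
        qed
        moreover have nd: "normal_density 0 (sqrt s) x = 1 / sqrt (2 * pi * s) * exp (- x\<^sup>2 / (2 * s))" if "s > 0" for s x
          using that by (simp add: normal_density_def)
        moreover have "(p * e) * (m * (p' * e')) = (p * p') * (m * (e * e'))" for p e m p' e' :: real
          by (simp only: mult_ac)
        ultimately show ?thesis
          by (simp only: nd[OF v] nd[OF w])
      qed
      then have "ennreal (normal_density 0 (sqrt w) y) * (ennreal \<bar>y\<bar> * ennreal (normal_density 0 (sqrt v) (y * z)))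
          = ennreal c * ennreal (\<bar>y\<bar> * exp (- ((z\<^sup>2 / v + 1 / w) * y\<^sup>2 / 2)))" for z
        using c0 by (simp add: ennreal_mult[symmetric])
      then show ?case
        using elim
        by (subst nn_integral_cmult[symmetric], simp, subst nn_integral_cmult[symmetric], simp)
           (auto intro!: nn_integral_cong simp: mult.assoc[symmetric])
    qed
  qed
  also have "\<dots> = (\<integral>\<^sup>+z. \<integral>\<^sup>+y. ennreal c * (ennreal (\<bar>y\<bar> * exp (- ((z\<^sup>2 / v + 1 / w) * y\<^sup>2 / 2))) * indicator A z) \<partial>lborel \<partial>lborel)"
    by (rule lborel_pair.Fubini') measurable
  also have "\<dots> = (\<integral>\<^sup>+z. ennreal (1 / (pi * (sqrt (v / w) * (1 + (z / sqrt (v / w))\<^sup>2)))) * indicator A z \<partial>lborel)"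
  proof (rule nn_integral_cong)
    fix z :: real
    have q: "z\<^sup>2 / v + 1 / w > 0" using v w by (intro add_nonneg_pos) auto
    have "c * (2 / (z\<^sup>2 / v + 1 / w)) = 1 / (pi * (sqrt (v * w) * (z\<^sup>2 / v + 1 / w)))"
      by (simp add: c_def)
    also have "sqrt (v * w) * (z\<^sup>2 / v + 1 / w) = sqrt (v / w) * (1 + (z / sqrt (v / w))\<^sup>2)"
    proof -
      have "sqrt (v * w) = sqrt (v / w) * w"
        using v w by (simp add: real_sqrt_mult real_sqrt_divide field_simps)
      then show ?thesis using v w by (simp add: power_divide field_simps)
    qed
    finally have e: "c * (2 / (z\<^sup>2 / v + 1 / w)) = 1 / (pi * (sqrt (v / w) * (1 + (z / sqrt (v / w))\<^sup>2)))" .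
    have "(\<integral>\<^sup>+y. ennreal c * (ennreal (\<bar>y\<bar> * exp (- ((z\<^sup>2 / v + 1 / w) * y\<^sup>2 / 2))) * indicator A z) \<partial>lborel)
       = ennreal c * (ennreal (2 / (z\<^sup>2 / v + 1 / w)) * indicator A z)"
      by (simp add: nn_integral_cmult nn_integral_multc nn_integral_abs_normal[OF q])
    also have "\<dots> = ennreal (c * (2 / (z\<^sup>2 / v + 1 / w))) * indicator A z"
      using c0 q by (subst ennreal_mult) (auto simp: mult.assoc)
    finally show "(\<integral>\<^sup>+y. ennreal c * (ennreal (\<bar>y\<bar> * exp (- ((z\<^sup>2 / v + 1 / w) * y\<^sup>2 / 2))) * indicator A z) \<partial>lborel)
       = ennreal (1 / (pi * (sqrt (v / w) * (1 + (z / sqrt (v / w))\<^sup>2)))) * indicator A z"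
      unfolding e .
  qed
  also have "\<dots> = emeasure (cauchy_law (sqrt (v / w))) A"
    using v w by (subst emeasure_cauchy_law) auto
  finally show "emeasure (distr (?N \<Otimes>\<^sub>M ?N') borel (\<lambda>(x, y). x / y)) A = emeasure (cauchy_law (sqrt (v / w))) A" .
qed

text \<open>The total mass is 1 because this is the law of the quotient of two independent standard
  normal variables.\<close>

lemma prob_space_cauchy_density: "prob_space (density lborel (\<lambda>x::real. ennreal (1 / (pi * (1 + x\<^sup>2)))))"
proof -
  let ?N = "density lborel (normal_density 0 (sqrt 1))"
  interpret N: prob_space ?N by (intro prob_space_normal_density) simp
  interpret P: pair_prob_space ?N ?N ..
  have "prob_space (distr (?N \<Otimes>\<^sub>M ?N) borel (\<lambda>(x, y). x / y))"
    by (intro P.prob_space_distr) simp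
  then have "prob_space (cauchy_law 1)"
    using distr_normal_ratio[of 1 1] by simp
  then show ?thesis by (simp add: cauchy_law_def distr_id2 cong: distr_cong)
qed

lemma real_distribution_cauchy_law: "real_distribution (cauchy_law k)"
  unfolding cauchy_law_def
  by (intro prob_space.real_distribution_distr prob_space_cauchy_density) simp

text \<open>All scales are expressed through one continuous function, so a convergent scale gives a
  convergent characteristic function.\<close>

lemma char_cauchy_law: "char (cauchy_law k) u = char (cauchy_law 1) (k * u)"
  unfolding cauchy_law_def char_def by (simp add: integral_distr mult_ac)

section \<open>Independence of uncorrelated jointly normal variables\<close>

context prob_space begin

lemma centered_normal_cos_sin:
  assumes "centered_normal M v Y"
  shows "(\<integral>\<omega>. cos (Y \<omega>) \<partial>M) = exp (- (v / 2))" "(\<integral>\<omega>. sin (Y \<omega>) \<partial>M) = 0"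
proof -
  have [measurable]: "Y \<in> borel_measurable M" using assms by (simp add: centered_normal_def)
  have i: "integrable M (\<lambda>\<omega>. iexp (Y \<omega>))"
    by (rule integrable_const_bound[of _ 1]) auto
  have "complex_of_real (exp (- (v * 1\<^sup>2 / 2))) = (CLINT \<omega>|M. iexp (1 * Y \<omega>))"
    using assms unfolding centered_normal_def by (subst char_distr[symmetric]) auto
  then have e: "(CLINT \<omega>|M. iexp (Y \<omega>)) = complex_of_real (exp (- (v / 2)))" by simp
  have "(\<integral>\<omega>. Re (iexp (Y \<omega>)) \<partial>M) = Re (CLINT \<omega>|M. iexp (Y \<omega>))"
    using i by (rule integral_Re)
  then show "(\<integral>\<omega>. cos (Y \<omega>) \<partial>M) = exp (- (v / 2))" by (simp add: e Re_exp Im_exp)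
  have "(\<integral>\<omega>. Im (iexp (Y \<omega>)) \<partial>M) = Im (CLINT \<omega>|M. iexp (Y \<omega>))"
    using i by (rule integral_Im)
  then show "(\<integral>\<omega>. sin (Y \<omega>) \<partial>M) = 0" by (simp add: e Re_exp Im_exp)
qed

text \<open>The weight \<open>2 + g\<close> is positive, so after normalisation it defines a probability measure
  under which \<open>Y\<close> has its original characteristic function.\<close>
lemma expectation_mult_indicator_eq:
  fixes g Y :: "'a \<Rightarrow> real"
  assumes [measurable]: "g \<in> borel_measurable M" "Y \<in> borel_measurable M" "B \<in> sets borel"
    and g1: "\<And>\<omega>. \<bar>g \<omega>\<bar> \<le> 1"
    and c: "\<And>b. (\<integral>\<omega>. g \<omega> * cos (b * Y \<omega>) \<partial>M) = (\<integral>\<omega>. g \<omega> \<partial>M) * (\<integral>\<omega>. cos (b * Y \<omega>) \<partial>M)"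
    and s: "\<And>b. (\<integral>\<omega>. g \<omega> * sin (b * Y \<omega>) \<partial>M) = (\<integral>\<omega>. g \<omega> \<partial>M) * (\<integral>\<omega>. sin (b * Y \<omega>) \<partial>M)"
  shows "(\<integral>\<omega>. g \<omega> * indicator B (Y \<omega>) \<partial>M) = (\<integral>\<omega>. g \<omega> \<partial>M) * (\<integral>\<omega>. indicator B (Y \<omega>) \<partial>M)"
proof -
  have ig: "integrable M g" by (rule integrable_const_bound[of _ 1]) (simp_all add: g1)
  have g1': "-1 \<le> g \<omega>" "g \<omega> \<le> 1" for \<omega> using g1[of \<omega>] by auto
  have Eg: "(\<integral>\<omega>. g \<omega> \<partial>M) \<ge> -1"
    using integral_mono[of M "\<lambda>_. -1" g] ig g1' by (simp add: prob_space)
  \<comment> \<open>Total mass of the weight 2 + g; at least 1 since g \<ge> -1.\<close>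
  define m where "m = 2 + (\<integral>\<omega>. g \<omega> \<partial>M)"
  have m: "m > 0" using Eg by (simp add: m_def)
  define d where "d = (\<lambda>\<omega>. (2 + g \<omega>) / m)"
  have d0: "d \<omega> \<ge> 0" for \<omega> using g1'(1)[of \<omega>] m by (auto simp: d_def)
  have [measurable]: "d \<in> borel_measurable M" by (simp add: d_def)
  have Id: "integrable M d" using ig by (auto simp: d_def)
  have Ed: "(\<integral>\<omega>. d \<omega> \<partial>M) = 1" using m ig by (simp add: d_def m_def prob_space)
  define N where "N = density M (\<lambda>\<omega>. ennreal (d \<omega>))"
  have pN: "prob_space N"
  proof
    show "emeasure N (space N) = 1"
      using nn_integral_eq_integral[OF Id] d0 Ed by (simp add: N_def emeasure_density)
  qed
  interpret N: prob_space N by fact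
  have [measurable_cong]: "sets N = sets M" by (simp add: N_def)
  have bnd: "integrable M (\<lambda>\<omega>. g \<omega> * f \<omega>)" if [measurable]: "f \<in> borel_measurable M" and "\<And>\<omega>. \<bar>f \<omega>\<bar> \<le> 1" for f
    by (rule integrable_const_bound[of _ 1]) (simp_all add: g1 that(2) abs_mult mult_le_one)
  have bnd1: "integrable M f" if [measurable]: "f \<in> borel_measurable M" and "\<And>\<omega>. \<bar>f \<omega>\<bar> \<le> 1" for f :: "'a \<Rightarrow> real"
    by (rule integrable_const_bound[of _ 1]) (simp_all add: that(2))
  have red: "(\<integral>\<omega>. f \<omega> \<partial>N) = (2 * (\<integral>\<omega>. f \<omega> \<partial>M) + (\<integral>\<omega>. g \<omega> * f \<omega> \<partial>M)) / m"
    if [measurable]: "f \<in> borel_measurable M" and f: "\<And>\<omega>. \<bar>f \<omega>\<bar> \<le> 1" for f :: "'a \<Rightarrow> real"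
  proof -
    have "(\<integral>\<omega>. f \<omega> \<partial>N) = (\<integral>\<omega>. d \<omega> * f \<omega> \<partial>M)"
      unfolding N_def by (subst integral_density) (auto simp: d0)
    also have "\<dots> = (\<integral>\<omega>. (2 * f \<omega> + g \<omega> * f \<omega>) / m \<partial>M)"
      by (intro Bochner_Integration.integral_cong) (auto simp: d_def algebra_simps)
    also have "\<dots> = (2 * (\<integral>\<omega>. f \<omega> \<partial>M) + (\<integral>\<omega>. g \<omega> * f \<omega> \<partial>M)) / m"
      using bnd[OF that] bnd1[OF that] by simp
    finally show ?thesis .
  qed
  \<comment> \<open>Where the mean of g f factorises, the reweighted mean of f equals its original
    mean.\<close>
  have fin: "(2 * x + (\<integral>\<omega>. g \<omega> \<partial>M) * x) / m = x" for x
    using m by (simp add: m_def field_simps)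
  have "distr N borel Y = distr M borel Y"
  proof (rule Levy_uniqueness)
    show "real_distribution (distr N borel Y)" by (rule N.real_distribution_distr) simp
    show "real_distribution (distr M borel Y)" by (rule real_distribution_distr) simp
    show "char (distr N borel Y) = char (distr M borel Y)"
    proof
      fix b
      have iN: "integrable N (\<lambda>\<omega>. iexp (b * Y \<omega>))" by (rule N.integrable_const_bound[of _ 1]) auto
      have iM: "integrable M (\<lambda>\<omega>. iexp (b * Y \<omega>))" by (rule integrable_const_bound[of _ 1]) auto
      have "(CLINT \<omega>|N. iexp (b * Y \<omega>)) = (CLINT \<omega>|M. iexp (b * Y \<omega>))"
      proof (rule complex_eqI)
        have "Re (CLINT \<omega>|N. iexp (b * Y \<omega>)) = (\<integral>\<omega>. cos (b * Y \<omega>) \<partial>N)"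
          using integral_Re[OF iN] by (simp add: Re_exp)
        also have "\<dots> = (\<integral>\<omega>. cos (b * Y \<omega>) \<partial>M)"
          by (subst red) (auto simp: c fin)
        also have "\<dots> = Re (CLINT \<omega>|M. iexp (b * Y \<omega>))"
          using integral_Re[OF iM] by (simp add: Re_exp)
        finally show "Re (CLINT \<omega>|N. iexp (b * Y \<omega>)) = Re (CLINT \<omega>|M. iexp (b * Y \<omega>))" .
        have "Im (CLINT \<omega>|N. iexp (b * Y \<omega>)) = (\<integral>\<omega>. sin (b * Y \<omega>) \<partial>N)"
          using integral_Im[OF iN] by (simp add: Im_exp)
        also have "\<dots> = (\<integral>\<omega>. sin (b * Y \<omega>) \<partial>M)"
          by (subst red) (auto simp: s fin)
        also have "\<dots> = Im (CLINT \<omega>|M. iexp (b * Y \<omega>))"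
          using integral_Im[OF iM] by (simp add: Im_exp)
        finally show "Im (CLINT \<omega>|N. iexp (b * Y \<omega>)) = Im (CLINT \<omega>|M. iexp (b * Y \<omega>))" .
      qed
      then show "char (distr N borel Y) b = char (distr M borel Y) b"
        by (subst (1 2) char_distr) auto
    qed
  qed
  then have "(\<integral>x. indicator B x \<partial>distr N borel Y) = (\<integral>x. (indicator B x :: real) \<partial>distr M borel Y)" by simp
  then have eqB: "(\<integral>\<omega>. (indicator B (Y \<omega>)::real) \<partial>N) = (\<integral>\<omega>. indicator B (Y \<omega>) \<partial>M)"
    by (subst (asm) (1 2) integral_distr) auto
  \<comment> \<open>Undoing the normalisation turns equality of the two probabilities of B into the
    product formula.\<close>
  have "(2 * (\<integral>\<omega>. indicator B (Y \<omega>) \<partial>M) + (\<integral>\<omega>. g \<omega> * indicator B (Y \<omega>) \<partial>M)) / m = (\<integral>\<omega>. indicator B (Y \<omega>) \<partial>M)"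
    using red[of "\<lambda>\<omega>. indicator B (Y \<omega>)"] eqB by (simp split: split_indicator)
  then have "2 * (\<integral>\<omega>. indicator B (Y \<omega>) \<partial>M) + (\<integral>\<omega>. g \<omega> * indicator B (Y \<omega>) \<partial>M) = m * (\<integral>\<omega>. indicator B (Y \<omega>) \<partial>M)"
    using m by (simp add: field_simps)
  then show ?thesis by (simp add: m_def algebra_simps)
qed

text \<open>The variance contains no mixed term in a b, so the joint characteristic function
  factorises; the addition formulas transfer this to the four products of cosines and sines. The
  reweighting argument then replaces trigonometric functions by indicators, one variable at a
  time.\<close>

lemma jointly_normal_joint_distr:
  assumes N: "\<And>a b. centered_normal M (a\<^sup>2 * v + b\<^sup>2 * w) (\<lambda>\<omega>. a * X \<omega> + b * Y \<omega>)"
  shows "distr M (borel \<Otimes>\<^sub>M borel) (\<lambda>\<omega>. (X \<omega>, Y \<omega>)) = distr M borel X \<Otimes>\<^sub>M distr M borel Y"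
proof -
  have X[measurable]: "X \<in> borel_measurable M" and Y[measurable]: "Y \<in> borel_measurable M"
    using N[of 1 0] N[of 0 1] by (auto simp: centered_normal_def)
  have cs: "(\<integral>\<omega>. cos (a * X \<omega> + b * Y \<omega>) \<partial>M) = exp (- ((a\<^sup>2 * v + b\<^sup>2 * w) / 2))"
      "(\<integral>\<omega>. sin (a * X \<omega> + b * Y \<omega>) \<partial>M) = 0" for a b
    using centered_normal_cos_sin[OF N] by auto
  have csX: "(\<integral>\<omega>. cos (a * X \<omega>) \<partial>M) = exp (- (a\<^sup>2 * v / 2))" "(\<integral>\<omega>. sin (a * X \<omega>) \<partial>M) = 0" for a
    using cs[of a 0] by auto
  have csY: "(\<integral>\<omega>. cos (b * Y \<omega>) \<partial>M) = exp (- (b\<^sup>2 * w / 2))" "(\<integral>\<omega>. sin (b * Y \<omega>) \<partial>M) = 0" for b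
    using cs[of 0 b] by auto
  have bnd: "integrable M f" if [measurable]: "f \<in> borel_measurable M" and "\<And>\<omega>. \<bar>f \<omega>\<bar> \<le> 1" for f :: "'a \<Rightarrow> real"
    by (rule integrable_const_bound[of _ 1]) (simp_all add: that(2))
  have ii: "integrable M (\<lambda>\<omega>. cos (a * X \<omega> + b * Y \<omega>))" "integrable M (\<lambda>\<omega>. sin (a * X \<omega> + b * Y \<omega>))" for a b
    by (auto intro!: bnd)
  have expm: "exp (- ((a\<^sup>2 * v + b\<^sup>2 * w) / 2)) = exp (- (a\<^sup>2 * v / 2)) * exp (- (b\<^sup>2 * w / 2))" for a b
    by (subst exp_add[symmetric]) (simp add: field_simps)
  have cc: "(\<integral>\<omega>. cos (a * X \<omega>) * cos (b * Y \<omega>) \<partial>M) = (\<integral>\<omega>. cos (a * X \<omega>) \<partial>M) * (\<integral>\<omega>. cos (b * Y \<omega>) \<partial>M)" for a b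
  proof -
    have "(\<integral>\<omega>. cos (a * X \<omega>) * cos (b * Y \<omega>) \<partial>M)
        = (\<integral>\<omega>. (cos (a * X \<omega> + b * Y \<omega>) + cos (a * X \<omega> + (- b) * Y \<omega>)) / 2 \<partial>M)"
      by (intro Bochner_Integration.integral_cong) (auto simp: cos_add sin_add cos_diff sin_diff)
    also have "\<dots> = exp (- ((a\<^sup>2 * v + b\<^sup>2 * w) / 2))"
      using ii[of a b] ii[of a "-b"] cs[of a b] cs[of a "-b"] by simp
    finally show ?thesis by (simp only: csX csY expm)
  qed
  have ss: "(\<integral>\<omega>. sin (a * X \<omega>) * sin (b * Y \<omega>) \<partial>M) = (\<integral>\<omega>. sin (a * X \<omega>) \<partial>M) * (\<integral>\<omega>. sin (b * Y \<omega>) \<partial>M)" for a b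
  proof -
    have "(\<integral>\<omega>. sin (a * X \<omega>) * sin (b * Y \<omega>) \<partial>M)
        = (\<integral>\<omega>. (cos (a * X \<omega> + (-b) * Y \<omega>) - cos (a * X \<omega> + b * Y \<omega>)) / 2 \<partial>M)"
      by (intro Bochner_Integration.integral_cong) (auto simp: cos_add sin_add cos_diff sin_diff)
    also have "\<dots> = 0"
      using ii[of a b] ii[of a "-b"] cs[of a b] cs[of a "-b"] by simp
    finally show ?thesis by (simp add: csX csY)
  qed
  have sc: "(\<integral>\<omega>. sin (a * X \<omega>) * cos (b * Y \<omega>) \<partial>M) = (\<integral>\<omega>. sin (a * X \<omega>) \<partial>M) * (\<integral>\<omega>. cos (b * Y \<omega>) \<partial>M)" for a b
  proof -
    have "(\<integral>\<omega>. sin (a * X \<omega>) * cos (b * Y \<omega>) \<partial>M)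
        = (\<integral>\<omega>. (sin (a * X \<omega> + b * Y \<omega>) + sin (a * X \<omega> + (- b) * Y \<omega>)) / 2 \<partial>M)"
      by (intro Bochner_Integration.integral_cong) (auto simp: cos_add sin_add cos_diff sin_diff)
    also have "\<dots> = 0"
      using ii[of a b] ii[of a "-b"] cs[of a b] cs[of a "-b"] by simp
    finally show ?thesis by (simp add: csX csY)
  qed
  have cs': "(\<integral>\<omega>. cos (a * X \<omega>) * sin (b * Y \<omega>) \<partial>M) = (\<integral>\<omega>. cos (a * X \<omega>) \<partial>M) * (\<integral>\<omega>. sin (b * Y \<omega>) \<partial>M)" for a b
  proof -
    have "(\<integral>\<omega>. cos (a * X \<omega>) * sin (b * Y \<omega>) \<partial>M)
        = (\<integral>\<omega>. (sin (a * X \<omega> + b * Y \<omega>) - sin (a * X \<omega> + (- b) * Y \<omega>)) / 2 \<partial>M)"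
      by (intro Bochner_Integration.integral_cong) (auto simp: cos_add sin_add cos_diff sin_diff)
    also have "\<dots> = 0"
      using ii[of a b] ii[of a "-b"] cs[of a b] cs[of a "-b"] by simp
    finally show ?thesis by (simp add: csX csY)
  qed
  have joint: "(\<integral>\<omega>. indicator B (Y \<omega>) * indicator A (X \<omega>) \<partial>M)
      = (\<integral>\<omega>. indicator B (Y \<omega>) \<partial>M) * (\<integral>\<omega>. (indicator A (X \<omega>) :: real) \<partial>M)"
    if [measurable]: "A \<in> sets borel" "B \<in> sets borel" for A B
  \<comment> \<open>Second use of the reweighting, now with weight
    \<open>indicator B (Y \<omega>)\<close>; its two hypotheses come from a first use with the
    weights cos (a X) and sin (a X).\<close>
  proof (rule expectation_mult_indicator_eq)
    fix a
    show "(\<integral>\<omega>. indicator B (Y \<omega>) * cos (a * X \<omega>) \<partial>M) = (\<integral>\<omega>. indicator B (Y \<omega>) \<partial>M) * (\<integral>\<omega>. cos (a * X \<omega>) \<partial>M)"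
      using expectation_mult_indicator_eq[OF _ _ \<open>B \<in> sets borel\<close> abs_cos_le_one cc cs', of a]
      by (simp add: mult.commute[of "indicator B _"] mult.commute[of "\<integral>\<omega>. indicator B (Y \<omega>) \<partial>M"])
    show "(\<integral>\<omega>. indicator B (Y \<omega>) * sin (a * X \<omega>) \<partial>M) = (\<integral>\<omega>. indicator B (Y \<omega>) \<partial>M) * (\<integral>\<omega>. sin (a * X \<omega>) \<partial>M)"
      using expectation_mult_indicator_eq[OF _ _ \<open>B \<in> sets borel\<close> abs_sin_le_one sc ss, of a]
      by (simp add: mult.commute[of "indicator B _"] mult.commute[of "\<integral>\<omega>. indicator B (Y \<omega>) \<partial>M"])
  qed (auto split: split_indicator)
  interpret DX: prob_space "distr M borel X" by (rule prob_space_distr) simp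
  interpret DY: prob_space "distr M borel Y" by (rule prob_space_distr) simp
  show ?thesis
  proof (rule pair_measure_eqI[symmetric])
    show "sigma_finite_measure (distr M borel X)" "sigma_finite_measure (distr M borel Y)" by unfold_locales
    show "sets (distr M borel X \<Otimes>\<^sub>M distr M borel Y) = sets (distr M (borel \<Otimes>\<^sub>M borel) (\<lambda>\<omega>. (X \<omega>, Y \<omega>)))"
      by (simp cong: sets_pair_measure_cong)
    fix A B assume "A \<in> sets (distr M borel X)" "B \<in> sets (distr M borel Y)"
    then have [measurable]: "A \<in> sets borel" "B \<in> sets borel" by auto
    have eI: "emeasure M {\<omega>\<in>space M. P \<omega>} = ennreal (\<integral>\<omega>. indicator {\<omega>. P \<omega>} \<omega> \<partial>M)"
      if "{\<omega>\<in>space M. P \<omega>} \<in> sets M" for P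
    proof -
      have "(\<integral>\<omega>. indicator {\<omega>. P \<omega>} \<omega> \<partial>M) = (\<integral>\<omega>. (indicator {\<omega>\<in>space M. P \<omega>} \<omega>::real) \<partial>M)"
        by (intro Bochner_Integration.integral_cong) (auto split: split_indicator)
      then show ?thesis using that by (simp add: emeasure_eq_measure)
    qed
    have "emeasure (distr M borel X) A * emeasure (distr M borel Y) B
        = emeasure M {\<omega>\<in>space M. X \<omega> \<in> A} * emeasure M {\<omega>\<in>space M. Y \<omega> \<in> B}"
      by (simp add: emeasure_distr vimage_def Int_def conj_commute)
    also have "\<dots> = ennreal (\<integral>\<omega>. indicator A (X \<omega>) \<partial>M) * ennreal (\<integral>\<omega>. indicator B (Y \<omega>) \<partial>M)"
      by (simp add: eI indicator_def)
    also have "\<dots> = ennreal (\<integral>\<omega>. indicator B (Y \<omega>) * indicator A (X \<omega>) \<partial>M)"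
      unfolding joint[OF \<open>A \<in> sets borel\<close> \<open>B \<in> sets borel\<close>]
      by (subst ennreal_mult) (auto simp: mult.commute intro!: integral_nonneg)
    also have "\<dots> = emeasure M {\<omega>\<in>space M. X \<omega> \<in> A \<and> Y \<omega> \<in> B}"
    proof -
      have "(\<lambda>\<omega>. indicator B (Y \<omega>) * indicator A (X \<omega>) :: real) = indicator {\<omega>. X \<omega> \<in> A \<and> Y \<omega> \<in> B}"
        by (auto simp: indicator_def fun_eq_iff)
      then show ?thesis by (subst eI) auto
    qed
    also have "\<dots> = emeasure (distr M (borel \<Otimes>\<^sub>M borel) (\<lambda>\<omega>. (X \<omega>, Y \<omega>))) (A \<times> B)"
    proof -
      have "{\<omega>\<in>space M. X \<omega> \<in> A \<and> Y \<omega> \<in> B} = (\<lambda>\<omega>. (X \<omega>, Y \<omega>)) -` (A \<times> B) \<inter> space M" by auto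
      then show ?thesis by (simp add: emeasure_distr)
    qed
    finally show "emeasure (distr M borel X) A * emeasure (distr M borel Y) B
      = emeasure (distr M (borel \<Otimes>\<^sub>M borel) (\<lambda>\<omega>. (X \<omega>, Y \<omega>))) (A \<times> B)" .
  qed
qed

lemma jointly_normal_ratio:
  assumes N: "\<And>a b. centered_normal M (a\<^sup>2 * v + b\<^sup>2 * w) (\<lambda>\<omega>. a * X \<omega> + b * Y \<omega>)"
    and v: "v > 0" and w: "w > 0"
  shows "distr M borel (\<lambda>\<omega>. X \<omega> / Y \<omega>) = cauchy_law (sqrt (v / w))"
proof -
  have NX: "centered_normal M v X" and NY: "centered_normal M w Y"
    using N[of 1 0] N[of 0 1] by auto
  then have [measurable]: "X \<in> borel_measurable M" "Y \<in> borel_measurable M"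
    by (auto simp: centered_normal_def)
  have "distr M borel (\<lambda>\<omega>. X \<omega> / Y \<omega>)
      = distr (distr M (borel \<Otimes>\<^sub>M borel) (\<lambda>\<omega>. (X \<omega>, Y \<omega>))) borel (\<lambda>(x, y). x / y)"
    by (subst distr_distr) (auto simp: comp_def)
  also have "\<dots> = distr (distr M borel X \<Otimes>\<^sub>M distr M borel Y) borel (\<lambda>(x, y). x / y)"
    by (simp add: jointly_normal_joint_distr[OF N])
  also have "distr M borel X = density lborel (normal_density 0 (sqrt v))"
    using centered_normal_law[OF NX v] by (simp add: distributed_def cong: distr_cong)
  also have "distr M borel Y = density lborel (normal_density 0 (sqrt w))"
    using centered_normal_law[OF NY w] by (simp add: distributed_def cong: distr_cong)
  finally show ?thesis by (simp add: distr_normal_ratio v w)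
qed

end

section \<open>Wiener integrals\<close>

text \<open>The Cauchy-Schwarz inequality in the index moves the square inside the finite
  sum.\<close>

lemma L2_tendsto_zero_sum:
  fixes g :: "'i \<Rightarrow> nat \<Rightarrow> 'b \<Rightarrow> real"
  assumes "finite I" and [measurable]: "\<And>i n. i \<in> I \<Longrightarrow> g i n \<in> borel_measurable N"
    and lim: "\<And>i. i \<in> I \<Longrightarrow> (\<lambda>n. \<integral>\<^sup>+x. ennreal ((g i n x)\<^sup>2) \<partial>N) \<longlonglongrightarrow> 0"
  shows "(\<lambda>n. \<integral>\<^sup>+x. ennreal ((\<Sum>i\<in>I. w i * g i n x)\<^sup>2) \<partial>N) \<longlonglongrightarrow> 0"
proof (rule tendsto_sandwich[OF _ _ tendsto_const])
  let ?K = "ennreal (\<Sum>i\<in>I. (w i)\<^sup>2)"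
  show "\<forall>\<^sub>F n in sequentially. (\<integral>\<^sup>+x. ennreal ((\<Sum>i\<in>I. w i * g i n x)\<^sup>2) \<partial>N)
      \<le> ?K * (\<Sum>i\<in>I. \<integral>\<^sup>+x. ennreal ((g i n x)\<^sup>2) \<partial>N)"
  proof (rule always_eventually, rule allI)
    fix n
    have "(\<integral>\<^sup>+x. ennreal ((\<Sum>i\<in>I. w i * g i n x)\<^sup>2) \<partial>N)
        \<le> (\<integral>\<^sup>+x. ?K * (\<Sum>i\<in>I. ennreal ((g i n x)\<^sup>2)) \<partial>N)"
      using Cauchy_Schwarz_ineq_sum[of w _ I]
      by (intro nn_integral_mono) (simp add: ennreal_mult[symmetric] sum_nonneg)
    also have "\<dots> = ?K * (\<Sum>i\<in>I. \<integral>\<^sup>+x. ennreal ((g i n x)\<^sup>2) \<partial>N)"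
      using assms(1) by (simp add: nn_integral_cmult nn_integral_sum del: sum_ennreal)
    finally show "(\<integral>\<^sup>+x. ennreal ((\<Sum>i\<in>I. w i * g i n x)\<^sup>2) \<partial>N)
      \<le> ?K * (\<Sum>i\<in>I. \<integral>\<^sup>+x. ennreal ((g i n x)\<^sup>2) \<partial>N)" .
  qed
  have "(\<lambda>n. ?K * (\<Sum>i\<in>I. \<integral>\<^sup>+x. ennreal ((g i n x)\<^sup>2) \<partial>N)) \<longlonglongrightarrow> ?K * (\<Sum>i\<in>I. 0)"
    by (intro ennreal_tendsto_cmult tendsto_sum lim) auto
  then show "(\<lambda>n. ?K * (\<Sum>i\<in>I. \<integral>\<^sup>+x. ennreal ((g i n x)\<^sup>2) \<partial>N)) \<longlonglongrightarrow> 0" by simp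
qed auto

text \<open>Rests on the pointwise bound |s^2 - f^2| \<le> (1 + 1/h) (f - s)^2 + h f^2 for every h >
  0, with h chosen after the required accuracy. Integrability of f^2 comes from a single index at
  which the distance is finite.\<close>

lemma L2_limit_integral:
  fixes f :: "'b \<Rightarrow> real" and s :: "nat \<Rightarrow> 'b \<Rightarrow> real"
  assumes [measurable]: "f \<in> borel_measurable N" "\<And>n. s n \<in> borel_measurable N"
    and s2: "\<And>n. integrable N (\<lambda>x. (s n x)\<^sup>2)"
    and lim: "(\<lambda>n. \<integral>\<^sup>+x. ennreal ((f x - s n x)\<^sup>2) \<partial>N) \<longlonglongrightarrow> 0"
  shows "integrable N (\<lambda>x. (f x)\<^sup>2)" "\<And>n. integrable N (\<lambda>x. (f x - s n x)\<^sup>2)"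
    "(\<lambda>n. \<integral>x. (s n x)\<^sup>2 \<partial>N) \<longlonglongrightarrow> (\<integral>x. (f x)\<^sup>2 \<partial>N)"
    "(\<lambda>n. \<integral>x. (f x - s n x)\<^sup>2 \<partial>N) \<longlonglongrightarrow> 0"
proof -
  have "\<forall>\<^sub>F n in sequentially. (\<integral>\<^sup>+x. ennreal ((f x - s n x)\<^sup>2) \<partial>N) < 1"
    using lim by (rule order_tendstoD) simp
  then obtain n where n: "(\<integral>\<^sup>+x. ennreal ((f x - s n x)\<^sup>2) \<partial>N) < 1"
    by (auto dest: eventually_happens)
  then have "integrable N (\<lambda>x. (f x - s n x)\<^sup>2)"
    by (intro integrableI_nonneg) (auto intro: less_trans)
  then have "integrable N (\<lambda>x. 2 * (f x - s n x)\<^sup>2 + 2 * (s n x)\<^sup>2)"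
    using s2[of n] by simp
  then show f2: "integrable N (\<lambda>x. (f x)\<^sup>2)"
  proof (rule Bochner_Integration.integrable_bound, simp, intro AE_I2)
    fix x
    have "0 \<le> (f x - 2 * s n x)\<^sup>2" by simp
    then have "(f x)\<^sup>2 \<le> 2 * (f x - s n x)\<^sup>2 + 2 * (s n x)\<^sup>2"
      by (simp add: power2_eq_square algebra_simps)
    then show "norm ((f x)\<^sup>2) \<le> norm (2 * (f x - s n x)\<^sup>2 + 2 * (s n x)\<^sup>2)"
      by simp
  qed
  show d2: "integrable N (\<lambda>x. (f x - s n x)\<^sup>2)" for n
  proof (rule Bochner_Integration.integrable_bound[of _ "\<lambda>x. 2 * (f x)\<^sup>2 + 2 * (s n x)\<^sup>2"])
    show "integrable N (\<lambda>x. 2 * (f x)\<^sup>2 + 2 * (s n x)\<^sup>2)" using f2 s2[of n] by simp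
    show "AE x in N. norm ((f x - s n x)\<^sup>2) \<le> norm (2 * (f x)\<^sup>2 + 2 * (s n x)\<^sup>2)"
    proof (intro AE_I2)
      fix x
      have "0 \<le> (f x + s n x)\<^sup>2" by simp
      then have "(f x - s n x)\<^sup>2 \<le> 2 * (f x)\<^sup>2 + 2 * (s n x)\<^sup>2"
        by (simp add: power2_eq_square algebra_simps)
      then show "norm ((f x - s n x)\<^sup>2) \<le> norm (2 * (f x)\<^sup>2 + 2 * (s n x)\<^sup>2)"
        by simp
    qed
  qed simp
  define D where "D n = (\<integral>x. (f x - s n x)\<^sup>2 \<partial>N)" for n
  have "(\<lambda>n. ennreal (D n)) \<longlonglongrightarrow> ennreal 0"
    using lim unfolding D_def by (simp add: nn_integral_eq_integral d2)
  then have D0: "D \<longlonglongrightarrow> 0"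
    by (subst (asm) tendsto_ennreal_iff) (auto simp: D_def intro!: integral_nonneg)
  then show "(\<lambda>n. \<integral>x. (f x - s n x)\<^sup>2 \<partial>N) \<longlonglongrightarrow> 0" unfolding D_def[symmetric] .
  define F where "F = (\<integral>x. (f x)\<^sup>2 \<partial>N)"
  have F0: "F \<ge> 0" by (simp add: F_def)
  have bound: "\<bar>(\<integral>x. (s n x)\<^sup>2 \<partial>N) - F\<bar> \<le> (1 + 1 / h) * D n + h * F" if h: "h > 0" for h n
  proof -
    have "\<bar>(\<integral>x. (s n x)\<^sup>2 \<partial>N) - F\<bar> = \<bar>\<integral>x. (s n x)\<^sup>2 - (f x)\<^sup>2 \<partial>N\<bar>"
      using s2[of n] f2 by (simp add: F_def)
    also have "\<dots> \<le> (\<integral>x. \<bar>(s n x)\<^sup>2 - (f x)\<^sup>2\<bar> \<partial>N)" by (rule integral_abs_bound)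
    also have "\<dots> \<le> (\<integral>x. (1 + 1 / h) * (f x - s n x)\<^sup>2 + h * (f x)\<^sup>2 \<partial>N)"
    proof (rule integral_mono)
      show "integrable N (\<lambda>x. \<bar>(s n x)\<^sup>2 - (f x)\<^sup>2\<bar>)" using s2[of n] f2 by simp
      show "integrable N (\<lambda>x. (1 + 1 / h) * (f x - s n x)\<^sup>2 + h * (f x)\<^sup>2)" using d2[of n] f2 by simp
      fix x
      define d where "d = f x - s n x"
      \<comment> \<open>The two signs of the weighted inequality 2 |f d| \<le> h f^2 + d^2 /
        h.\<close>
      have "0 \<le> (h * f x - d)\<^sup>2 / h" "0 \<le> (h * f x + d)\<^sup>2 / h" using h by auto
      then have "2 * (f x * d) \<le> h * (f x)\<^sup>2 + d\<^sup>2 / h" "- 2 * (f x * d) \<le> h * (f x)\<^sup>2 + d\<^sup>2 / h"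
        using h by (auto simp: power2_eq_square field_simps)
      moreover have "(s n x)\<^sup>2 - (f x)\<^sup>2 = d\<^sup>2 - 2 * (f x * d)"
        by (simp add: d_def power2_eq_square algebra_simps)
      moreover have "(1 + 1 / h) * (f x - s n x)\<^sup>2 + h * (f x)\<^sup>2 = d\<^sup>2 + d\<^sup>2 / h + h * (f x)\<^sup>2"
        by (simp add: d_def algebra_simps)
      moreover have "0 \<le> d\<^sup>2" by simp
      ultimately show "\<bar>(s n x)\<^sup>2 - (f x)\<^sup>2\<bar> \<le> (1 + 1 / h) * (f x - s n x)\<^sup>2 + h * (f x)\<^sup>2"
        by linarith
    qed
    also have "\<dots> = (1 + 1 / h) * D n + h * F"
      using d2[of n] f2 by (simp add: D_def F_def)
    finally show ?thesis .
  qed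
  show "(\<lambda>n. \<integral>x. (s n x)\<^sup>2 \<partial>N) \<longlonglongrightarrow> (\<integral>x. (f x)\<^sup>2 \<partial>N)"
    unfolding F_def[symmetric]
  proof (rule LIMSEQ_I)
    fix r :: real assume r: "r > 0"
    \<comment> \<open>Gives h F \<le> r/2; the summand 1 keeps the quotient meaningful when F =
      0.\<close>
    define h where "h = r / (2 * (F + 1))"
    have h: "h > 0" using r F0 by (simp add: h_def)
    have hF: "h * F \<le> r / 2" using r F0 by (simp add: h_def field_simps)
    have "(\<lambda>n. (1 + 1 / h) * D n) \<longlonglongrightarrow> (1 + 1 / h) * 0" by (intro tendsto_intros D0)
    then have "\<forall>\<^sub>F n in sequentially. (1 + 1 / h) * D n < r / 2"
      using r by (intro order_tendstoD) auto
    then obtain n0 where n0: "\<And>n. n \<ge> n0 \<Longrightarrow> (1 + 1 / h) * D n < r / 2"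
      by (auto simp: eventually_sequentially)
    show "\<exists>n0. \<forall>n\<ge>n0. norm ((\<integral>x. (s n x)\<^sup>2 \<partial>N) - F) < r"
    proof (intro exI allI impI)
      fix n assume "n \<ge> n0"
      then show "norm ((\<integral>x. (s n x)\<^sup>2 \<partial>N) - F) < r"
        using bound[OF h, of n] n0[of n] hF unfolding real_norm_def by linarith
    qed
  qed
qed

context prob_space begin

lemma centered_normal_scale:
  assumes "centered_normal M v Y"
  shows "centered_normal M (c\<^sup>2 * v) (\<lambda>\<omega>. c * Y \<omega>)"
proof -
  have [measurable]: "Y \<in> borel_measurable M" and v: "v \<ge> 0"
    using assms by (simp_all add: centered_normal_def)
  have "char (distr M borel (\<lambda>\<omega>. c * Y \<omega>)) u = char (distr M borel Y) (c * u)" for u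
    by (subst (1 2) char_distr) (auto simp: mult_ac)
  then show ?thesis
    using assms by (auto simp: centered_normal_def power_mult_distrib mult_ac)
qed

lemma centered_normal_indep_sum:
  assumes "finite I" and ind: "indep_vars (\<lambda>_. borel) Y I"
    and N: "\<And>i. i \<in> I \<Longrightarrow> centered_normal M (v i) (Y i)"
  shows "centered_normal M (\<Sum>i\<in>I. v i) (\<lambda>\<omega>. \<Sum>i\<in>I. Y i \<omega>)"
  unfolding centered_normal_def
proof (intro conjI allI)
  have "Y i \<in> borel_measurable M" if "i \<in> I" for i using N[OF that] by (simp add: centered_normal_def)
  then show "(\<lambda>\<omega>. \<Sum>i\<in>I. Y i \<omega>) \<in> borel_measurable M" by simp
  show "0 \<le> (\<Sum>i\<in>I. v i)" using N by (intro sum_nonneg) (simp add: centered_normal_def)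
  fix u
  have "char (distr M borel (\<lambda>\<omega>. \<Sum>i\<in>I. Y i \<omega>)) u = (\<Prod>i\<in>I. char (distr M borel (Y i)) u)"
    by (rule char_distr_sum[OF ind])
  also have "\<dots> = (\<Prod>i\<in>I. complex_of_real (exp (- (v i * u\<^sup>2 / 2))))"
    using N by (intro prod.cong) (auto simp: centered_normal_def)
  also have "\<dots> = complex_of_real (exp (\<Sum>i\<in>I. - (v i * u\<^sup>2 / 2)))"
    using assms(1) by (simp add: exp_sum)
  also have "(\<Sum>i\<in>I. - (v i * u\<^sup>2 / 2)) = - ((\<Sum>i\<in>I. v i) * u\<^sup>2 / 2)"
    by (simp add: sum_negf sum_distrib_right sum_divide_distrib)
  finally show "char (distr M borel (\<lambda>\<omega>. \<Sum>i\<in>I. Y i \<omega>)) u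
      = complex_of_real (exp (- ((\<Sum>i\<in>I. v i) * u\<^sup>2 / 2)))" .
qed

text \<open>Mean-square convergence yields an almost surely convergent subsequence, whose limit is
  normal with some variance; the second moment identifies that variance as w.\<close>

lemma centered_normal_L2_limit:
  assumes N: "\<And>n. centered_normal M (v n) (Yn n)" and [measurable]: "Y \<in> borel_measurable M"
    and lim: "(\<lambda>n. \<integral>\<^sup>+\<omega>. ennreal ((Y \<omega> - Yn n \<omega>)\<^sup>2) \<partial>M) \<longlonglongrightarrow> 0"
    and v: "v \<longlonglongrightarrow> w"
  shows "centered_normal M w Y"
proof -
  have [measurable]: "Yn n \<in> borel_measurable M" for n
    using N[of n] by (simp add: centered_normal_def)
  note L = L2_limit_integral[OF _ _ centered_normal_moment(1)[OF N] lim]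
  have "(\<lambda>n. v n) \<longlonglongrightarrow> (\<integral>\<omega>. (Y \<omega>)\<^sup>2 \<partial>M)"
    using L(3) by (simp add: centered_normal_moment(2)[OF N])
  then have w: "w = (\<integral>\<omega>. (Y \<omega>)\<^sup>2 \<partial>M)" using v LIMSEQ_unique by blast
  obtain r where r: "strict_mono r" "AE \<omega> in M. (\<lambda>n. (Y \<omega> - Yn (r n) \<omega>)\<^sup>2) \<longlonglongrightarrow> 0"
    using tendsto_L1_AE_subseq[of M "\<lambda>n \<omega>. (Y \<omega> - Yn n \<omega>)\<^sup>2"] L(2,4) by auto
  have "AE \<omega> in M. (\<lambda>n. Yn (r n) \<omega>) \<longlonglongrightarrow> Y \<omega>"
    using r(2)
  proof eventually_elim
    case (elim \<omega>)
    then have "(\<lambda>n. sqrt ((Y \<omega> - Yn (r n) \<omega>)\<^sup>2)) \<longlonglongrightarrow> sqrt 0" by (intro tendsto_intros)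
    then have "(\<lambda>n. Y \<omega> - Yn (r n) \<omega>) \<longlonglongrightarrow> 0" by (simp add: tendsto_rabs_zero_iff)
    then have "(\<lambda>n. Y \<omega> - (Y \<omega> - Yn (r n) \<omega>)) \<longlonglongrightarrow> Y \<omega> - 0" by (intro tendsto_intros)
    then show ?case by simp
  qed
  then obtain w' where w': "centered_normal M w' Y"
    using centered_normal_AE_limit[of "\<lambda>n. v (r n)" "\<lambda>n. Yn (r n)" Y] N by auto
  then show ?thesis using centered_normal_moment(2)[OF w'] w by simp
qed

end

section \<open>Linear combinations of Wiener increments and of Wiener integrals\<close>

lemma standard_wiener_increments:
  assumes W: "standard_wiener M W" and \<tau>: "strict_mono \<tau>" "0 \<le> \<tau> (0::nat)"
  shows "centered_normal M (\<Sum>k<n. (d k)\<^sup>2 * (\<tau> (Suc k) - \<tau> k))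
    (\<lambda>\<omega>. \<Sum>k<n. d k * (W (\<tau> (Suc k)) \<omega> - W (\<tau> k) \<omega>))"
proof -
  interpret prob_space M using W by (simp add: standard_wiener_def)
  have mono: "\<tau> 0 \<le> \<tau> k" for k using \<tau>(1) by (simp add: strict_mono_less_eq)
  have lt: "\<tau> k < \<tau> (Suc k)" for k using \<tau>(1) by (simp add: strict_mono_less)
  have N: "centered_normal M (\<tau> (Suc k) - \<tau> k) (\<lambda>\<omega>. W (\<tau> (Suc k)) \<omega> - W (\<tau> k) \<omega>)" for k
  proof -
    have D: "distributed M lborel (\<lambda>\<omega>. W (\<tau> (Suc k)) \<omega> - W (\<tau> k) \<omega>) (normal_density 0 (sqrt (\<tau> (Suc k) - \<tau> k)))"
      using W lt[of k] mono[of k] \<tau>(2) by (auto simp: standard_wiener_def)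
    then have m: "(\<lambda>\<omega>. W (\<tau> (Suc k)) \<omega> - W (\<tau> k) \<omega>) \<in> borel_measurable M"
      by (simp add: distributed_def)
    have "distr M borel (\<lambda>\<omega>. W (\<tau> (Suc k)) \<omega> - W (\<tau> k) \<omega>) = density lborel (normal_density 0 (sqrt (\<tau> (Suc k) - \<tau> k)))"
      using D by (simp add: distributed_def cong: distr_cong)
    then show ?thesis
      using m lt[of k] by (simp add: centered_normal_def char_normal)
  qed
  have ind: "indep_vars (\<lambda>_. borel) (\<lambda>k \<omega>. W (\<tau> (Suc k)) \<omega> - W (\<tau> k) \<omega>) {..<n}"
    using W \<tau> by (auto simp: standard_wiener_def)
  have "indep_vars (\<lambda>_. borel) (\<lambda>k \<omega>. d k * (W (\<tau> (Suc k)) \<omega> - W (\<tau> k) \<omega>)) {..<n}"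
    by (rule indep_vars_compose2[OF ind, where Y="\<lambda>k x. d k * x"]) simp
  then show ?thesis
    by (intro centered_normal_indep_sum centered_normal_scale N) auto
qed

lemma telescope_indicator:
  fixes f :: "nat \<Rightarrow> real"
  assumes "i \<le> l" "l \<le> n"
  shows "(\<Sum>k<n. of_bool (i \<le> k \<and> k < l) * (f (Suc k) - f k)) = f l - f i"
proof -
  have "(\<Sum>k<n. of_bool (i \<le> k \<and> k < l) * (f (Suc k) - f k)) = (\<Sum>k\<in>{i..<l}. f (Suc k) - f k)"
    using assms by (intro sum.mono_neutral_cong_right) auto
  also have "\<dots> = f l - f i" using assms by (simp add: sum_Suc_diff')
  finally show ?thesis .
qed

text \<open>The intervals may overlap, so they are cut along the common grid of all end points. On
  the cells the increments of W are independent and the indicators are disjoint, and one and the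
  same regrouping serves the random sum and the step function h.\<close>

lemma standard_wiener_lincomb:
  fixes a b c :: "'j \<Rightarrow> real"
  assumes W: "standard_wiener M W" and fin: "finite J"
    and ab: "\<And>j. j \<in> J \<Longrightarrow> 0 \<le> a j \<and> a j \<le> b j"
  defines "h \<equiv> \<lambda>s. \<Sum>j\<in>J. c j * indicator {a j<..b j} s"
  shows "centered_normal M (\<integral>s. (h s)\<^sup>2 \<partial>lborel) (\<lambda>\<omega>. \<Sum>j\<in>J. c j * (W (b j) \<omega> - W (a j) \<omega>))"
    and "integrable lborel (\<lambda>s. (h s)\<^sup>2)"
proof -
  \<comment> \<open>The point 0 makes the grid nonempty even when J is empty.\<close>
  define P where "P = insert 0 (a ` J \<union> b ` J)"
  define xs where "xs = sorted_list_of_set P"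
  define N where "N = length xs"
  \<comment> \<open>Independence of increments is available for infinite strictly increasing
    sequences, so the grid is continued beyond its last point in unit steps.\<close>
  define \<tau> where "\<tau> k = (if k < N then xs ! k else xs ! (N - 1) + real (k - N + 1))" for k
  have finP: "finite P" using fin by (simp add: P_def)
  have setxs: "set xs = P" using finP by (simp add: xs_def)
  have srt: "sorted_wrt (<) xs" by (simp add: xs_def)
  have N0: "N > 0" using setxs by (auto simp: N_def P_def)
  have mono: "strict_mono \<tau>"
    unfolding strict_mono_Suc_iff
  proof
    fix k
    show "\<tau> k < \<tau> (Suc k)"
    proof (cases "Suc k < N")
      case True
      then show ?thesis using sorted_wrt_nth_less[OF srt, of k "Suc k"] by (simp add: \<tau>_def N_def)
    next
      case False
      then show ?thesis by (cases "k < N") (auto simp: \<tau>_def le_Suc_eq not_less)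
    qed
  qed
  have P0: "p \<ge> 0" if "p \<in> P" for p using that ab by (auto simp: P_def intro: order_trans)
  have \<tau>0: "0 \<le> \<tau> 0" using N0 P0[of "xs ! 0"] setxs nth_mem[of 0 xs] by (simp add: \<tau>_def N_def)
  define n where "n = N - 1"
  have "\<exists>i\<le>n. \<tau> i = p" if "p \<in> P" for p
  proof -
    have "p \<in> set xs" using that setxs by simp
    then obtain i where "i < N" "xs ! i = p"
      unfolding in_set_conv_nth N_def by blast
    then show ?thesis by (intro exI[of _ i]) (auto simp: \<tau>_def n_def)
  qed
  then have "\<forall>p\<in>P. \<exists>i. i \<le> n \<and> \<tau> i = p" by blast
  then obtain ix where ix: "\<And>p. p \<in> P \<Longrightarrow> ix p \<le> n \<and> \<tau> (ix p) = p"
    unfolding bchoice_iff by blast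
  have aP: "a j \<in> P" "b j \<in> P" if "j \<in> J" for j using that by (auto simp: P_def)
  define d where "d k = (\<Sum>j\<in>J. c j * of_bool (ix (a j) \<le> k \<and> k < ix (b j)))" for k
  \<comment> \<open>Kept for an arbitrary f: used once with a path of W and once with f t =
    \<open>of_bool (s \<le> t)\<close>.\<close>
  have expand: "(\<Sum>j\<in>J. c j * (f (b j) - f (a j))) = (\<Sum>k<n. d k * (f (\<tau> (Suc k)) - f (\<tau> k)))" for f :: "real \<Rightarrow> real"
  proof -
    have 1: "f (b j) - f (a j) = (\<Sum>k<n. of_bool (ix (a j) \<le> k \<and> k < ix (b j)) * (f (\<tau> (Suc k)) - f (\<tau> k)))" if "j \<in> J" for j
    proof -
      have "\<tau> (ix (a j)) \<le> \<tau> (ix (b j))" using ix aP[OF that] ab[OF that] by simp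
      then have "ix (a j) \<le> ix (b j)" using mono by (simp add: strict_mono_less_eq)
      then have "(\<Sum>k<n. of_bool (ix (a j) \<le> k \<and> k < ix (b j)) * (f (\<tau> (Suc k)) - f (\<tau> k)))
          = f (\<tau> (ix (b j))) - f (\<tau> (ix (a j)))"
        using ix[OF aP(2)[OF that]] by (intro telescope_indicator[where f="\<lambda>k. f (\<tau> k)"]) auto
      then show ?thesis
        using ix[OF aP(1)[OF that]] ix[OF aP(2)[OF that]] by simp
    qed
    have "(\<Sum>j\<in>J. c j * (f (b j) - f (a j)))
       = (\<Sum>j\<in>J. \<Sum>k<n. c j * (of_bool (ix (a j) \<le> k \<and> k < ix (b j)) * (f (\<tau> (Suc k)) - f (\<tau> k))))"
      by (intro sum.cong refl, subst 1, assumption, rule sum_distrib_left)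
    also have "\<dots> = (\<Sum>k<n. \<Sum>j\<in>J. c j * (of_bool (ix (a j) \<le> k \<and> k < ix (b j)) * (f (\<tau> (Suc k)) - f (\<tau> k))))"
      by (rule sum.swap)
    also have "\<dots> = (\<Sum>k<n. d k * (f (\<tau> (Suc k)) - f (\<tau> k)))"
      by (simp add: d_def sum_distrib_right mult.assoc)
    finally show ?thesis .
  qed
  have ind: "indicator {x<..y} s = of_bool (s \<le> y) - (of_bool (s \<le> x) :: real)" if "x \<le> y" for x y s :: real
    using that by (auto simp: indicator_def)
  have le: "\<tau> k \<le> \<tau> (Suc k)" for k using mono by (simp add: strict_mono_less_eq)
  have h_eq: "h s = (\<Sum>k<n. d k * indicator {\<tau> k<..\<tau> (Suc k)} s)" for s
  proof -
    have "h s = (\<Sum>j\<in>J. c j * (of_bool (s \<le> b j) - of_bool (s \<le> a j)))"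
      unfolding h_def using ab by (intro sum.cong) (auto simp: ind)
    also have "\<dots> = (\<Sum>k<n. d k * (of_bool (s \<le> \<tau> (Suc k)) - of_bool (s \<le> \<tau> k)))"
      by (rule expand)
    also have "\<dots> = (\<Sum>k<n. d k * indicator {\<tau> k<..\<tau> (Suc k)} s)"
      by (simp only: ind[OF le])
    finally show ?thesis .
  qed
  \<comment> \<open>Distinct cells are disjoint, so squaring the sum produces no cross
    terms.\<close>
  have disj: "indicator {\<tau> k<..\<tau> (Suc k)} s * indicator {\<tau> l<..\<tau> (Suc l)} s = (if l = k then indicator {\<tau> k<..\<tau> (Suc k)} s else (0::real))" for k l s
  proof (cases k l rule: linorder_cases)
    case less
    then have "\<tau> (Suc k) \<le> \<tau> l" using mono by (simp add: strict_mono_less_eq)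
    then show ?thesis using less by (auto simp: indicator_def)
  next
    case greater
    then have "\<tau> (Suc l) \<le> \<tau> k" using mono by (simp add: strict_mono_less_eq)
    then show ?thesis using greater by (auto simp: indicator_def)
  qed (auto simp: indicator_def)
  have h2: "(h s)\<^sup>2 = (\<Sum>k<n. (d k)\<^sup>2 * indicator {\<tau> k<..\<tau> (Suc k)} s)" for s
  proof -
    have "(h s)\<^sup>2 = (\<Sum>k<n. \<Sum>l<n. d k * d l * (indicator {\<tau> k<..\<tau> (Suc k)} s * indicator {\<tau> l<..\<tau> (Suc l)} s))"
      unfolding h_eq power2_eq_square sum_product by (intro sum.cong refl) (simp add: mult_ac)
    also have "\<dots> = (\<Sum>k<n. (d k)\<^sup>2 * indicator {\<tau> k<..\<tau> (Suc k)} s)"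
      unfolding disj by (intro sum.cong refl) (simp add: if_distrib sum.delta' power2_eq_square cong: if_cong)
    finally show ?thesis .
  qed
  show "integrable lborel (\<lambda>s. (h s)\<^sup>2)" unfolding h2 using le by (intro Bochner_Integration.integrable_sum integrable_mult_right) simp
  have "(\<integral>s. (h s)\<^sup>2 \<partial>lborel) = (\<Sum>k<n. (d k)\<^sup>2 * (\<tau> (Suc k) - \<tau> k))"
    unfolding h2 using le by (subst Bochner_Integration.integral_sum) (simp_all del: sum_mult_indicator)
  moreover have "(\<lambda>\<omega>. \<Sum>j\<in>J. c j * (W (b j) \<omega> - W (a j) \<omega>)) = (\<lambda>\<omega>. \<Sum>k<n. d k * (W (\<tau> (Suc k)) \<omega> - W (\<tau> k) \<omega>))"
    using expand[of "\<lambda>t. W t _"] by (intro ext) simp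
  ultimately show "centered_normal M (\<integral>s. (h s)\<^sup>2 \<partial>lborel) (\<lambda>\<omega>. \<Sum>j\<in>J. c j * (W (b j) \<omega> - W (a j) \<omega>))"
    using standard_wiener_increments[OF W mono \<tau>0] by simp
qed

text \<open>Each integral has its own horizon and its own approximating step functions. For fixed n
  the weighted approximants form one finite family of intervals, indexed by pairs, to which the
  result for increments applies; the limit is then taken simultaneously in L_2 of time and in L_2 of
  the probability space.\<close>

lemma wiener_integral_lincomb:
  fixes t w :: "'i \<Rightarrow> real"
  assumes W: "standard_wiener M W" and fin: "finite I"
    and Y: "\<And>i. i \<in> I \<Longrightarrow> has_wiener_integral M W (t i) (f i) (Y i)"
  defines "F \<equiv> \<lambda>r. \<Sum>i\<in>I. w i * (indicator {0..t i} r * f i r)"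
  shows "centered_normal M (\<integral>r. (F r)\<^sup>2 \<partial>lborel) (\<lambda>\<omega>. \<Sum>i\<in>I. w i * Y i \<omega>)"
    and "integrable lborel (\<lambda>r. (F r)\<^sup>2)"
proof -
  interpret prob_space M using W by (simp add: standard_wiener_def)
  define P where "P i N \<tau> c \<longleftrightarrow> (\<forall>n. mono (\<tau> n) \<and> range (\<tau> n) \<subseteq> {0..t i}) \<and>
        (\<lambda>n. \<integral>\<^sup>+ s \<in> {0..t i}. ennreal ((f i s - step_fun (N n) (\<tau> n) (c n) s)\<^sup>2) \<partial>lborel) \<longlonglongrightarrow> 0 \<and>
        (\<lambda>n. \<integral>\<^sup>+ \<omega>. ennreal ((Y i \<omega> - step_wiener_integral W (N n) (\<tau> n) (c n) \<omega>)\<^sup>2) \<partial>M) \<longlonglongrightarrow> 0"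
    for i and N :: "nat \<Rightarrow> nat" and \<tau> c :: "nat \<Rightarrow> nat \<Rightarrow> real"
  have "\<forall>i\<in>I. \<exists>N \<tau> c. P i N \<tau> c"
    using Y unfolding has_wiener_integral_def P_def by blast
  then obtain N \<tau> c where P: "\<forall>i\<in>I. P i (N i) (\<tau> i) (c i)"
    unfolding bchoice_iff by blast
  have \<tau>: "\<And>i n. i \<in> I \<Longrightarrow> mono (\<tau> i n)" "\<And>i n. i \<in> I \<Longrightarrow> range (\<tau> i n) \<subseteq> {0..t i}" and
    l1: "\<And>i. i \<in> I \<Longrightarrow> (\<lambda>n. \<integral>\<^sup>+ s \<in> {0..t i}. ennreal ((f i s - step_fun (N i n) (\<tau> i n) (c i n) s)\<^sup>2) \<partial>lborel) \<longlonglongrightarrow> 0" and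
    l2: "\<And>i. i \<in> I \<Longrightarrow> (\<lambda>n. \<integral>\<^sup>+ \<omega>. ennreal ((Y i \<omega> - step_wiener_integral W (N i n) (\<tau> i n) (c i n) \<omega>)\<^sup>2) \<partial>M) \<longlonglongrightarrow> 0"
    using bspec[OF P] unfolding P_def by blast+
  have Wm: "W s \<in> borel_measurable M" if "s \<ge> 0" for s using W that by (simp add: standard_wiener_def)
  have \<tau>I: "\<tau> i n k \<in> {0..t i}" if "i \<in> I" for i n k
    using \<tau>(2)[OF that, of n] by (rule subsetD) (rule rangeI)
  have \<tau>0: "\<tau> i n k \<ge> 0" if "i \<in> I" for i n k using \<tau>I[OF that, of n k] by simp
  have [measurable]: "Y i \<in> borel_measurable M" if "i \<in> I" for i
    using Y[OF that] by (simp add: has_wiener_integral_def)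
  have [measurable]: "(\<lambda>r. indicator {0..t i} r * f i r) \<in> borel_measurable lborel" if "i \<in> I" for i
    using Y[OF that] by (simp add: has_wiener_integral_def set_borel_measurable_def)
  have [measurable]: "step_fun n1 \<tau>1 c1 \<in> borel_measurable lborel" for n1 \<tau>1 c1
    unfolding step_fun_def[abs_def] by (intro borel_measurable_sum) simp
  have swm[measurable]: "step_wiener_integral W (N i n) (\<tau> i n) (c i n) \<in> borel_measurable M" if "i \<in> I" for i n
    unfolding step_wiener_integral_def[abs_def] using Wm \<tau>0[OF that] by (intro borel_measurable_sum) auto
  define S where "S n r = (\<Sum>i\<in>I. w i * step_fun (N i n) (\<tau> i n) (c i n) r)" for n r
  define SW where "SW n \<omega> = (\<Sum>i\<in>I. w i * step_wiener_integral W (N i n) (\<tau> i n) (c i n) \<omega>)" for n \<omega>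
  have Sm[measurable]: "S n \<in> borel_measurable lborel" for n unfolding S_def[abs_def] by simp
  have lc: "centered_normal M (\<integral>r. (S n r)\<^sup>2 \<partial>lborel) (SW n)" "integrable lborel (\<lambda>r. (S n r)\<^sup>2)" for n
  proof -
    define J where "J = (SIGMA i:I. {..<N i n})"
    have J: "finite J" using fin by (simp add: J_def)
    have 1: "(\<Sum>j\<in>J. w (fst j) * c (fst j) n (snd j) * indicator {\<tau> (fst j) n (snd j)<..\<tau> (fst j) n (Suc (snd j))} r) = S n r" for r
      unfolding J_def S_def step_fun_def using fin
      by (subst sum.Sigma[symmetric, where g="\<lambda>x y. w x * c x n y * indicator {\<tau> x n y<..\<tau> x n (Suc y)} r", unfolded case_prod_beta])
         (auto simp: sum_distrib_left mult.assoc simp del: sum_mult_indicator)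
    have 2: "(\<Sum>j\<in>J. w (fst j) * c (fst j) n (snd j) * (W (\<tau> (fst j) n (Suc (snd j))) \<omega> - W (\<tau> (fst j) n (snd j)) \<omega>)) = SW n \<omega>" for \<omega>
      unfolding J_def SW_def step_wiener_integral_def using fin
      by (subst sum.Sigma[symmetric, where g="\<lambda>x y. w x * c x n y * (W (\<tau> x n (Suc y)) \<omega> - W (\<tau> x n y) \<omega>)", unfolded case_prod_beta])
         (auto simp: sum_distrib_left mult.assoc simp del: sum_mult_indicator)
    have ab: "0 \<le> \<tau> (fst j) n (snd j) \<and> \<tau> (fst j) n (snd j) \<le> \<tau> (fst j) n (Suc (snd j))" if "j \<in> J" for j
      using that \<tau>0 \<tau>(1) by (auto simp: J_def intro: monoD)
    show "centered_normal M (\<integral>r. (S n r)\<^sup>2 \<partial>lborel) (SW n)" "integrable lborel (\<lambda>r. (S n r)\<^sup>2)"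
      using standard_wiener_lincomb[OF W J ab, of "\<lambda>j. j" "\<lambda>j. w (fst j) * c (fst j) n (snd j)"]
      unfolding 1 2 by auto
  qed
  \<comment> \<open>The partition points lie in \<open>{0..t i}\<close>, so extension by 0 leaves
    the L_2 error unchanged.\<close>
  have supp: "step_fun (N i n) (\<tau> i n) (c i n) r = 0" if "i \<in> I" "r \<notin> {0..t i}" for i n r
    unfolding step_fun_def
  proof (rule sum.neutral, rule ballI)
    fix k
    have "\<tau> i n k \<in> {0..t i}" "\<tau> i n (Suc k) \<in> {0..t i}" using \<tau>I[OF that(1)] by auto
    then show "c i n k * indicator {\<tau> i n k<..\<tau> i n (Suc k)} r = 0"
      using that(2) by (auto simp: indicator_def)
  qed
  have "(\<lambda>n. \<integral>\<^sup>+r. ennreal ((\<Sum>i\<in>I. w i * (indicator {0..t i} r * f i r - step_fun (N i n) (\<tau> i n) (c i n) r))\<^sup>2) \<partial>lborel) \<longlonglongrightarrow> 0"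
  proof (rule L2_tendsto_zero_sum[OF fin])
    fix i assume i: "i \<in> I"
    have "(\<integral>\<^sup>+r. ennreal ((indicator {0..t i} r * f i r - step_fun (N i n) (\<tau> i n) (c i n) r)\<^sup>2) \<partial>lborel)
        = (\<integral>\<^sup>+ s \<in> {0..t i}. ennreal ((f i s - step_fun (N i n) (\<tau> i n) (c i n) s)\<^sup>2) \<partial>lborel)" for n
      using supp[OF i] by (intro nn_integral_cong) (auto simp: indicator_def)
    then show "(\<lambda>n. \<integral>\<^sup>+r. ennreal ((indicator {0..t i} r * f i r - step_fun (N i n) (\<tau> i n) (c i n) r)\<^sup>2) \<partial>lborel) \<longlonglongrightarrow> 0"
      using l1[OF i] by simp
  qed simp
  then have lF: "(\<lambda>n. \<integral>\<^sup>+r. ennreal ((F r - S n r)\<^sup>2) \<partial>lborel) \<longlonglongrightarrow> 0"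
    by (simp add: F_def S_def right_diff_distrib sum_subtractf)
  have "(\<lambda>n. \<integral>\<^sup>+\<omega>. ennreal ((\<Sum>i\<in>I. w i * (Y i \<omega> - step_wiener_integral W (N i n) (\<tau> i n) (c i n) \<omega>))\<^sup>2) \<partial>M) \<longlonglongrightarrow> 0"
    by (rule L2_tendsto_zero_sum[OF fin _ l2]) measurable
  then have lY: "(\<lambda>n. \<integral>\<^sup>+\<omega>. ennreal (((\<Sum>i\<in>I. w i * Y i \<omega>) - SW n \<omega>)\<^sup>2) \<partial>M) \<longlonglongrightarrow> 0"
    by (simp add: SW_def right_diff_distrib sum_subtractf)
  have [measurable]: "F \<in> borel_measurable lborel" unfolding F_def by measurable
  note L = L2_limit_integral[OF _ Sm lc(2) lF]
  show "integrable lborel (\<lambda>r. (F r)\<^sup>2)" by (rule L(1)) simp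
  show "centered_normal M (\<integral>r. (F r)\<^sup>2 \<partial>lborel) (\<lambda>\<omega>. \<Sum>i\<in>I. w i * Y i \<omega>)"
    by (rule centered_normal_L2_limit[OF lc(1) _ lY L(3)]) measurable
qed

section \<open>Covariance of the Volterra process\<close>

lemma nn_integral_powr_from_0:
  fixes a c :: real
  assumes "a > -1" "c \<ge> 0"
  shows "(\<integral>\<^sup>+x. (if 0 < x \<and> x < c then ennreal (x powr a) else 0) \<partial>lborel) = ennreal (c powr (a + 1) / (a + 1))"
proof -
  have "(\<integral>\<^sup>+x. ennreal (indicator {0..c} x * x powr a) \<partial>lborel) = ennreal (c powr (a + 1) / (a + 1))"
  proof (rule nn_integral_has_integral_lborel)
    have "(\<lambda>x. indicator {0..c} x * x powr a) = (\<lambda>x. if x \<in> {0..c} then x powr a else 0)"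
      by (auto simp: indicator_def)
    then show "((\<lambda>x. indicator {0..c} x * x powr a) has_integral c powr (a + 1) / (a + 1)) UNIV"
      using has_integral_powr_from_0[OF assms] by (simp only: has_integral_restrict_UNIV)
  qed auto
  moreover have "(\<integral>\<^sup>+x. (if 0 < x \<and> x < c then ennreal (x powr a) else 0) \<partial>lborel)
      = (\<integral>\<^sup>+x. ennreal (indicator {0..c} x * x powr a) \<partial>lborel)"
  proof (rule nn_integral_cong_AE)
    have "AE x in lborel. x \<noteq> c" by (rule AE_lborel_singleton)
    then show "AE x in lborel. (if 0 < x \<and> x < c then ennreal (x powr a) else 0)
        = ennreal (indicator {0..c} x * x powr a)"
      by eventually_elim (auto simp: indicator_def)
  qed
  ultimately show ?thesis by simp
qed

section \<open>Covariance density and increments of the Volterra kernel\<close>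

locale volterra_exponents =
  fixes \<alpha> \<beta> \<gamma> :: real
  assumes \<alpha>: "\<alpha> > - 1/2" and \<gamma>: "\<gamma> > - 1" and sum_exponents: "\<alpha> + \<beta> + \<gamma> > - 3/2"
begin

text \<open>Formally \<open>X\<^sub>t = \<integral>\<^sub>0\<^sup>t u\<^sup>\<beta> Y\<^sub>u du\<close> for a process \<open>Y\<close> with covariance function \<open>cov_kernel\<close>;
  on the diagonal the latter is infinite if \<open>\<gamma> \<le> -1/2\<close>.\<close>
definition cov_kernel :: "real \<Rightarrow> real \<Rightarrow> ennreal" where
  "cov_kernel a b = (\<integral>\<^sup>+r. (if 0 < r \<and> r < a \<and> r < b
     then ennreal (r powr (2 * \<alpha>) * ((a - r) powr \<gamma> * (b - r) powr \<gamma>)) else 0) \<partial>lborel)"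

text \<open>Formal mixed second derivative of the covariance of X: its integral over (0, s] x (0, t]
  is the covariance of X(s) and X(t).\<close>

definition wcov :: "real \<Rightarrow> real \<Rightarrow> ennreal" where
  "wcov a b = ennreal (a powr \<beta> * b powr \<beta>) * cov_kernel a b"

text \<open>For A = \<open>{s<..t}\<close> and r > 0 this is the kernel of X(t) minus the kernel of
  X(s), as an extended nonnegative number.\<close>

definition incr_kernel :: "real set \<Rightarrow> real \<Rightarrow> ennreal" where
  "incr_kernel A r = ennreal (r powr \<alpha>) *
     (\<integral>\<^sup>+u. (if u \<in> A \<and> r < u then ennreal (u powr \<beta> * (u - r) powr \<gamma>) else 0) \<partial>lborel)"

definition rect_cov :: "real set \<Rightarrow> real set \<Rightarrow> ennreal" where
  "rect_cov A B = (\<integral>\<^sup>+a. \<integral>\<^sup>+b. (if a \<in> A \<and> b \<in> B then wcov a b else 0) \<partial>lborel \<partial>lborel)"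

lemma measurable_cov_kernel[measurable (raw)]:
  assumes [measurable]: "f \<in> borel_measurable M" "g \<in> borel_measurable M"
  shows "(\<lambda>x. cov_kernel (f x) (g x)) \<in> borel_measurable M"
  unfolding cov_kernel_def by measurable

lemma measurable_wcov[measurable (raw)]:
  assumes [measurable]: "f \<in> borel_measurable M" "g \<in> borel_measurable M"
  shows "(\<lambda>x. wcov (f x) (g x)) \<in> borel_measurable M"
  unfolding wcov_def by measurable

lemma measurable_incr_kernel[measurable (raw)]:
  assumes [measurable]: "f \<in> borel_measurable M" "A \<in> sets borel"
  shows "(\<lambda>x. incr_kernel A (f x)) \<in> borel_measurable M"
  unfolding incr_kernel_def by measurable

lemma cov_kernel_commute: "cov_kernel a b = cov_kernel b a"
  unfolding cov_kernel_def by (intro nn_integral_cong) (auto simp: mult_ac)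

text \<open>Both factors are integrals over u; Tonelli moves the integral over r innermost, where it
  becomes the covariance kernel. The identity lives in \<open>ennreal\<close>, so the singular
  diagonal causes no difficulty.\<close>

lemma incr_kernel_mult:
  assumes [measurable]: "A \<in> sets borel" "B \<in> sets borel"
  shows "(\<integral>\<^sup>+r. (if 0 < r then incr_kernel A r * incr_kernel B r else 0) \<partial>lborel) = rect_cov A B"
proof -
  define G where "G r a b = (if 0 < r \<and> r < a \<and> r < b \<and> a \<in> A \<and> b \<in> B
    then ennreal ((a powr \<beta> * b powr \<beta>) * (r powr (2 * \<alpha>) * ((a - r) powr \<gamma> * (b - r) powr \<gamma>))) else 0)" for r a b
  have [measurable]: "(\<lambda>x. G (f x) (g x) (h x)) \<in> borel_measurable N"
    if [measurable]: "f \<in> borel_measurable N" "g \<in> borel_measurable N" "h \<in> borel_measurable N" for f g h and N :: "'z measure"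
    unfolding G_def by measurable
  have 1: "(if 0 < r then incr_kernel A r * incr_kernel B r else 0) = (\<integral>\<^sup>+a. \<integral>\<^sup>+b. G r a b \<partial>lborel \<partial>lborel)" for r
  proof (cases "0 < r")
    case True
    define FA where "FA u = (if u \<in> A \<and> r < u then ennreal (u powr \<beta> * (u - r) powr \<gamma>) else 0)" for u
    define FB where "FB u = (if u \<in> B \<and> r < u then ennreal (u powr \<beta> * (u - r) powr \<gamma>) else 0)" for u
    have [measurable]: "FA \<in> borel_measurable borel" "FB \<in> borel_measurable borel"
      unfolding FA_def FB_def by measurable
    have G: "G r a b = ennreal (r powr \<alpha>) * FA a * (ennreal (r powr \<alpha>) * FB b)" for a b
    proof (cases "a \<in> A \<and> r < a \<and> b \<in> B \<and> r < b")
      case T: True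
      have "r powr (2 * \<alpha>) = r powr \<alpha> * r powr \<alpha>" by (simp add: powr_add[symmetric])
      then have "(a powr \<beta> * b powr \<beta>) * (r powr (2 * \<alpha>) * ((a - r) powr \<gamma> * (b - r) powr \<gamma>))
        = r powr \<alpha> * (a powr \<beta> * (a - r) powr \<gamma>) * (r powr \<alpha> * (b powr \<beta> * (b - r) powr \<gamma>))"
        by (simp add: mult_ac)
      then show ?thesis using T True by (simp add: G_def FA_def FB_def ennreal_mult mult_ac)
    qed (auto simp: G_def FA_def FB_def)
    have "(\<integral>\<^sup>+a. \<integral>\<^sup>+b. G r a b \<partial>lborel \<partial>lborel)
        = (\<integral>\<^sup>+a. ennreal (r powr \<alpha>) * FA a * (ennreal (r powr \<alpha>) * (\<integral>\<^sup>+b. FB b \<partial>lborel)) \<partial>lborel)"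
      unfolding G by (simp add: nn_integral_cmult)
    also have "\<dots> = ennreal (r powr \<alpha>) * (\<integral>\<^sup>+a. FA a \<partial>lborel) * (ennreal (r powr \<alpha>) * (\<integral>\<^sup>+b. FB b \<partial>lborel))"
      by (simp add: nn_integral_cmult nn_integral_multc)
    also have "\<dots> = incr_kernel A r * incr_kernel B r"
      by (simp add: incr_kernel_def FA_def FB_def)
    finally show ?thesis using True by simp
  qed (simp add: G_def)
  have 2: "(\<integral>\<^sup>+r. G r a b \<partial>lborel) = (if a \<in> A \<and> b \<in> B then wcov a b else 0)" for a b
  proof (cases "a \<in> A \<and> b \<in> B")
    case True
    then have "(\<integral>\<^sup>+r. G r a b \<partial>lborel) = (\<integral>\<^sup>+r. ennreal (a powr \<beta> * b powr \<beta>) * (if 0 < r \<and> r < a \<and> r < b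
     then ennreal (r powr (2 * \<alpha>) * ((a - r) powr \<gamma> * (b - r) powr \<gamma>)) else 0) \<partial>lborel)"
      by (intro nn_integral_cong) (auto simp: G_def ennreal_mult)
    also have "\<dots> = wcov a b" unfolding wcov_def cov_kernel_def by (rule nn_integral_cmult) measurable
    finally show ?thesis using True by simp
  next
    case False
    then have "G r a b = 0" for r by (auto simp: G_def)
    then show ?thesis using False by auto
  qed
  have "(\<integral>\<^sup>+r. (if 0 < r then incr_kernel A r * incr_kernel B r else 0) \<partial>lborel)
      = (\<integral>\<^sup>+r. \<integral>\<^sup>+a. \<integral>\<^sup>+b. G r a b \<partial>lborel \<partial>lborel \<partial>lborel)"
    by (simp add: 1)
  also have "\<dots> = (\<integral>\<^sup>+a. \<integral>\<^sup>+r. \<integral>\<^sup>+b. G r a b \<partial>lborel \<partial>lborel \<partial>lborel)"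
    by (rule lborel_pair.Fubini') measurable
  also have "\<dots> = (\<integral>\<^sup>+a. \<integral>\<^sup>+b. \<integral>\<^sup>+r. G r a b \<partial>lborel \<partial>lborel \<partial>lborel)"
    by (intro nn_integral_cong lborel_pair.Fubini') measurable
  finally show ?thesis by (simp add: 2 rect_cov_def)
qed

text \<open>As r > 0, the factor \<open>u powr \<beta>\<close> is bounded between r and t whatever
  the sign of \<beta>, and (u - r)^\<gamma> is integrable at r because \<gamma> > -1.\<close>

lemma incr_kernel_finite:
  assumes "0 < r"
  shows "incr_kernel {s<..t} r < \<infinity>"
proof (cases "r < t")
  case True
  define m where "m = max (r powr \<beta>) (t powr \<beta>)"
  have m: "u powr \<beta> \<le> m" if "r < u" "u \<le> t" for u
  proof (cases "\<beta> \<ge> 0")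
    case True
    then have "u powr \<beta> \<le> t powr \<beta>" using that assms by (intro powr_mono2) auto
    then show ?thesis by (simp add: m_def)
  next
    case False
    then have "u powr \<beta> \<le> r powr \<beta>" using that assms by (intro powr_mono2') auto
    then show ?thesis by (simp add: m_def)
  qed
  have m0: "m \<ge> 0" by (simp add: m_def le_max_iff_disj)
  have "(\<integral>\<^sup>+u. (if u \<in> {s<..t} \<and> r < u then ennreal (u powr \<beta> * (u - r) powr \<gamma>) else 0) \<partial>lborel)
     \<le> (\<integral>\<^sup>+u. ennreal m * (if 0 < u - r \<and> u - r < t - r + 1 then ennreal ((u - r) powr \<gamma>) else 0) \<partial>lborel)"
    using m m0 by (intro nn_integral_mono) (auto simp: ennreal_mult[symmetric] intro!: ennreal_leI mult_right_mono)
  also have "\<dots> = ennreal m * (\<integral>\<^sup>+u. (if 0 < u - r \<and> u - r < t - r + 1 then ennreal ((u - r) powr \<gamma>) else 0) \<partial>lborel)"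
    by (rule nn_integral_cmult) measurable
  also have "(\<integral>\<^sup>+u. (if 0 < u - r \<and> u - r < t - r + 1 then ennreal ((u - r) powr \<gamma>) else 0) \<partial>lborel)
     = (\<integral>\<^sup>+x. (if 0 < x \<and> x < t - r + 1 then ennreal (x powr \<gamma>) else 0) \<partial>lborel)"
    by (subst nn_integral_real_affine[where c=1 and t=r]) (simp_all cong: if_cong)
  also have "(\<integral>\<^sup>+x. (if 0 < x \<and> x < t - r + 1 then ennreal (x powr \<gamma>) else 0) \<partial>lborel) = ennreal ((t - r + 1) powr (\<gamma> + 1) / (\<gamma> + 1))"
    using \<gamma> True by (intro nn_integral_powr_from_0) auto
  finally have "(\<integral>\<^sup>+u. (if u \<in> {s<..t} \<and> r < u then ennreal (u powr \<beta> * (u - r) powr \<gamma>) else 0) \<partial>lborel) < \<infinity>"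
    by (rule le_less_trans) (simp add: ennreal_mult_less_top)
  then show ?thesis unfolding incr_kernel_def by (simp add: ennreal_mult_less_top)
next
  case False
  then have "(if u \<in> {s<..t} \<and> r < u then ennreal (u powr \<beta> * (u - r) powr \<gamma>) else 0) = 0" for u by auto
  then show ?thesis by (simp add: incr_kernel_def)
qed

text \<open>Bridge between the Bochner integral in \<open>volterra_kernel\<close> and extended
  values: finiteness of the increment kernel supplies the integrability without which the Bochner
  integral would default to 0.\<close>

lemma volterra_kernel_eq:
  assumes "0 < r"
  shows "ennreal (indicator {0..t} r * volterra_kernel \<alpha> \<beta> \<gamma> t r) = incr_kernel {0<..t} r"
    and "0 \<le> indicator {0..t} r * volterra_kernel \<alpha> \<beta> \<gamma> t r"
proof -
  define f where "f u = indicator {r..t} u * (u powr \<beta> * (u - r) powr \<gamma>)" for u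
  have f0: "f u \<ge> 0" for u by (simp add: f_def)
  have [measurable]: "f \<in> borel_measurable borel" unfolding f_def by measurable
  have nf: "(\<integral>\<^sup>+u. ennreal (f u) \<partial>lborel)
     = (\<integral>\<^sup>+u. (if u \<in> {0<..t} \<and> r < u then ennreal (u powr \<beta> * (u - r) powr \<gamma>) else 0) \<partial>lborel)"
  proof (rule nn_integral_cong_AE)
    have "AE u in lborel. u \<noteq> r" by (rule AE_lborel_singleton)
    then show "AE u in lborel. ennreal (f u) = (if u \<in> {0<..t} \<and> r < u then ennreal (u powr \<beta> * (u - r) powr \<gamma>) else 0)"
      by eventually_elim (use assms in \<open>auto simp: f_def indicator_def\<close>)
  qed
  have "incr_kernel {0<..t} r < \<infinity>" by (rule incr_kernel_finite[OF assms])
  then have "(\<integral>\<^sup>+u. ennreal (f u) \<partial>lborel) < \<infinity>"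
    using assms unfolding incr_kernel_def nf[symmetric] by (auto simp: ennreal_mult_less_top)
  then have "integrable lborel f" using f0 by (intro integrableI_nonneg) auto
  then have "(\<integral>\<^sup>+u. ennreal (f u) \<partial>lborel) = ennreal (\<integral>u. f u \<partial>lborel)"
    using f0 by (intro nn_integral_eq_integral) auto
  moreover have K: "volterra_kernel \<alpha> \<beta> \<gamma> t r = r powr \<alpha> * (\<integral>u. f u \<partial>lborel)"
    by (simp add: volterra_kernel_def set_lebesgue_integral_def f_def)
  moreover have I0: "(\<integral>u. f u \<partial>lborel) \<ge> 0" using f0 by simp
  ultimately have "ennreal (volterra_kernel \<alpha> \<beta> \<gamma> t r) = incr_kernel {0<..t} r"
    unfolding incr_kernel_def nf[symmetric] by (simp add: ennreal_mult)
  moreover have "incr_kernel {0<..t} r = 0" if "t < r"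
  proof -
    have "(if u \<in> {0<..t} \<and> r < u then ennreal (u powr \<beta> * (u - r) powr \<gamma>) else 0) = 0" for u
      using that by auto
    then show ?thesis unfolding incr_kernel_def by simp
  qed
  ultimately show "ennreal (indicator {0..t} r * volterra_kernel \<alpha> \<beta> \<gamma> t r) = incr_kernel {0<..t} r"
    using assms by (auto simp: indicator_def)
  show "0 \<le> indicator {0..t} r * volterra_kernel \<alpha> \<beta> \<gamma> t r"
    using K I0 by simp
qed

lemma incr_kernel_add:
  assumes "0 \<le> s" "s \<le> t"
  shows "incr_kernel {0<..t} r = incr_kernel {0<..s} r + incr_kernel {s<..t} r"
  unfolding incr_kernel_def distrib_left[symmetric]
  by (subst nn_integral_add[symmetric]) (use assms in \<open>auto intro!: arg_cong2[where f="(*)"] nn_integral_cong\<close>)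

text \<open>Additivity of \<open>incr_kernel\<close> over adjacent intervals. The kernel is
  therefore nondecreasing in t, which is what makes all covariances of increments
  nonnegative.\<close>

lemma volterra_kernel_diff:
  assumes "0 < r" "0 \<le> s" "s \<le> t"
  shows "ennreal (indicator {0..t} r * volterra_kernel \<alpha> \<beta> \<gamma> t r - indicator {0..s} r * volterra_kernel \<alpha> \<beta> \<gamma> s r)
      = incr_kernel {s<..t} r"
    and "indicator {0..s} r * volterra_kernel \<alpha> \<beta> \<gamma> s r \<le> indicator {0..t} r * volterra_kernel \<alpha> \<beta> \<gamma> t r"
proof -
  have e: "ennreal (indicator {0..t} r * volterra_kernel \<alpha> \<beta> \<gamma> t r)
      = ennreal (indicator {0..s} r * volterra_kernel \<alpha> \<beta> \<gamma> s r) + incr_kernel {s<..t} r"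
    using incr_kernel_add[OF assms(2,3)] volterra_kernel_eq(1)[OF assms(1)] by simp
  then have "ennreal (indicator {0..s} r * volterra_kernel \<alpha> \<beta> \<gamma> s r) \<le> ennreal (indicator {0..t} r * volterra_kernel \<alpha> \<beta> \<gamma> t r)"
    by simp
  then show "indicator {0..s} r * volterra_kernel \<alpha> \<beta> \<gamma> s r \<le> indicator {0..t} r * volterra_kernel \<alpha> \<beta> \<gamma> t r"
    using volterra_kernel_eq(2)[OF assms(1)] by (subst (asm) ennreal_le_iff) auto
  show "ennreal (indicator {0..t} r * volterra_kernel \<alpha> \<beta> \<gamma> t r - indicator {0..s} r * volterra_kernel \<alpha> \<beta> \<gamma> s r)
      = incr_kernel {s<..t} r"
    using volterra_kernel_eq(2)[OF assms(1), of s]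
    by (subst ennreal_minus[symmetric]) (auto simp: e intro!: ennreal_add_diff_cancel_left)
qed

section \<open>Self-similarity and positivity\<close>

lemma cov_kernel_scale:
  assumes "c > 0"
  shows "cov_kernel (c * a) (c * b) = ennreal (c powr (2 * \<alpha> + 2 * \<gamma> + 1)) * cov_kernel a b"
proof -
  have "cov_kernel (c * a) (c * b) = ennreal c * (\<integral>\<^sup>+r. (if 0 < c * r \<and> c * r < c * a \<and> c * r < c * b
     then ennreal ((c * r) powr (2 * \<alpha>) * ((c * a - c * r) powr \<gamma> * (c * b - c * r) powr \<gamma>)) else 0) \<partial>lborel)"
    unfolding cov_kernel_def using assms by (subst nn_integral_real_affine[where c=c and t=0]) (simp_all cong: if_cong)
  also have "\<dots> = ennreal c * (\<integral>\<^sup>+r. ennreal (c powr (2 * \<alpha> + 2 * \<gamma>)) * (if 0 < r \<and> r < a \<and> r < b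
     then ennreal (r powr (2 * \<alpha>) * ((a - r) powr \<gamma> * (b - r) powr \<gamma>)) else 0) \<partial>lborel)"
  proof (intro arg_cong[where f="\<lambda>x. ennreal c * x"] nn_integral_cong)
    fix r :: real
    have "(c * r) powr (2 * \<alpha>) * ((c * a - c * r) powr \<gamma> * (c * b - c * r) powr \<gamma>)
        = c powr (2 * \<alpha> + 2 * \<gamma>) * (r powr (2 * \<alpha>) * ((a - r) powr \<gamma> * (b - r) powr \<gamma>))"
      if "0 < r" "r < a" "r < b"
    proof -
      have "c * a - c * r = c * (a - r)" "c * b - c * r = c * (b - r)" by (simp_all add: algebra_simps)
      moreover have "c powr (2 * \<alpha> + 2 * \<gamma>) = c powr (2 * \<alpha>) * (c powr \<gamma> * c powr \<gamma>)"
        by (simp add: powr_add[symmetric])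
      ultimately show ?thesis using that assms by (simp add: powr_mult mult_ac)
    qed
    then show "(if 0 < c * r \<and> c * r < c * a \<and> c * r < c * b
     then ennreal ((c * r) powr (2 * \<alpha>) * ((c * a - c * r) powr \<gamma> * (c * b - c * r) powr \<gamma>)) else 0)
     = ennreal (c powr (2 * \<alpha> + 2 * \<gamma>)) * (if 0 < r \<and> r < a \<and> r < b
     then ennreal (r powr (2 * \<alpha>) * ((a - r) powr \<gamma> * (b - r) powr \<gamma>)) else 0)"
      using assms by (auto simp: ennreal_mult zero_less_mult_iff)
  qed
  also have "\<dots> = ennreal c * (ennreal (c powr (2 * \<alpha> + 2 * \<gamma>)) * cov_kernel a b)"
    unfolding cov_kernel_def by (subst nn_integral_cmult) measurable
  also have "\<dots> = ennreal (c * c powr (2 * \<alpha> + 2 * \<gamma>)) * cov_kernel a b"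
    using assms by (simp add: ennreal_mult mult.assoc)
  also have "c * c powr (2 * \<alpha> + 2 * \<gamma>) = c powr (2 * \<alpha> + 2 * \<gamma> + 1)"
    using assms by (simp add: powr_add)
  finally show ?thesis .
qed

text \<open>Twice the self-similarity index of X: the degree 2\<alpha> + 2\<gamma> + 1 of
  \<open>cov_kernel\<close>, 2\<beta> from the weights, and 2 from the double integral.\<close>

definition var_exp :: real where "var_exp = 2 * (\<alpha> + \<beta> + \<gamma>) + 3"

lemma var_exp_pos: "var_exp > 0" using sum_exponents by (simp add: var_exp_def)

text \<open>The two factors c on the left are the Jacobians of the double integral in
  \<open>rect_cov\<close>.\<close>

lemma wcov_scale:
  assumes "c > 0" "a > 0" "b > 0"
  shows "ennreal c * (ennreal c * wcov (c * a) (c * b)) = ennreal (c powr var_exp) * wcov a b"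
proof -
  have "ennreal c * (ennreal c * wcov (c * a) (c * b))
      = ennreal (c * c * (c powr \<beta> * c powr \<beta>) * c powr (2 * \<alpha> + 2 * \<gamma> + 1)) * wcov a b"
    unfolding wcov_def cov_kernel_scale[OF assms(1)] using assms
    by (simp add: powr_mult ennreal_mult mult_ac)
  also have "c * c * (c powr \<beta> * c powr \<beta>) * c powr (2 * \<alpha> + 2 * \<gamma> + 1) = c powr var_exp"
  proof -
    have "c * c * (c powr \<beta> * c powr \<beta>) * c powr (2 * \<alpha> + 2 * \<gamma> + 1)
        = (c powr 1 * c powr 1) * (c powr \<beta> * c powr \<beta>) * c powr (2 * \<alpha> + 2 * \<gamma> + 1)"
      using assms by simp
    also have "\<dots> = c powr var_exp"
      unfolding powr_add[symmetric] by (simp add: var_exp_def algebra_simps)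
    finally show ?thesis .
  qed
  finally show ?thesis .
qed

lemma rect_cov_scale:
  assumes c: "c > 0"
  shows "rect_cov {0<..c * s} {0<..c * t} = ennreal (c powr var_exp) * rect_cov {0<..s} {0<..t}"
proof -
  have "rect_cov {0<..c * s} {0<..c * t} = ennreal \<bar>c\<bar> * (\<integral>\<^sup>+a. \<integral>\<^sup>+b. (if 0 + c * a \<in> {0<..c * s} \<and> b \<in> {0<..c * t} then wcov (0 + c * a) b else 0) \<partial>lborel \<partial>lborel)"
    unfolding rect_cov_def using c by (intro nn_integral_real_affine) auto
  also have "\<dots> = ennreal \<bar>c\<bar> * (\<integral>\<^sup>+a. ennreal \<bar>c\<bar> * (\<integral>\<^sup>+b. (if 0 + c * a \<in> {0<..c * s} \<and> 0 + c * b \<in> {0<..c * t} then wcov (0 + c * a) (0 + c * b) else 0) \<partial>lborel) \<partial>lborel)"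
    using c by (intro arg_cong[where f="\<lambda>x. ennreal \<bar>c\<bar> * x"] nn_integral_cong nn_integral_real_affine) auto
  also have "\<dots> = (\<integral>\<^sup>+a. \<integral>\<^sup>+b. ennreal c * (ennreal c * (if c * a \<in> {0<..c * s} \<and> c * b \<in> {0<..c * t} then wcov (c * a) (c * b) else 0)) \<partial>lborel \<partial>lborel)"
    using c by (simp add: nn_integral_cmult cong: if_cong)
  also have "\<dots> = (\<integral>\<^sup>+a. \<integral>\<^sup>+b. ennreal (c powr var_exp) * (if a \<in> {0<..s} \<and> b \<in> {0<..t} then wcov a b else 0) \<partial>lborel \<partial>lborel)"
    using c by (intro nn_integral_cong) (auto simp: wcov_scale zero_less_mult_iff)
  also have "\<dots> = ennreal (c powr var_exp) * rect_cov {0<..s} {0<..t}"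
    by (simp add: rect_cov_def nn_integral_cmult)
  finally show ?thesis .
qed

lemma rect_cov_mono: "A \<subseteq> A' \<Longrightarrow> B \<subseteq> B' \<Longrightarrow> rect_cov A B \<le> rect_cov A' B'"
  unfolding rect_cov_def by (intro nn_integral_mono) auto

lemma rect_cov_diag: "t > 0 \<Longrightarrow> rect_cov {0<..t} {0<..t} = ennreal (t powr var_exp) * rect_cov {0<..1} {0<..1}"
  using rect_cov_scale[of t 1 1] by simp

text \<open>Were it 0, the increment kernel would vanish for almost every r in (0, 1), although its
  integrand is positive on the whole interval from r to 1.\<close>

lemma rect_cov_pos: "rect_cov {0<..1} {0<..1} > 0"
proof (rule ccontr)
  assume "\<not> rect_cov {0<..1} {0<..1} > 0"
  then have "(\<integral>\<^sup>+r. (if 0 < r then incr_kernel {0<..1} r * incr_kernel {0<..1} r else 0) \<partial>lborel) = 0"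
    by (subst incr_kernel_mult) auto
  then have "AE r in lborel. (if 0 < r then incr_kernel {0<..1} r * incr_kernel {0<..1} r else 0) = 0"
    by (subst (asm) nn_integral_0_iff_AE) auto
  then have "AE r in lborel. r \<notin> {0<..<1::real}"
  proof eventually_elim
    case (elim r)
    show ?case
    proof
      assume r: "r \<in> {0<..<1}"
      then have "incr_kernel {0<..1} r = 0" using elim by simp
      then have "(\<integral>\<^sup>+u. (if u \<in> {0<..1} \<and> r < u then ennreal (u powr \<beta> * (u - r) powr \<gamma>) else 0) \<partial>lborel) = 0"
        using r by (auto simp: incr_kernel_def)
      then have "AE u in lborel. (if u \<in> {0<..1} \<and> r < u then ennreal (u powr \<beta> * (u - r) powr \<gamma>) else 0) = 0"
        by (subst (asm) nn_integral_0_iff_AE) auto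
      then have "AE u in lborel. u \<notin> {r<..1}"
        by eventually_elim (use r in \<open>auto split: if_splits\<close>)
      moreover have "{u. \<not> u \<notin> {r<..1}} = {r<..1}" by auto
      ultimately have "emeasure lborel {r<..1} = 0"
        by (subst (asm) AE_iff_measurable[OF _ refl]) auto
      then show False using r by simp
    qed
  qed
  moreover have "{r. \<not> r \<notin> {0<..<1}} = {0<..<1::real}" by auto
  ultimately have "emeasure lborel {0<..<1::real} = 0"
    by (subst (asm) AE_iff_measurable[OF _ refl]) auto
  then show False by simp
qed

end

text \<open>Rounding t down to the grid of mesh 1/(n+1) leaves countably many measurable slices;
  continuity of the paths gives pointwise convergence.\<close>

lemma measurable_continuous_process:
  fixes f :: "real \<Rightarrow> 'a \<Rightarrow> real"
  assumes m: "\<And>t. f t \<in> borel_measurable M"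
    and c: "\<And>\<omega>. \<omega> \<in> space M \<Longrightarrow> continuous_on UNIV (\<lambda>t. f t \<omega>)"
  shows "(\<lambda>(t, \<omega>). f t \<omega>) \<in> borel_measurable (borel \<Otimes>\<^sub>M M)"
proof (rule borel_measurable_LIMSEQ_real)
  define u where "u n p = f (real_of_int \<lfloor>real (Suc n) * fst p\<rfloor> / real (Suc n)) (snd p)" for n and p :: "real \<times> 'a"
  show "u n \<in> borel_measurable (borel \<Otimes>\<^sub>M M)" for n
    unfolding u_def
  proof (rule measurable_compose_countable[where f="\<lambda>i p. f (real_of_int i / real (Suc n)) (snd p)"])
    show "(\<lambda>p. f (real_of_int i / real (Suc n)) (snd p)) \<in> borel_measurable (borel \<Otimes>\<^sub>M M)" for i
      using m by measurable
    show "(\<lambda>p. \<lfloor>real (Suc n) * fst p\<rfloor>) \<in> (borel :: real measure) \<Otimes>\<^sub>M M \<rightarrow>\<^sub>M count_space UNIV"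
      by measurable
  qed
  fix p assume "p \<in> space ((borel :: real measure) \<Otimes>\<^sub>M M)"
  then have \<omega>: "snd p \<in> space M" by (auto simp: space_pair_measure)
  have lim: "(\<lambda>n. real_of_int \<lfloor>real (Suc n) * fst p\<rfloor> / real (Suc n)) \<longlonglongrightarrow> fst p"
  proof (rule tendsto_sandwich)
    have low: "fst p - 1 / real (Suc n) \<le> real_of_int \<lfloor>real (Suc n) * fst p\<rfloor> / real (Suc n)" for n
    proof -
      have "real (Suc n) * fst p - 1 \<le> real_of_int \<lfloor>real (Suc n) * fst p\<rfloor>" by linarith
      then have "(real (Suc n) * fst p - 1) / real (Suc n) \<le> real_of_int \<lfloor>real (Suc n) * fst p\<rfloor> / real (Suc n)"
        by (intro divide_right_mono) auto
      then show ?thesis by (simp add: diff_divide_distrib)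
    qed
    have up: "real_of_int \<lfloor>real (Suc n) * fst p\<rfloor> / real (Suc n) \<le> fst p" for n
      by (simp add: divide_le_eq mult.commute[of "fst p"])
    show "\<forall>\<^sub>F n in sequentially. fst p - 1 / real (Suc n) \<le> real_of_int \<lfloor>real (Suc n) * fst p\<rfloor> / real (Suc n)"
      "\<forall>\<^sub>F n in sequentially. real_of_int \<lfloor>real (Suc n) * fst p\<rfloor> / real (Suc n) \<le> fst p"
      using low up by (auto intro!: always_eventually)
    have "(\<lambda>n. fst p - 1 / real (Suc n)) \<longlonglongrightarrow> fst p - 0"
      by (intro tendsto_intros LIMSEQ_Suc lim_1_over_n)
    then show "(\<lambda>n. fst p - 1 / real (Suc n)) \<longlonglongrightarrow> fst p" by simp
  qed simp
  have "isCont (\<lambda>t. f t (snd p)) (fst p)"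
    using c[OF \<omega>] by (simp add: continuous_on_eq_continuous_at)
  from isCont_tendsto_compose[OF this lim]
  show "(\<lambda>n. u n p) \<longlonglongrightarrow> (case p of (t, \<omega>) \<Rightarrow> f t \<omega>)"
    by (simp add: u_def case_prod_beta)
qed

text \<open>Fubini for A(s) B(t) on the triple product. Nonnegative covariances allow the outcome to
  be stated as an \<open>ennreal\<close> integral, ready to be exchanged with the integrals that
  express those covariances.\<close>

lemma (in prob_space) bilinear_moment:
  fixes A B :: "'b \<Rightarrow> 'a \<Rightarrow> real"
  assumes pN: "prob_space N"
    and A[measurable]: "(\<lambda>(s, \<omega>). A s \<omega>) \<in> borel_measurable (N \<Otimes>\<^sub>M M)"
    and B[measurable]: "(\<lambda>(s, \<omega>). B s \<omega>) \<in> borel_measurable (N \<Otimes>\<^sub>M M)"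
    and A2: "(\<integral>\<^sup>+s. \<integral>\<^sup>+\<omega>. ennreal ((A s \<omega>)\<^sup>2) \<partial>M \<partial>N) < \<infinity>"
    and B2: "(\<integral>\<^sup>+s. \<integral>\<^sup>+\<omega>. ennreal ((B s \<omega>)\<^sup>2) \<partial>M \<partial>N) < \<infinity>"
    and nonneg: "\<And>s t. s \<in> space N \<Longrightarrow> t \<in> space N \<Longrightarrow> 0 \<le> (\<integral>\<omega>. A s \<omega> * B t \<omega> \<partial>M)"
  shows "integrable M (\<lambda>\<omega>. (\<integral>s. A s \<omega> \<partial>N) * (\<integral>s. B s \<omega> \<partial>N))"
    and "ennreal (\<integral>\<omega>. (\<integral>s. A s \<omega> \<partial>N) * (\<integral>s. B s \<omega> \<partial>N) \<partial>M)
      = (\<integral>\<^sup>+s. \<integral>\<^sup>+t. ennreal (\<integral>\<omega>. A s \<omega> * B t \<omega> \<partial>M) \<partial>N \<partial>N)"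
    and "0 \<le> (\<integral>\<omega>. (\<integral>s. A s \<omega> \<partial>N) * (\<integral>s. B s \<omega> \<partial>N) \<partial>M)"
proof -
  interpret N: prob_space N by fact
  interpret NN: pair_prob_space N N ..
  interpret P: pair_sigma_finite "N \<Otimes>\<^sub>M N" M ..
  have mA: "(\<lambda>x. A (f x) (g x)) \<in> borel_measurable K"
    if [measurable]: "f \<in> measurable K N" "g \<in> measurable K M" for f g and K :: "'c measure"
    using measurable_compose[OF measurable_Pair[OF that] A] by simp
  have mB: "(\<lambda>x. B (f x) (g x)) \<in> borel_measurable K"
    if [measurable]: "f \<in> measurable K N" "g \<in> measurable K M" for f g and K :: "'c measure"
    using measurable_compose[OF measurable_Pair[OF that] B] by simp
  define F where "F p \<omega> = A (fst p) \<omega> * B (snd p) \<omega>" for p \<omega>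
  have Fm[measurable]: "(\<lambda>(p, \<omega>). F p \<omega>) \<in> borel_measurable ((N \<Otimes>\<^sub>M N) \<Otimes>\<^sub>M M)"
    unfolding F_def case_prod_beta by (intro borel_measurable_times mA mB) measurable
  have [measurable]: "(\<lambda>q. A (fst (fst q)) (snd q)) \<in> borel_measurable ((N \<Otimes>\<^sub>M N) \<Otimes>\<^sub>M M)"
     "(\<lambda>q. B (snd (fst q)) (snd q)) \<in> borel_measurable ((N \<Otimes>\<^sub>M N) \<Otimes>\<^sub>M M)"
    by (intro mA mB; measurable)+
  have Am[measurable]: "(\<lambda>\<omega>. A s \<omega>) \<in> borel_measurable M" if "s \<in> space N" for s
    using that by (intro mA) auto
  have Bm[measurable]: "(\<lambda>\<omega>. B s \<omega>) \<in> borel_measurable M" if "s \<in> space N" for s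
    using that by (intro mB) auto
  \<comment> \<open>The bound |A B| \<le> A^2 + B^2 reduces integrability on the triple product to
    the two given second moments, because N has mass 1.\<close>
  have "(\<integral>\<^sup>+q. ennreal (norm (F (fst q) (snd q))) \<partial>((N \<Otimes>\<^sub>M N) \<Otimes>\<^sub>M M))
      \<le> (\<integral>\<^sup>+q. ennreal ((A (fst (fst q)) (snd q))\<^sup>2) + ennreal ((B (snd (fst q)) (snd q))\<^sup>2) \<partial>((N \<Otimes>\<^sub>M N) \<Otimes>\<^sub>M M))"
  proof (rule nn_integral_mono)
    fix q
    define a b where "a = A (fst (fst q)) (snd q)" and "b = B (snd (fst q)) (snd q)"
    have "0 \<le> (\<bar>a\<bar> - \<bar>b\<bar>)\<^sup>2" by simp
    then have "2 * (\<bar>a\<bar> * \<bar>b\<bar>) \<le> \<bar>a\<bar>\<^sup>2 + \<bar>b\<bar>\<^sup>2" by (simp add: power2_eq_square algebra_simps)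
    moreover have "0 \<le> \<bar>a\<bar> * \<bar>b\<bar>" by simp
    ultimately have "\<bar>a\<bar> * \<bar>b\<bar> \<le> a\<^sup>2 + b\<^sup>2" by (simp only: power2_abs)
    then show "ennreal (norm (F (fst q) (snd q)))
        \<le> ennreal ((A (fst (fst q)) (snd q))\<^sup>2) + ennreal ((B (snd (fst q)) (snd q))\<^sup>2)"
      by (simp add: F_def a_def b_def abs_mult ennreal_plus[symmetric] del: ennreal_plus)
  qed
  also have "\<dots> = (\<integral>\<^sup>+q. ennreal ((A (fst (fst q)) (snd q))\<^sup>2) \<partial>((N \<Otimes>\<^sub>M N) \<Otimes>\<^sub>M M))
      + (\<integral>\<^sup>+q. ennreal ((B (snd (fst q)) (snd q))\<^sup>2) \<partial>((N \<Otimes>\<^sub>M N) \<Otimes>\<^sub>M M))"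
    by (rule nn_integral_add) measurable
  also have "(\<integral>\<^sup>+q. ennreal ((A (fst (fst q)) (snd q))\<^sup>2) \<partial>((N \<Otimes>\<^sub>M N) \<Otimes>\<^sub>M M))
      = (\<integral>\<^sup>+p. \<integral>\<^sup>+\<omega>. ennreal ((A (fst p) \<omega>)\<^sup>2) \<partial>M \<partial>(N \<Otimes>\<^sub>M N))"
    by (subst nn_integral_fst[symmetric]) auto
  also have "\<dots> = (\<integral>\<^sup>+s. \<integral>\<^sup>+t. \<integral>\<^sup>+\<omega>. ennreal ((A s \<omega>)\<^sup>2) \<partial>M \<partial>N \<partial>N)"
    by (subst N.nn_integral_fst[symmetric]) (auto intro!: borel_measurable_nn_integral)
  also have "\<dots> = (\<integral>\<^sup>+s. \<integral>\<^sup>+\<omega>. ennreal ((A s \<omega>)\<^sup>2) \<partial>M \<partial>N)"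
    by (simp add: N.emeasure_space_1)
  also have "(\<integral>\<^sup>+q. ennreal ((B (snd (fst q)) (snd q))\<^sup>2) \<partial>((N \<Otimes>\<^sub>M N) \<Otimes>\<^sub>M M))
      = (\<integral>\<^sup>+p. \<integral>\<^sup>+\<omega>. ennreal ((B (snd p) \<omega>)\<^sup>2) \<partial>M \<partial>(N \<Otimes>\<^sub>M N))"
    by (subst nn_integral_fst[symmetric]) auto
  also have "\<dots> = (\<integral>\<^sup>+s. \<integral>\<^sup>+t. \<integral>\<^sup>+\<omega>. ennreal ((B t \<omega>)\<^sup>2) \<partial>M \<partial>N \<partial>N)"
    by (subst N.nn_integral_fst[symmetric]) (auto intro!: borel_measurable_nn_integral)
  also have "\<dots> = (\<integral>\<^sup>+s. \<integral>\<^sup>+\<omega>. ennreal ((B s \<omega>)\<^sup>2) \<partial>M \<partial>N)"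
    by (simp add: N.emeasure_space_1)
  also have "(\<integral>\<^sup>+s. \<integral>\<^sup>+\<omega>. ennreal ((A s \<omega>)\<^sup>2) \<partial>M \<partial>N) + (\<integral>\<^sup>+s. \<integral>\<^sup>+\<omega>. ennreal ((B s \<omega>)\<^sup>2) \<partial>M \<partial>N) < \<infinity>"
    using A2 B2 by simp
  finally have IF: "integrable ((N \<Otimes>\<^sub>M N) \<Otimes>\<^sub>M M) (\<lambda>(p, \<omega>). F p \<omega>)"
    by (intro integrableI_bounded) (auto simp: case_prod_beta)
  have IF': "integrable (M \<Otimes>\<^sub>M (N \<Otimes>\<^sub>M N)) (\<lambda>(\<omega>, p). F p \<omega>)"
    using P.integrable_product_swap[OF IF] by (simp add: case_prod_beta)
  interpret P': pair_sigma_finite M "N \<Otimes>\<^sub>M N" ..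
  have "AE \<omega> in M. integrable (N \<Otimes>\<^sub>M N) (\<lambda>p. F p \<omega>)"
    using P'.AE_integrable_fst'[OF IF'] by simp
  then have ae: "AE \<omega> in M. (\<integral>p. F p \<omega> \<partial>(N \<Otimes>\<^sub>M N)) = (\<integral>s. A s \<omega> \<partial>N) * (\<integral>s. B s \<omega> \<partial>N)"
  proof eventually_elim
    case (elim \<omega>)
    then have "(\<integral>s. \<integral>t. F (s, t) \<omega> \<partial>N \<partial>N) = (\<integral>p. F p \<omega> \<partial>(N \<Otimes>\<^sub>M N))"
      by (intro NN.integral_fst')
    then show ?case by (simp add: F_def)
  qed
  have mAB: "(\<lambda>\<omega>. (\<integral>s. A s \<omega> \<partial>N) * (\<integral>s. B s \<omega> \<partial>N)) \<in> borel_measurable M"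
    by (intro borel_measurable_times N.borel_measurable_lebesgue_integral)
       (unfold case_prod_beta, (intro mA mB; measurable)+)
  have mF: "(\<lambda>\<omega>. \<integral>p. F p \<omega> \<partial>(N \<Otimes>\<^sub>M N)) \<in> borel_measurable M"
    using P'.integrable_fst'[OF IF'] by simp
  have "integrable M (\<lambda>\<omega>. \<integral>p. F p \<omega> \<partial>(N \<Otimes>\<^sub>M N))"
    using P'.integrable_fst'[OF IF'] by simp
  then show "integrable M (\<lambda>\<omega>. (\<integral>s. A s \<omega> \<partial>N) * (\<integral>s. B s \<omega> \<partial>N))"
    using ae mAB mF by (subst (asm) integrable_cong_AE) auto
  have "(\<integral>\<omega>. (\<integral>s. A s \<omega> \<partial>N) * (\<integral>s. B s \<omega> \<partial>N) \<partial>M) = (\<integral>\<omega>. \<integral>p. F p \<omega> \<partial>(N \<Otimes>\<^sub>M N) \<partial>M)"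
    using ae mAB mF by (intro integral_cong_AE) auto
  also have "\<dots> = (\<integral>p. \<integral>\<omega>. F p \<omega> \<partial>M \<partial>(N \<Otimes>\<^sub>M N))"
    by (rule P.Fubini_integral[OF IF])
  finally have e: "(\<integral>\<omega>. (\<integral>s. A s \<omega> \<partial>N) * (\<integral>s. B s \<omega> \<partial>N) \<partial>M) = (\<integral>p. \<integral>\<omega>. F p \<omega> \<partial>M \<partial>(N \<Otimes>\<^sub>M N))" .
  have i2: "integrable (N \<Otimes>\<^sub>M N) (\<lambda>p. \<integral>\<omega>. F p \<omega> \<partial>M)"
    using P.integrable_fst'[OF IF] by simp
  have [measurable]: "(\<lambda>p. \<integral>\<omega>. F p \<omega> \<partial>M) \<in> borel_measurable (N \<Otimes>\<^sub>M N)"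
    using i2 by simp
  have "ennreal (\<integral>p. \<integral>\<omega>. F p \<omega> \<partial>M \<partial>(N \<Otimes>\<^sub>M N)) = (\<integral>\<^sup>+p. ennreal (\<integral>\<omega>. F p \<omega> \<partial>M) \<partial>(N \<Otimes>\<^sub>M N))"
    using nonneg by (intro nn_integral_eq_integral[symmetric] i2) (auto simp: F_def space_pair_measure)
  also have "\<dots> = (\<integral>\<^sup>+s. \<integral>\<^sup>+t. ennreal (\<integral>\<omega>. A s \<omega> * B t \<omega> \<partial>M) \<partial>N \<partial>N)"
    by (subst N.nn_integral_fst[symmetric]) (auto simp: F_def[abs_def])
  finally show "ennreal (\<integral>\<omega>. (\<integral>s. A s \<omega> \<partial>N) * (\<integral>s. B s \<omega> \<partial>N) \<partial>M)
      = (\<integral>\<^sup>+s. \<integral>\<^sup>+t. ennreal (\<integral>\<omega>. A s \<omega> * B t \<omega> \<partial>M) \<partial>N \<partial>N)"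
    unfolding e .
  show "0 \<le> (\<integral>\<omega>. (\<integral>s. A s \<omega> \<partial>N) * (\<integral>s. B s \<omega> \<partial>N) \<partial>M)"
    unfolding e F_def by (rule Bochner_Integration.integral_nonneg, rule nonneg) (auto simp: space_pair_measure)
qed

section \<open>Moments of the Volterra process\<close>

locale volterra_process = volterra_exponents \<alpha> \<beta> \<gamma> for \<alpha> \<beta> \<gamma> +
  fixes M :: "'a measure" and W X :: "real \<Rightarrow> 'a \<Rightarrow> real"
  assumes W: "standard_wiener M W" and X: "continuous_volterra_process M W \<alpha> \<beta> \<gamma> X"
begin

sublocale prob_space M using W by (simp add: standard_wiener_def)

text \<open>Extended by 0 beyond t, so that kernels with different horizons can be added on the
  whole line.\<close>

definition K :: "real \<Rightarrow> real \<Rightarrow> real" where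
  "K t r = indicator {0..t} r * volterra_kernel \<alpha> \<beta> \<gamma> t r"

lemma X_wiener: "t \<ge> 0 \<Longrightarrow> has_wiener_integral M W t (volterra_kernel \<alpha> \<beta> \<gamma> t) (X t)"
  using X by (simp add: continuous_volterra_process_def)

lemma X_0: "\<omega> \<in> space M \<Longrightarrow> X 0 \<omega> = 0"
  using X by (simp add: continuous_volterra_process_def)

lemma X_continuous: "\<omega> \<in> space M \<Longrightarrow> continuous_on {0..} (\<lambda>t. X t \<omega>)"
  using X by (simp add: continuous_volterra_process_def)

lemma X_measurable: "t \<ge> 0 \<Longrightarrow> X t \<in> borel_measurable M"
  using X_wiener by (simp add: has_wiener_integral_def)

lemma K_measurable: "t \<ge> 0 \<Longrightarrow> K t \<in> borel_measurable borel"
  using X_wiener[of t] by (simp add: has_wiener_integral_def set_borel_measurable_def K_def[abs_def])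

lemma lincomb_normal:
  assumes "finite I" "\<And>i. i \<in> I \<Longrightarrow> t i \<ge> 0"
  shows "centered_normal M (\<integral>r. (\<Sum>i\<in>I. w i * K (t i) r)\<^sup>2 \<partial>lborel) (\<lambda>\<omega>. \<Sum>i\<in>I. w i * X (t i) \<omega>)"
    and "integrable lborel (\<lambda>r. (\<Sum>i\<in>I. w i * K (t i) r)\<^sup>2)"
  using wiener_integral_lincomb[OF W assms(1), of t "\<lambda>i. volterra_kernel \<alpha> \<beta> \<gamma> (t i)" "\<lambda>i. X (t i)" w]
    X_wiener assms(2) by (auto simp: K_def)

lemma square_integrable_prod:
  fixes f g :: "'z \<Rightarrow> real"
  assumes [measurable]: "f \<in> borel_measurable N" "g \<in> borel_measurable N"
    and "integrable N (\<lambda>x. (f x)\<^sup>2)" "integrable N (\<lambda>x. (g x)\<^sup>2)"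
  shows "integrable N (\<lambda>x. f x * g x)"
proof (rule Bochner_Integration.integrable_bound[of _ "\<lambda>x. (f x)\<^sup>2 + (g x)\<^sup>2"])
  show "AE x in N. norm (f x * g x) \<le> norm ((f x)\<^sup>2 + (g x)\<^sup>2)"
  proof (rule AE_I2)
    fix x
    have "0 \<le> (\<bar>f x\<bar> - \<bar>g x\<bar>)\<^sup>2" by simp
    then have "2 * (\<bar>f x\<bar> * \<bar>g x\<bar>) \<le> \<bar>f x\<bar>\<^sup>2 + \<bar>g x\<bar>\<^sup>2" by (simp add: power2_eq_square algebra_simps)
    moreover have "0 \<le> \<bar>f x\<bar> * \<bar>g x\<bar>" by simp
    ultimately have "\<bar>f x\<bar> * \<bar>g x\<bar> \<le> (f x)\<^sup>2 + (g x)\<^sup>2" by (simp only: power2_abs)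
    then show "norm (f x * g x) \<le> norm ((f x)\<^sup>2 + (g x)\<^sup>2)" by (simp add: abs_mult)
  qed
qed (use assms in auto)

lemma X_square_integrable: "t \<ge> 0 \<Longrightarrow> integrable M (\<lambda>\<omega>. (X t \<omega>)\<^sup>2)"
  using centered_normal_moment(1)[OF lincomb_normal(1)[of "{t}" "\<lambda>i. i" "\<lambda>_. 1"]] by simp

lemma K_square_integrable: "t \<ge> 0 \<Longrightarrow> integrable lborel (\<lambda>r. (K t r)\<^sup>2)"
  using lincomb_normal(2)[of "{t}" "\<lambda>i. i" "\<lambda>_. 1"] by simp

lemma X_prod_integrable: "s \<ge> 0 \<Longrightarrow> t \<ge> 0 \<Longrightarrow> integrable M (\<lambda>\<omega>. X s \<omega> * X t \<omega>)"
  by (intro square_integrable_prod X_measurable X_square_integrable)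

lemma K_prod_integrable: "s \<ge> 0 \<Longrightarrow> t \<ge> 0 \<Longrightarrow> integrable lborel (\<lambda>r. K s r * K t r)"
  using K_measurable by (intro square_integrable_prod K_square_integrable) auto

text \<open>Polarisation: the isometry is available for squares of linear combinations.\<close>

lemma X_covariance:
  assumes "s \<ge> 0" "t \<ge> 0"
  shows "(\<integral>\<omega>. X s \<omega> * X t \<omega> \<partial>M) = (\<integral>r. K s r * K t r \<partial>lborel)"
proof -
  \<comment> \<open>The index type \<open>bool\<close> keeps two summands even when s = t.\<close>
  have e: "(\<integral>\<omega>. (X s \<omega> + c * X t \<omega>)\<^sup>2 \<partial>M) = (\<integral>r. (K s r + c * K t r)\<^sup>2 \<partial>lborel)" for c
    using centered_normal_moment(2)[OF lincomb_normal(1)[of "UNIV :: bool set" "\<lambda>b. if b then s else t" "\<lambda>b. if b then 1 else c"]] assms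
    by (simp add: UNIV_bool add.commute)
  have "(\<integral>\<omega>. X s \<omega> * X t \<omega> \<partial>M) = (\<integral>\<omega>. (X s \<omega> + 1 * X t \<omega>)\<^sup>2 \<partial>M) / 2 - (\<integral>\<omega>. (X s \<omega> + 0 * X t \<omega>)\<^sup>2 \<partial>M) / 2 - (\<integral>\<omega>. (X t \<omega> + 0 * X s \<omega>)\<^sup>2 \<partial>M) / 2"
    using X_square_integrable assms X_prod_integrable[OF assms] by (simp add: power2_sum mult.assoc add_divide_distrib)
  also have "\<dots> = (\<integral>r. (K s r + 1 * K t r)\<^sup>2 \<partial>lborel) / 2 - (\<integral>r. (K s r + 0 * K t r)\<^sup>2 \<partial>lborel) / 2 - (\<integral>r. (K t r + 0 * K s r)\<^sup>2 \<partial>lborel) / 2"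
    unfolding e
    using centered_normal_moment(2)[OF lincomb_normal(1)[of "{t}" "\<lambda>i. i" "\<lambda>_. 1"]] assms by simp
  also have "\<dots> = (\<integral>r. K s r * K t r \<partial>lborel)"
    using K_square_integrable assms K_prod_integrable[OF assms] by (simp add: power2_sum mult.assoc add_divide_distrib)
  finally show ?thesis .
qed

text \<open>The isometry expresses the moment through kernel increments, which are nonnegative for r
  > 0 and vanish for r < 0; the integral of their product is the rectangle integral of the
  density.\<close>

lemma increment_covariance:
  assumes st: "0 \<le> s" "s \<le> t" and st': "0 \<le> s'" "s' \<le> t'"
  shows "integrable M (\<lambda>\<omega>. (X t \<omega> - X s \<omega>) * (X t' \<omega> - X s' \<omega>))"
    and "0 \<le> (\<integral>\<omega>. (X t \<omega> - X s \<omega>) * (X t' \<omega> - X s' \<omega>) \<partial>M)"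
    and "ennreal (\<integral>\<omega>. (X t \<omega> - X s \<omega>) * (X t' \<omega> - X s' \<omega>) \<partial>M) = rect_cov {s<..t} {s'<..t'}"
proof -
  have p: "t \<ge> 0" "t' \<ge> 0" using assms by auto
  note pX = X_prod_integrable[OF p] X_prod_integrable[OF st(1) p(2)] X_prod_integrable[OF p(1) st'(1)] X_prod_integrable[OF st(1) st'(1)]
  note pK = K_prod_integrable[OF p] K_prod_integrable[OF st(1) p(2)] K_prod_integrable[OF p(1) st'(1)] K_prod_integrable[OF st(1) st'(1)]
  show "integrable M (\<lambda>\<omega>. (X t \<omega> - X s \<omega>) * (X t' \<omega> - X s' \<omega>))"
    using pX by (simp add: algebra_simps)
  have iK: "integrable lborel (\<lambda>r. (K t r - K s r) * (K t' r - K s' r))"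
    using pK by (simp add: algebra_simps)
  have "(\<integral>\<omega>. (X t \<omega> - X s \<omega>) * (X t' \<omega> - X s' \<omega>) \<partial>M)
      = (\<integral>\<omega>. X t \<omega> * X t' \<omega> \<partial>M) - (\<integral>\<omega>. X s \<omega> * X t' \<omega> \<partial>M) - (\<integral>\<omega>. X t \<omega> * X s' \<omega> \<partial>M) + (\<integral>\<omega>. X s \<omega> * X s' \<omega> \<partial>M)"
    using pX by (simp add: algebra_simps)
  also have "\<dots> = (\<integral>r. K t r * K t' r \<partial>lborel) - (\<integral>r. K s r * K t' r \<partial>lborel) - (\<integral>r. K t r * K s' r \<partial>lborel) + (\<integral>r. K s r * K s' r \<partial>lborel)"
    using p st(1) st'(1) by (simp add: X_covariance)
  also have "\<dots> = (\<integral>r. (K t r - K s r) * (K t' r - K s' r) \<partial>lborel)"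
    using pK by (simp add: algebra_simps)
  finally have e: "(\<integral>\<omega>. (X t \<omega> - X s \<omega>) * (X t' \<omega> - X s' \<omega>) \<partial>M) = (\<integral>r. (K t r - K s r) * (K t' r - K s' r) \<partial>lborel)" .
  have K0: "K u r = 0" if "r < 0" for u r using that by (simp add: K_def)
  have nn: "AE r in lborel. 0 \<le> (K t r - K s r) * (K t' r - K s' r)"
    using AE_lborel_singleton[of 0]
  proof eventually_elim
    case (elim r)
    then show ?case
      using volterra_kernel_diff(2)[OF _ st, of r] volterra_kernel_diff(2)[OF _ st', of r] K0[of r]
      by (cases "r < 0") (auto simp: K_def)
  qed
  then show "0 \<le> (\<integral>\<omega>. (X t \<omega> - X s \<omega>) * (X t' \<omega> - X s' \<omega>) \<partial>M)"
    unfolding e by (rule integral_nonneg_AE)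
  have "ennreal (\<integral>r. (K t r - K s r) * (K t' r - K s' r) \<partial>lborel)
      = (\<integral>\<^sup>+r. ennreal ((K t r - K s r) * (K t' r - K s' r)) \<partial>lborel)"
    using nn iK by (intro nn_integral_eq_integral[symmetric])
  also have "\<dots> = (\<integral>\<^sup>+r. (if 0 < r then incr_kernel {s<..t} r * incr_kernel {s'<..t'} r else 0) \<partial>lborel)"
  proof (rule nn_integral_cong_AE)
    show "AE r in lborel. ennreal ((K t r - K s r) * (K t' r - K s' r)) = (if 0 < r then incr_kernel {s<..t} r * incr_kernel {s'<..t'} r else 0)"
      using AE_lborel_singleton[of 0]
    proof eventually_elim
      case (elim r)
      show ?case
      proof (cases "r < 0")
        case False
        then have r: "0 < r" using elim by simp
        show ?thesis
          using r volterra_kernel_diff[OF r st] volterra_kernel_diff[OF r st']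
          by (simp add: K_def ennreal_mult)
      qed (simp add: K0)
    qed
  qed
  also have "\<dots> = rect_cov {s<..t} {s'<..t'}" by (rule incr_kernel_mult) auto
  finally show "ennreal (\<integral>\<omega>. (X t \<omega> - X s \<omega>) * (X t' \<omega> - X s' \<omega>) \<partial>M) = rect_cov {s<..t} {s'<..t'}"
    unfolding e .
qed

definition R1 :: real where "R1 = (\<integral>\<omega>. (X 1 \<omega>)\<^sup>2 \<partial>M)"

lemma rect_cov_1: "rect_cov {0<..1} {0<..1} = ennreal R1"
proof -
  have "ennreal (\<integral>\<omega>. (X 1 \<omega> - X 0 \<omega>) * (X 1 \<omega> - X 0 \<omega>) \<partial>M) = rect_cov {0<..1} {0<..1}"
    by (rule increment_covariance(3)) auto
  moreover have "(\<integral>\<omega>. (X 1 \<omega> - X 0 \<omega>) * (X 1 \<omega> - X 0 \<omega>) \<partial>M) = R1"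
    unfolding R1_def by (intro Bochner_Integration.integral_cong) (auto simp: X_0 power2_eq_square)
  ultimately show ?thesis by simp
qed

lemma R1_pos: "R1 > 0"
  using rect_cov_pos rect_cov_1 by simp

text \<open>Self-similarity reduces time t to time 1; time 0 is separate because scaling needs a
  positive factor.\<close>

lemma X_second_moment:
  assumes "t \<ge> 0"
  shows "(\<integral>\<omega>. (X t \<omega>)\<^sup>2 \<partial>M) = t powr var_exp * R1"
proof (cases "t = 0")
  case True
  have "(\<integral>\<omega>. (X t \<omega>)\<^sup>2 \<partial>M) = (\<integral>\<omega>. 0 \<partial>M)"
    using True by (intro Bochner_Integration.integral_cong) (auto simp: X_0)
  then show ?thesis using True by simp
next
  case False
  then have t: "t > 0" using assms by simp
  have "(\<integral>\<omega>. (X t \<omega> - X 0 \<omega>) * (X t \<omega> - X 0 \<omega>) \<partial>M) = (\<integral>\<omega>. (X t \<omega>)\<^sup>2 \<partial>M)"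
    by (intro Bochner_Integration.integral_cong) (auto simp: X_0 power2_eq_square)
  then have "ennreal (\<integral>\<omega>. (X t \<omega>)\<^sup>2 \<partial>M) = rect_cov {0<..t} {0<..t}"
    using increment_covariance(3)[of 0 t 0 t] t by simp
  also have "\<dots> = ennreal (t powr var_exp * R1)"
    using rect_cov_diag[OF t] R1_pos by (simp add: rect_cov_1 ennreal_mult)
  finally show ?thesis using R1_pos by (subst (asm) ennreal_inj) auto
qed

text \<open>Frozen at its initial value for negative times: the paths become continuous on the whole
  line, which makes the process jointly measurable.\<close>

definition X' :: "real \<Rightarrow> 'a \<Rightarrow> real" where "X' t \<omega> = X (max 0 t) \<omega>"

lemma X'_continuous: "\<omega> \<in> space M \<Longrightarrow> continuous_on A (\<lambda>t. X' t \<omega>)"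
  unfolding X'_def
  by (rule continuous_on_compose2[OF X_continuous, where f="\<lambda>t. max 0 t"]) (auto intro!: continuous_intros)

lemma X'_measurable[measurable]: "(\<lambda>(t, \<omega>). X' t \<omega>) \<in> borel_measurable (borel \<Otimes>\<^sub>M M)"
proof (rule measurable_continuous_process)
  show "X' t \<in> borel_measurable M" for t by (simp add: X'_def[abs_def] X_measurable)
qed (rule X'_continuous)

lemma X'_measurable_compose[measurable (raw)]:
  assumes [measurable]: "f \<in> borel_measurable N" "g \<in> measurable N M"
  shows "(\<lambda>x. X' (f x) (g x)) \<in> borel_measurable N"
  using measurable_compose[OF measurable_Pair[OF assms] X'_measurable] by simp

end

section \<open>Exponential averages of the process\<close>

lemma nn_integral_Gamma_scaled:
  fixes a c :: real
  assumes "a > 0" "c > 0"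
  shows "(\<integral>\<^sup>+x. (if 0 < x then ennreal (x powr (a - 1) * exp (- (c * x))) else 0) \<partial>lborel) = ennreal (Gamma a * c powr (- a))"
proof -
  have "(\<integral>\<^sup>+x. (if 0 < x then ennreal (x powr (a - 1) * exp (- (c * x))) else 0) \<partial>lborel)
      = ennreal \<bar>1 / c\<bar> * (\<integral>\<^sup>+x. (if 0 < 0 + 1 / c * x then ennreal ((0 + 1 / c * x) powr (a - 1) * exp (- (c * (0 + 1 / c * x)))) else 0) \<partial>lborel)"
    using assms by (intro nn_integral_real_affine) auto
  also have "(\<integral>\<^sup>+x. (if 0 < 0 + 1 / c * x then ennreal ((0 + 1 / c * x) powr (a - 1) * exp (- (c * (0 + 1 / c * x)))) else 0) \<partial>lborel)
      = (\<integral>\<^sup>+x. ennreal (c powr (1 - a)) * ennreal (indicator {0..} x * x powr (a - 1) / exp x) \<partial>lborel)"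
  proof (rule nn_integral_cong_AE)
    show "AE x in lborel. (if 0 < 0 + 1 / c * x then ennreal ((0 + 1 / c * x) powr (a - 1) * exp (- (c * (0 + 1 / c * x)))) else 0)
        = ennreal (c powr (1 - a)) * ennreal (indicator {0..} x * x powr (a - 1) / exp x)"
      using AE_lborel_singleton[of 0]
    proof eventually_elim
      case (elim x)
      have "(x / c) powr (a - 1) = c powr (1 - a) * x powr (a - 1)" if "x > 0"
        using that assms(2) by (subst powr_divide) (auto simp: powr_diff field_simps)
      then show ?case
        using elim assms(2) by (auto simp: indicator_def ennreal_mult[symmetric] exp_minus field_simps zero_less_mult_iff zero_less_divide_iff)
    qed
  qed
  also have "\<dots> = ennreal (c powr (1 - a)) * ennreal (Gamma a)"
    by (subst nn_integral_cmult) (auto simp: Gamma_conv_nn_integral_real[OF assms(1)])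
  also have "ennreal \<bar>1 / c\<bar> * (ennreal (c powr (1 - a)) * ennreal (Gamma a)) = ennreal (1 / c * c powr (1 - a) * Gamma a)"
    using assms by (simp add: ennreal_mult[symmetric] Gamma_real_pos less_imp_le mult.assoc)
  also have "1 / c * c powr (1 - a) * Gamma a = Gamma a * c powr (- a)"
    using assms by (simp add: powr_diff powr_minus field_simps)
  finally show ?thesis .
qed

lemma exponential_tail:
  fixes c \<theta> :: real
  assumes "c \<ge> 0" "\<theta> > 0"
  shows "(\<integral>\<^sup>+v. (if c \<le> v then 1 else 0) \<partial>density lborel (exponential_density \<theta>)) = ennreal (exp (- (\<theta> * c)))"
    and "(\<integral>\<^sup>+v. (if c < v then 1 else 0) \<partial>density lborel (exponential_density \<theta>)) = ennreal (exp (- (\<theta> * c)))"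
proof -
  have lim: "((\<lambda>x. - exp (- (\<theta> * x))) \<longlongrightarrow> - 0) at_top"
    using assms(2)
    by (intro tendsto_minus filterlim_compose[OF exp_at_bot] filterlim_compose[OF filterlim_uminus_at_bot_at_top] filterlim_tendsto_pos_mult_at_top[OF tendsto_const _ filterlim_ident])
  have "(\<integral>\<^sup>+v. (if c \<le> v then 1 else 0) \<partial>density lborel (exponential_density \<theta>))
      = (\<integral>\<^sup>+v. ennreal (exponential_density \<theta> v) * (if c \<le> v then 1 else 0) \<partial>lborel)"
    by (subst nn_integral_density) auto
  also have "\<dots> = (\<integral>\<^sup>+v. ennreal (\<theta> * exp (- (\<theta> * v))) * indicator {c..} v \<partial>lborel)"
    using assms by (intro nn_integral_cong) (auto simp: exponential_density_def indicator_def mult.commute)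
  also have "\<dots> = ennreal (- 0 - - exp (- (\<theta> * c)))"
    using assms(2) lim by (intro nn_integral_FTC_atLeast) (auto intro!: derivative_eq_intros)
  finally show 1: "(\<integral>\<^sup>+v. (if c \<le> v then 1 else 0) \<partial>density lborel (exponential_density \<theta>)) = ennreal (exp (- (\<theta> * c)))"
    by simp
  have "AE v in density lborel (exponential_density \<theta>). v \<noteq> c"
    using AE_lborel_singleton[of c] by (subst AE_density) auto
  then have "AE v in density lborel (exponential_density \<theta>). (if c < v then 1 else 0 :: ennreal) = (if c \<le> v then 1 else 0)"
    by (rule eventually_mono) auto
  then have "(\<integral>\<^sup>+v. (if c < v then 1 else 0) \<partial>density lborel (exponential_density \<theta>))
      = (\<integral>\<^sup>+v. (if c \<le> v then 1 else 0) \<partial>density lborel (exponential_density \<theta>))"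
    by (rule nn_integral_cong_AE)
  then show "(\<integral>\<^sup>+v. (if c < v then 1 else 0) \<partial>density lborel (exponential_density \<theta>)) = ennreal (exp (- (\<theta> * c)))"
    using 1 by simp
qed

text \<open>An average of indicators of random sets is a weight: \<open>k a\<close> is the mass of
  the v whose set contains a. Tonelli carries both averages inside the double integral of the
  density.\<close>

lemma (in volterra_exponents) rect_cov_average:
  assumes "sigma_finite_measure N" "sigma_finite_measure N'"
    and [measurable]: "(\<lambda>p. snd p \<in> S (fst p)) \<in> measurable (N \<Otimes>\<^sub>M borel) (count_space UNIV)"
      "(\<lambda>p. snd p \<in> S' (fst p)) \<in> measurable (N' \<Otimes>\<^sub>M borel) (count_space UNIV)"
    and k: "\<And>a. k a = (\<integral>\<^sup>+v. (if a \<in> S v then 1 else 0) \<partial>N)"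
    and k': "\<And>b. k' b = (\<integral>\<^sup>+w. (if b \<in> S' w then 1 else 0) \<partial>N')"
  shows "(\<integral>\<^sup>+v. \<integral>\<^sup>+w. rect_cov (S v) (S' w) \<partial>N' \<partial>N) = (\<integral>\<^sup>+a. \<integral>\<^sup>+b. k a * k' b * wcov a b \<partial>lborel \<partial>lborel)"
proof -
  interpret N: sigma_finite_measure N by fact
  interpret N': sigma_finite_measure N' by fact
  interpret P: pair_sigma_finite lborel N ..
  interpret P': pair_sigma_finite lborel N' ..
  define g where "g v a = (if a \<in> S v then 1 else 0 :: ennreal)" for v a
  define g' where "g' v a = (if a \<in> S' v then 1 else 0 :: ennreal)" for v a
  have gm: "(\<lambda>p. g (fst p) (snd p)) \<in> borel_measurable (N \<Otimes>\<^sub>M borel)" unfolding g_def by measurable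
  have gm': "(\<lambda>p. g' (fst p) (snd p)) \<in> borel_measurable (N' \<Otimes>\<^sub>M borel)" unfolding g'_def by measurable
  have [measurable]: "(\<lambda>x. g (f1 x) (f2 x)) \<in> borel_measurable R"
    if [measurable]: "f1 \<in> measurable R N" "f2 \<in> borel_measurable R" for f1 f2 and R :: "'z measure"
    using measurable_compose[OF measurable_Pair[OF that] gm] by simp
  have [measurable]: "(\<lambda>x. g' (f1 x) (f2 x)) \<in> borel_measurable R"
    if [measurable]: "f1 \<in> measurable R N'" "f2 \<in> borel_measurable R" for f1 f2 and R :: "'z measure"
    using measurable_compose[OF measurable_Pair[OF that] gm'] by simp
  have rc: "rect_cov (S v) (S' w) = (\<integral>\<^sup>+a. \<integral>\<^sup>+b. g v a * (g' w b * wcov a b) \<partial>lborel \<partial>lborel)" for v w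
    unfolding rect_cov_def by (intro nn_integral_cong) (auto simp: g_def g'_def)
  have "(\<integral>\<^sup>+v. \<integral>\<^sup>+w. rect_cov (S v) (S' w) \<partial>N' \<partial>N)
      = (\<integral>\<^sup>+v. \<integral>\<^sup>+w. \<integral>\<^sup>+a. \<integral>\<^sup>+b. g v a * (g' w b * wcov a b) \<partial>lborel \<partial>lborel \<partial>N' \<partial>N)"
    by (simp add: rc)
  also have "\<dots> = (\<integral>\<^sup>+v. \<integral>\<^sup>+a. \<integral>\<^sup>+w. \<integral>\<^sup>+b. g v a * (g' w b * wcov a b) \<partial>lborel \<partial>N' \<partial>lborel \<partial>N)"
    by (intro nn_integral_cong P'.Fubini') measurable
  also have "\<dots> = (\<integral>\<^sup>+v. \<integral>\<^sup>+a. \<integral>\<^sup>+b. \<integral>\<^sup>+w. g v a * (g' w b * wcov a b) \<partial>N' \<partial>lborel \<partial>lborel \<partial>N)"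
    by (intro nn_integral_cong P'.Fubini') measurable
  also have "\<dots> = (\<integral>\<^sup>+v. \<integral>\<^sup>+a. \<integral>\<^sup>+b. g v a * (k' b * wcov a b) \<partial>lborel \<partial>lborel \<partial>N)"
    by (intro nn_integral_cong) (simp add: nn_integral_cmult nn_integral_multc k' g'_def[symmetric])
  also have "\<dots> = (\<integral>\<^sup>+a. \<integral>\<^sup>+v. \<integral>\<^sup>+b. g v a * (k' b * wcov a b) \<partial>lborel \<partial>N \<partial>lborel)"
    unfolding k' g'_def[symmetric] by (intro P.Fubini') measurable
  also have "\<dots> = (\<integral>\<^sup>+a. \<integral>\<^sup>+b. \<integral>\<^sup>+v. g v a * (k' b * wcov a b) \<partial>N \<partial>lborel \<partial>lborel)"
    unfolding k' g'_def[symmetric] by (intro nn_integral_cong P.Fubini') measurable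
  also have "\<dots> = (\<integral>\<^sup>+a. \<integral>\<^sup>+b. k a * k' b * wcov a b \<partial>lborel \<partial>lborel)"
    by (intro nn_integral_cong) (simp add: nn_integral_multc k g_def[symmetric] mult.assoc)
  finally show ?thesis .
qed

section \<open>Averages over an exponential lag and an exponential time\<close>

locale volterra_drift = volterra_process +
  fixes \<theta> :: real
  assumes \<theta>: "\<theta> > 0"
begin

definition expo :: "real measure" where "expo = density lborel (exponential_density \<theta>)"

lemma sets_expo[measurable_cong, simp]: "sets expo = sets borel" by (simp add: expo_def)

lemma space_expo[simp]: "space expo = UNIV" by (simp add: expo_def)

sublocale expo: prob_space expo
  unfolding expo_def by (rule prob_space_exponential_density) (rule \<theta>)

text \<open>Defined for all real lags. The exponential law charges only v \<ge> 0, and the maximum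
  keeps the earlier time from exceeding T for the other v.\<close>

definition lag_incr :: "real \<Rightarrow> real \<Rightarrow> 'a \<Rightarrow> real" where
  "lag_incr T v \<omega> = X' T \<omega> - X' (T - max 0 v) \<omega>"

text \<open>\<open>innov T\<close> is \<open>e\<^sup>-\<^sup>\<theta>\<^sup>T \<integral>\<^sub>0\<^sup>T e\<^sup>\<theta>\<^sup>s dX\<^sub>s\<close> after integration by parts, written as an average of
  increments of \<open>X\<close> (recall \<open>X 0 = 0\<close>).\<close>
definition innov :: "real \<Rightarrow> 'a \<Rightarrow> real" where
  "innov T \<omega> = (\<integral>v. lag_incr T v \<omega> \<partial>expo)"

text \<open>\<open>mean_X\<close> equals \<open>\<theta> \<eta>\<^sub>\<infinity>\<close> almost surely.\<close>
definition mean_X :: "'a \<Rightarrow> real" where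
  "mean_X \<omega> = (\<integral>s. X' s \<omega> \<partial>expo)"

lemma lag_incr_measurable: "(\<lambda>(s, \<omega>). lag_incr T s \<omega>) \<in> borel_measurable (expo \<Otimes>\<^sub>M M)"
  unfolding lag_incr_def by measurable

lemma X'_measurable_expo: "(\<lambda>(s, \<omega>). X' s \<omega>) \<in> borel_measurable (expo \<Otimes>\<^sub>M M)"
  by measurable

lemma lag_incr_eq: "T \<ge> 0 \<Longrightarrow> lag_incr T v \<omega> = X T \<omega> - X (max 0 (T - max 0 v)) \<omega>"
  by (simp add: lag_incr_def X'_def)

lemma X'_eq: "\<omega> \<in> space M \<Longrightarrow> X' s \<omega> = X (max 0 s) \<omega> - X 0 \<omega>"
  by (simp add: X'_def X_0)

text \<open>Uniform in the lag: every lagged square lies in (0, T] x (0, T], whose integral is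
  finite.\<close>

lemma lag_incr_second_moment:
  assumes "T \<ge> 0"
  shows "(\<integral>\<^sup>+v. \<integral>\<^sup>+\<omega>. ennreal ((lag_incr T v \<omega>)\<^sup>2) \<partial>M \<partial>expo) < \<infinity>"
proof -
  have "(\<integral>\<^sup>+\<omega>. ennreal ((lag_incr T v \<omega>)\<^sup>2) \<partial>M) \<le> rect_cov {0<..T} {0<..T}" for v
  proof -
    let ?s = "max 0 (T - max 0 v)"
    have s: "0 \<le> ?s" "?s \<le> T" using assms by auto
    have "(\<integral>\<^sup>+\<omega>. ennreal ((lag_incr T v \<omega>)\<^sup>2) \<partial>M) = (\<integral>\<^sup>+\<omega>. ennreal ((X T \<omega> - X ?s \<omega>) * (X T \<omega> - X ?s \<omega>)) \<partial>M)"
      by (simp add: lag_incr_eq[OF assms] power2_eq_square)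
    also have "\<dots> = ennreal (\<integral>\<omega>. (X T \<omega> - X ?s \<omega>) * (X T \<omega> - X ?s \<omega>) \<partial>M)"
      by (intro nn_integral_eq_integral increment_covariance(1) s) auto
    also have "\<dots> = rect_cov {?s<..T} {?s<..T}" by (intro increment_covariance(3) s)
    also have "\<dots> \<le> rect_cov {0<..T} {0<..T}" by (intro rect_cov_mono) auto
    finally show ?thesis .
  qed
  then have "(\<integral>\<^sup>+v. \<integral>\<^sup>+\<omega>. ennreal ((lag_incr T v \<omega>)\<^sup>2) \<partial>M \<partial>expo) \<le> (\<integral>\<^sup>+v. rect_cov {0<..T} {0<..T} \<partial>expo)"
    by (intro nn_integral_mono)
  also have "\<dots> = rect_cov {0<..T} {0<..T}" using expo.emeasure_space_1 by simp
  also have "\<dots> < \<infinity>"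
  proof (cases "T = 0")
    case True
    then have "rect_cov {0<..T} {0<..T} = 0" by (simp add: rect_cov_def)
    then show ?thesis by simp
  next
    case False
    then show ?thesis using assms rect_cov_diag[of T] by (simp add: rect_cov_1 ennreal_mult_less_top)
  qed
  finally show ?thesis .
qed

lemma X'_nn_second_moment:
  "(\<integral>\<^sup>+\<omega>. ennreal ((X' s \<omega>)\<^sup>2) \<partial>M) = ennreal ((max 0 s) powr var_exp * R1)"
proof -
  have "(\<integral>\<^sup>+\<omega>. ennreal ((X' s \<omega>)\<^sup>2) \<partial>M) = ennreal (\<integral>\<omega>. (X' s \<omega>)\<^sup>2 \<partial>M)"
    unfolding X'_def by (intro nn_integral_eq_integral X_square_integrable) auto
  then show ?thesis unfolding X'_def by (subst (asm) X_second_moment) auto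
qed

text \<open>The second moment is a power of s, so this is a Gamma integral. It serves twice: for the
  square integrability behind \<open>mean_X\<close> and for the growth of almost every path.\<close>

lemma X'_exp_second_moment:
  assumes "c > 0"
  shows "(\<integral>\<^sup>+s. (if 0 < s then ennreal (exp (- (c * s))) else 0) * (\<integral>\<^sup>+\<omega>. ennreal ((X' s \<omega>)\<^sup>2) \<partial>M) \<partial>lborel) < \<infinity>"
proof -
  have "(\<integral>\<^sup>+s. (if 0 < s then ennreal (exp (- (c * s))) else 0) * (\<integral>\<^sup>+\<omega>. ennreal ((X' s \<omega>)\<^sup>2) \<partial>M) \<partial>lborel)
      = (\<integral>\<^sup>+s. ennreal R1 * (if 0 < s then ennreal (s powr (var_exp + 1 - 1) * exp (- (c * s))) else 0) \<partial>lborel)"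
    using R1_pos unfolding X'_nn_second_moment
    by (intro nn_integral_cong) (auto simp: ennreal_mult[symmetric] mult_ac)
  also have "\<dots> = ennreal R1 * ennreal (Gamma (var_exp + 1) * c powr (- (var_exp + 1)))"
    using nn_integral_Gamma_scaled[of "var_exp + 1" c] assms var_exp_pos
    by (subst nn_integral_cmult) simp_all
  also have "\<dots> < \<infinity>" by (simp add: ennreal_mult_less_top)
  finally show ?thesis .
qed

lemma mean_X_second_moment: "(\<integral>\<^sup>+s. \<integral>\<^sup>+\<omega>. ennreal ((X' s \<omega>)\<^sup>2) \<partial>M \<partial>expo) < \<infinity>"
proof -
  have "(\<integral>\<^sup>+s. \<integral>\<^sup>+\<omega>. ennreal ((X' s \<omega>)\<^sup>2) \<partial>M \<partial>expo)
      = (\<integral>\<^sup>+s. ennreal (exponential_density \<theta> s) * (\<integral>\<^sup>+\<omega>. ennreal ((X' s \<omega>)\<^sup>2) \<partial>M) \<partial>lborel)"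
    unfolding expo_def by (subst nn_integral_density) auto
  also have "\<dots> = (\<integral>\<^sup>+s. ennreal \<theta> * ((if 0 < s then ennreal (exp (- (\<theta> * s))) else 0) * (\<integral>\<^sup>+\<omega>. ennreal ((X' s \<omega>)\<^sup>2) \<partial>M)) \<partial>lborel)"
  proof (rule nn_integral_cong_AE)
    show "AE s in lborel. ennreal (exponential_density \<theta> s) * (\<integral>\<^sup>+\<omega>. ennreal ((X' s \<omega>)\<^sup>2) \<partial>M)
        = ennreal \<theta> * ((if 0 < s then ennreal (exp (- (\<theta> * s))) else 0) * (\<integral>\<^sup>+\<omega>. ennreal ((X' s \<omega>)\<^sup>2) \<partial>M))"
      using AE_lborel_singleton[of 0]
      by eventually_elim (use \<theta> in \<open>auto simp: exponential_density_def ennreal_mult mult_ac\<close>)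
  qed
  also have "\<dots> = ennreal \<theta> * (\<integral>\<^sup>+s. (if 0 < s then ennreal (exp (- (\<theta> * s))) else 0) * (\<integral>\<^sup>+\<omega>. ennreal ((X' s \<omega>)\<^sup>2) \<partial>M) \<partial>lborel)"
    by (rule nn_integral_cmult) measurable
  also have "\<dots> < \<infinity>" using X'_exp_second_moment[OF \<theta>] by (simp add: ennreal_mult_less_top)
  finally show ?thesis .
qed

lemma lag_cov:
  assumes "T \<ge> 0"
  shows "0 \<le> (\<integral>\<omega>. lag_incr T v \<omega> * lag_incr T w \<omega> \<partial>M)"
    "ennreal (\<integral>\<omega>. lag_incr T v \<omega> * lag_incr T w \<omega> \<partial>M) = rect_cov {max 0 (T - max 0 v)<..T} {max 0 (T - max 0 w)<..T}"
    "0 \<le> (\<integral>\<omega>. lag_incr T v \<omega> * X' s \<omega> \<partial>M)"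
    "ennreal (\<integral>\<omega>. lag_incr T v \<omega> * X' s \<omega> \<partial>M) = rect_cov {max 0 (T - max 0 v)<..T} {0<..max 0 s}"
    "0 \<le> (\<integral>\<omega>. X' r \<omega> * X' s \<omega> \<partial>M)"
    "ennreal (\<integral>\<omega>. X' r \<omega> * X' s \<omega> \<partial>M) = rect_cov {0<..max 0 r} {0<..max 0 s}"
proof -
  have s: "0 \<le> max 0 (T - max 0 v)" "max 0 (T - max 0 v) \<le> T" for v using assms by auto
  have e1: "(\<integral>\<omega>. lag_incr T v \<omega> * X' s \<omega> \<partial>M) = (\<integral>\<omega>. lag_incr T v \<omega> * (X (max 0 s) \<omega> - X 0 \<omega>) \<partial>M)"
    by (intro Bochner_Integration.integral_cong) (auto simp: X'_eq)
  have e2: "(\<integral>\<omega>. X' r \<omega> * X' s \<omega> \<partial>M) = (\<integral>\<omega>. (X (max 0 r) \<omega> - X 0 \<omega>) * (X (max 0 s) \<omega> - X 0 \<omega>) \<partial>M)"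
    by (intro Bochner_Integration.integral_cong) (auto simp: X'_eq)
  show "0 \<le> (\<integral>\<omega>. lag_incr T v \<omega> * lag_incr T w \<omega> \<partial>M)"
    "ennreal (\<integral>\<omega>. lag_incr T v \<omega> * lag_incr T w \<omega> \<partial>M) = rect_cov {max 0 (T - max 0 v)<..T} {max 0 (T - max 0 w)<..T}"
    unfolding lag_incr_eq[OF assms] by (intro increment_covariance s)+
  show "0 \<le> (\<integral>\<omega>. lag_incr T v \<omega> * X' s \<omega> \<partial>M)"
    "ennreal (\<integral>\<omega>. lag_incr T v \<omega> * X' s \<omega> \<partial>M) = rect_cov {max 0 (T - max 0 v)<..T} {0<..max 0 s}"
    unfolding e1 unfolding lag_incr_eq[OF assms] by (intro increment_covariance s; simp)+
  show "0 \<le> (\<integral>\<omega>. X' r \<omega> * X' s \<omega> \<partial>M)"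
    "ennreal (\<integral>\<omega>. X' r \<omega> * X' s \<omega> \<partial>M) = rect_cov {0<..max 0 r} {0<..max 0 s}"
    unfolding e2 by (intro increment_covariance; simp)+
qed

text \<open>For 0 < a \<le> T the lagged interval contains a exactly when the lag exceeds T - a; the
  exponential tail is the source of the weight exp(-\<theta> (T - a)).\<close>

lemma lag_tail:
  assumes "T \<ge> 0"
  shows "(\<integral>\<^sup>+v. (if a \<in> {max 0 (T - max 0 v)<..T} then 1 else 0) \<partial>expo)
    = (if 0 < a \<and> a \<le> T then ennreal (exp (- (\<theta> * (T - a)))) else 0)"
proof (cases "0 < a \<and> a \<le> T")
  case True
  then have "(\<integral>\<^sup>+v. (if a \<in> {max 0 (T - max 0 v)<..T} then 1 else 0) \<partial>expo) = (\<integral>\<^sup>+v. (if T - a < v then 1 else 0) \<partial>expo)"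
    by (intro nn_integral_cong) auto
  then show ?thesis using True exponential_tail(2)[OF _ \<theta>, of "T - a"] by (simp add: expo_def)
next
  case False
  then have "(if a \<in> {max 0 (T - max 0 v)<..T} then 1 else 0 :: ennreal) = 0" for v by auto
  then show ?thesis using False by auto
qed

lemma X'_tail:
  "(\<integral>\<^sup>+s. (if b \<in> {0<..max 0 s} then 1 else 0) \<partial>expo) = (if 0 < b then ennreal (exp (- (\<theta> * b))) else 0)"
proof (cases "0 < b")
  case True
  then have "(\<integral>\<^sup>+s. (if b \<in> {0<..max 0 s} then 1 else 0) \<partial>expo) = (\<integral>\<^sup>+v. (if b \<le> v then 1 else 0) \<partial>expo)"
    by (intro nn_integral_cong) auto
  then show ?thesis using True exponential_tail(1)[OF _ \<theta>, of b] by (simp add: expo_def)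
qed simp

lemma innov_second_moment:
  assumes "T \<ge> 0"
  shows "ennreal (\<integral>\<omega>. (innov T \<omega>)\<^sup>2 \<partial>M) = (\<integral>\<^sup>+a. \<integral>\<^sup>+b.
      (if 0 < a \<and> a \<le> T then ennreal (exp (- (\<theta> * (T - a)))) else 0) *
      (if 0 < b \<and> b \<le> T then ennreal (exp (- (\<theta> * (T - b)))) else 0) * wcov a b \<partial>lborel \<partial>lborel)"
proof -
  note B = bilinear_moment[OF expo.prob_space_axioms lag_incr_measurable lag_incr_measurable lag_incr_second_moment[OF assms] lag_incr_second_moment[OF assms] lag_cov(1)[OF assms]]
  have "ennreal (\<integral>\<omega>. (innov T \<omega>)\<^sup>2 \<partial>M)
      = (\<integral>\<^sup>+v. \<integral>\<^sup>+w. rect_cov {max 0 (T - max 0 v)<..T} {max 0 (T - max 0 w)<..T} \<partial>expo \<partial>expo)"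
    using B(2) by (simp add: innov_def power2_eq_square lag_cov[OF assms])
  also have "\<dots> = (\<integral>\<^sup>+a. \<integral>\<^sup>+b.
      (if 0 < a \<and> a \<le> T then ennreal (exp (- (\<theta> * (T - a)))) else 0) *
      (if 0 < b \<and> b \<le> T then ennreal (exp (- (\<theta> * (T - b)))) else 0) * wcov a b \<partial>lborel \<partial>lborel)"
    by (intro rect_cov_average expo.sigma_finite_measure_axioms lag_tail[OF assms, symmetric]) simp_all
  finally show ?thesis .
qed

lemma innov_mean_X_cov:
  assumes "T \<ge> 0"
  shows "integrable M (\<lambda>\<omega>. innov T \<omega> * mean_X \<omega>)"
    "ennreal (\<integral>\<omega>. innov T \<omega> * mean_X \<omega> \<partial>M) = (\<integral>\<^sup>+a. \<integral>\<^sup>+b.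
      (if 0 < a \<and> a \<le> T then ennreal (exp (- (\<theta> * (T - a)))) else 0) *
      (if 0 < b then ennreal (exp (- (\<theta> * b))) else 0) * wcov a b \<partial>lborel \<partial>lborel)"
proof -
  note B = bilinear_moment[OF expo.prob_space_axioms lag_incr_measurable X'_measurable_expo lag_incr_second_moment[OF assms] mean_X_second_moment lag_cov(3)[OF assms]]
  show "integrable M (\<lambda>\<omega>. innov T \<omega> * mean_X \<omega>)" using B(1) by (simp add: innov_def mean_X_def)
  have "ennreal (\<integral>\<omega>. innov T \<omega> * mean_X \<omega> \<partial>M)
      = (\<integral>\<^sup>+v. \<integral>\<^sup>+s. rect_cov {max 0 (T - max 0 v)<..T} {0<..max 0 s} \<partial>expo \<partial>expo)"
    using B(2) by (simp add: innov_def mean_X_def lag_cov[OF assms])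
  also have "\<dots> = (\<integral>\<^sup>+a. \<integral>\<^sup>+b.
      (if 0 < a \<and> a \<le> T then ennreal (exp (- (\<theta> * (T - a)))) else 0) *
      (if 0 < b then ennreal (exp (- (\<theta> * b))) else 0) * wcov a b \<partial>lborel \<partial>lborel)"
    by (intro rect_cov_average expo.sigma_finite_measure_axioms lag_tail[OF assms, symmetric] X'_tail[symmetric]) simp_all
  finally show "ennreal (\<integral>\<omega>. innov T \<omega> * mean_X \<omega> \<partial>M) = (\<integral>\<^sup>+a. \<integral>\<^sup>+b.
      (if 0 < a \<and> a \<le> T then ennreal (exp (- (\<theta> * (T - a)))) else 0) *
      (if 0 < b then ennreal (exp (- (\<theta> * b))) else 0) * wcov a b \<partial>lborel \<partial>lborel)" .
qed

lemma innov_mean_X_cov_nonneg: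
  assumes "T \<ge> 0"
  shows "0 \<le> (\<integral>\<omega>. innov T \<omega> * mean_X \<omega> \<partial>M)"
  unfolding innov_def mean_X_def
  by (rule bilinear_moment(3)[OF expo.prob_space_axioms lag_incr_measurable X'_measurable_expo lag_incr_second_moment[OF assms] mean_X_second_moment lag_cov(3)[OF assms]])

text \<open>Restriction to r, s \<ge> 1, which has positive probability, leaves rectangles
  containing the unit square, over which the density integrates to R1 > 0.\<close>

lemma mean_X_variance_pos: "(\<integral>\<omega>. (mean_X \<omega>)\<^sup>2 \<partial>M) > 0"
proof -
  note B = bilinear_moment[OF expo.prob_space_axioms X'_measurable_expo X'_measurable_expo mean_X_second_moment mean_X_second_moment lag_cov(5)[of 0, simplified]]
  have e: "ennreal (\<integral>\<omega>. (mean_X \<omega>)\<^sup>2 \<partial>M) = (\<integral>\<^sup>+r. \<integral>\<^sup>+s. rect_cov {0<..max 0 r} {0<..max 0 s} \<partial>expo \<partial>expo)"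
    using B(2) by (simp add: mean_X_def power2_eq_square lag_cov(6)[of 0, simplified])
  have "0 < ennreal (exp (- (\<theta> * 1))) * (ennreal (exp (- (\<theta> * 1))) * ennreal R1)"
    using R1_pos by (simp add: ennreal_mult[symmetric])
  also have "\<dots> = (\<integral>\<^sup>+r. \<integral>\<^sup>+s. (if 1 \<le> r then 1 else 0) * ((if 1 \<le> s then 1 else 0) * ennreal R1) \<partial>expo \<partial>expo)"
    using exponential_tail(1)[OF _ \<theta>, of 1] by (simp add: nn_integral_cmult nn_integral_multc expo_def[symmetric])
  also have "\<dots> \<le> (\<integral>\<^sup>+r. \<integral>\<^sup>+s. rect_cov {0<..max 0 r} {0<..max 0 s} \<partial>expo \<partial>expo)"
    unfolding rect_cov_1[symmetric]
    by (intro nn_integral_mono) (auto intro!: rect_cov_mono)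
  finally show ?thesis unfolding e[symmetric] by simp
qed

end

section \<open>Covariance near the diagonal\<close>

lemma nn_integral_Beta:
  fixes a b :: real
  assumes "a > 0" "b > 0"
  shows "(\<integral>\<^sup>+z. (if 0 < z \<and> z < 1 then ennreal (z powr (a - 1) * (1 - z) powr (b - 1)) else 0) \<partial>lborel) = ennreal (Beta a b)"
proof -
  have "(\<integral>\<^sup>+z. ennreal (indicator {0..1} z * (z powr (a - 1) * (1 - z) powr (b - 1))) \<partial>lborel) = ennreal (Beta a b)"
  proof (rule nn_integral_has_integral_lborel)
    have "(\<lambda>z. indicator {0..1} z * (z powr (a - 1) * (1 - z) powr (b - 1)))
        = (\<lambda>z. if z \<in> {0..1} then z powr (a - 1) * (1 - z) powr (b - 1) else 0)"
      by (auto simp: indicator_def)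
    then show "((\<lambda>z. indicator {0..1} z * (z powr (a - 1) * (1 - z) powr (b - 1))) has_integral Beta a b) UNIV"
      using has_integral_Beta_real[OF assms] by (simp only: has_integral_restrict_UNIV)
  qed auto
  moreover have "(\<integral>\<^sup>+z. (if 0 < z \<and> z < 1 then ennreal (z powr (a - 1) * (1 - z) powr (b - 1)) else 0) \<partial>lborel)
      = (\<integral>\<^sup>+z. ennreal (indicator {0..1} z * (z powr (a - 1) * (1 - z) powr (b - 1))) \<partial>lborel)"
    by (intro nn_integral_cong) (auto simp: indicator_def not_less le_less)
  ultimately show ?thesis by simp
qed

text \<open>Write \<open>(1+y)\<^sup>\<gamma>\<close> as a Gamma integral and exchange the integrations.\<close>
lemma nn_integral_Beta_infinite:
  fixes \<gamma> :: real
  assumes \<gamma>: "- 1 < \<gamma>" "\<gamma> < - 1/2"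
  shows "(\<integral>\<^sup>+y. (if 0 < y then ennreal (y powr \<gamma> * (1 + y) powr \<gamma>) else 0) \<partial>lborel)
    = ennreal (Gamma (\<gamma> + 1) * Gamma (- 2 * \<gamma> - 1) / Gamma (- \<gamma>))"
proof -
  have pos: "Gamma (- \<gamma>) > 0" "Gamma (\<gamma> + 1) > 0" "Gamma (- 2 * \<gamma> - 1) > 0"
    using \<gamma> by (auto intro!: Gamma_real_pos)
  define F where "F s y = (if 0 < s \<and> 0 < y then ennreal (s powr (- \<gamma> - 1) * exp (- (s * (1 + y))) * y powr \<gamma>) else 0)" for s y :: real
  have "ennreal (Gamma (- \<gamma>)) * (\<integral>\<^sup>+y. (if 0 < y then ennreal (y powr \<gamma> * (1 + y) powr \<gamma>) else 0) \<partial>lborel)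
      = (\<integral>\<^sup>+y. ennreal (Gamma (- \<gamma>)) * (if 0 < y then ennreal (y powr \<gamma> * (1 + y) powr \<gamma>) else 0) \<partial>lborel)"
    by (rule nn_integral_cmult[symmetric]) measurable
  also have "\<dots> = (\<integral>\<^sup>+y. \<integral>\<^sup>+s. F s y \<partial>lborel \<partial>lborel)"
  proof (rule nn_integral_cong)
    fix y :: real
    show "ennreal (Gamma (- \<gamma>)) * (if 0 < y then ennreal (y powr \<gamma> * (1 + y) powr \<gamma>) else 0) = (\<integral>\<^sup>+s. F s y \<partial>lborel)"
    proof (cases "0 < y")
      case True
      have "(\<integral>\<^sup>+s. F s y \<partial>lborel) = (\<integral>\<^sup>+s. ennreal (y powr \<gamma>) * (if 0 < s then ennreal (s powr (- \<gamma> - 1) * exp (- ((1 + y) * s))) else 0) \<partial>lborel)"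
        using True by (intro nn_integral_cong) (auto simp: F_def ennreal_mult[symmetric] mult_ac)
      also have "\<dots> = ennreal (y powr \<gamma>) * ennreal (Gamma (- \<gamma>) * (1 + y) powr \<gamma>)"
        using nn_integral_Gamma_scaled[of "- \<gamma>" "1 + y"] \<gamma> True by (subst nn_integral_cmult) simp_all
      also have "\<dots> = ennreal (Gamma (- \<gamma>)) * ennreal (y powr \<gamma> * (1 + y) powr \<gamma>)"
        using pos by (simp add: ennreal_mult[symmetric] less_imp_le mult_ac)
      finally show ?thesis using True by simp
    qed (simp add: F_def)
  qed
  also have "\<dots> = (\<integral>\<^sup>+s. \<integral>\<^sup>+y. F s y \<partial>lborel \<partial>lborel)"
    unfolding F_def by (rule lborel_pair.Fubini') measurable
  also have "\<dots> = (\<integral>\<^sup>+s. ennreal (Gamma (\<gamma> + 1)) * (if 0 < s then ennreal (s powr ((- 2 * \<gamma> - 1) - 1) * exp (- (1 * s))) else 0) \<partial>lborel)"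
  proof (rule nn_integral_cong)
    fix s :: real
    show "(\<integral>\<^sup>+y. F s y \<partial>lborel) = ennreal (Gamma (\<gamma> + 1)) * (if 0 < s then ennreal (s powr ((- 2 * \<gamma> - 1) - 1) * exp (- (1 * s))) else 0)"
    proof (cases "0 < s")
      case True
      have "(\<integral>\<^sup>+y. F s y \<partial>lborel) = (\<integral>\<^sup>+y. ennreal (s powr (- \<gamma> - 1) * exp (- s)) * (if 0 < y then ennreal (y powr ((\<gamma> + 1) - 1) * exp (- (s * y))) else 0) \<partial>lborel)"
        using True by (intro nn_integral_cong) (auto simp: F_def ennreal_mult[symmetric] exp_add[symmetric] algebra_simps)
      also have "\<dots> = ennreal (s powr (- \<gamma> - 1) * exp (- s)) * ennreal (Gamma (\<gamma> + 1) * s powr (- (\<gamma> + 1)))"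
        using nn_integral_Gamma_scaled[of "\<gamma> + 1" s] \<gamma> True by (subst nn_integral_cmult) simp_all
      also have "\<dots> = ennreal (Gamma (\<gamma> + 1) * ((s powr (- \<gamma> - 1) * s powr (- (\<gamma> + 1))) * exp (- s)))"
        using pos by (simp add: ennreal_mult[symmetric] less_imp_le mult_ac)
      also have "s powr (- \<gamma> - 1) * s powr (- (\<gamma> + 1)) = s powr ((- 2 * \<gamma> - 1) - 1)"
        unfolding powr_add[symmetric] by (rule arg_cong[where f="\<lambda>x. s powr x"]) simp
      also have "ennreal (Gamma (\<gamma> + 1) * (s powr ((- 2 * \<gamma> - 1) - 1) * exp (- s)))
        = ennreal (Gamma (\<gamma> + 1)) * ennreal (s powr ((- 2 * \<gamma> - 1) - 1) * exp (- (1 * s)))"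
        using pos by (subst ennreal_mult) (auto simp: less_imp_le)
      finally show ?thesis using True by simp
    qed (simp add: F_def)
  qed
  also have "\<dots> = ennreal (Gamma (\<gamma> + 1)) * ennreal (Gamma (- 2 * \<gamma> - 1))"
    using nn_integral_Gamma_scaled[of "- 2 * \<gamma> - 1" 1] \<gamma> by (subst nn_integral_cmult) simp_all
  also have "\<dots> = ennreal (Gamma (- \<gamma>)) * ennreal (Gamma (\<gamma> + 1) * Gamma (- 2 * \<gamma> - 1) / Gamma (- \<gamma>))"
    using pos by (simp add: ennreal_mult[symmetric] less_imp_le)
  finally show ?thesis
    using pos by (subst (asm) ennreal_mult_cancel_left) auto
qed

section \<open>The covariance kernel at small relative distance\<close>

context volterra_exponents begin

text \<open>For d > 0 this is \<open>cov_kernel 1 (1 + d)\<close> after the substitution r = 1 - z;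
  the singularity of the diagonal then sits at z = 0.\<close>

definition profile :: "real \<Rightarrow> ennreal" where
  "profile d = (\<integral>\<^sup>+z. (if 0 < z \<and> z < 1
     then ennreal ((1 - z) powr (2 * \<alpha>) * (z powr \<gamma> * (d + z) powr \<gamma>)) else 0) \<partial>lborel)"

lemma measurable_profile[measurable (raw)]:
  assumes [measurable]: "f \<in> borel_measurable N"
  shows "(\<lambda>x. profile (f x)) \<in> borel_measurable N"
  unfolding profile_def by measurable

text \<open>Homogeneity, with the smaller argument taken as the unit.\<close>

lemma cov_kernel_profile_less:
  assumes "0 < a" "a < b"
  shows "cov_kernel a b = ennreal (a powr (2 * \<alpha> + 2 * \<gamma> + 1)) * profile ((b - a) / a)"
proof -
  have "cov_kernel a b = cov_kernel (a * 1) (a * (b / a))" using assms by simp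
  also have "\<dots> = ennreal (a powr (2 * \<alpha> + 2 * \<gamma> + 1)) * cov_kernel 1 (b / a)"
    by (rule cov_kernel_scale) (use assms in auto)
  also have "cov_kernel 1 (b / a) = ennreal \<bar>-1\<bar> * (\<integral>\<^sup>+z. (if 0 < 1 + (-1) * z \<and> 1 + (-1) * z < 1 \<and> 1 + (-1) * z < b / a
     then ennreal ((1 + (-1) * z) powr (2 * \<alpha>) * ((1 - (1 + (-1) * z)) powr \<gamma> * (b / a - (1 + (-1) * z)) powr \<gamma>)) else 0) \<partial>lborel)"
    unfolding cov_kernel_def by (rule nn_integral_real_affine) auto
  also have "\<dots> = profile ((b - a) / a)"
  proof -
    have "1 < b / a" using assms by simp
    then have "1 + - 1 * z < b / a" if "0 < z" for z using that by linarith
    moreover have e: "b / a - (1 - z) = (b - a) / a + z" for z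
      using assms by (simp add: field_simps)
    ultimately show ?thesis
      unfolding profile_def by (auto intro!: nn_integral_cong simp: e)
  qed
  finally show ?thesis .
qed

lemma cov_kernel_profile:
  assumes "0 < a" "0 < b" "a \<noteq> b"
  shows "cov_kernel a b = ennreal ((min a b) powr (2 * \<alpha> + 2 * \<gamma> + 1)) * profile (\<bar>a - b\<bar> / min a b)"
proof (cases "a < b")
  case True
  then show ?thesis using cov_kernel_profile_less[of a b] assms by (simp add: min_def)
next
  case False
  then show ?thesis using cov_kernel_profile_less[of b a] assms
    by (subst cov_kernel_commute) (simp add: min_def)
qed

text \<open>For \<gamma> > -1/2 the integral still converges at d = 0, where it is the Beta integral
  whose value is the square of \<open>varsigma_const\<close>; dominated convergence gives the
  limit.\<close>

lemma profile_smooth: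
  assumes g: "\<gamma> > - 1/2"
  shows "\<exists>c\<ge>0. \<forall>d. 0 < d \<and> d \<le> 1 \<longrightarrow> profile d \<le> ennreal c"
    and "(\<And>n. 0 < d n \<and> d n \<le> 1) \<Longrightarrow> d \<longlonglongrightarrow> 0 \<Longrightarrow> (\<lambda>n. profile (d n)) \<longlonglongrightarrow> ennreal ((varsigma_const \<alpha> \<gamma>)\<^sup>2)"
proof -
  \<comment> \<open>The two summands cover the two signs of \<gamma>: for d \<le> 1 the factor (d +
    z)^\<gamma> is at most 2^\<gamma> when \<gamma> \<ge> 0 and at most z^\<gamma> when \<gamma> <
    0.\<close>
  define w where "w z = (if 0 < z \<and> z < 1 then ennreal (2 powr \<bar>\<gamma>\<bar>) * ennreal (z powr (\<gamma> + 1 - 1) * (1 - z) powr (2 * \<alpha> + 1 - 1))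
     + ennreal (z powr (2 * \<gamma> + 1 - 1) * (1 - z) powr (2 * \<alpha> + 1 - 1)) else 0)" for z
  have [measurable]: "w \<in> borel_measurable borel" unfolding w_def by measurable
  have w_eq: "w z = ennreal (2 powr \<bar>\<gamma>\<bar>) * (if 0 < z \<and> z < 1 then ennreal (z powr (\<gamma> + 1 - 1) * (1 - z) powr (2 * \<alpha> + 1 - 1)) else 0)
     + (if 0 < z \<and> z < 1 then ennreal (z powr (2 * \<gamma> + 1 - 1) * (1 - z) powr (2 * \<alpha> + 1 - 1)) else 0)" for z
    by (simp add: w_def)
  have W: "(\<integral>\<^sup>+z. w z \<partial>lborel) = ennreal (2 powr \<bar>\<gamma>\<bar> * Beta (\<gamma> + 1) (2 * \<alpha> + 1) + Beta (2 * \<gamma> + 1) (2 * \<alpha> + 1))" (is "_ = ennreal ?c")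
  proof -
    have B: "Beta (\<gamma> + 1) (2 * \<alpha> + 1) \<ge> 0" "Beta (2 * \<gamma> + 1) (2 * \<alpha> + 1) \<ge> 0"
      using g \<alpha> by (auto simp: Beta_def intro!: divide_nonneg_pos mult_nonneg_nonneg less_imp_le[OF Gamma_real_pos] Gamma_real_pos)
    have "(\<integral>\<^sup>+z. w z \<partial>lborel) = ennreal (2 powr \<bar>\<gamma>\<bar>) * ennreal (Beta (\<gamma> + 1) (2 * \<alpha> + 1)) + ennreal (Beta (2 * \<gamma> + 1) (2 * \<alpha> + 1))"
      unfolding w_eq using g \<alpha> \<gamma>
      by (subst nn_integral_add, measurable, subst nn_integral_cmult, measurable)
         (subst nn_integral_Beta, simp, simp, subst nn_integral_Beta, simp_all)
    then show ?thesis using B by (simp add: ennreal_mult[symmetric] ennreal_plus[symmetric] del: ennreal_plus)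
  qed
  have le: "(if 0 < z \<and> z < 1 then ennreal ((1 - z) powr (2 * \<alpha>) * (z powr \<gamma> * (d + z) powr \<gamma>)) else 0) \<le> w z"
    if d: "0 < d" "d \<le> 1" for d z
  proof (cases "0 < z \<and> z < 1")
    case True
    have "(d + z) powr \<gamma> \<le> 2 powr \<bar>\<gamma>\<bar> + z powr \<gamma>"
    proof (cases "\<gamma> \<ge> 0")
      case G: True
      then have "(d + z) powr \<gamma> \<le> 2 powr \<gamma>" using True d by (intro powr_mono2) auto
      then show ?thesis using G by (simp add: add_increasing2)
    next
      case False
      then have "(d + z) powr \<gamma> \<le> z powr \<gamma>" using True d by (intro powr_mono2') auto
      then show ?thesis by (simp add: add_increasing)
    qed
    then have "(1 - z) powr (2 * \<alpha>) * (z powr \<gamma> * (d + z) powr \<gamma>) \<le> (1 - z) powr (2 * \<alpha>) * (z powr \<gamma> * (2 powr \<bar>\<gamma>\<bar> + z powr \<gamma>))"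
      by (intro mult_left_mono) auto
    also have "\<dots> = 2 powr \<bar>\<gamma>\<bar> * (z powr \<gamma> * (1 - z) powr (2 * \<alpha>)) + z powr (2 * \<gamma>) * (1 - z) powr (2 * \<alpha>)"
    proof -
      have "z powr (2 * \<gamma>) = z powr \<gamma> * z powr \<gamma>" by (simp add: powr_add[symmetric])
      then show ?thesis by (simp add: algebra_simps)
    qed
    finally show ?thesis
      using True unfolding w_def
      by (simp add: ennreal_mult[symmetric] ennreal_plus[symmetric] ennreal_leI del: ennreal_plus)
  qed auto
  show "\<exists>c\<ge>0. \<forall>d. 0 < d \<and> d \<le> 1 \<longrightarrow> profile d \<le> ennreal c"
  proof (intro exI[of _ "max 0 ?c"] conjI allI impI)
    fix d :: real assume "0 < d \<and> d \<le> 1"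
    then have "profile d \<le> (\<integral>\<^sup>+z. w z \<partial>lborel)" unfolding profile_def by (intro nn_integral_mono le) auto
    then show "profile d \<le> ennreal (max 0 ?c)" unfolding W by (rule order_trans) (simp add: ennreal_leI)
  qed simp
  assume d: "\<And>n. 0 < d n \<and> d n \<le> 1" and d0: "d \<longlonglongrightarrow> 0"
  have "(\<lambda>n. profile (d n)) \<longlonglongrightarrow> (\<integral>\<^sup>+z. (if 0 < z \<and> z < 1 then ennreal (z powr (2 * \<gamma> + 1 - 1) * (1 - z) powr (2 * \<alpha> + 1 - 1)) else 0) \<partial>lborel)"
    unfolding profile_def
  proof (rule nn_integral_dominated_convergence[where w=w])
    show "(\<integral>\<^sup>+z. w z \<partial>lborel) < \<infinity>" unfolding W by simp
    show "AE z in lborel. (if 0 < z \<and> z < 1 then ennreal ((1 - z) powr (2 * \<alpha>) * (z powr \<gamma> * (d n + z) powr \<gamma>)) else 0) \<le> w z" for n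
      using le d by auto
    show "AE z in lborel. (\<lambda>n. if 0 < z \<and> z < 1 then ennreal ((1 - z) powr (2 * \<alpha>) * (z powr \<gamma> * (d n + z) powr \<gamma>)) else 0)
        \<longlonglongrightarrow> (if 0 < z \<and> z < 1 then ennreal (z powr (2 * \<gamma> + 1 - 1) * (1 - z) powr (2 * \<alpha> + 1 - 1)) else 0)"
    proof (rule AE_I2)
      fix z :: real
      show "(\<lambda>n. if 0 < z \<and> z < 1 then ennreal ((1 - z) powr (2 * \<alpha>) * (z powr \<gamma> * (d n + z) powr \<gamma>)) else 0)
        \<longlonglongrightarrow> (if 0 < z \<and> z < 1 then ennreal (z powr (2 * \<gamma> + 1 - 1) * (1 - z) powr (2 * \<alpha> + 1 - 1)) else 0)"
      proof (cases "0 < z \<and> z < 1")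
        case True
        have "(\<lambda>n. (1 - z) powr (2 * \<alpha>) * (z powr \<gamma> * (d n + z) powr \<gamma>)) \<longlonglongrightarrow> (1 - z) powr (2 * \<alpha>) * (z powr \<gamma> * (0 + z) powr \<gamma>)"
          using True by (intro tendsto_intros d0) auto
        moreover have "(1 - z) powr (2 * \<alpha>) * (z powr \<gamma> * (0 + z) powr \<gamma>) = z powr (2 * \<gamma> + 1 - 1) * (1 - z) powr (2 * \<alpha> + 1 - 1)"
          by (simp add: powr_add[symmetric])
        ultimately have "(\<lambda>n. (1 - z) powr (2 * \<alpha>) * (z powr \<gamma> * (d n + z) powr \<gamma>)) \<longlonglongrightarrow> z powr (2 * \<gamma> + 1 - 1) * (1 - z) powr (2 * \<alpha> + 1 - 1)"
          by (simp only:)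
        from tendsto_ennrealI[OF this] show ?thesis using True by simp
      next
        case False
        then show ?thesis by (simp only: if_False tendsto_const)
      qed
    qed
  qed measurable
  also have "(\<integral>\<^sup>+z. (if 0 < z \<and> z < 1 then ennreal (z powr (2 * \<gamma> + 1 - 1) * (1 - z) powr (2 * \<alpha> + 1 - 1)) else 0) \<partial>lborel) = ennreal (Beta (2 * \<gamma> + 1) (2 * \<alpha> + 1))"
    using g \<alpha> by (intro nn_integral_Beta) auto
  also have "Beta (2 * \<gamma> + 1) (2 * \<alpha> + 1) = (varsigma_const \<alpha> \<gamma>)\<^sup>2"
  proof -
    have "Gamma (2 * \<alpha> + 1) * Gamma (2 * \<gamma> + 1) / Gamma (2 * \<alpha> + 2 * \<gamma> + 2) \<ge> 0"
      using g \<alpha> by (auto intro!: divide_nonneg_nonneg mult_nonneg_nonneg less_imp_le[OF Gamma_real_pos])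
    then show ?thesis
      unfolding varsigma_const_def by (simp add: Beta_def mult.commute add_ac)
  qed
  finally show "(\<lambda>n. profile (d n)) \<longlonglongrightarrow> ennreal ((varsigma_const \<alpha> \<gamma>)\<^sup>2)" .
qed


text \<open>The substitution z = d y on 0 < z < 1/2 extracts d^(2\<gamma>+1) and leaves an integral
  that converges to that of y^\<gamma> (1+y)^\<gamma>, finite because 2\<gamma> < -1. The part z
  \<ge> 1/2 stays bounded, hence is negligible against the diverging power.\<close>

lemma profile_singular:
  assumes g: "\<gamma> < - 1/2"
  defines "B \<equiv> Gamma (\<gamma> + 1) * Gamma (- 2 * \<gamma> - 1) / Gamma (- \<gamma>)"
  shows "\<exists>c\<ge>0. \<forall>d. 0 < d \<and> d \<le> 1 \<longrightarrow> profile d \<le> ennreal (c * d powr (2 * \<gamma> + 1))"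
    and "(\<And>n. 0 < d n \<and> d n \<le> 1) \<Longrightarrow> d \<longlonglongrightarrow> 0 \<Longrightarrow>
      (\<lambda>n. ennreal (d n powr (- (2 * \<gamma> + 1))) * profile (d n)) \<longlonglongrightarrow> ennreal B"
proof -
  have B0: "B \<ge> 0"
    unfolding B_def using g \<gamma> by (auto intro!: divide_nonneg_nonneg mult_nonneg_nonneg less_imp_le[OF Gamma_real_pos])
  \<comment> \<open>The cut at 1/2 keeps 1 - d y away from 0, so its power is bounded for either
    sign of \<alpha>.\<close>
  define h where "h d = (\<integral>\<^sup>+y. (if 0 < y \<and> d * y < 1/2 then ennreal ((1 - d * y) powr (2 * \<alpha>) * (y powr \<gamma> * (1 + y) powr \<gamma>)) else 0) \<partial>lborel)" for d
  \<comment> \<open>Bound for the part z \<ge> 1/2: both powers with exponent \<gamma> < 0 are at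
    most (1/2)^\<gamma>, and (1 - z)^(2\<alpha>) has a Beta integral.\<close>
  define c2 where "c2 = 2 powr (- 2 * \<gamma>) * Beta 1 (2 * \<alpha> + 1)"
  have c20: "c2 \<ge> 0"
    unfolding c2_def using \<alpha> by (auto simp: Beta_def intro!: mult_nonneg_nonneg divide_nonneg_nonneg less_imp_le[OF Gamma_real_pos])
  have split: "ennreal (d powr (2 * \<gamma> + 1)) * h d \<le> profile d \<and> profile d \<le> ennreal (d powr (2 * \<gamma> + 1)) * h d + ennreal c2"
    if d: "0 < d" for d
  proof -
    define f where "f z = ennreal ((1 - z) powr (2 * \<alpha>) * (z powr \<gamma> * (d + z) powr \<gamma>))" for z
    have [measurable]: "f \<in> borel_measurable borel" unfolding f_def by measurable
    have p1: "(\<integral>\<^sup>+z. (if 0 < z \<and> z < 1/2 then f z else 0) \<partial>lborel) = ennreal (d powr (2 * \<gamma> + 1)) * h d"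
    proof -
      have "(\<integral>\<^sup>+z. (if 0 < z \<and> z < 1/2 then f z else 0) \<partial>lborel) = ennreal \<bar>d\<bar> * (\<integral>\<^sup>+y. (if 0 < 0 + d * y \<and> 0 + d * y < 1/2 then f (0 + d * y) else 0) \<partial>lborel)"
        using d by (intro nn_integral_real_affine) auto
      also have "(\<integral>\<^sup>+y. (if 0 < 0 + d * y \<and> 0 + d * y < 1/2 then f (0 + d * y) else 0) \<partial>lborel)
          = (\<integral>\<^sup>+y. ennreal (d powr (2 * \<gamma>)) * (if 0 < y \<and> d * y < 1/2 then ennreal ((1 - d * y) powr (2 * \<alpha>) * (y powr \<gamma> * (1 + y) powr \<gamma>)) else 0) \<partial>lborel)"
      proof (rule nn_integral_cong)
        fix y :: real
        have "f (d * y) = ennreal (d powr (2 * \<gamma>)) * ennreal ((1 - d * y) powr (2 * \<alpha>) * (y powr \<gamma> * (1 + y) powr \<gamma>))" if "0 < y"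
        proof -
          have "d + d * y = d * (1 + y)" by (simp add: algebra_simps)
          moreover have "d powr (2 * \<gamma>) = d powr \<gamma> * d powr \<gamma>" by (simp add: powr_add[symmetric])
          ultimately show ?thesis
            using that d by (simp add: f_def powr_mult ennreal_mult[symmetric] mult_ac)
        qed
        then show "(if 0 < 0 + d * y \<and> 0 + d * y < 1/2 then f (0 + d * y) else 0)
          = ennreal (d powr (2 * \<gamma>)) * (if 0 < y \<and> d * y < 1/2 then ennreal ((1 - d * y) powr (2 * \<alpha>) * (y powr \<gamma> * (1 + y) powr \<gamma>)) else 0)"
          using d by (auto simp: zero_less_mult_iff)
      qed
      also have "\<dots> = ennreal (d powr (2 * \<gamma>)) * h d"
        unfolding h_def by (rule nn_integral_cmult) measurable
      also have "ennreal \<bar>d\<bar> * (ennreal (d powr (2 * \<gamma>)) * h d) = ennreal (d powr (2 * \<gamma> + 1)) * h d"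
      proof -
        have "d * d powr (2 * \<gamma>) = d powr (2 * \<gamma> + 1)" using d by (simp add: powr_add)
        then show ?thesis using d by (subst mult.assoc[symmetric], subst ennreal_mult[symmetric]) simp_all
      qed
      finally show ?thesis .
    qed
    have p2: "(\<integral>\<^sup>+z. (if 1/2 \<le> z \<and> z < 1 then f z else 0) \<partial>lborel) \<le> ennreal c2"
    proof -
      have "(\<integral>\<^sup>+z. (if 1/2 \<le> z \<and> z < 1 then f z else 0) \<partial>lborel)
          \<le> (\<integral>\<^sup>+z. ennreal (2 powr (- 2 * \<gamma>)) * (if 0 < z \<and> z < 1 then ennreal (z powr (1 - 1) * (1 - z) powr (2 * \<alpha> + 1 - 1)) else 0) \<partial>lborel)"
      proof (rule nn_integral_mono)
        fix z :: real
        have "f z \<le> ennreal (2 powr (- 2 * \<gamma>)) * ennreal ((1 - z) powr (2 * \<alpha>))" if z: "1/2 \<le> z" "z < 1"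
        proof -
          have "z powr \<gamma> \<le> (1/2) powr \<gamma>" using z g by (intro powr_mono2') auto
          moreover have "(d + z) powr \<gamma> \<le> (1/2) powr \<gamma>" using z g d by (intro powr_mono2') auto
          ultimately have "z powr \<gamma> * (d + z) powr \<gamma> \<le> (1/2) powr \<gamma> * (1/2) powr \<gamma>" by (intro mult_mono) auto
          also have "\<dots> = (1/2) powr (2 * \<gamma>)" by (simp add: powr_add[symmetric])
          also have "\<dots> = 2 powr (- 2 * \<gamma>)" by (simp add: powr_divide powr_minus_divide)
          finally have "(1 - z) powr (2 * \<alpha>) * (z powr \<gamma> * (d + z) powr \<gamma>) \<le> 2 powr (- 2 * \<gamma>) * (1 - z) powr (2 * \<alpha>)"
            by (subst mult.commute) (rule mult_right_mono, auto)
          then show ?thesis unfolding f_def by (subst ennreal_mult[symmetric]) (auto intro: ennreal_leI)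
        qed
        then show "(if 1/2 \<le> z \<and> z < 1 then f z else 0) \<le> ennreal (2 powr (- 2 * \<gamma>)) * (if 0 < z \<and> z < 1 then ennreal (z powr (1 - 1) * (1 - z) powr (2 * \<alpha> + 1 - 1)) else 0)"
          by auto
      qed
      also have "\<dots> = ennreal (2 powr (- 2 * \<gamma>)) * ennreal (Beta 1 (2 * \<alpha> + 1))"
        using nn_integral_Beta[of 1 "2 * \<alpha> + 1"] \<alpha> by (subst nn_integral_cmult) simp_all
      also have "\<dots> = ennreal c2" using c20 unfolding c2_def by (subst ennreal_mult') auto
      finally show ?thesis .
    qed
    have "profile d = (\<integral>\<^sup>+z. (if 0 < z \<and> z < 1/2 then f z else 0) + (if 1/2 \<le> z \<and> z < 1 then f z else 0) \<partial>lborel)"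
      unfolding profile_def by (intro nn_integral_cong) (auto simp: f_def)
    also have "\<dots> = (\<integral>\<^sup>+z. (if 0 < z \<and> z < 1/2 then f z else 0) \<partial>lborel) + (\<integral>\<^sup>+z. (if 1/2 \<le> z \<and> z < 1 then f z else 0) \<partial>lborel)"
      by (rule nn_integral_add) measurable
    finally have "profile d = ennreal (d powr (2 * \<gamma> + 1)) * h d + (\<integral>\<^sup>+z. (if 1/2 \<le> z \<and> z < 1 then f z else 0) \<partial>lborel)"
      unfolding p1 .
    then show ?thesis using p2 by (auto intro: add_left_mono)
  qed
  have dom: "(if 0 < y \<and> d * y < 1/2 then ennreal ((1 - d * y) powr (2 * \<alpha>) * (y powr \<gamma> * (1 + y) powr \<gamma>)) else 0)
      \<le> ennreal (2 powr \<bar>2 * \<alpha>\<bar>) * (if 0 < y then ennreal (y powr \<gamma> * (1 + y) powr \<gamma>) else 0)" if d: "0 < d" for d y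
  proof (cases "0 < y \<and> d * y < 1/2")
    case True
    have x: "1/2 \<le> 1 - d * y" "1 - d * y \<le> 1" using True d by auto
    have "(1 - d * y) powr (2 * \<alpha>) \<le> 2 powr \<bar>2 * \<alpha>\<bar>"
    proof (cases "\<alpha> \<ge> 0")
      case A: True
      have "(1 - d * y) powr (2 * \<alpha>) \<le> 1 powr (2 * \<alpha>)" using x A by (intro powr_mono2) auto
      also have "\<dots> \<le> 2 powr \<bar>2 * \<alpha>\<bar>" by (simp add: ge_one_powr_ge_zero)
      finally show ?thesis .
    next
      case False
      have "(1 - d * y) powr (2 * \<alpha>) \<le> (1/2) powr (2 * \<alpha>)" using x False by (intro powr_mono2') auto
      also have "\<dots> = 2 powr \<bar>2 * \<alpha>\<bar>" using False by (simp add: powr_divide powr_minus_divide)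
      finally show ?thesis .
    qed
    then have "(1 - d * y) powr (2 * \<alpha>) * (y powr \<gamma> * (1 + y) powr \<gamma>) \<le> 2 powr \<bar>2 * \<alpha>\<bar> * (y powr \<gamma> * (1 + y) powr \<gamma>)"
      by (intro mult_right_mono) auto
    then show ?thesis using True by (auto simp: ennreal_mult[symmetric] intro: ennreal_leI)
  qed auto
  have domI: "(\<integral>\<^sup>+y. ennreal (2 powr \<bar>2 * \<alpha>\<bar>) * (if 0 < y then ennreal (y powr \<gamma> * (1 + y) powr \<gamma>) else 0) \<partial>lborel) = ennreal (2 powr \<bar>2 * \<alpha>\<bar> * B)"
    using nn_integral_Beta_infinite[OF \<gamma> g] B0 unfolding B_def[symmetric]
    by (subst nn_integral_cmult) (simp_all add: ennreal_mult)
  have h_le: "h d \<le> ennreal (2 powr \<bar>2 * \<alpha>\<bar> * B)" if "0 < d" for d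
    unfolding h_def domI[symmetric] by (intro nn_integral_mono dom that)
  show "\<exists>c\<ge>0. \<forall>d. 0 < d \<and> d \<le> 1 \<longrightarrow> profile d \<le> ennreal (c * d powr (2 * \<gamma> + 1))"
  proof (intro exI[of _ "2 powr \<bar>2 * \<alpha>\<bar> * B + c2"] conjI allI impI)
    fix d :: real assume d: "0 < d \<and> d \<le> 1"
    \<comment> \<open>For d \<le> 1 the negative exponent makes this power at least 1, so it absorbs
      the bounded part.\<close>
    have "1 \<le> d powr (2 * \<gamma> + 1)"
      using d g powr_mono2'[of "2 * \<gamma> + 1" d 1] by simp
    then have "c2 \<le> c2 * d powr (2 * \<gamma> + 1)" using c20 by (simp add: mult_le_cancel_left1)
    have "profile d \<le> ennreal (d powr (2 * \<gamma> + 1)) * h d + ennreal c2" using split d by auto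
    also have "\<dots> \<le> ennreal (d powr (2 * \<gamma> + 1)) * ennreal (2 powr \<bar>2 * \<alpha>\<bar> * B) + ennreal (c2 * d powr (2 * \<gamma> + 1))"
      using d \<open>c2 \<le> _\<close> by (intro add_mono mult_left_mono h_le ennreal_leI) auto
    also have "\<dots> = ennreal ((2 powr \<bar>2 * \<alpha>\<bar> * B + c2) * d powr (2 * \<gamma> + 1))"
      using B0 c20 by (simp add: ennreal_mult[symmetric] ennreal_plus[symmetric] algebra_simps del: ennreal_plus)
    finally show "profile d \<le> ennreal ((2 powr \<bar>2 * \<alpha>\<bar> * B + c2) * d powr (2 * \<gamma> + 1))" .
  qed (use B0 c20 in auto)
  assume d: "\<And>n. 0 < d n \<and> d n \<le> 1" and d0: "d \<longlonglongrightarrow> 0"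
  have hlim: "(\<lambda>n. h (d n)) \<longlonglongrightarrow> ennreal B"
    unfolding h_def B_def nn_integral_Beta_infinite[OF \<gamma> g, symmetric]
  proof (rule nn_integral_dominated_convergence[where w="\<lambda>y. ennreal (2 powr \<bar>2 * \<alpha>\<bar>) * (if 0 < y then ennreal (y powr \<gamma> * (1 + y) powr \<gamma>) else 0)"])
    show "(\<integral>\<^sup>+y. ennreal (2 powr \<bar>2 * \<alpha>\<bar>) * (if 0 < y then ennreal (y powr \<gamma> * (1 + y) powr \<gamma>) else 0) \<partial>lborel) < \<infinity>"
      unfolding domI by simp
    show "AE y in lborel. (if 0 < y \<and> d n * y < 1/2 then ennreal ((1 - d n * y) powr (2 * \<alpha>) * (y powr \<gamma> * (1 + y) powr \<gamma>)) else 0)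
      \<le> ennreal (2 powr \<bar>2 * \<alpha>\<bar>) * (if 0 < y then ennreal (y powr \<gamma> * (1 + y) powr \<gamma>) else 0)" for n
      using dom[of "d n"] d by (intro AE_I2) auto
    show "AE y in lborel. (\<lambda>n. if 0 < y \<and> d n * y < 1/2 then ennreal ((1 - d n * y) powr (2 * \<alpha>) * (y powr \<gamma> * (1 + y) powr \<gamma>)) else 0)
        \<longlonglongrightarrow> (if 0 < y then ennreal (y powr \<gamma> * (1 + y) powr \<gamma>) else 0)"
    proof (rule AE_I2)
      fix y :: real
      show "(\<lambda>n. if 0 < y \<and> d n * y < 1/2 then ennreal ((1 - d n * y) powr (2 * \<alpha>) * (y powr \<gamma> * (1 + y) powr \<gamma>)) else 0)
        \<longlonglongrightarrow> (if 0 < y then ennreal (y powr \<gamma> * (1 + y) powr \<gamma>) else 0)"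
      proof (cases "0 < y")
        case True
        have dy: "(\<lambda>n. d n * y) \<longlonglongrightarrow> 0" using tendsto_mult_right[OF d0, of y] by simp
        have "\<forall>\<^sub>F n in sequentially. d n * y < 1/2" using dy by (rule order_tendstoD) simp
        then have ev: "\<forall>\<^sub>F n in sequentially. ennreal ((1 - d n * y) powr (2 * \<alpha>) * (y powr \<gamma> * (1 + y) powr \<gamma>))
            = (if 0 < y \<and> d n * y < 1/2 then ennreal ((1 - d n * y) powr (2 * \<alpha>) * (y powr \<gamma> * (1 + y) powr \<gamma>)) else 0)"
          by (rule eventually_mono) (use True in simp)
        have lim: "(\<lambda>n. ennreal ((1 - d n * y) powr (2 * \<alpha>) * (y powr \<gamma> * (1 + y) powr \<gamma>))) \<longlonglongrightarrow> ennreal ((1 - 0) powr (2 * \<alpha>) * (y powr \<gamma> * (1 + y) powr \<gamma>))"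
          by (intro tendsto_ennrealI tendsto_intros dy) auto
        show ?thesis using Lim_transform_eventually[OF lim ev] True by simp
      qed simp
    qed
  qed measurable
  have eq: "ennreal (d n powr (- (2 * \<gamma> + 1))) * (ennreal (d n powr (2 * \<gamma> + 1)) * x) = x" for n x
    using d[of n] by (simp add: mult.assoc[symmetric] ennreal_mult[symmetric] powr_add[symmetric] del: minus_add_distrib)
  show "(\<lambda>n. ennreal (d n powr (- (2 * \<gamma> + 1))) * profile (d n)) \<longlonglongrightarrow> ennreal B"
  proof (rule tendsto_sandwich[OF _ _ hlim])
    show "\<forall>\<^sub>F n in sequentially. h (d n) \<le> ennreal (d n powr (- (2 * \<gamma> + 1))) * profile (d n)"
    proof (intro always_eventually allI)
      fix n
      have "h (d n) = ennreal (d n powr (- (2 * \<gamma> + 1))) * (ennreal (d n powr (2 * \<gamma> + 1)) * h (d n))" by (rule eq[symmetric])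
      also have "\<dots> \<le> ennreal (d n powr (- (2 * \<gamma> + 1))) * profile (d n)"
        using split[of "d n"] d by (intro mult_left_mono) auto
      finally show "h (d n) \<le> ennreal (d n powr (- (2 * \<gamma> + 1))) * profile (d n)" .
    qed
    show "\<forall>\<^sub>F n in sequentially. ennreal (d n powr (- (2 * \<gamma> + 1))) * profile (d n) \<le> h (d n) + ennreal (d n powr (- (2 * \<gamma> + 1))) * ennreal c2"
    proof (intro always_eventually allI)
      fix n
      have "ennreal (d n powr (- (2 * \<gamma> + 1))) * profile (d n) \<le> ennreal (d n powr (- (2 * \<gamma> + 1))) * (ennreal (d n powr (2 * \<gamma> + 1)) * h (d n) + ennreal c2)"
        using split[of "d n"] d by (intro mult_left_mono) auto
      also have "\<dots> = h (d n) + ennreal (d n powr (- (2 * \<gamma> + 1))) * ennreal c2"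
        by (simp only: distrib_left eq)
      finally show "ennreal (d n powr (- (2 * \<gamma> + 1))) * profile (d n) \<le> h (d n) + ennreal (d n powr (- (2 * \<gamma> + 1))) * ennreal c2" .
    qed
    \<comment> \<open>The exponent is positive, so the contribution of z \<ge> 1/2 vanishes in the
      limit.\<close>
    have "(\<lambda>n. d n powr (- (2 * \<gamma> + 1)) * c2) \<longlonglongrightarrow> 0 powr (- (2 * \<gamma> + 1)) * c2"
      using d g by (intro tendsto_intros tendsto_powr' d0) (auto intro!: always_eventually simp: less_imp_le)
    then have "(\<lambda>n. ennreal (d n powr (- (2 * \<gamma> + 1)) * c2)) \<longlonglongrightarrow> ennreal (0 powr (- (2 * \<gamma> + 1)) * c2)"
      by (rule tendsto_ennrealI)
    then have "(\<lambda>n. h (d n) + ennreal (d n powr (- (2 * \<gamma> + 1)) * c2)) \<longlonglongrightarrow> ennreal B + ennreal (0 powr (- (2 * \<gamma> + 1)) * c2)"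
      by (intro tendsto_add hlim)
    then show "(\<lambda>n. h (d n) + ennreal (d n powr (- (2 * \<gamma> + 1))) * ennreal c2) \<longlonglongrightarrow> ennreal B"
      using c20 by (simp add: ennreal_mult)
  qed
qed

text \<open>Replacing (1 - z)^(2\<alpha>) by 1 costs a bounded amount: the replacement error is at
  most z times an integrable function, while z^(-1/2) (d + z)^(-1/2) is at most 1/z. The remaining
  integral \<open>L d\<close> exceeds ln (1/d) by at most 2.\<close>

lemma profile_log:
  assumes g: "\<gamma> = - 1/2"
  shows "\<exists>A\<ge>0. \<forall>d. 0 < d \<and> d \<le> 1 \<longrightarrow> profile d \<le> ennreal (ln (1 / d) + A) \<and> ennreal (ln (1 / d)) \<le> profile d + ennreal A"
proof -
  \<comment> \<open>The first term is the mean value bound used for z < 1/2; the summand 2 treats z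
    \<ge> 1/2, where 1 \<le> 2 z.\<close>
  define c where "c = \<bar>2 * \<alpha>\<bar> * 2 powr \<bar>2 * \<alpha> - 1\<bar> + 2"
  have c0: "c \<ge> 0" by (simp add: c_def)
  define D where "D z = (if 0 < z \<and> z < 1 then ennreal c * ennreal (z powr (1 - 1) * (1 - z) powr (1 - 1)) + ennreal 2 * ennreal (z powr (1 - 1) * (1 - z) powr (2 * \<alpha> + 1 - 1)) else 0)" for z
  define L where "L d = (\<integral>\<^sup>+z. (if 0 < z \<and> z < 1 then ennreal (z powr \<gamma> * (d + z) powr \<gamma>) else 0) \<partial>lborel)" for d
  define A0 where "A0 = c * Beta 1 1 + 2 * Beta 1 (2 * \<alpha> + 1)"
  have Bp: "Beta 1 1 \<ge> (0::real)" "Beta 1 (2 * \<alpha> + 1) \<ge> 0"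
    using \<alpha> by (auto simp: Beta_def intro!: divide_nonneg_nonneg mult_nonneg_nonneg less_imp_le[OF Gamma_real_pos])
  have A00: "A0 \<ge> 0" using c0 Bp by (simp add: A0_def)
  have [measurable]: "D \<in> borel_measurable borel" unfolding D_def by measurable
  have D_int: "(\<integral>\<^sup>+z. D z \<partial>lborel) = ennreal A0"
  proof -
    have "D z = ennreal c * (if 0 < z \<and> z < 1 then ennreal (z powr (1 - 1) * (1 - z) powr (1 - 1)) else 0) + ennreal 2 * (if 0 < z \<and> z < 1 then ennreal (z powr (1 - 1) * (1 - z) powr (2 * \<alpha> + 1 - 1)) else 0)" for z
      by (simp add: D_def)
    then have "(\<integral>\<^sup>+z. D z \<partial>lborel) = (\<integral>\<^sup>+z. ennreal c * (if 0 < z \<and> z < 1 then ennreal (z powr (1 - 1) * (1 - z) powr (1 - 1)) else 0) \<partial>lborel)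
        + (\<integral>\<^sup>+z. ennreal 2 * (if 0 < z \<and> z < 1 then ennreal (z powr (1 - 1) * (1 - z) powr (2 * \<alpha> + 1 - 1)) else 0) \<partial>lborel)"
      by (simp only:) (rule nn_integral_add, measurable)
    also have "(\<integral>\<^sup>+z. ennreal c * (if 0 < z \<and> z < 1 then ennreal (z powr (1 - 1) * (1 - z) powr (1 - 1)) else 0) \<partial>lborel) = ennreal c * ennreal (Beta 1 1)"
      using nn_integral_Beta[of 1 1] by (subst nn_integral_cmult) simp_all
    also have "(\<integral>\<^sup>+z. ennreal 2 * (if 0 < z \<and> z < 1 then ennreal (z powr (1 - 1) * (1 - z) powr (2 * \<alpha> + 1 - 1)) else 0) \<partial>lborel) = ennreal 2 * ennreal (Beta 1 (2 * \<alpha> + 1))"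
      using nn_integral_Beta[of 1 "2 * \<alpha> + 1"] \<alpha> by (subst nn_integral_cmult) simp_all
    also have "ennreal c * ennreal (Beta 1 1) + ennreal 2 * ennreal (Beta 1 (2 * \<alpha> + 1)) = ennreal A0"
      unfolding A0_def using c0 Bp by (subst ennreal_plus) (auto simp: ennreal_mult)
    finally show ?thesis .
  qed
  have weight: "\<bar>(1 - z) powr (2 * \<alpha>) - 1\<bar> \<le> (c + 2 * (1 - z) powr (2 * \<alpha>)) * z" if z: "0 < z" "z < 1" for z
  proof (cases "z < 1/2")
    case True
    have "\<exists>x>1 - z. x < 1 \<and> 1 powr (2 * \<alpha>) - (1 - z) powr (2 * \<alpha>) = (1 - (1 - z)) * (2 * \<alpha> * x powr (2 * \<alpha> - 1))"
      using z by (intro MVT2) (auto intro!: derivative_eq_intros)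
    then obtain x where x: "1 - z < x" "x < 1" "1 - (1 - z) powr (2 * \<alpha>) = z * (2 * \<alpha> * x powr (2 * \<alpha> - 1))"
      by auto
    have "x powr (2 * \<alpha> - 1) \<le> 2 powr \<bar>2 * \<alpha> - 1\<bar>"
    proof (cases "2 * \<alpha> - 1 \<ge> 0")
      case T: True
      have "x powr (2 * \<alpha> - 1) \<le> 1 powr (2 * \<alpha> - 1)" using x True T by (intro powr_mono2) auto
      also have "\<dots> \<le> 2 powr \<bar>2 * \<alpha> - 1\<bar>" by (simp add: ge_one_powr_ge_zero)
      finally show ?thesis .
    next
      case False
      have "x powr (2 * \<alpha> - 1) \<le> (1/2) powr (2 * \<alpha> - 1)" using x True False by (intro powr_mono2') auto
      also have "\<dots> = 2 powr \<bar>2 * \<alpha> - 1\<bar>" using False by (simp add: powr_divide powr_diff)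
      finally show ?thesis .
    qed
    then have "\<bar>2 * \<alpha> * x powr (2 * \<alpha> - 1)\<bar> \<le> \<bar>2 * \<alpha>\<bar> * 2 powr \<bar>2 * \<alpha> - 1\<bar>"
      by (subst abs_mult) (intro mult_left_mono, auto)
    also have "\<dots> \<le> c + 2 * (1 - z) powr (2 * \<alpha>)" by (simp add: c_def add_nonneg_nonneg)
    finally have "z * \<bar>2 * \<alpha> * x powr (2 * \<alpha> - 1)\<bar> \<le> z * (c + 2 * (1 - z) powr (2 * \<alpha>))"
      using z by (intro mult_left_mono) auto
    moreover have "\<bar>(1 - z) powr (2 * \<alpha>) - 1\<bar> = z * \<bar>2 * \<alpha> * x powr (2 * \<alpha> - 1)\<bar>"
      using x(3) z by (subst abs_minus_commute) (simp add: abs_mult)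
    ultimately show ?thesis by (simp add: mult.commute)
  next
    case False
    have "\<bar>(1 - z) powr (2 * \<alpha>) - 1\<bar> \<le> (1 - z) powr (2 * \<alpha>) + 1"
      using powr_ge_zero[of "1 - z" "2 * \<alpha>"] by linarith
    also have "\<dots> = (2 + 2 * (1 - z) powr (2 * \<alpha>)) * (1/2)" by simp
    also have "\<dots> \<le> (c + 2 * (1 - z) powr (2 * \<alpha>)) * z"
      using False c0 by (intro mult_mono) (auto simp: c_def add_nonneg_nonneg)
    finally show ?thesis .
  qed
  have cmp: "profile d \<le> L d + ennreal A0 \<and> L d \<le> profile d + ennreal A0" if d: "0 < d" for d
  proof -
    define t where "t z = z powr \<gamma> * (d + z) powr \<gamma>" for z
    have [measurable]: "t \<in> borel_measurable borel" unfolding t_def by measurable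
    have t: "0 \<le> t z \<and> t z * z \<le> 1" if "0 < z" for z
    proof -
      have "(d + z) powr \<gamma> \<le> z powr \<gamma>" using that d g by (intro powr_mono2') auto
      then have "t z \<le> z powr \<gamma> * z powr \<gamma>" unfolding t_def by (intro mult_left_mono) auto
      also have "\<dots> = 1 / z" using that g by (simp add: powr_add[symmetric] powr_minus_divide)
      finally show ?thesis using that by (simp add: t_def field_simps)
    qed
    have "\<bar>(1 - z) powr (2 * \<alpha>) * t z - t z\<bar> \<le> c + 2 * (1 - z) powr (2 * \<alpha>)" if z: "0 < z" "z < 1" for z
    proof -
      have "\<bar>(1 - z) powr (2 * \<alpha>) * t z - t z\<bar> = \<bar>(1 - z) powr (2 * \<alpha>) - 1\<bar> * t z"
        using t[OF z(1)] by (simp add: abs_mult_pos' abs_mult[symmetric] algebra_simps)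
      also have "\<dots> \<le> ((c + 2 * (1 - z) powr (2 * \<alpha>)) * z) * t z"
        using t[OF z(1)] by (intro mult_right_mono weight z) auto
      also have "\<dots> = (c + 2 * (1 - z) powr (2 * \<alpha>)) * (t z * z)" by simp
      also have "\<dots> \<le> (c + 2 * (1 - z) powr (2 * \<alpha>)) * 1"
        using t[OF z(1)] c0 by (intro mult_left_mono) auto
      finally show ?thesis by simp
    qed
    then have "(1 - z) powr (2 * \<alpha>) * t z \<le> t z + (c + 2 * (1 - z) powr (2 * \<alpha>))"
      "t z \<le> (1 - z) powr (2 * \<alpha>) * t z + (c + 2 * (1 - z) powr (2 * \<alpha>))" if "0 < z" "z < 1" for z
      using that by (auto simp: abs_le_iff algebra_simps)
    moreover have "D z = ennreal (c + 2 * (1 - z) powr (2 * \<alpha>))" if "0 < z" "z < 1" for z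
      using that c0 by (simp add: D_def ennreal_mult)
    ultimately have pt: "(if 0 < z \<and> z < 1 then ennreal ((1 - z) powr (2 * \<alpha>) * t z) else 0) \<le> (if 0 < z \<and> z < 1 then ennreal (t z) else 0) + D z"
      "(if 0 < z \<and> z < 1 then ennreal (t z) else 0) \<le> (if 0 < z \<and> z < 1 then ennreal ((1 - z) powr (2 * \<alpha>) * t z) else 0) + D z" for z
      using t[of z] c0 by (auto simp: ennreal_plus[symmetric] intro!: ennreal_leI simp del: ennreal_plus)
    have "profile d \<le> (\<integral>\<^sup>+z. (if 0 < z \<and> z < 1 then ennreal (t z) else 0) + D z \<partial>lborel)"
      unfolding profile_def t_def[symmetric] by (intro nn_integral_mono pt(1))
    also have "\<dots> = L d + ennreal A0"
      by (subst nn_integral_add) (auto simp: D_int L_def t_def cong: if_cong)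
    finally have 1: "profile d \<le> L d + ennreal A0" .
    have "L d \<le> (\<integral>\<^sup>+z. (if 0 < z \<and> z < 1 then ennreal ((1 - z) powr (2 * \<alpha>) * t z) else 0) + D z \<partial>lborel)"
      unfolding L_def t_def[symmetric] by (intro nn_integral_mono pt(2))
    also have "\<dots> = profile d + ennreal A0"
      by (subst nn_integral_add) (auto simp: D_int profile_def t_def cong: if_cong)
    finally show ?thesis using 1 by simp
  qed
  \<comment> \<open>Split at z = d. Below, (d + z)^\<gamma> \<le> d^\<gamma> contributes
    d^(2\<gamma>+1)/(\<gamma>+1) = 2; above, the integrand is at most 1/z. In the other direction it
    is at least 1/(d + z).\<close>
  have Lbound: "L d \<le> ennreal (ln (1 / d) + 2) \<and> ennreal (ln (1 / d)) \<le> L d" if d: "0 < d" "d \<le> 1" for d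
  proof
    have ld: "ln (1 / d) \<ge> 0" using d by simp
    have "L d \<le> (\<integral>\<^sup>+z. ennreal (d powr \<gamma>) * (if 0 < z \<and> z < d then ennreal (z powr \<gamma>) else 0) + ennreal (1 / z) * indicator {d..1} z \<partial>lborel)"
      unfolding L_def
    proof (rule nn_integral_mono)
      fix z :: real
      consider "0 < z" "z < d" | "d \<le> z" "z < 1" | "z \<le> 0 \<or> z \<ge> 1" using d by linarith
      then show "(if 0 < z \<and> z < 1 then ennreal (z powr \<gamma> * (d + z) powr \<gamma>) else 0)
        \<le> ennreal (d powr \<gamma>) * (if 0 < z \<and> z < d then ennreal (z powr \<gamma>) else 0) + ennreal (1 / z) * indicator {d..1} z"
      proof cases
        case 1
        have "(d + z) powr \<gamma> \<le> d powr \<gamma>" using 1 d g by (intro powr_mono2') auto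
        then have "z powr \<gamma> * (d + z) powr \<gamma> \<le> d powr \<gamma> * z powr \<gamma>" by (subst mult.commute) (intro mult_right_mono, auto)
        then show ?thesis using 1 d by (auto simp: ennreal_mult[symmetric] intro: ennreal_leI)
      next
        case 2
        have "(d + z) powr \<gamma> \<le> z powr \<gamma>" using 2 d g by (intro powr_mono2') auto
        then have "z powr \<gamma> * (d + z) powr \<gamma> \<le> z powr \<gamma> * z powr \<gamma>" by (intro mult_left_mono) auto
        also have "\<dots> = 1 / z" using 2 d g by (simp add: powr_add[symmetric] powr_minus_divide)
        finally show ?thesis using 2 d by (auto intro: ennreal_leI)
      qed auto
    qed
    also have "\<dots> = ennreal (d powr \<gamma>) * ennreal (d powr (\<gamma> + 1) / (\<gamma> + 1)) + (\<integral>\<^sup>+z. ennreal (1 / z) * indicator {d..1} z \<partial>lborel)"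
      using nn_integral_powr_from_0[OF \<gamma>, of d] d by (subst nn_integral_add) (auto simp: nn_integral_cmult)
    also have "(\<integral>\<^sup>+z. ennreal (1 / z) * indicator {d..1} z \<partial>lborel) = ennreal (ln 1 - ln d)"
      using d by (intro nn_integral_FTC_Icc) (auto intro!: derivative_eq_intros)
    also have "ennreal (d powr \<gamma>) * ennreal (d powr (\<gamma> + 1) / (\<gamma> + 1)) = ennreal 2"
    proof -
      have "d powr \<gamma> * d powr (\<gamma> + 1) = 1"
        unfolding powr_add[symmetric] using d g by simp
      then have "d powr \<gamma> * (d powr (\<gamma> + 1) / (\<gamma> + 1)) = 2" using g by simp
      then show ?thesis using \<gamma> by (subst ennreal_mult[symmetric]) auto
    qed
    also have "ennreal 2 + ennreal (ln 1 - ln d) = ennreal (ln (1 / d) + 2)"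
      using ld d by (subst ennreal_plus[symmetric]) (auto simp: ln_div)
    finally show "L d \<le> ennreal (ln (1 / d) + 2)" .
    have "ennreal (ln (1 / d)) \<le> ennreal (ln (d + 1) - ln (d + 0))"
      using d by (intro ennreal_leI) (simp add: ln_div)
    also have "\<dots> = (\<integral>\<^sup>+z. ennreal (1 / (d + z)) * indicator {0..1} z \<partial>lborel)"
      using d by (intro nn_integral_FTC_Icc[symmetric]) (auto intro!: derivative_eq_intros)
    also have "\<dots> \<le> L d"
      unfolding L_def
    proof (rule nn_integral_mono_AE)
      show "AE z in lborel. ennreal (1 / (d + z)) * indicator {0..1} z \<le> (if 0 < z \<and> z < 1 then ennreal (z powr \<gamma> * (d + z) powr \<gamma>) else 0)"
        using AE_lborel_singleton[of "0::real"] AE_lborel_singleton[of "1::real"]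
      proof eventually_elim
        case (elim z)
        have "1 / (d + z) \<le> z powr \<gamma> * (d + z) powr \<gamma>" if "0 < z"
        proof -
          have "(d + z) powr \<gamma> \<le> z powr \<gamma>" using that d g by (intro powr_mono2') auto
          then have "(d + z) powr \<gamma> * (d + z) powr \<gamma> \<le> z powr \<gamma> * (d + z) powr \<gamma>" by (intro mult_right_mono) auto
          moreover have "(d + z) powr \<gamma> * (d + z) powr \<gamma> = 1 / (d + z)" using that d g by (simp add: powr_add[symmetric] powr_minus_divide)
          ultimately show ?thesis by simp
        qed
        then show ?case using elim by (auto simp: indicator_def intro: ennreal_leI)
      qed
    qed
    finally show "ennreal (ln (1 / d)) \<le> L d" .
  qed
  show ?thesis
  proof (intro exI[of _ "A0 + 2"] conjI allI impI)
    fix d :: real assume d: "0 < d \<and> d \<le> 1"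
    have ld: "ln (1 / d) \<ge> 0" using d by simp
    have "profile d \<le> L d + ennreal A0" using cmp d by auto
    also have "\<dots> \<le> ennreal (ln (1 / d) + 2) + ennreal A0" using Lbound d by (intro add_right_mono) auto
    also have "\<dots> = ennreal (ln (1 / d) + (A0 + 2))"
      using ld A00 by (simp add: ennreal_plus[symmetric] add_ac del: ennreal_plus)
    finally show "profile d \<le> ennreal (ln (1 / d) + (A0 + 2))" .
    have "ennreal (ln (1 / d)) \<le> L d" using Lbound d by auto
    also have "\<dots> \<le> profile d + ennreal A0" using cmp d by auto
    also have "\<dots> \<le> profile d + ennreal (A0 + 2)" by (intro add_left_mono ennreal_leI) simp
    finally show "ennreal (ln (1 / d)) \<le> profile d + ennreal (A0 + 2)" .
  qed (use A00 in simp)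
qed

end

section \<open>Asymptotics of the variance\<close>

lemma exp_powr_decay:
  fixes c e :: real
  assumes "c > 0"
  shows "((\<lambda>T. exp (- (c * T)) * T powr e) \<longlongrightarrow> 0) at_top"
  using assms by real_asymp

lemma nn_integral_exp_decay:
  fixes c :: real
  assumes "c > 0"
  shows "(\<integral>\<^sup>+x. (if 0 < x then ennreal (exp (- (c * x))) else 0) \<partial>lborel) = ennreal (1 / c)"
proof -
  have "(\<integral>\<^sup>+x. (if 0 < x then ennreal (exp (- (c * x))) else 0) \<partial>lborel)
      = (\<integral>\<^sup>+x. (if 0 < x then ennreal (x powr (1 - 1) * exp (- (c * x))) else 0) \<partial>lborel)"
    by (intro nn_integral_cong) auto
  also have "\<dots> = ennreal (1 / c)"
    using assms by (subst nn_integral_Gamma_scaled) (auto simp: powr_minus_divide)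
  finally show ?thesis .
qed

text \<open>By symmetry twice the part x < y; with y = x + h the integral over x is 1/(2\<theta>).
  One factor 1/\<theta> of the limiting variance arises here.\<close>

lemma nn_integral_exp_difference:
  fixes \<theta> :: real
  assumes \<theta>: "\<theta> > 0" and [measurable]: "F \<in> borel_measurable borel"
  shows "(\<integral>\<^sup>+x. \<integral>\<^sup>+y. (if 0 < x \<and> 0 < y \<and> x \<noteq> y then ennreal (exp (- (\<theta> * (x + y)))) * F \<bar>x - y\<bar> else 0) \<partial>lborel \<partial>lborel)
    = ennreal (1 / \<theta>) * (\<integral>\<^sup>+h. (if 0 < h then ennreal (exp (- (\<theta> * h))) * F h else 0) \<partial>lborel)"
proof -
  define I where "I = (\<integral>\<^sup>+h. (if 0 < h then ennreal (exp (- (\<theta> * h))) * F h else 0) \<partial>lborel)"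
  define f where "f x y = (if 0 < x \<and> x < y then ennreal (exp (- (\<theta> * (x + y)))) * F \<bar>x - y\<bar> else 0)" for x y :: real
  have [measurable]: "(\<lambda>x. f (a x) (b x)) \<in> borel_measurable N"
    if [measurable]: "a \<in> borel_measurable N" "b \<in> borel_measurable N" for a b and N :: "'z measure"
    unfolding f_def by measurable
  have half: "(\<integral>\<^sup>+x. \<integral>\<^sup>+y. f x y \<partial>lborel \<partial>lborel) = ennreal (1 / (2 * \<theta>)) * I"
  proof -
    have "(\<integral>\<^sup>+y. f x y \<partial>lborel) = (if 0 < x then ennreal (exp (- (2 * \<theta> * x))) else 0) * I" for x
    proof (cases "0 < x")
      case True
      have "(\<integral>\<^sup>+y. f x y \<partial>lborel) = ennreal \<bar>1\<bar> * (\<integral>\<^sup>+h. f x (x + 1 * h) \<partial>lborel)"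
        by (intro nn_integral_real_affine) auto
      also have "(\<integral>\<^sup>+h. f x (x + 1 * h) \<partial>lborel)
          = (\<integral>\<^sup>+h. ennreal (exp (- (2 * \<theta> * x))) * (if 0 < h then ennreal (exp (- (\<theta> * h))) * F h else 0) \<partial>lborel)"
      proof (rule nn_integral_cong)
        fix h :: real
        have "exp (- (\<theta> * (x + (x + h)))) = exp (- (2 * \<theta> * x)) * exp (- (\<theta> * h))"
          by (subst exp_add[symmetric]) (simp add: algebra_simps)
        then show "f x (x + 1 * h) = ennreal (exp (- (2 * \<theta> * x))) * (if 0 < h then ennreal (exp (- (\<theta> * h))) * F h else 0)"
          using True by (simp add: f_def ennreal_mult mult.assoc)
      qed
      also have "\<dots> = ennreal (exp (- (2 * \<theta> * x))) * I"
        unfolding I_def by (rule nn_integral_cmult) measurable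
      finally show ?thesis using True by simp
    qed (simp add: f_def)
    then have "(\<integral>\<^sup>+x. \<integral>\<^sup>+y. f x y \<partial>lborel \<partial>lborel) = (\<integral>\<^sup>+x. (if 0 < x then ennreal (exp (- (2 * \<theta> * x))) else 0) * I \<partial>lborel)"
      by simp
    also have "\<dots> = ennreal (1 / (2 * \<theta>)) * I"
      using nn_integral_exp_decay[of "2 * \<theta>"] \<theta> by (subst nn_integral_multc) simp_all
    finally show ?thesis .
  qed
  have "(\<integral>\<^sup>+x. \<integral>\<^sup>+y. (if 0 < x \<and> 0 < y \<and> x \<noteq> y then ennreal (exp (- (\<theta> * (x + y)))) * F \<bar>x - y\<bar> else 0) \<partial>lborel \<partial>lborel)
      = (\<integral>\<^sup>+x. \<integral>\<^sup>+y. f x y + f y x \<partial>lborel \<partial>lborel)"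
    by (intro nn_integral_cong) (auto simp: f_def abs_minus_commute add.commute)
  also have "\<dots> = (\<integral>\<^sup>+x. \<integral>\<^sup>+y. f x y \<partial>lborel \<partial>lborel) + (\<integral>\<^sup>+x. \<integral>\<^sup>+y. f y x \<partial>lborel \<partial>lborel)"
    by (simp add: nn_integral_add)
  also have "(\<integral>\<^sup>+x. \<integral>\<^sup>+y. f y x \<partial>lborel \<partial>lborel) = (\<integral>\<^sup>+x. \<integral>\<^sup>+y. f x y \<partial>lborel \<partial>lborel)"
    by (rule lborel_pair.Fubini') measurable
  also have "(\<integral>\<^sup>+x. \<integral>\<^sup>+y. f x y \<partial>lborel \<partial>lborel) + (\<integral>\<^sup>+x. \<integral>\<^sup>+y. f x y \<partial>lborel \<partial>lborel) = (ennreal (1 / (2 * \<theta>)) + ennreal (1 / (2 * \<theta>))) * I"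
    unfolding half by (simp add: distrib_right)
  also have "ennreal (1 / (2 * \<theta>)) + ennreal (1 / (2 * \<theta>)) = ennreal (1 / \<theta>)"
    using \<theta> by (subst ennreal_plus[symmetric]) (auto simp: field_simps)
  finally show ?thesis by (simp add: I_def)
qed

lemma powr_ratio_bound:
  fixes x e :: real
  assumes "1/2 \<le> x" "x \<le> 1"
  shows "x powr e \<le> 2 powr \<bar>e\<bar>"
proof (cases "e \<ge> 0")
  case True
  have "x powr e \<le> 1 powr e" using assms True by (intro powr_mono2) auto
  also have "\<dots> \<le> 2 powr \<bar>e\<bar>" by (simp add: ge_one_powr_ge_zero)
  finally show ?thesis .
next
  case False
  have "x powr e \<le> (1/2) powr e" using assms False by (intro powr_mono2') auto
  also have "\<dots> = 2 powr \<bar>e\<bar>" using False by (simp add: powr_divide powr_minus_divide)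
  finally show ?thesis .
qed

context volterra_drift begin

text \<open>Degree of homogeneity of \<open>cov_kernel\<close>.\<close>

abbreviation "\<kappa> \<equiv> 2 * \<alpha> + 2 * \<gamma> + 1"

text \<open>Common frame of the three regimes: q(T) is the order of the profile at distance h on
  scale T, \<phi> its limiting shape in h, and \<Phi> a majorant. With a = T - x and b = T - y the
  powers of T separate, the remaining ratios tend to 1, and dominated convergence leaves the Laplace
  transform of \<phi> at \<theta>.\<close>

lemma innov_variance_limit:
  fixes q \<phi> \<Phi> :: "real \<Rightarrow> real"
  assumes [measurable]: "\<phi> \<in> borel_measurable borel" "\<Phi> \<in> borel_measurable borel"
    and \<phi>0: "\<And>h. 0 < h \<Longrightarrow> 0 \<le> \<phi> h" and \<Phi>0: "\<And>h. 0 < h \<Longrightarrow> 0 \<le> \<Phi> h"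
    and T0: "T0 \<ge> 1" and q: "\<And>T. T \<ge> T0 \<Longrightarrow> q T \<ge> 1"
    and bound: "\<And>T m h. T \<ge> T0 \<Longrightarrow> T / 2 \<le> m \<Longrightarrow> m \<le> T \<Longrightarrow> 0 < h \<Longrightarrow> h \<le> m \<Longrightarrow> profile (h / m) \<le> ennreal (q T * \<Phi> h)"
    and lim: "\<And>h c. 0 < h \<Longrightarrow> ((\<lambda>T. profile (h / (T - c)) / ennreal (q T)) \<longlongrightarrow> ennreal (\<phi> h)) at_top"
    and fin: "(\<integral>\<^sup>+h. (if 0 < h then ennreal (exp (- (\<theta> * h))) * ennreal (\<Phi> h) else 0) \<partial>lborel) < \<infinity>"
    and L: "(\<integral>\<^sup>+h. (if 0 < h then ennreal (exp (- (\<theta> * h))) * ennreal (\<phi> h) else 0) \<partial>lborel) = ennreal L" "L \<ge> 0"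
    and \<tau>: "filterlim \<tau> at_top sequentially" and \<tau>T0: "\<And>n. \<tau> n \<ge> T0"
  shows "(\<lambda>n. (\<integral>\<omega>. (innov (\<tau> n) \<omega>)\<^sup>2 \<partial>M) / (\<tau> n powr (2 * \<beta> + \<kappa>) * q (\<tau> n))) \<longlonglongrightarrow> L / \<theta>"
proof -
  have \<tau>1: "\<tau> n \<ge> 1" for n using \<tau>T0[of n] T0 by simp
  have q1: "q (\<tau> n) \<ge> 1" for n using q \<tau>T0 by simp
  define S where "S n = \<tau> n powr (2 * \<beta> + \<kappa>) * q (\<tau> n)" for n
  have S0: "S n > 0" for n using \<tau>1[of n] q1[of n] unfolding S_def by (intro mult_pos_pos) auto
  \<comment> \<open>Integrand on the block a, b > T/2 after division by \<open>S n\<close>; the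
    diagonal is left out because the profile formula concerns distinct arguments.\<close>
  define u where "u n x y = (if 0 < x \<and> x < \<tau> n / 2 \<and> 0 < y \<and> y < \<tau> n / 2 \<and> x \<noteq> y
     then ennreal (exp (- (\<theta> * (x + y))) * (((\<tau> n - x) / \<tau> n) powr \<beta> * ((\<tau> n - y) / \<tau> n) powr \<beta> * ((\<tau> n - max x y) / \<tau> n) powr \<kappa>))
       * (profile (\<bar>x - y\<bar> / (\<tau> n - max x y)) / ennreal (q (\<tau> n))) else 0)" for n x y
  have um[measurable]: "(\<lambda>z. u n (f z) (g z)) \<in> borel_measurable N"
    if [measurable]: "f \<in> borel_measurable N" "g \<in> borel_measurable N" for n f g and N :: "'z measure"
    unfolding u_def by measurable
  \<comment> \<open>On the block all three ratios lie in [1/2, 1], so each power is at most 2 to the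
    absolute value of its exponent.\<close>
  define C where "C = 2 powr \<bar>\<beta>\<bar> * 2 powr \<bar>\<beta>\<bar> * 2 powr \<bar>\<kappa>\<bar>"
  have C0: "C \<ge> 0" by (simp add: C_def)
  define w where "w x y = ennreal C * (if 0 < x \<and> 0 < y \<and> x \<noteq> y then ennreal (exp (- (\<theta> * (x + y)))) * ennreal (\<Phi> \<bar>x - y\<bar>) else 0)" for x y
  define u' where "u' x y = (if 0 < x \<and> 0 < y \<and> x \<noteq> y then ennreal (exp (- (\<theta> * (x + y)))) * ennreal (\<phi> \<bar>x - y\<bar>) else 0)" for x y
  have wm[measurable]: "(\<lambda>p. w (fst p) (snd p)) \<in> borel_measurable (borel \<Otimes>\<^sub>M borel)"
    unfolding w_def by measurable
  have um'[measurable]: "(\<lambda>p. u' (fst p) (snd p)) \<in> borel_measurable (borel \<Otimes>\<^sub>M borel)"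
    unfolding u'_def by measurable
  define I where "I n = (\<integral>\<^sup>+p. u n (fst p) (snd p) \<partial>(lborel \<Otimes>\<^sub>M lborel))" for n
  have uw: "u n x y \<le> w x y" for n x y
  proof (cases "0 < x \<and> x < \<tau> n / 2 \<and> 0 < y \<and> y < \<tau> n / 2 \<and> x \<noteq> y")
    case True
    define m where "m = \<tau> n - max x y"
    have m: "\<tau> n / 2 \<le> m" "m \<le> \<tau> n" "\<bar>x - y\<bar> \<le> m" using True by (auto simp: m_def max_def abs_if)
    have "profile (\<bar>x - y\<bar> / m) \<le> ennreal (q (\<tau> n) * \<Phi> \<bar>x - y\<bar>)"
      using True m \<tau>T0 by (intro bound) auto
    then have "profile (\<bar>x - y\<bar> / m) / ennreal (q (\<tau> n)) \<le> ennreal (q (\<tau> n) * \<Phi> \<bar>x - y\<bar>) / ennreal (q (\<tau> n))"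
      by (rule divide_right_mono_ennreal)
    also have "\<dots> = ennreal (\<Phi> \<bar>x - y\<bar>)"
      using q1[of n] \<Phi>0[of "\<bar>x - y\<bar>"] True by (subst divide_ennreal) auto
    finally have P: "profile (\<bar>x - y\<bar> / m) / ennreal (q (\<tau> n)) \<le> ennreal (\<Phi> \<bar>x - y\<bar>)" .
    have rb: "((\<tau> n - s) / \<tau> n) powr e \<le> 2 powr \<bar>e\<bar>" if "0 \<le> s" "s \<le> \<tau> n / 2" for s e
      using \<tau>1[of n] that by (intro powr_ratio_bound) (auto simp: field_simps)
    have "((\<tau> n - x) / \<tau> n) powr \<beta> * ((\<tau> n - y) / \<tau> n) powr \<beta> * ((\<tau> n - max x y) / \<tau> n) powr \<kappa> \<le> C"
      unfolding C_def using True by (intro mult_mono rb) auto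
    then have "exp (- (\<theta> * (x + y))) * (((\<tau> n - x) / \<tau> n) powr \<beta> * ((\<tau> n - y) / \<tau> n) powr \<beta> * ((\<tau> n - max x y) / \<tau> n) powr \<kappa>) \<le> exp (- (\<theta> * (x + y))) * C"
      by (intro mult_left_mono) auto
    then have "u n x y \<le> ennreal (exp (- (\<theta> * (x + y))) * C) * ennreal (\<Phi> \<bar>x - y\<bar>)"
      using True P unfolding u_def m_def[symmetric] by (auto intro!: mult_mono ennreal_leI)
    also have "\<dots> = w x y" using True C0 by (simp add: w_def ennreal_mult mult_ac)
    finally show ?thesis .
  next
    case False
    then have "u n x y = 0" by (simp only: u_def if_False)
    then show ?thesis by simp
  qed
  have wI: "(\<integral>\<^sup>+p. w (fst p) (snd p) \<partial>(lborel \<Otimes>\<^sub>M lborel)) < \<infinity>"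
  proof -
    have "(\<integral>\<^sup>+p. w (fst p) (snd p) \<partial>(lborel \<Otimes>\<^sub>M lborel)) = (\<integral>\<^sup>+x. \<integral>\<^sup>+y. w x y \<partial>lborel \<partial>lborel)"
      by (subst lborel.nn_integral_fst[symmetric]) auto
    also have "\<dots> = ennreal C * (\<integral>\<^sup>+x. \<integral>\<^sup>+y. (if 0 < x \<and> 0 < y \<and> x \<noteq> y then ennreal (exp (- (\<theta> * (x + y)))) * ennreal (\<Phi> \<bar>x - y\<bar>) else 0) \<partial>lborel \<partial>lborel)"
      unfolding w_def by (simp add: nn_integral_cmult)
    also have "\<dots> = ennreal C * (ennreal (1 / \<theta>) * (\<integral>\<^sup>+h. (if 0 < h then ennreal (exp (- (\<theta> * h))) * ennreal (\<Phi> h) else 0) \<partial>lborel))"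
      using nn_integral_exp_difference[OF \<theta>, of "\<lambda>h. ennreal (\<Phi> h)"] by simp
    also have "\<dots> < \<infinity>" using fin by (simp add: ennreal_mult_less_top)
    finally show ?thesis .
  qed
  have uI: "(\<integral>\<^sup>+p. u' (fst p) (snd p) \<partial>(lborel \<Otimes>\<^sub>M lborel)) = ennreal (L / \<theta>)"
  proof -
    have "(\<integral>\<^sup>+p. u' (fst p) (snd p) \<partial>(lborel \<Otimes>\<^sub>M lborel)) = (\<integral>\<^sup>+x. \<integral>\<^sup>+y. u' x y \<partial>lborel \<partial>lborel)"
      by (subst lborel.nn_integral_fst[symmetric]) auto
    also have "\<dots> = ennreal (1 / \<theta>) * (\<integral>\<^sup>+h. (if 0 < h then ennreal (exp (- (\<theta> * h))) * ennreal (\<phi> h) else 0) \<partial>lborel)"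
      unfolding u'_def using nn_integral_exp_difference[OF \<theta>, of "\<lambda>h. ennreal (\<phi> h)"] by simp
    also have "\<dots> = ennreal (L / \<theta>)" using L \<theta> by (simp add: ennreal_mult[symmetric])
    finally show ?thesis .
  qed
  have Ilim: "I \<longlonglongrightarrow> ennreal (L / \<theta>)"
    unfolding I_def uI[symmetric]
  proof (rule nn_integral_dominated_convergence[where w="\<lambda>p. w (fst p) (snd p)"])
    show "AE p in lborel \<Otimes>\<^sub>M lborel. u n (fst p) (snd p) \<le> w (fst p) (snd p)" for n
      using uw by (intro AE_I2)
    show "AE p in lborel \<Otimes>\<^sub>M lborel. (\<lambda>n. u n (fst p) (snd p)) \<longlonglongrightarrow> u' (fst p) (snd p)"
    proof (rule AE_I2)
      fix p :: "real \<times> real"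
      obtain x y where p: "p = (x, y)" by (cases p)
      show "(\<lambda>n. u n (fst p) (snd p)) \<longlonglongrightarrow> u' (fst p) (snd p)"
      proof (cases "0 < x \<and> 0 < y \<and> x \<noteq> y")
        case True
        have r: "(\<lambda>n. (\<tau> n - s) / \<tau> n) \<longlonglongrightarrow> 1" for s
        proof (rule filterlim_compose[OF _ \<tau>])
          show "((\<lambda>T. (T - s) / T) \<longlongrightarrow> 1) at_top" by real_asymp
        qed
        have pr: "(\<lambda>n. profile (\<bar>x - y\<bar> / (\<tau> n - max x y)) / ennreal (q (\<tau> n))) \<longlonglongrightarrow> ennreal (\<phi> \<bar>x - y\<bar>)"
          by (rule filterlim_compose[OF lim \<tau>]) (use True in auto)
        have "(\<lambda>n. exp (- (\<theta> * (x + y))) * (((\<tau> n - x) / \<tau> n) powr \<beta> * ((\<tau> n - y) / \<tau> n) powr \<beta> * ((\<tau> n - max x y) / \<tau> n) powr \<kappa>))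
            \<longlonglongrightarrow> exp (- (\<theta> * (x + y))) * (1 powr \<beta> * 1 powr \<beta> * 1 powr \<kappa>)"
          by (intro tendsto_intros r) auto
        from tendsto_mult_ennreal[OF tendsto_ennrealI[OF this] pr]
        have lim1: "(\<lambda>n. ennreal (exp (- (\<theta> * (x + y))) * (((\<tau> n - x) / \<tau> n) powr \<beta> * ((\<tau> n - y) / \<tau> n) powr \<beta> * ((\<tau> n - max x y) / \<tau> n) powr \<kappa>))
            * (profile (\<bar>x - y\<bar> / (\<tau> n - max x y)) / ennreal (q (\<tau> n)))) \<longlonglongrightarrow> u' x y"
          using True by (simp add: u'_def)
        have "\<forall>\<^sub>F n in sequentially. \<tau> n > 2 * max x y"
          using \<tau> by (rule filterlim_at_top_dense[THEN iffD1, rule_format])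
        then have "\<forall>\<^sub>F n in sequentially. ennreal (exp (- (\<theta> * (x + y))) * (((\<tau> n - x) / \<tau> n) powr \<beta> * ((\<tau> n - y) / \<tau> n) powr \<beta> * ((\<tau> n - max x y) / \<tau> n) powr \<kappa>))
            * (profile (\<bar>x - y\<bar> / (\<tau> n - max x y)) / ennreal (q (\<tau> n))) = u n x y"
          by (rule eventually_mono) (use True in \<open>auto simp: u_def\<close>)
        from Lim_transform_eventually[OF lim1 this] show ?thesis by (simp add: p)
      next
        case False
        then have "u n x y = 0" "u' x y = 0" for n by (auto simp: u_def u'_def)
        then show ?thesis by (simp add: p)
      qed
    qed
  qed (use wI in auto)
  define E where "E n a = (if 0 < a \<and> a \<le> \<tau> n then ennreal (exp (- (\<theta> * (\<tau> n - a)))) else 0)" for n a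
  have Em[measurable]: "E n \<in> borel_measurable borel" for n unfolding E_def by measurable
  have V: "ennreal (\<integral>\<omega>. (innov (\<tau> n) \<omega>)\<^sup>2 \<partial>M) = (\<integral>\<^sup>+a. \<integral>\<^sup>+b. E n a * E n b * wcov a b \<partial>lborel \<partial>lborel)" for n
    using \<tau>1[of n] unfolding E_def by (intro innov_second_moment) simp
  \<comment> \<open>Both times in the last half of [0, T]; strict inequality at T removes only a
    null set.\<close>
  define near where "near n = (\<integral>\<^sup>+a. \<integral>\<^sup>+b. (if \<tau> n / 2 < a \<and> a < \<tau> n \<and> \<tau> n / 2 < b \<and> b < \<tau> n then E n a * E n b * wcov a b else 0) \<partial>lborel \<partial>lborel)" for n
  have near_le: "near n \<le> ennreal (\<integral>\<omega>. (innov (\<tau> n) \<omega>)\<^sup>2 \<partial>M)" for n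
    unfolding V near_def by (intro nn_integral_mono) auto
  have near_eq: "near n = ennreal (S n) * I n" for n
  proof -
    define F where "F x y = (if 0 < x \<and> x < \<tau> n / 2 \<and> 0 < y \<and> y < \<tau> n / 2 then ennreal (exp (- (\<theta> * x))) * ennreal (exp (- (\<theta> * y))) * wcov (\<tau> n - x) (\<tau> n - y) else 0)" for x y
    have "near n = ennreal \<bar>-1\<bar> * (\<integral>\<^sup>+x. \<integral>\<^sup>+b. (if \<tau> n / 2 < \<tau> n + (-1) * x \<and> \<tau> n + (-1) * x < \<tau> n \<and> \<tau> n / 2 < b \<and> b < \<tau> n then E n (\<tau> n + (-1) * x) * E n b * wcov (\<tau> n + (-1) * x) b else 0) \<partial>lborel \<partial>lborel)"
      unfolding near_def by (intro nn_integral_real_affine) auto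
    also have "\<dots> = ennreal \<bar>-1\<bar> * (\<integral>\<^sup>+x. ennreal \<bar>-1\<bar> * (\<integral>\<^sup>+y. (if \<tau> n / 2 < \<tau> n + (-1) * x \<and> \<tau> n + (-1) * x < \<tau> n \<and> \<tau> n / 2 < \<tau> n + (-1) * y \<and> \<tau> n + (-1) * y < \<tau> n then E n (\<tau> n + (-1) * x) * E n (\<tau> n + (-1) * y) * wcov (\<tau> n + (-1) * x) (\<tau> n + (-1) * y) else 0) \<partial>lborel) \<partial>lborel)"
      by (intro arg_cong[where f="\<lambda>x. ennreal \<bar>-1\<bar> * x"] nn_integral_cong nn_integral_real_affine) auto
    also have "\<dots> = (\<integral>\<^sup>+x. \<integral>\<^sup>+y. F x y \<partial>lborel \<partial>lborel)"
      using \<tau>1[of n] by (auto intro!: nn_integral_cong simp: F_def E_def)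
    also have "\<dots> = (\<integral>\<^sup>+x. \<integral>\<^sup>+y. ennreal (S n) * u n x y \<partial>lborel \<partial>lborel)"
    \<comment> \<open>The two sides may differ at y = x, a null set for every x.\<close>
    proof (rule nn_integral_cong, rule nn_integral_cong_AE)
      fix x :: real
      show "AE y in lborel. F x y = ennreal (S n) * u n x y"
        using AE_lborel_singleton[of x]
      proof eventually_elim
        case (elim y)
        show ?case
        proof (cases "0 < x \<and> x < \<tau> n / 2 \<and> 0 < y \<and> y < \<tau> n / 2")
          case True
          define m where "m = \<tau> n - max x y"
          have m: "min (\<tau> n - x) (\<tau> n - y) = m" "m > 0" using True by (auto simp: m_def)
          have pos: "\<tau> n > 0" "\<tau> n - x > 0" "\<tau> n - y > 0" using True by auto
          have ck: "cov_kernel (\<tau> n - x) (\<tau> n - y) = ennreal (m powr \<kappa>) * profile (\<bar>x - y\<bar> / m)"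
            using cov_kernel_profile[of "\<tau> n - x" "\<tau> n - y"] pos elim unfolding m by (simp add: abs_minus_commute)
          have sc: "\<tau> n powr (2 * \<beta> + \<kappa>) * (((\<tau> n - x) / \<tau> n) powr \<beta> * ((\<tau> n - y) / \<tau> n) powr \<beta> * (m / \<tau> n) powr \<kappa>)
              = (\<tau> n - x) powr \<beta> * (\<tau> n - y) powr \<beta> * m powr \<kappa>"
          proof -
            have "\<tau> n powr (2 * \<beta> + \<kappa>) = \<tau> n powr \<beta> * \<tau> n powr \<beta> * \<tau> n powr \<kappa>"
              by (simp only: powr_add[symmetric]) simp
            then show ?thesis using pos m(2) by (simp add: powr_divide)
          qed
          have qq: "ennreal (q (\<tau> n)) * (P / ennreal (q (\<tau> n))) = P" for P
            using q1[of n] by (subst ennreal_times_divide) (auto simp: mult.commute intro!: mult_divide_eq_ennreal)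
          have "F x y = ennreal (exp (- (\<theta> * x)) * exp (- (\<theta> * y)) * ((\<tau> n - x) powr \<beta> * (\<tau> n - y) powr \<beta> * m powr \<kappa>)) * profile (\<bar>x - y\<bar> / m)"
            using True by (simp add: F_def wcov_def ck ennreal_mult mult_ac)
          also have "\<dots> = ennreal (\<tau> n powr (2 * \<beta> + \<kappa>) * (exp (- (\<theta> * (x + y))) * (((\<tau> n - x) / \<tau> n) powr \<beta> * ((\<tau> n - y) / \<tau> n) powr \<beta> * (m / \<tau> n) powr \<kappa>))) * profile (\<bar>x - y\<bar> / m)"
            unfolding sc[symmetric] by (simp add: exp_add[symmetric] algebra_simps)
          also have "\<dots> = ennreal (\<tau> n powr (2 * \<beta> + \<kappa>)) * ennreal (exp (- (\<theta> * (x + y))) * (((\<tau> n - x) / \<tau> n) powr \<beta> * ((\<tau> n - y) / \<tau> n) powr \<beta> * (m / \<tau> n) powr \<kappa>))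
              * (ennreal (q (\<tau> n)) * (profile (\<bar>x - y\<bar> / m) / ennreal (q (\<tau> n))))"
            unfolding qq by (subst ennreal_mult) auto
          also have "\<dots> = ennreal (S n) * u n x y"
            using True elim q1[of n] by (simp add: S_def u_def m_def ennreal_mult mult_ac)
          finally show ?thesis .
        qed (auto simp: F_def u_def)
      qed
    qed
    also have "\<dots> = ennreal (S n) * I n"
      unfolding I_def by (subst lborel.nn_integral_fst[symmetric]) (auto simp: nn_integral_cmult)
    finally show ?thesis .
  qed
  \<comment> \<open>Outside the block one of the two weights is at most exp(-\<theta> T/2), and the
    density integrates to the second moment of X(T).\<close>
  define far where "far n = exp (- (\<theta> * \<tau> n / 2)) * (\<tau> n powr var_exp * R1)" for n
  have far0: "far n \<ge> 0" for n using R1_pos by (simp add: far_def)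
  have le_near: "ennreal (\<integral>\<omega>. (innov (\<tau> n) \<omega>)\<^sup>2 \<partial>M) \<le> near n + ennreal (2 * far n)" for n
  proof -
    let ?T = "\<tau> n"
    have T: "?T \<ge> 1" by (rule \<tau>1)
    have Rc: "rect_cov {0<..?T} {0<..?T} = ennreal (?T powr var_exp * R1)"
      using T R1_pos rect_cov_diag[of ?T] by (simp add: rect_cov_1 ennreal_mult)
    have e: "E n a \<le> 1" "a \<le> ?T / 2 \<Longrightarrow> E n a \<le> ennreal (exp (- (\<theta> * ?T / 2)))" for a
    proof -
      show "E n a \<le> 1" using \<theta> T by (auto simp: E_def)
      assume "a \<le> ?T / 2"
      then have "\<theta> * (?T / 2) \<le> \<theta> * (?T - a)" using \<theta> by (intro mult_left_mono) auto
      then show "E n a \<le> ennreal (exp (- (\<theta> * ?T / 2)))"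
        by (auto simp: E_def intro!: ennreal_leI)
    qed
    have Es: "E n a = 0" if "\<not> (0 < a \<and> a \<le> ?T)" for a using that by (simp only: E_def if_False)
    have prod: "E n a * E n b \<le> ennreal (exp (- (\<theta> * ?T / 2)))" if "a \<le> ?T / 2 \<or> b \<le> ?T / 2" for a b
      using that
    proof
      assume "a \<le> ?T / 2"
      then have "E n a * E n b \<le> ennreal (exp (- (\<theta> * ?T / 2))) * 1" by (intro mult_mono e) auto
      then show ?thesis by simp
    next
      assume "b \<le> ?T / 2"
      then have "E n a * E n b \<le> 1 * ennreal (exp (- (\<theta> * ?T / 2)))" by (intro mult_mono e) auto
      then show ?thesis by simp
    qed
    have "ennreal (\<integral>\<omega>. (innov ?T \<omega>)\<^sup>2 \<partial>M)
        \<le> (\<integral>\<^sup>+a. \<integral>\<^sup>+b. (if ?T / 2 < a \<and> a < ?T \<and> ?T / 2 < b \<and> b < ?T then E n a * E n b * wcov a b else 0)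
          + ennreal (exp (- (\<theta> * ?T / 2))) * (if a \<in> {0<..?T} \<and> b \<in> {0<..?T} then wcov a b else 0) \<partial>lborel \<partial>lborel)"
      unfolding V
    proof (rule nn_integral_mono_AE, use AE_lborel_singleton[of ?T] in eventually_elim)
      case (elim a)
      show ?case
      proof (rule nn_integral_mono_AE, use AE_lborel_singleton[of ?T] in eventually_elim)
        case (elim b)
        note ne = \<open>a \<noteq> ?T\<close> \<open>b \<noteq> ?T\<close>
        show ?case
        proof (cases "0 < a \<and> a \<le> ?T \<and> 0 < b \<and> b \<le> ?T")
          case True
          show ?thesis
          proof (cases "a \<le> ?T / 2 \<or> b \<le> ?T / 2")
            case near: True
            then have "E n a * E n b * wcov a b \<le> ennreal (exp (- (\<theta> * ?T / 2))) * wcov a b"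
              by (intro mult_right_mono prod) auto
            then show ?thesis using True by (simp add: add_increasing)
          qed (use True ne in \<open>auto simp: add_increasing2\<close>)
        next
          case False
          then have "E n a * E n b = 0" using Es[of a] Es[of b] by auto
          then show ?thesis by (simp only: mult_zero_left if_cancel zero_le)
        qed
      qed
    qed
    also have "\<dots> = near n + ennreal (exp (- (\<theta> * ?T / 2))) * rect_cov {0<..?T} {0<..?T}"
      unfolding near_def rect_cov_def by (simp add: nn_integral_add nn_integral_cmult)
    also have "ennreal (exp (- (\<theta> * ?T / 2))) * rect_cov {0<..?T} {0<..?T} = ennreal (far n)"
      unfolding Rc far_def using R1_pos by (simp add: ennreal_mult)
    also have "near n + ennreal (far n) \<le> near n + ennreal (2 * far n)"
      using far0[of n] by (intro add_left_mono ennreal_leI) simp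
    finally show ?thesis .
  qed
  define v where "v n = (\<integral>\<omega>. (innov (\<tau> n) \<omega>)\<^sup>2 \<partial>M)" for n
  have v0: "v n \<ge> 0" for n by (simp add: v_def)
  have vS: "ennreal (v n) = ennreal (S n) * ennreal (v n / S n)" for n
    using S0[of n] v0[of n] by (simp add: ennreal_mult[symmetric])
  have lower: "I n \<le> ennreal (v n / S n)" for n
  proof -
    have "ennreal (S n) * I n \<le> ennreal (S n) * ennreal (v n / S n)"
      using near_le[of n] unfolding near_eq v_def[symmetric] vS[of n] .
    then show ?thesis using S0[of n] by (subst (asm) ennreal_mult_le_mult_iff) auto
  qed
  have upper: "ennreal (v n / S n) \<le> I n + ennreal (2 * far n / S n)" for n
  proof -
    have "ennreal (S n) * ennreal (v n / S n) \<le> ennreal (S n) * I n + ennreal (S n) * ennreal (2 * far n / S n)"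
      using le_near[of n] S0[of n] far0[of n] unfolding near_eq v_def[symmetric] vS[of n]
      by (simp add: ennreal_mult[symmetric])
    then show ?thesis
      unfolding distrib_left[symmetric] using S0[of n] by (subst (asm) ennreal_mult_le_mult_iff) auto
  qed
  \<comment> \<open>\<open>S n\<close> is at least a fixed power of T because q \<ge> 1, so
    exponential decay remains after the division.\<close>
  have farS: "(\<lambda>n. 2 * far n / S n) \<longlonglongrightarrow> 0"
  proof (rule tendsto_sandwich[OF _ _ tendsto_const])
    show "\<forall>\<^sub>F n in sequentially. 0 \<le> 2 * far n / S n"
      using far0 S0 by (intro always_eventually allI divide_nonneg_pos) auto
    show "\<forall>\<^sub>F n in sequentially. 2 * far n / S n \<le> 2 * R1 * (exp (- (\<theta> * \<tau> n / 2)) * \<tau> n powr (var_exp - (2 * \<beta> + \<kappa>)))"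
    proof (intro always_eventually allI)
      fix n
      have "2 * far n / S n \<le> 2 * far n / (\<tau> n powr (2 * \<beta> + \<kappa>))"
        using far0[of n] q1[of n] \<tau>1[of n] unfolding S_def by (intro divide_left_mono) auto
      also have "\<dots> = 2 * R1 * (exp (- (\<theta> * \<tau> n / 2)) * \<tau> n powr (var_exp - (2 * \<beta> + \<kappa>)))"
        by (simp add: far_def powr_diff)
      finally show "2 * far n / S n \<le> 2 * R1 * (exp (- (\<theta> * \<tau> n / 2)) * \<tau> n powr (var_exp - (2 * \<beta> + \<kappa>)))" .
    qed
    have "(\<lambda>n. exp (- (\<theta> / 2 * \<tau> n)) * \<tau> n powr (var_exp - (2 * \<beta> + \<kappa>))) \<longlonglongrightarrow> 0"
      by (rule filterlim_compose[OF exp_powr_decay \<tau>]) (use \<theta> in simp)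
    from tendsto_mult_left[OF this, of "2 * R1"]
    show "(\<lambda>n. 2 * R1 * (exp (- (\<theta> * \<tau> n / 2)) * \<tau> n powr (var_exp - (2 * \<beta> + \<kappa>)))) \<longlonglongrightarrow> 0"
      by simp
  qed
  have "(\<lambda>n. ennreal (v n / S n)) \<longlonglongrightarrow> ennreal (L / \<theta>)"
  proof (rule tendsto_sandwich[OF _ _ Ilim])
    show "\<forall>\<^sub>F n in sequentially. I n \<le> ennreal (v n / S n)"
      "\<forall>\<^sub>F n in sequentially. ennreal (v n / S n) \<le> I n + ennreal (2 * far n / S n)"
      using lower upper by (auto intro: always_eventually)
    show "(\<lambda>n. I n + ennreal (2 * far n / S n)) \<longlonglongrightarrow> ennreal (L / \<theta>)"
      using tendsto_add[OF Ilim tendsto_ennrealI[OF farS]] by simp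
  qed
  then have "(\<lambda>n. v n / S n) \<longlonglongrightarrow> L / \<theta>"
    using L(2) \<theta> v0 S0 by (subst (asm) tendsto_ennreal_iff) (auto intro!: always_eventually divide_nonneg_pos)
  then show ?thesis by (simp add: v_def S_def)
qed

text \<open>The profile has a finite limit, so q = 1 and \<phi> is constant; the Laplace transform
  of a constant gives the second factor 1/\<theta>.\<close>

lemma innov_variance_smooth:
  assumes g: "\<gamma> > - 1/2" and \<tau>: "filterlim \<tau> at_top sequentially" "\<And>n. \<tau> n \<ge> 1"
  shows "(\<lambda>n. (\<integral>\<omega>. (innov (\<tau> n) \<omega>)\<^sup>2 \<partial>M) / (\<tau> n powr (2 * \<beta> + \<kappa>) * 1)) \<longlonglongrightarrow> (varsigma_const \<alpha> \<gamma>)\<^sup>2 / \<theta> / \<theta>"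
proof -
  obtain c where c: "c \<ge> 0" "\<And>d. 0 < d \<Longrightarrow> d \<le> 1 \<Longrightarrow> profile d \<le> ennreal c"
    using profile_smooth(1)[OF g] by auto
  have lim0: "(profile \<longlongrightarrow> ennreal ((varsigma_const \<alpha> \<gamma>)\<^sup>2)) (at_right 0)"
    by (rule tendsto_at_right_sequentially[of 0 1], simp, rule profile_smooth(2)[OF g]) (auto simp: less_imp_le)
  have I: "(\<integral>\<^sup>+h. (if 0 < h then ennreal (exp (- (\<theta> * h))) * ennreal e else 0) \<partial>lborel) = ennreal (e / \<theta>)" if "e \<ge> 0" for e
  proof -
    have "(\<integral>\<^sup>+h. (if 0 < h then ennreal (exp (- (\<theta> * h))) * ennreal e else 0) \<partial>lborel)
        = (\<integral>\<^sup>+h. (if 0 < h then ennreal (exp (- (\<theta> * h))) else 0) * ennreal e \<partial>lborel)"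
      by (intro nn_integral_cong) auto
    also have "\<dots> = ennreal (1 / \<theta>) * ennreal e"
      using nn_integral_exp_decay[OF \<theta>] by (subst nn_integral_multc) simp_all
    finally show ?thesis using that \<theta> by (simp add: ennreal_mult[symmetric])
  qed
  show ?thesis
  proof (rule innov_variance_limit[where \<phi>="\<lambda>_. (varsigma_const \<alpha> \<gamma>)\<^sup>2" and \<Phi>="\<lambda>_. c" and q="\<lambda>_. 1" and ?T0.0=1])
    fix T m h :: real
    assume "T \<ge> 1" "T / 2 \<le> m" "m \<le> T" "0 < h" "h \<le> m"
    then show "profile (h / m) \<le> ennreal (1 * c)" using c(2)[of "h / m"] by simp
  next
    fix h c :: real assume h: "0 < h"
    have "filterlim (\<lambda>T. h / (T - c)) (at_right 0) at_top" using h by real_asymp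
    from filterlim_compose[OF lim0 this]
    show "((\<lambda>T. profile (h / (T - c)) / ennreal 1) \<longlongrightarrow> ennreal ((varsigma_const \<alpha> \<gamma>)\<^sup>2)) at_top"
      by (simp add: divide_ennreal_def)
  qed (use c(1) \<tau> I \<theta> in auto)
qed

text \<open>The profile at h/T is of order T^(-(2\<gamma>+1)) h^(2\<gamma>+1). The Laplace transform
  of h^(2\<gamma>+1) contributes Gamma(2\<gamma>+2) \<theta>^(-(2\<gamma>+2)), and this Gamma factor
  completes the infinite Beta integral to the square of \<open>sigma_const \<gamma>\<close>.\<close>

lemma innov_variance_singular:
  assumes g: "\<gamma> < - 1/2" and \<tau>: "filterlim \<tau> at_top sequentially" "\<And>n. \<tau> n \<ge> 1"
  shows "(\<lambda>n. (\<integral>\<omega>. (innov (\<tau> n) \<omega>)\<^sup>2 \<partial>M) / (\<tau> n powr (2 * \<beta> + \<kappa>) * \<tau> n powr (- (2 * \<gamma> + 1)))) \<longlonglongrightarrow> (sigma_const \<gamma>)\<^sup>2 * \<theta> powr (- (2 * \<gamma> + 2)) / \<theta>"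
proof -
  define e where "e = - (2 * \<gamma> + 1)"
  have e: "e > 0" "2 * \<gamma> + 1 = - e" using g by (auto simp: e_def)
  define B where "B = Gamma (\<gamma> + 1) * Gamma (- 2 * \<gamma> - 1) / Gamma (- \<gamma>)"
  have G: "Gamma (2 * \<gamma> + 2) > 0" using \<gamma> by (auto intro: Gamma_real_pos)
  have B0: "B \<ge> 0"
    unfolding B_def using g \<gamma> by (auto intro!: divide_nonneg_nonneg mult_nonneg_nonneg less_imp_le[OF Gamma_real_pos])
  have sig: "(sigma_const \<gamma>)\<^sup>2 = B * Gamma (2 * \<gamma> + 2)"
  proof -
    have "Gamma (\<gamma> + 1) * Gamma (- 2 * \<gamma> - 1) * Gamma (2 * \<gamma> + 2) / Gamma (- \<gamma>) = B * Gamma (2 * \<gamma> + 2)"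
      by (simp add: B_def)
    then show ?thesis using B0 G unfolding sigma_const_def by simp
  qed
  obtain c where c: "c \<ge> 0" "\<And>d. 0 < d \<Longrightarrow> d \<le> 1 \<Longrightarrow> profile d \<le> ennreal (c * d powr (- e))"
    using profile_singular(1)[OF g] unfolding e(2) by auto
  have lim0: "((\<lambda>d. ennreal (d powr e) * profile d) \<longlongrightarrow> ennreal B) (at_right 0)"
    unfolding B_def e_def
    by (rule tendsto_at_right_sequentially[of 0 1], simp, rule profile_singular(2)[OF g]) (auto simp: less_imp_le)
  have I: "(\<integral>\<^sup>+h. (if 0 < h then ennreal (exp (- (\<theta> * h))) * ennreal (x * h powr (- e)) else 0) \<partial>lborel)
      = ennreal (x * (Gamma (2 * \<gamma> + 2) * \<theta> powr (- (2 * \<gamma> + 2))))" if "x \<ge> 0" for x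
  proof -
    have "(\<integral>\<^sup>+h. (if 0 < h then ennreal (exp (- (\<theta> * h))) * ennreal (x * h powr (- e)) else 0) \<partial>lborel)
        = (\<integral>\<^sup>+h. ennreal x * (if 0 < h then ennreal (h powr (2 * \<gamma> + 2 - 1) * exp (- (\<theta> * h))) else 0) \<partial>lborel)"
      using that by (intro nn_integral_cong) (auto simp: e_def ennreal_mult[symmetric] mult_ac)
    also have "\<dots> = ennreal x * ennreal (Gamma (2 * \<gamma> + 2) * \<theta> powr (- (2 * \<gamma> + 2)))"
      using nn_integral_Gamma_scaled[of "2 * \<gamma> + 2" \<theta>] \<gamma> \<theta> by (subst nn_integral_cmult) simp_all
    finally show ?thesis using that G by (simp add: ennreal_mult)
  qed
  have "(\<lambda>n. (\<integral>\<omega>. (innov (\<tau> n) \<omega>)\<^sup>2 \<partial>M) / (\<tau> n powr (2 * \<beta> + \<kappa>) * \<tau> n powr e)) \<longlonglongrightarrow> B * (Gamma (2 * \<gamma> + 2) * \<theta> powr (- (2 * \<gamma> + 2))) / \<theta>"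
  proof (rule innov_variance_limit[where \<phi>="\<lambda>h. B * h powr (- e)" and \<Phi>="\<lambda>h. c * h powr (- e)" and q="\<lambda>T. T powr e" and ?T0.0=1])
    fix T m h :: real
    assume A: "T \<ge> 1" "T / 2 \<le> m" "m \<le> T" "0 < h" "h \<le> m"
    then have "profile (h / m) \<le> ennreal (c * (h / m) powr (- e))" by (intro c(2)) auto
    also have "c * (h / m) powr (- e) \<le> T powr e * (c * h powr (- e))"
    proof -
      have "(h / m) powr (- e) = m powr e * h powr (- e)"
        using A by (subst powr_divide) (auto simp: powr_minus field_simps)
      also have "\<dots> \<le> T powr e * h powr (- e)" using A e by (intro mult_right_mono powr_mono2) auto
      finally have "c * (h / m) powr (- e) \<le> c * (T powr e * h powr (- e))" using c(1) by (rule mult_left_mono)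
      then show ?thesis by (simp add: mult_ac)
    qed
    finally show "profile (h / m) \<le> ennreal (T powr e * (c * h powr (- e)))" by (simp add: ennreal_leI)
  next
    fix h c :: real assume h: "0 < h"
    have f: "filterlim (\<lambda>T. h / (T - c)) (at_right 0) at_top" using h by real_asymp
    \<comment> \<open>The auxiliary factor is chosen so that (h/(T-c))^e h^(-e) ((T-c)/T)^e =
      T^(-e); it converts the limit of the profile at 0 into division by q(T).\<close>
    have "((\<lambda>T. (T - c) / T) \<longlongrightarrow> 1) at_top" by real_asymp
    then have "((\<lambda>T. h powr (- e) * ((T - c) / T) powr e) \<longlongrightarrow> h powr (- e) * 1 powr e) at_top"
      by (intro tendsto_intros) auto
    from tendsto_mult_ennreal[OF filterlim_compose[OF lim0 f] tendsto_ennrealI[OF this]]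
    have l: "((\<lambda>T. ennreal ((h / (T - c)) powr e) * profile (h / (T - c)) * ennreal (h powr (- e) * ((T - c) / T) powr e)) \<longlongrightarrow> ennreal B * ennreal (h powr (- e))) at_top"
      by simp
    have "\<forall>\<^sub>F T in at_top. ennreal ((h / (T - c)) powr e) * profile (h / (T - c)) * ennreal (h powr (- e) * ((T - c) / T) powr e) = profile (h / (T - c)) / ennreal (T powr e)"
      using eventually_gt_at_top[of 0] eventually_gt_at_top[of c]
    proof eventually_elim
      case (elim T)
      have "(h / (T - c)) powr e * (h powr (- e) * ((T - c) / T) powr e) = inverse (T powr e)"
        using elim h by (simp add: powr_divide powr_minus field_simps)
      then have "ennreal ((h / (T - c)) powr e) * ennreal (h powr (- e) * ((T - c) / T) powr e) = inverse (ennreal (T powr e))"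
        using elim by (simp add: ennreal_mult[symmetric] inverse_ennreal)
      then have "ennreal ((h / (T - c)) powr e) * ennreal (h powr (- e) * ((T - c) / T) powr e) * profile (h / (T - c)) = inverse (ennreal (T powr e)) * profile (h / (T - c))"
        by (simp only:)
      then show ?case by (simp only: divide_ennreal_def mult_ac)
    qed
    from Lim_transform_eventually[OF l this]
    show "((\<lambda>T. profile (h / (T - c)) / ennreal (T powr e)) \<longlongrightarrow> ennreal (B * h powr (- e))) at_top"
      using B0 by (simp add: ennreal_mult)
  qed (use c(1) \<tau> I \<theta> B0 G e in \<open>auto simp: ge_one_powr_ge_zero\<close>)
  then show ?thesis unfolding sig e_def by (simp add: mult.assoc)
qed

text \<open>The profile at h/(T - c) is ln (T - c) - ln h up to a bounded error; divided by ln T it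
  tends to 1 for every h, so \<phi> = 1. Times start at exp 1 to have ln T \<ge> 1.\<close>

lemma innov_variance_log:
  assumes g: "\<gamma> = - 1/2" and \<tau>: "filterlim \<tau> at_top sequentially" "\<And>n. \<tau> n \<ge> exp 1"
  shows "(\<lambda>n. (\<integral>\<omega>. (innov (\<tau> n) \<omega>)\<^sup>2 \<partial>M) / (\<tau> n powr (2 * \<beta> + \<kappa>) * ln (\<tau> n))) \<longlonglongrightarrow> 1 / \<theta> / \<theta>"
proof -
  obtain A where A: "A \<ge> 0" "\<And>d. 0 < d \<Longrightarrow> d \<le> 1 \<Longrightarrow> profile d \<le> ennreal (ln (1 / d) + A)"
    "\<And>d. 0 < d \<Longrightarrow> d \<le> 1 \<Longrightarrow> ennreal (ln (1 / d)) \<le> profile d + ennreal A"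
    using profile_log[OF g] by auto
  have e1: "exp 1 \<ge> (1::real)" by simp
  \<comment> \<open>Majorant from |ln h| \<le> h + 2 h^(-1/2), integrable against exp(-\<theta> h)
    both at 0 and at infinity.\<close>
  define \<Phi> where "\<Phi> h = 1 + A + h + 2 * h powr (- 1/2)" for h :: real
  have \<Phi>: "\<bar>ln h\<bar> \<le> h + 2 * h powr (- 1/2)" if "0 < h" for h :: real
  proof -
    have "ln h \<le> h" using ln_le_minus_one[OF that] by simp
    moreover have "- ln h = 2 * ln (h powr (- 1/2))" using that by (simp add: ln_powr)
    moreover have "ln (h powr (- 1/2)) \<le> h powr (- 1/2)" using ln_le_minus_one[of "h powr (- 1/2)"] that by simp
    moreover have "0 \<le> h powr (- 1/2)" by simp
    ultimately show ?thesis using that unfolding abs_le_iff by linarith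
  qed
  have I1: "(\<integral>\<^sup>+h. (if 0 < h then ennreal (exp (- (\<theta> * h))) * ennreal 1 else 0) \<partial>lborel) = ennreal (1 / \<theta>)"
    using nn_integral_exp_decay[OF \<theta>] by (simp cong: if_cong)
  have fin: "(\<integral>\<^sup>+h. (if 0 < h then ennreal (exp (- (\<theta> * h))) * ennreal (\<Phi> h) else 0) \<partial>lborel) < \<infinity>"
  proof -
    define g where "g a h = (if 0 < h then ennreal (h powr (a - 1) * exp (- (\<theta> * h))) else 0)" for a h :: real
    have [measurable]: "g a \<in> borel_measurable borel" for a unfolding g_def by measurable
    have "(\<integral>\<^sup>+h. (if 0 < h then ennreal (exp (- (\<theta> * h))) * ennreal (\<Phi> h) else 0) \<partial>lborel)
        = (\<integral>\<^sup>+h. ennreal (1 + A) * g 1 h + (g 2 h + ennreal 2 * g (1/2) h) \<partial>lborel)"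
    proof (rule nn_integral_cong)
      fix h :: real
      have "ennreal (exp (- (\<theta> * h))) * ennreal (\<Phi> h) = ennreal (1 + A) * ennreal (exp (- (\<theta> * h))) + (ennreal (h * exp (- (\<theta> * h))) + ennreal 2 * ennreal (h powr (- 1/2) * exp (- (\<theta> * h))))" if "0 < h"
      proof -
        have "ennreal (exp (- (\<theta> * h))) * ennreal (\<Phi> h) = ennreal (exp (- (\<theta> * h)) * \<Phi> h)"
          using that A(1) by (intro ennreal_mult[symmetric]) (auto simp: \<Phi>_def)
        also have "exp (- (\<theta> * h)) * \<Phi> h = (1 + A) * exp (- (\<theta> * h)) + (h * exp (- (\<theta> * h)) + 2 * (h powr (- 1/2) * exp (- (\<theta> * h))))"
          by (simp add: \<Phi>_def algebra_simps)
        also have "ennreal \<dots> = ennreal ((1 + A) * exp (- (\<theta> * h))) + (ennreal (h * exp (- (\<theta> * h))) + ennreal (2 * (h powr (- 1/2) * exp (- (\<theta> * h)))))"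
          using that A(1) by (subst ennreal_plus, simp, simp, subst ennreal_plus) simp_all
        finally show ?thesis using that A(1) by (simp only: ennreal_mult powr_ge_zero exp_ge_zero mult_nonneg_nonneg add_nonneg_nonneg zero_le_one zero_le_numeral)
      qed
      then show "(if 0 < h then ennreal (exp (- (\<theta> * h))) * ennreal (\<Phi> h) else 0) = ennreal (1 + A) * g 1 h + (g 2 h + ennreal 2 * g (1/2) h)"
        by (simp add: g_def)
    qed
    also have "\<dots> = ennreal (1 + A) * (\<integral>\<^sup>+h. g 1 h \<partial>lborel) + ((\<integral>\<^sup>+h. g 2 h \<partial>lborel) + ennreal 2 * (\<integral>\<^sup>+h. g (1/2) h \<partial>lborel))"
      by (simp add: nn_integral_add nn_integral_cmult)
    also have "\<dots> < \<infinity>"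
      using \<theta> unfolding g_def by (simp only: nn_integral_Gamma_scaled[OF _ \<theta>] zero_less_one zero_less_numeral half_gt_zero_iff) (simp add: ennreal_mult_less_top)
    finally show ?thesis .
  qed
  show ?thesis
  proof (rule innov_variance_limit[where \<phi>="\<lambda>h. 1" and \<Phi>="\<Phi>" and q="ln" and ?T0.0="exp 1"])
    fix T :: real assume "T \<ge> exp 1"
    then show "ln T \<ge> 1" using ln_mono[of "exp 1" T] by simp
  next
    fix T m h :: real
    assume B: "T \<ge> exp 1" "T / 2 \<le> m" "m \<le> T" "0 < h" "h \<le> m"
    have lT: "ln T \<ge> 1" using B(1) ln_mono[of "exp 1" T] by simp
    have "profile (h / m) \<le> ennreal (ln (1 / (h / m)) + A)" using B by (intro A(2)) auto
    also have "ln (1 / (h / m)) + A \<le> ln T * \<Phi> h"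
    proof -
      have "ln (1 / (h / m)) = ln m - ln h" using B by (simp add: ln_div)
      also have "\<dots> \<le> ln T + \<bar>ln h\<bar>"
      proof -
        have "ln m \<le> ln T" using B by simp
        then show ?thesis by linarith
      qed
      finally have "ln (1 / (h / m)) + A \<le> ln T * 1 + 1 * (A + h + 2 * h powr (- 1/2))" using \<Phi>[OF B(4)] by simp
      also have "\<dots> \<le> ln T * 1 + ln T * (A + h + 2 * h powr (- 1/2))"
        using lT B A(1) by (intro add_left_mono mult_right_mono) auto
      also have "\<dots> = ln T * \<Phi> h" by (simp add: \<Phi>_def algebra_simps)
      finally show ?thesis .
    qed
    finally show "profile (h / m) \<le> ennreal (ln T * \<Phi> h)" by (simp add: ennreal_leI)
  next
    fix h c :: real assume h: "0 < h"
    have f: "filterlim (\<lambda>T. h / (T - c)) (at_right 0) at_top" using h by real_asymp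
    have ev: "\<forall>\<^sub>F T in at_top. 0 < h / (T - c) \<and> h / (T - c) \<le> 1 \<and> 1 / (h / (T - c)) = (T - c) / h \<and> T > exp 1 \<and> ln T \<ge> 1 \<and> c + h < T"
      using eventually_gt_at_top[of "c + h"] eventually_gt_at_top[of "exp 1"]
    proof eventually_elim
      case (elim T)
      then show ?case using h ln_mono[of "exp 1" T] by (auto simp: field_simps)
    qed
    show "((\<lambda>T. profile (h / (T - c)) / ennreal (ln T)) \<longlongrightarrow> ennreal 1) at_top"
    proof (rule tendsto_sandwich)
      show "\<forall>\<^sub>F T in at_top. ennreal ((ln ((T - c) / h) - A) / ln T) \<le> profile (h / (T - c)) / ennreal (ln T)"
        using ev
      proof eventually_elim
        case (elim T)
        then have "ennreal (ln ((T - c) / h)) \<le> profile (h / (T - c)) + ennreal A" using A(3)[of "h / (T - c)"] by simp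
        then have "ennreal (ln ((T - c) / h)) - ennreal A \<le> profile (h / (T - c))"
          by (simp add: ennreal_minus_le_iff add.commute)
        then have "ennreal (ln ((T - c) / h) - A) / ennreal (ln T) \<le> profile (h / (T - c)) / ennreal (ln T)"
          using A(1) by (simp add: ennreal_minus divide_right_mono_ennreal)
        moreover have "ennreal ((ln ((T - c) / h) - A) / ln T) = ennreal (ln ((T - c) / h) - A) / ennreal (ln T)"
        proof (cases "ln ((T - c) / h) - A \<ge> 0")
          case True
          then show ?thesis using elim by (subst divide_ennreal) auto
        next
          case False
          then show ?thesis using elim by (simp add: ennreal_neg divide_nonpos_pos)
        qed
        ultimately show ?case by simp
      qed
      show "\<forall>\<^sub>F T in at_top. profile (h / (T - c)) / ennreal (ln T) \<le> ennreal ((ln ((T - c) / h) + A) / ln T)"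
        using ev
      proof eventually_elim
        case (elim T)
        then have "profile (h / (T - c)) \<le> ennreal (ln ((T - c) / h) + A)" using A(2)[of "h / (T - c)"] by simp
        then have "profile (h / (T - c)) / ennreal (ln T) \<le> ennreal (ln ((T - c) / h) + A) / ennreal (ln T)"
          by (rule divide_right_mono_ennreal)
        also have "\<dots> = ennreal ((ln ((T - c) / h) + A) / ln T)"
        proof (rule divide_ennreal)
          have "h \<le> T - c" using elim by auto
          then have "1 \<le> (T - c) / h" using h by (simp add: field_simps)
          then show "0 \<le> ln ((T - c) / h) + A" using A(1) by simp
        qed (use elim in auto)
        finally show ?case .
      qed
      have l: "((\<lambda>T. (ln ((T - c) / h) - A) / ln T) \<longlongrightarrow> 1) at_top" "((\<lambda>T. (ln ((T - c) / h) + A) / ln T) \<longlongrightarrow> 1) at_top"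
        using h by real_asymp+
      show "((\<lambda>T. ennreal ((ln ((T - c) / h) - A) / ln T)) \<longlongrightarrow> ennreal 1) at_top"
        "((\<lambda>T. ennreal ((ln ((T - c) / h) + A) / ln T)) \<longlongrightarrow> ennreal 1) at_top"
        using tendsto_ennrealI[OF l(1)] tendsto_ennrealI[OF l(2)] by simp_all
    qed
  next
    show "\<Phi> \<in> borel_measurable borel" unfolding \<Phi>_def by measurable
    show "0 \<le> \<Phi> h" if "0 < h" for h using that A(1) by (simp add: \<Phi>_def)
  qed (use \<tau> I1 \<theta> fin in auto)
qed

text \<open>For r < b \<le> T/4 the distance a - r is comparable to T, through the ratios (a - r)/a
  and a/T, both in [1/2, 1]. Hence T^\<gamma> comes out of the integral and a Beta integral over (0,
  b) remains.\<close>

lemma cov_kernel_off_diagonal: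
  assumes "T > 0" "T / 2 < a" "a \<le> T" "0 < b" "b \<le> T / 4"
  shows "cov_kernel a b \<le> ennreal (2 powr \<bar>\<gamma>\<bar> * 2 powr \<bar>\<gamma>\<bar> * T powr \<gamma> * (b powr (2 * \<alpha> + \<gamma> + 1) * Beta (2 * \<alpha> + 1) (\<gamma> + 1)))"
proof -
  define C where "C = 2 powr \<bar>\<gamma>\<bar> * 2 powr \<bar>\<gamma>\<bar> * T powr \<gamma>"
  have C0: "C \<ge> 0" by (simp add: C_def)
  have Bp: "Beta (2 * \<alpha> + 1) (\<gamma> + 1) \<ge> 0"
    using \<alpha> \<gamma> by (auto simp: Beta_def intro!: divide_nonneg_nonneg mult_nonneg_nonneg less_imp_le[OF Gamma_real_pos])
  have "cov_kernel a b \<le> (\<integral>\<^sup>+r. ennreal C * (if 0 < r \<and> r < b then ennreal (r powr (2 * \<alpha>) * (b - r) powr \<gamma>) else 0) \<partial>lborel)"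
    unfolding cov_kernel_def
  proof (rule nn_integral_mono)
    fix r :: real
    have "r powr (2 * \<alpha>) * ((a - r) powr \<gamma> * (b - r) powr \<gamma>) \<le> C * (r powr (2 * \<alpha>) * (b - r) powr \<gamma>)" if r: "0 < r" "r < b"
    proof -
      have "(a - r) powr \<gamma> = ((a - r) / a) powr \<gamma> * ((a / T) powr \<gamma> * T powr \<gamma>)"
        using assms r by (simp add: powr_divide)
      also have "\<dots> \<le> 2 powr \<bar>\<gamma>\<bar> * (2 powr \<bar>\<gamma>\<bar> * T powr \<gamma>)"
        using assms r by (intro mult_mono powr_ratio_bound) (auto simp: field_simps)
      also have "\<dots> = C" by (simp add: C_def)
      finally have "(a - r) powr \<gamma> * (r powr (2 * \<alpha>) * (b - r) powr \<gamma>) \<le> C * (r powr (2 * \<alpha>) * (b - r) powr \<gamma>)"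
        by (rule mult_right_mono) simp
      then show ?thesis by (simp add: mult_ac)
    qed
    then show "(if 0 < r \<and> r < a \<and> r < b then ennreal (r powr (2 * \<alpha>) * ((a - r) powr \<gamma> * (b - r) powr \<gamma>)) else 0)
      \<le> ennreal C * (if 0 < r \<and> r < b then ennreal (r powr (2 * \<alpha>) * (b - r) powr \<gamma>) else 0)"
      using C0 by (auto simp: ennreal_mult[symmetric] intro!: ennreal_leI)
  qed
  also have "\<dots> = ennreal C * (\<integral>\<^sup>+r. (if 0 < r \<and> r < b then ennreal (r powr (2 * \<alpha>) * (b - r) powr \<gamma>) else 0) \<partial>lborel)"
    by (rule nn_integral_cmult) measurable
  also have "(\<integral>\<^sup>+r. (if 0 < r \<and> r < b then ennreal (r powr (2 * \<alpha>) * (b - r) powr \<gamma>) else 0) \<partial>lborel)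
      = ennreal \<bar>b\<bar> * (\<integral>\<^sup>+z. (if 0 < 0 + b * z \<and> 0 + b * z < b then ennreal ((0 + b * z) powr (2 * \<alpha>) * (b - (0 + b * z)) powr \<gamma>) else 0) \<partial>lborel)"
    using assms by (intro nn_integral_real_affine) auto
  also have "(\<integral>\<^sup>+z. (if 0 < 0 + b * z \<and> 0 + b * z < b then ennreal ((0 + b * z) powr (2 * \<alpha>) * (b - (0 + b * z)) powr \<gamma>) else 0) \<partial>lborel)
      = (\<integral>\<^sup>+z. ennreal (b powr (2 * \<alpha> + \<gamma>)) * (if 0 < z \<and> z < 1 then ennreal (z powr (2 * \<alpha> + 1 - 1) * (1 - z) powr (\<gamma> + 1 - 1)) else 0) \<partial>lborel)"
  proof (rule nn_integral_cong)
    fix z :: real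
    have "(b * z) powr (2 * \<alpha>) * (b - b * z) powr \<gamma> = b powr (2 * \<alpha> + \<gamma>) * (z powr (2 * \<alpha>) * (1 - z) powr \<gamma>)" if "0 < z" "z < 1"
    proof -
      have "b - b * z = b * (1 - z)" by (simp add: algebra_simps)
      then show ?thesis using that assms by (simp add: powr_mult powr_add mult_ac)
    qed
    then show "(if 0 < 0 + b * z \<and> 0 + b * z < b then ennreal ((0 + b * z) powr (2 * \<alpha>) * (b - (0 + b * z)) powr \<gamma>) else 0)
      = ennreal (b powr (2 * \<alpha> + \<gamma>)) * (if 0 < z \<and> z < 1 then ennreal (z powr (2 * \<alpha> + 1 - 1) * (1 - z) powr (\<gamma> + 1 - 1)) else 0)"
      using assms by (auto simp: ennreal_mult[symmetric] zero_less_mult_iff)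
  qed
  also have "\<dots> = ennreal (b powr (2 * \<alpha> + \<gamma>)) * ennreal (Beta (2 * \<alpha> + 1) (\<gamma> + 1))"
    using nn_integral_Beta[of "2 * \<alpha> + 1" "\<gamma> + 1"] \<alpha> \<gamma> by (subst nn_integral_cmult) simp_all
  also have "ennreal C * (ennreal \<bar>b\<bar> * (ennreal (b powr (2 * \<alpha> + \<gamma>)) * ennreal (Beta (2 * \<alpha> + 1) (\<gamma> + 1))))
      = ennreal (C * (b powr (2 * \<alpha> + \<gamma> + 1) * Beta (2 * \<alpha> + 1) (\<gamma> + 1)))"
    using assms C0 Bp by (simp add: ennreal_mult[symmetric] powr_add mult_ac)
  finally show ?thesis by (simp add: C_def)
qed

lemma one_plus_powr_le:
  fixes s p :: real
  assumes "s \<ge> 0" "p \<ge> 0"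
  shows "(1 + s) powr p \<le> 2 powr p * (1 + s powr p)"
proof (cases "s \<le> 1")
  case True
  have "(1 + s) powr p \<le> 2 powr p" using True assms by (intro powr_mono2) auto
  also have "\<dots> \<le> 2 powr p * (1 + s powr p)" by simp
  finally show ?thesis .
next
  case False
  have "(1 + s) powr p \<le> (2 * s) powr p" using False assms by (intro powr_mono2) auto
  also have "\<dots> = 2 powr p * s powr p" using False by (simp add: powr_mult)
  also have "\<dots> \<le> 2 powr p * (1 + s powr p)" by simp
  finally show ?thesis .
qed

text \<open>exp(-k b) is the tail of an exponential variable s, so the integral is a mean of
  rectangle integrals over (0, T] x (0, s]. The rectangle lies in the square of side T (1 + s),
  where self-similarity gives the \<open>var_exp\<close>-th power of the side, and this power has a
  finite mean in s.\<close>

lemma exp_averaged_cov_bound: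
  assumes k: "k > 0"
  shows "\<exists>C\<ge>0. \<forall>T\<ge>1. (\<integral>\<^sup>+a. \<integral>\<^sup>+b. (if 0 < a \<and> a \<le> T then 1 else 0) * (if 0 < b then ennreal (exp (- (k * b))) else 0) * wcov a b \<partial>lborel \<partial>lborel) \<le> ennreal (C * T powr var_exp)"
proof -
  let ?N = "density lborel (exponential_density k)"
  interpret N: prob_space ?N by (rule prob_space_exponential_density) (rule k)
  have p0: "var_exp \<ge> 0" using var_exp_pos by simp
  define m where "m = (\<integral>\<^sup>+s. ennreal (2 powr var_exp * (1 + (max 0 s) powr var_exp)) \<partial>?N)"
  have "m < \<infinity>"
  proof -
    have "m = (\<integral>\<^sup>+s. ennreal (exponential_density k s) * ennreal (2 powr var_exp * (1 + (max 0 s) powr var_exp)) \<partial>lborel)"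
      unfolding m_def by (subst nn_integral_density) auto
    also have "\<dots> = (\<integral>\<^sup>+s. ennreal (2 powr var_exp) * (ennreal k * (if 0 < s then ennreal (s powr (1 - 1) * exp (- (k * s))) else 0) + ennreal k * (if 0 < s then ennreal (s powr (var_exp + 1 - 1) * exp (- (k * s))) else 0)) \<partial>lborel)"
    proof (rule nn_integral_cong_AE)
      show "AE s in lborel. ennreal (exponential_density k s) * ennreal (2 powr var_exp * (1 + (max 0 s) powr var_exp))
        = ennreal (2 powr var_exp) * (ennreal k * (if 0 < s then ennreal (s powr (1 - 1) * exp (- (k * s))) else 0) + ennreal k * (if 0 < s then ennreal (s powr (var_exp + 1 - 1) * exp (- (k * s))) else 0))"
        using AE_lborel_singleton[of 0]
      proof eventually_elim
        case (elim s)
        show ?case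
        proof (cases "0 < s")
          case True
          have "exponential_density k s * (2 powr var_exp * (1 + s powr var_exp)) = 2 powr var_exp * (k * exp (- (k * s)) + k * (s powr var_exp * exp (- (k * s))))"
            using True by (simp add: exponential_density_def algebra_simps)
          then have "ennreal (exponential_density k s) * ennreal (2 powr var_exp * (1 + s powr var_exp)) = ennreal (2 powr var_exp * (k * exp (- (k * s)) + k * (s powr var_exp * exp (- (k * s)))))"
            using k by (subst ennreal_mult[symmetric]) (auto simp: exponential_density_nonneg)
          then show ?thesis using True k by (simp add: ennreal_mult ennreal_plus)
        qed (use elim in \<open>simp add: exponential_density_def\<close>)
      qed
    qed
    also have "\<dots> = ennreal (2 powr var_exp) * (ennreal k * (\<integral>\<^sup>+s. (if 0 < s then ennreal (s powr (1 - 1) * exp (- (k * s))) else 0) \<partial>lborel)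
        + ennreal k * (\<integral>\<^sup>+s. (if 0 < s then ennreal (s powr (var_exp + 1 - 1) * exp (- (k * s))) else 0) \<partial>lborel))"
    proof -
      define g where "g a s = (if 0 < s then ennreal (s powr (a - 1) * exp (- (k * s))) else 0)" for a s :: real
      have [measurable]: "g a \<in> borel_measurable borel" for a unfolding g_def by measurable
      show ?thesis unfolding g_def[symmetric] by (simp add: nn_integral_cmult nn_integral_add)
    qed
    also have "\<dots> = ennreal (2 powr var_exp) * (ennreal k * ennreal (Gamma 1 * k powr (- 1)) + ennreal k * ennreal (Gamma (var_exp + 1) * k powr (- (var_exp + 1))))"
      using p0 by (subst (1 2) nn_integral_Gamma_scaled[OF _ k]) simp_all
    also have "\<dots> < \<infinity>" by (simp add: ennreal_mult_less_top)
    finally show ?thesis .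
  qed
  then obtain c where c: "c \<ge> 0" "m = ennreal c" by (cases m) auto
  show ?thesis
  proof (intro exI[of _ "R1 * c"] conjI allI impI)
    fix T :: real assume T: "T \<ge> 1"
    \<comment> \<open>A constant interval averaged over the same law, so that the averaging identity
      also covers the variable a with its flat weight.\<close>
    have k1: "(if 0 < a \<and> a \<le> T then 1 else 0) = (\<integral>\<^sup>+v. (if a \<in> {0<..T} then 1 else 0) \<partial>?N)" for a
      using N.emeasure_space_1 by simp
    have k2: "(if 0 < b then ennreal (exp (- (k * b))) else 0) = (\<integral>\<^sup>+s. (if b \<in> {0<..max 0 s} then 1 else 0) \<partial>?N)" for b
    proof (cases "0 < b")
      case True
      then have "(\<integral>\<^sup>+s. (if b \<in> {0<..max 0 s} then 1 else 0) \<partial>?N) = (\<integral>\<^sup>+v. (if b \<le> v then 1 else 0) \<partial>?N)"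
        by (intro nn_integral_cong) auto
      then show ?thesis using True exponential_tail(1)[OF _ k, of b] by simp
    qed simp
    have "(\<integral>\<^sup>+a. \<integral>\<^sup>+b. (if 0 < a \<and> a \<le> T then 1 else 0) * (if 0 < b then ennreal (exp (- (k * b))) else 0) * wcov a b \<partial>lborel \<partial>lborel)
        = (\<integral>\<^sup>+v. \<integral>\<^sup>+s. rect_cov {0<..T} {0<..max 0 s} \<partial>?N \<partial>?N)"
      by (intro rect_cov_average[symmetric] N.sigma_finite_measure_axioms k1 k2) simp_all
    also have "\<dots> = (\<integral>\<^sup>+s. rect_cov {0<..T} {0<..max 0 s} \<partial>?N)"
      using N.emeasure_space_1 by simp
    also have "\<dots> \<le> (\<integral>\<^sup>+s. ennreal (R1 * T powr var_exp) * ennreal (2 powr var_exp * (1 + (max 0 s) powr var_exp)) \<partial>?N)"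
    proof (rule nn_integral_mono)
      fix s :: real
      define s' where "s' = max 0 s"
      have s': "s' \<ge> 0" by (simp add: s'_def)
      have "rect_cov {0<..T} {0<..s'} \<le> rect_cov {0<..T * (1 + s')} {0<..T * (1 + s')}"
      proof (intro rect_cov_mono)
        have "0 \<le> T * s'" "s' \<le> T * s'" using T s' mult_right_mono[of 1 T s'] by simp_all
        moreover define Q where "Q = T * (1 + s')"
        ultimately have "T \<le> Q" "s' \<le> Q" using T by (simp_all add: algebra_simps)
        then show "{0<..T} \<subseteq> {0<..T * (1 + s')}" "{0<..s'} \<subseteq> {0<..T * (1 + s')}"
          unfolding Q_def[symmetric] by auto
      qed
      also have "\<dots> = ennreal ((T * (1 + s')) powr var_exp * R1)"
        using T s' R1_pos by (subst rect_cov_diag) (auto simp: rect_cov_1 ennreal_mult intro!: mult_pos_pos)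
      also have "(T * (1 + s')) powr var_exp * R1 \<le> (R1 * T powr var_exp) * (2 powr var_exp * (1 + s' powr var_exp))"
      proof -
        have "(T * (1 + s')) powr var_exp * R1 = (R1 * T powr var_exp) * (1 + s') powr var_exp"
          using T s' by (simp add: powr_mult)
        also have "\<dots> \<le> (R1 * T powr var_exp) * (2 powr var_exp * (1 + s' powr var_exp))"
          using one_plus_powr_le[OF s' p0] R1_pos by (intro mult_left_mono) auto
        finally show ?thesis .
      qed
      finally show "rect_cov {0<..T} {0<..max 0 s} \<le> ennreal (R1 * T powr var_exp) * ennreal (2 powr var_exp * (1 + (max 0 s) powr var_exp))"
        using R1_pos unfolding s'_def by (subst ennreal_mult[symmetric]) (auto simp: ennreal_leI)
    qed
    also have "\<dots> = ennreal (R1 * T powr var_exp) * m"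
      unfolding m_def by (rule nn_integral_cmult) measurable
    also have "\<dots> = ennreal (R1 * c * T powr var_exp)"
      using c R1_pos by (simp add: ennreal_mult[symmetric] mult_ac)
    finally show "(\<integral>\<^sup>+a. \<integral>\<^sup>+b. (if 0 < a \<and> a \<le> T then 1 else 0) * (if 0 < b then ennreal (exp (- (k * b))) else 0) * wcov a b \<partial>lborel \<partial>lborel) \<le> ennreal (R1 * c * T powr var_exp)" .
  qed (use c R1_pos in simp)
qed

text \<open>An average concentrated near T and one concentrated near 0 have covariance of order at
  most T^(\<beta>+\<gamma>), up to exponentially small terms. The normaliser is at least
  T^(\<alpha>+\<beta>+\<gamma>+1/2), which leaves T^(-\<alpha>-1/2); here \<alpha> > -1/2
  enters.\<close>

lemma innov_mean_X_cov_limit: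
  assumes \<tau>: "filterlim \<tau> at_top sequentially" "\<And>n. \<tau> n \<ge> 1"
    and S: "\<And>n. S n \<ge> \<tau> n powr (2 * \<beta> + \<kappa>)"
  shows "(\<lambda>n. (\<integral>\<omega>. innov (\<tau> n) \<omega> * mean_X \<omega> \<partial>M) / sqrt (S n)) \<longlonglongrightarrow> 0"
proof -
  define P where "P k T = (\<integral>\<^sup>+a. \<integral>\<^sup>+b. (if 0 < a \<and> a \<le> T then 1 else 0) * (if 0 < b then ennreal (exp (- (k * b))) else 0) * wcov a b \<partial>lborel \<partial>lborel)" for k T
  obtain C1 where C1: "C1 \<ge> 0" "\<And>T. T \<ge> 1 \<Longrightarrow> P \<theta> T \<le> ennreal (C1 * T powr var_exp)"
    using exp_averaged_cov_bound[OF \<theta>] unfolding P_def by auto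
  obtain C2 where C2: "C2 \<ge> 0" "\<And>T. T \<ge> 1 \<Longrightarrow> P (\<theta> / 2) T \<le> ennreal (C2 * T powr var_exp)"
    using exp_averaged_cov_bound[of "\<theta> / 2"] \<theta> unfolding P_def by auto
  define D where "D = 2 powr \<bar>\<beta>\<bar> * (2 powr \<bar>\<gamma>\<bar> * 2 powr \<bar>\<gamma>\<bar>) * Beta (2 * \<alpha> + 1) (\<gamma> + 1)"
  have Bp: "Beta (2 * \<alpha> + 1) (\<gamma> + 1) \<ge> 0"
    using \<alpha> \<gamma> by (auto simp: Beta_def intro!: divide_nonneg_nonneg mult_nonneg_nonneg less_imp_le[OF Gamma_real_pos])
  have D0: "D \<ge> 0" using Bp by (simp add: D_def)
  \<comment> \<open>x - 1 is the power of b in the region b \<le> T/4; x > 0 because \<alpha> +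
    (\<alpha> + \<beta> + \<gamma>) > -2.\<close>
  define x where "x = 2 * \<alpha> + \<beta> + \<gamma> + 2"
  have x: "x > 0" using \<alpha> sum_exponents by (simp add: x_def)
  have Gx: "Gamma x > 0" using x by (rule Gamma_real_pos)
  define C3 where "C3 = D * (1 / \<theta>) * (Gamma x * \<theta> powr (- x))"
  have C30: "C3 \<ge> 0" using D0 \<theta> Gx by (simp add: C3_def)
  have bound: "(\<integral>\<omega>. innov T \<omega> * mean_X \<omega> \<partial>M) \<le> C3 * T powr (\<beta> + \<gamma>) + C1 * (exp (- (\<theta> / 2 * T)) * T powr var_exp) + C2 * (exp (- (\<theta> / 8 * T)) * T powr var_exp)"
    if T: "T \<ge> 1" for T
  proof -
    define E where "E a = (if 0 < a \<and> a \<le> T then ennreal (exp (- (\<theta> * (T - a)))) else 0)" for a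
    define F where "F b = (if 0 < b then ennreal (exp (- (\<theta> * b))) else 0)" for b
    have Em[measurable]: "E \<in> borel_measurable borel" "F \<in> borel_measurable borel" unfolding E_def F_def by measurable
    have E1: "E a \<le> (if 0 < a \<and> a \<le> T then 1 else 0)" for a
      using \<theta> by (auto simp: E_def)
    have intE: "(\<integral>\<^sup>+a. E a \<partial>lborel) \<le> ennreal (1 / \<theta>)"
    proof -
      have "(\<integral>\<^sup>+a. E a \<partial>lborel) = ennreal \<bar>-1\<bar> * (\<integral>\<^sup>+y. E (T + (-1) * y) \<partial>lborel)"
        by (intro nn_integral_real_affine) auto
      also have "\<dots> = (\<integral>\<^sup>+y. E (T - y) \<partial>lborel)" by simp
      also have "\<dots> \<le> (\<integral>\<^sup>+y. (if 0 < y then ennreal (exp (- (\<theta> * y))) else 0) \<partial>lborel)"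
        by (rule nn_integral_mono_AE, use AE_lborel_singleton[of 0] in eventually_elim) (auto simp: E_def)
      also have "\<dots> = ennreal (1 / \<theta>)" by (rule nn_integral_exp_decay[OF \<theta>])
      finally show ?thesis .
    qed
    have V: "ennreal (\<integral>\<omega>. innov T \<omega> * mean_X \<omega> \<partial>M) = (\<integral>\<^sup>+a. \<integral>\<^sup>+b. E a * F b * wcov a b \<partial>lborel \<partial>lborel)"
      using innov_mean_X_cov(2)[of T] T by (simp add: E_def F_def)
    \<comment> \<open>Three majorants: the main region a > T/2, b \<le> T/4; then a \<le> T/2, where
      the first weight is small; then b > T/4, where exp(-\<theta> b) \<le> exp(-\<theta> T/8)
      exp(-\<theta> b/2).\<close>
    have pt: "E a * F b * wcov a b \<le> ennreal (D * T powr (\<beta> + \<gamma>)) * E a * (if 0 < b then ennreal (b powr (x - 1) * exp (- (\<theta> * b))) else 0)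
        + (ennreal (exp (- (\<theta> / 2 * T))) * ((if 0 < a \<and> a \<le> T then 1 else 0) * F b * wcov a b)
        + ennreal (exp (- (\<theta> / 8 * T))) * ((if 0 < a \<and> a \<le> T then 1 else 0) * (if 0 < b then ennreal (exp (- (\<theta> / 2 * b))) else 0) * wcov a b))" (is "_ \<le> ?A1 + (?A2 + ?A3)") for a b
    proof -
      consider "\<not> (0 < a \<and> a \<le> T)" | "b \<le> 0" | "0 < a" "a \<le> T / 2" "0 < b" | "0 < a" "a \<le> T" "T / 4 < b" "0 < b" | "T / 2 < a" "a \<le> T" "0 < b" "b \<le> T / 4"
        using T by linarith
      then show ?thesis
      proof cases
        case 1
        then have "E a = 0" by (simp only: E_def if_False)
        then show ?thesis by simp
      next
        case 2
        then show ?thesis by (simp add: F_def)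
      next
        case 3
        have "\<theta> / 2 * T = \<theta> * (T - T / 2)" by (simp add: field_simps)
        also have "\<dots> \<le> \<theta> * (T - a)" using 3 \<theta> by (intro mult_left_mono) auto
        finally have "\<theta> / 2 * T \<le> \<theta> * (T - a)" .
        then have "E a \<le> ennreal (exp (- (\<theta> / 2 * T)))" using 3 by (auto simp: E_def intro!: ennreal_leI)
        then have "E a * (F b * wcov a b) \<le> ennreal (exp (- (\<theta> / 2 * T))) * (F b * wcov a b)" by (rule mult_right_mono) simp
        also have "\<dots> = ?A2" using 3 T by simp
        also have "?A2 \<le> ?A1 + (?A2 + ?A3)" by (simp add: add_increasing add_increasing2)
        finally show ?thesis by (simp add: mult.assoc)
      next
        case 4
        have "- (\<theta> * b) \<le> - (\<theta> / 8 * T) + - (\<theta> / 2 * b)"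
        proof -
          have "\<theta> * (T / 4) \<le> \<theta> * b" using 4 \<theta> by (intro mult_left_mono) auto
          moreover have "\<theta> / 8 * T = \<theta> * (T / 4) / 2" "\<theta> / 2 * b = \<theta> * b / 2" by simp_all
          ultimately show ?thesis by linarith
        qed
        then have "exp (- (\<theta> * b)) \<le> exp (- (\<theta> / 8 * T)) * exp (- (\<theta> / 2 * b))"
          by (subst exp_add[symmetric]) simp
        then have "F b \<le> ennreal (exp (- (\<theta> / 8 * T))) * ennreal (exp (- (\<theta> / 2 * b)))"
          using 4 by (simp add: F_def ennreal_mult[symmetric] ennreal_leI)
        then have "E a * F b * wcov a b \<le> 1 * (ennreal (exp (- (\<theta> / 8 * T))) * ennreal (exp (- (\<theta> / 2 * b)))) * wcov a b"
          using E1[of a] 4 by (intro mult_right_mono mult_mono) auto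
        also have "\<dots> = ?A3" using 4 by (simp add: mult.assoc)
        also have "?A3 \<le> ?A1 + (?A2 + ?A3)" by (simp add: add_increasing)
        finally show ?thesis .
      next
        case 5
        have T': "T > 0" using T by simp
        have "a powr \<beta> = (a / T) powr \<beta> * T powr \<beta>" using 5 T by (simp add: powr_divide)
        also have "\<dots> \<le> 2 powr \<bar>\<beta>\<bar> * T powr \<beta>" using 5 T by (intro mult_right_mono powr_ratio_bound) (auto simp: field_simps)
        finally have ab: "a powr \<beta> \<le> 2 powr \<bar>\<beta>\<bar> * T powr \<beta>" .
        have "wcov a b \<le> ennreal ((2 powr \<bar>\<beta>\<bar> * T powr \<beta>) * b powr \<beta>) * ennreal (2 powr \<bar>\<gamma>\<bar> * 2 powr \<bar>\<gamma>\<bar> * T powr \<gamma> * (b powr (2 * \<alpha> + \<gamma> + 1) * Beta (2 * \<alpha> + 1) (\<gamma> + 1)))"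
          unfolding wcov_def using ab 5 T' by (intro mult_mono ennreal_leI mult_right_mono cov_kernel_off_diagonal) auto
        also have "\<dots> = ennreal ((D * T powr (\<beta> + \<gamma>)) * b powr (x - 1))"
        proof -
          have "b powr (x - 1) = b powr \<beta> * b powr (2 * \<alpha> + \<gamma> + 1)" unfolding powr_add[symmetric] by (simp add: x_def algebra_simps)
          moreover have "T powr (\<beta> + \<gamma>) = T powr \<beta> * T powr \<gamma>" by (rule powr_add)
          ultimately show ?thesis using Bp by (subst ennreal_mult[symmetric]) (auto simp: D_def mult_ac)
        qed
        finally have "E a * F b * wcov a b \<le> E a * ennreal (exp (- (\<theta> * b))) * ennreal ((D * T powr (\<beta> + \<gamma>)) * b powr (x - 1))"
          using 5 by (simp add: F_def mult_left_mono)
        also have "\<dots> = ?A1" using 5 D0 by (simp add: ennreal_mult mult_ac)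
        also have "?A1 \<le> ?A1 + (?A2 + ?A3)" by (simp add: add_increasing2)
        finally show ?thesis .
      qed
    qed
    have "ennreal (\<integral>\<omega>. innov T \<omega> * mean_X \<omega> \<partial>M) \<le> (\<integral>\<^sup>+a. \<integral>\<^sup>+b. ennreal (D * T powr (\<beta> + \<gamma>)) * E a * (if 0 < b then ennreal (b powr (x - 1) * exp (- (\<theta> * b))) else 0)
        + (ennreal (exp (- (\<theta> / 2 * T))) * ((if 0 < a \<and> a \<le> T then 1 else 0) * F b * wcov a b)
        + ennreal (exp (- (\<theta> / 8 * T))) * ((if 0 < a \<and> a \<le> T then 1 else 0) * (if 0 < b then ennreal (exp (- (\<theta> / 2 * b))) else 0) * wcov a b)) \<partial>lborel \<partial>lborel)"
      unfolding V by (intro nn_integral_mono pt)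
    also have "\<dots> = (\<integral>\<^sup>+a. \<integral>\<^sup>+b. ennreal (D * T powr (\<beta> + \<gamma>)) * E a * (if 0 < b then ennreal (b powr (x - 1) * exp (- (\<theta> * b))) else 0) \<partial>lborel \<partial>lborel)
        + ((\<integral>\<^sup>+a. \<integral>\<^sup>+b. ennreal (exp (- (\<theta> / 2 * T))) * ((if 0 < a \<and> a \<le> T then 1 else 0) * F b * wcov a b) \<partial>lborel \<partial>lborel)
        + (\<integral>\<^sup>+a. \<integral>\<^sup>+b. ennreal (exp (- (\<theta> / 8 * T))) * ((if 0 < a \<and> a \<le> T then 1 else 0) * (if 0 < b then ennreal (exp (- (\<theta> / 2 * b))) else 0) * wcov a b) \<partial>lborel \<partial>lborel))"
      by (subst nn_integral_add[symmetric], measurable, subst nn_integral_add[symmetric], measurable)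
         (intro nn_integral_cong, subst nn_integral_add, measurable, subst nn_integral_add, measurable)
    also have "(\<integral>\<^sup>+a. \<integral>\<^sup>+b. ennreal (exp (- (\<theta> / 2 * T))) * ((if 0 < a \<and> a \<le> T then 1 else 0) * F b * wcov a b) \<partial>lborel \<partial>lborel) = ennreal (exp (- (\<theta> / 2 * T))) * P \<theta> T"
      unfolding P_def F_def by (subst nn_integral_cmult, measurable, subst nn_integral_cmult, measurable)
    also have "(\<integral>\<^sup>+a. \<integral>\<^sup>+b. ennreal (exp (- (\<theta> / 8 * T))) * ((if 0 < a \<and> a \<le> T then 1 else 0) * (if 0 < b then ennreal (exp (- (\<theta> / 2 * b))) else 0) * wcov a b) \<partial>lborel \<partial>lborel) = ennreal (exp (- (\<theta> / 8 * T))) * P (\<theta> / 2) T"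
      unfolding P_def by (subst nn_integral_cmult, measurable, subst nn_integral_cmult, measurable)
    also have "(\<integral>\<^sup>+a. \<integral>\<^sup>+b. ennreal (D * T powr (\<beta> + \<gamma>)) * E a * (if 0 < b then ennreal (b powr (x - 1) * exp (- (\<theta> * b))) else 0) \<partial>lborel \<partial>lborel)
        = ennreal (D * T powr (\<beta> + \<gamma>)) * (\<integral>\<^sup>+a. E a \<partial>lborel) * ennreal (Gamma x * \<theta> powr (- x))"
      using nn_integral_Gamma_scaled[OF x \<theta>] by (subst nn_integral_cmult, measurable) (simp add: nn_integral_multc nn_integral_cmult)
    also have "ennreal (D * T powr (\<beta> + \<gamma>)) * (\<integral>\<^sup>+a. E a \<partial>lborel) * ennreal (Gamma x * \<theta> powr (- x))
        + (ennreal (exp (- (\<theta> / 2 * T))) * P \<theta> T + ennreal (exp (- (\<theta> / 8 * T))) * P (\<theta> / 2) T)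
        \<le> ennreal (D * T powr (\<beta> + \<gamma>)) * ennreal (1 / \<theta>) * ennreal (Gamma x * \<theta> powr (- x))
        + (ennreal (exp (- (\<theta> / 2 * T))) * ennreal (C1 * T powr var_exp) + ennreal (exp (- (\<theta> / 8 * T))) * ennreal (C2 * T powr var_exp))"
      using T by (intro add_mono mult_mono mult_left_mono mult_right_mono intE C1(2) C2(2)) auto
    also have "\<dots> = ennreal (C3 * T powr (\<beta> + \<gamma>) + (C1 * (exp (- (\<theta> / 2 * T)) * T powr var_exp) + C2 * (exp (- (\<theta> / 8 * T)) * T powr var_exp)))"
    proof -
      have "ennreal (D * T powr (\<beta> + \<gamma>)) * ennreal (1 / \<theta>) * ennreal (Gamma x * \<theta> powr (- x)) = ennreal (C3 * T powr (\<beta> + \<gamma>))"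
        using D0 \<theta> Gx by (simp add: ennreal_mult[symmetric] C3_def mult_ac)
      moreover have "ennreal (exp (- (\<theta> / 2 * T))) * ennreal (C1 * T powr var_exp) = ennreal (C1 * (exp (- (\<theta> / 2 * T)) * T powr var_exp))"
        using C1(1) by (subst ennreal_mult[symmetric]) (auto simp: mult_ac)
      moreover have "ennreal (exp (- (\<theta> / 8 * T))) * ennreal (C2 * T powr var_exp) = ennreal (C2 * (exp (- (\<theta> / 8 * T)) * T powr var_exp))"
        using C2(1) by (subst ennreal_mult[symmetric]) (auto simp: mult_ac)
      ultimately show ?thesis using C1(1) C2(1) C30 by (subst ennreal_plus, simp, simp, subst ennreal_plus) simp_all
    qed
    finally show ?thesis
      using C1(1) C2(1) C30 by (subst (asm) ennreal_le_iff) (auto simp: add.assoc)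
  qed
  have nn: "0 \<le> (\<integral>\<omega>. innov (\<tau> n) \<omega> * mean_X \<omega> \<partial>M)" for n
    using \<tau>(2)[of n] by (intro innov_mean_X_cov_nonneg) simp
  show ?thesis
  proof (rule tendsto_sandwich[OF _ _ tendsto_const])
    define e where "e = \<beta> + \<kappa> / 2"
    have sq: "\<tau> n powr e \<le> sqrt (S n)" for n
    proof -
      have "\<tau> n powr e = sqrt (\<tau> n powr (2 * \<beta> + \<kappa>))"
      proof (rule real_sqrt_unique[symmetric])
        have "(\<tau> n powr e)\<^sup>2 = \<tau> n powr (e + e)" by (simp only: power2_eq_square powr_add)
        then show "(\<tau> n powr e)\<^sup>2 = \<tau> n powr (2 * \<beta> + \<kappa>)" by (simp add: e_def)
      qed simp
      then show ?thesis using S[of n] by simp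
    qed
    have pos: "\<tau> n powr e > 0" for n using \<tau>(2)[of n] by simp
    show "\<forall>\<^sub>F n in sequentially. 0 \<le> (\<integral>\<omega>. innov (\<tau> n) \<omega> * mean_X \<omega> \<partial>M) / sqrt (S n)"
    proof (intro always_eventually allI divide_nonneg_nonneg nn)
      show "0 \<le> sqrt (S n)" for n using sq[of n] pos[of n] by linarith
    qed
    define f where "f T = C3 * T powr (- \<alpha> - 1/2) + C1 * (exp (- (\<theta> / 2 * T)) * T powr (var_exp - e)) + C2 * (exp (- (\<theta> / 8 * T)) * T powr (var_exp - e))" for T
    show "\<forall>\<^sub>F n in sequentially. (\<integral>\<omega>. innov (\<tau> n) \<omega> * mean_X \<omega> \<partial>M) / sqrt (S n) \<le> f (\<tau> n)"
    proof (intro always_eventually allI)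
      fix n
      let ?T = "\<tau> n"
      have "(\<integral>\<omega>. innov ?T \<omega> * mean_X \<omega> \<partial>M) / sqrt (S n) \<le> (\<integral>\<omega>. innov ?T \<omega> * mean_X \<omega> \<partial>M) / ?T powr e"
        using sq[of n] pos[of n] nn[of n] less_le_trans[OF pos sq, of n]
        by (intro divide_left_mono mult_pos_pos) auto
      also have "\<dots> \<le> (C3 * ?T powr (\<beta> + \<gamma>) + C1 * (exp (- (\<theta> / 2 * ?T)) * ?T powr var_exp) + C2 * (exp (- (\<theta> / 8 * ?T)) * ?T powr var_exp)) / ?T powr e"
        using bound[OF \<tau>(2), of n] pos[of n] by (intro divide_right_mono) auto
      also have "\<dots> = f ?T"
      proof -
        have 1: "?T powr (\<beta> + \<gamma>) / ?T powr e = ?T powr (- \<alpha> - 1/2)"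
          unfolding powr_diff[symmetric] by (rule arg_cong[where f="\<lambda>z. ?T powr z"]) (simp add: e_def field_simps)
        show ?thesis
          unfolding f_def 1[symmetric] powr_diff[of _ var_exp e] by (simp add: add_divide_distrib)
      qed
      finally show "(\<integral>\<omega>. innov ?T \<omega> * mean_X \<omega> \<partial>M) / sqrt (S n) \<le> f ?T" .
    qed
    have "((\<lambda>T. T powr (- \<alpha> - 1/2)) \<longlongrightarrow> 0) at_top"
      using \<alpha> by (intro tendsto_neg_powr filterlim_ident) auto
    then have "(f \<longlongrightarrow> C3 * 0 + C1 * 0 + C2 * 0) at_top"
      unfolding f_def using \<theta> by (intro tendsto_add tendsto_mult_left exp_powr_decay) auto
    then have "(f \<longlongrightarrow> 0) at_top" by simp
    then show "(\<lambda>n. f (\<tau> n)) \<longlonglongrightarrow> 0" by (rule filterlim_compose[OF _ \<tau>(1)])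
  qed
qed

end

section \<open>Pathwise expansion of the estimator\<close>

lemma continuous_on_set_integrable:
  fixes f :: "real \<Rightarrow> real"
  assumes "continuous_on {0..} f" "0 \<le> a"
  shows "set_integrable lborel {a..b} f"
  using assms by (intro borel_integrable_atLeastAtMost') (auto intro: continuous_on_subset)

lemma set_integral_singleton: "(LBINT s:{a::real}. f s) = (0::real)"
  unfolding set_lebesgue_integral_def
  by (rule integral_eq_zero_AE, use AE_lborel_singleton[of a] in eventually_elim) (auto simp: indicator_def)

lemma set_integral_derivative:
  fixes f :: "real \<Rightarrow> real"
  assumes f: "continuous_on {0..} f" and t: "t \<in> {0..b}"
  shows "((\<lambda>u. LBINT s:{0..u}. f s) has_real_derivative f t) (at t within {0..b})"
proof -
  have c: "continuous_on {0..b} f" using f by (rule continuous_on_subset) auto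
  have e: "(LBINT s:{0..u}. f s) = integral {0..u} f" if "u \<in> {0..b}" for u
    using continuous_on_set_integrable[OF f, of 0 u] by (simp add: set_borel_integral_eq_integral)
  have "((\<lambda>u. integral {0..u} f) has_real_derivative f t) (at t within {0..b})"
    by (rule integral_has_real_derivative[OF c t])
  then show ?thesis
    by (rule has_field_derivative_transform_within[OF _ zero_less_one t]) (simp add: e)
qed

section \<open>A single path: variation of constants\<close>

locale langevin_path =
  fixes x z :: "real \<Rightarrow> real" and \<theta> :: real
  assumes x_cont: "continuous_on {0..} x"
    and z_int: "\<And>t. 0 \<le> t \<Longrightarrow> set_integrable lborel {0..t} z"
    and z_eq: "\<And>t. 0 \<le> t \<Longrightarrow> z t = \<theta> * (LBINT s:{0..t}. z s) + x t"
    and \<theta>: "\<theta> > 0"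
begin

definition V :: "real \<Rightarrow> real" where "V t = (LBINT s:{0..t}. z s)"

definition eta :: "real \<Rightarrow> real" where "eta t = (LBINT s:{0..t}. exp (- \<theta> * s) * x s)"

definition eta_inf :: real where "eta_inf = (LBINT s:{0..}. exp (- \<theta> * s) * x s)"

definition U :: "real \<Rightarrow> real" where
  "U T = x T - \<theta> * exp (- \<theta> * T) * (LBINT s:{0..T}. exp (\<theta> * s) * x s)"

text \<open>At this stage z is known only to be locally integrable. Continuity of its indefinite
  integral comes first; the equation then makes z continuous, and V continuously
  differentiable.\<close>

lemma V_cont: "continuous_on {0..} V"
proof -
  have "continuous_on {0..b} V" for b
  proof -
    have e: "V u = integral {0..u} z" if "u \<in> {0..b}" for u
      using z_int[of u] that unfolding V_def by (simp add: set_borel_integral_eq_integral)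
    have "continuous_on {0..b} (\<lambda>u. integral {0..u} z)"
    proof (cases "b \<ge> 0")
      case True
      then have "z integrable_on {0..b}" using z_int by (simp add: set_borel_integral_eq_integral)
      then show ?thesis by (rule indefinite_integral_continuous_1)
    qed simp
    then show ?thesis by (rule continuous_on_eq) (simp add: e)
  qed
  then have "continuous (at t within {0..}) V" if "t \<ge> 0" for t
  proof -
    have "continuous (at t within {0..t+1}) V"
      using \<open>\<And>b. continuous_on {0..b} V\<close>[of "t + 1"] that by (simp add: continuous_on_eq_continuous_within)
    moreover have "at t within {0..t+1} = at t within {0..}"
      using that by (intro at_within_nhd[where S="{t-1<..<t+1}"]) auto
    ultimately show ?thesis by simp
  qed
  then show ?thesis by (simp add: continuous_on_eq_continuous_within)
qed

lemma z_V: "0 \<le> t \<Longrightarrow> z t = \<theta> * V t + x t"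
  using z_eq by (simp add: V_def)

lemma z_cont: "continuous_on {0..} z"
proof -
  have "continuous_on {0..} (\<lambda>t. \<theta> * V t + x t)" by (intro continuous_intros V_cont x_cont)
  then show ?thesis by (rule continuous_on_eq) (simp add: z_V)
qed

lemma ex_cont: "continuous_on {0..} (\<lambda>s. exp (c * s) * x s)"
  by (intro continuous_intros x_cont)

text \<open>exp(-\<theta> t) V(t) and eta(t) have the same derivative and both vanish at 0.\<close>

lemma V_eta: assumes t: "0 \<le> t" shows "V t = exp (\<theta> * t) * eta t"
proof -
  define D where "D u = exp (- \<theta> * u) * V u - eta u" for u
  have "(D has_real_derivative 0) (at u within {0..t})" if u: "u \<in> {0..t}" for u
  proof -
    have dV: "(V has_real_derivative z u) (at u within {0..t})"
      unfolding V_def[abs_def] by (rule set_integral_derivative[OF z_cont u])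
    have de: "(eta has_real_derivative exp (- \<theta> * u) * x u) (at u within {0..t})"
      unfolding eta_def[abs_def] by (rule set_integral_derivative[OF ex_cont u])
    have "(D has_real_derivative (exp (- \<theta> * u) * (- \<theta>)) * V u + z u * exp (- \<theta> * u) - exp (- \<theta> * u) * x u) (at u within {0..t})"
      unfolding D_def[abs_def] by (intro derivative_intros DERIV_mult dV de) (auto intro!: derivative_eq_intros)
    then show ?thesis using u by (simp add: z_V algebra_simps)
  qed
  then obtain c where c: "\<And>u. u \<in> {0..t} \<Longrightarrow> D u = c"
    using has_field_derivative_zero_constant[of "{0..t}" D] by auto
  have "D 0 = 0" by (simp add: D_def V_def eta_def set_integral_singleton)
  then have "D t = 0" using c[of t] c[of 0] t by simp
  then show ?thesis by (simp add: D_def exp_minus field_simps)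
qed

text \<open>The integral of V^2 is eliminated by integrating the derivative 2 V z of V^2. The terms
  of order exp(2\<theta>T) cancel, and every survivor carries a factor x.\<close>

lemma numerator_eq:
  assumes T: "0 \<le> T"
  shows "(z T)\<^sup>2 - 2 * \<theta> * (LBINT s:{0..T}. (z s)\<^sup>2)
    = 2 * \<theta> * V T * x T + (x T)\<^sup>2 - 2 * \<theta>\<^sup>2 * (LBINT s:{0..T}. V s * x s) - 2 * \<theta> * (LBINT s:{0..T}. (x s)\<^sup>2)"
proof -
  have iVV: "set_integrable lborel {0..T} (\<lambda>s. (V s)\<^sup>2)"
    by (rule continuous_on_set_integrable) (auto intro!: continuous_intros V_cont)
  have iVx: "set_integrable lborel {0..T} (\<lambda>s. V s * x s)"
    by (rule continuous_on_set_integrable) (auto intro!: continuous_intros V_cont x_cont)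
  have ixx: "set_integrable lborel {0..T} (\<lambda>s. (x s)\<^sup>2)"
    by (rule continuous_on_set_integrable) (auto intro!: continuous_intros x_cont)
  have zz: "(LBINT s:{0..T}. (z s)\<^sup>2) = \<theta>\<^sup>2 * (LBINT s:{0..T}. (V s)\<^sup>2) + 2 * \<theta> * (LBINT s:{0..T}. V s * x s) + (LBINT s:{0..T}. (x s)\<^sup>2)"
  proof -
    have "(LBINT s:{0..T}. (z s)\<^sup>2) = (LBINT s:{0..T}. \<theta>\<^sup>2 * (V s)\<^sup>2 + 2 * \<theta> * (V s * x s) + (x s)\<^sup>2)"
      by (rule set_lebesgue_integral_cong) (auto simp: z_V power2_eq_square algebra_simps)
    also have "\<dots> = \<theta>\<^sup>2 * (LBINT s:{0..T}. (V s)\<^sup>2) + 2 * \<theta> * (LBINT s:{0..T}. V s * x s) + (LBINT s:{0..T}. (x s)\<^sup>2)"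
      using iVV iVx ixx by (simp add: set_integral_add set_integral_mult_right)
    finally show ?thesis .
  qed
  have VV: "(V T)\<^sup>2 = 2 * \<theta> * (LBINT s:{0..T}. (V s)\<^sup>2) + 2 * (LBINT s:{0..T}. V s * x s)"
  proof -
    have "((\<lambda>s. 2 * V s * z s) has_integral ((V T)\<^sup>2 - (V 0)\<^sup>2)) {0..T}"
    proof (rule fundamental_theorem_of_calculus[OF T])
      fix u assume u: "u \<in> {0..T}"
      have dV: "(V has_real_derivative z u) (at u within {0..T})"
        unfolding V_def[abs_def] by (rule set_integral_derivative[OF z_cont u])
      show "((\<lambda>u. (V u)\<^sup>2) has_vector_derivative 2 * V u * z u) (at u within {0..T})"
        unfolding has_real_derivative_iff_has_vector_derivative[symmetric]
        by (rule derivative_eq_intros dV refl)+ simp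
    qed
    moreover have "V 0 = 0" using V_eta[of 0] by (simp add: eta_def set_integral_singleton)
    ultimately have "(V T)\<^sup>2 = integral {0..T} (\<lambda>s. 2 * V s * z s)" by (simp add: integral_unique)
    also have "\<dots> = (LBINT s:{0..T}. 2 * V s * z s)"
      by (rule set_borel_integral_eq_integral(2)[symmetric], rule continuous_on_set_integrable)
         (auto intro!: continuous_intros V_cont z_cont)
    also have "\<dots> = (LBINT s:{0..T}. 2 * \<theta> * (V s)\<^sup>2 + 2 * (V s * x s))"
      by (rule set_lebesgue_integral_cong) (auto simp: z_V power2_eq_square algebra_simps)
    also have "\<dots> = 2 * \<theta> * (LBINT s:{0..T}. (V s)\<^sup>2) + 2 * (LBINT s:{0..T}. V s * x s)"
      using iVV iVx by (simp add: set_integral_add set_integral_mult_right)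
    finally show ?thesis .
  qed
  have "(z T)\<^sup>2 = \<theta>\<^sup>2 * (V T)\<^sup>2 + 2 * \<theta> * V T * x T + (x T)\<^sup>2"
    using T by (simp add: z_V power2_eq_square algebra_simps)
  then show ?thesis unfolding zz VV by (simp add: power2_eq_square algebra_simps)
qed

end

text \<open>Growth is imposed in integral form because that is what the second moment provides for
  almost every path. The factor 16 is a margin; the error estimates rely on \<theta> >
  4\<delta>.\<close>

locale langevin_path_growth = langevin_path +
  fixes \<delta> :: real
  assumes \<delta>: "\<delta> > 0" "16 * \<delta> \<le> \<theta>"
    and growth: "set_integrable lborel {0..} (\<lambda>s. exp (- (\<delta> * s)) * (1 + (x s)\<^sup>2))"
begin

definition B :: real where "B = (LBINT s:{0..}. exp (- (\<delta> * s)) * (1 + (x s)\<^sup>2))"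

lemma B_nonneg: "B \<ge> 0"
  unfolding B_def set_lebesgue_integral_def by (rule Bochner_Integration.integral_nonneg) (auto simp: indicator_def)

lemma growth_le_B:
  assumes "A \<subseteq> {0..}" and [measurable]: "A \<in> sets borel"
  shows "set_integrable lborel A (\<lambda>s. exp (- (\<delta> * s)) * (1 + (x s)\<^sup>2))"
    "(LBINT s:A. exp (- (\<delta> * s)) * (1 + (x s)\<^sup>2)) \<le> B"
proof -
  show i: "set_integrable lborel A (\<lambda>s. exp (- (\<delta> * s)) * (1 + (x s)\<^sup>2))"
    by (rule set_integrable_subset[OF growth]) (use assms in auto)
  show "(LBINT s:A. exp (- (\<delta> * s)) * (1 + (x s)\<^sup>2)) \<le> B"
    using i growth assms(1) unfolding B_def set_lebesgue_integral_def set_integrable_def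
    by (intro integral_mono) (auto simp: indicator_def)
qed

text \<open>Every error integral is compared with the one finite constant B through the growth
  weight.\<close>

lemma weighted_integral_bound:
  assumes A: "A \<subseteq> {0..}" and Am[measurable]: "A \<in> sets borel" and c: "c \<ge> 0"
    and m: "set_borel_measurable lborel A f"
    and f: "\<And>s. s \<in> A \<Longrightarrow> \<bar>f s\<bar> \<le> c * (exp (- (\<delta> * s)) * (1 + (x s)\<^sup>2))"
  shows "set_integrable lborel A f" "\<bar>LBINT s:A. f s\<bar> \<le> c * B"
proof -
  have i: "set_integrable lborel A (\<lambda>s. c * (exp (- (\<delta> * s)) * (1 + (x s)\<^sup>2)))"
    using growth_le_B(1)[OF A Am] by (rule set_integrable_mult_right)
  show fi: "set_integrable lborel A f"
    by (rule set_integrable_bound[OF i m]) (use f c in \<open>auto intro!: AE_I2 simp: abs_mult\<close>)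
  have "\<bar>LBINT s:A. f s\<bar> \<le> (LBINT s:A. \<bar>f s\<bar>)"
    unfolding set_lebesgue_integral_def
    by (rule order_trans[OF integral_abs_bound]) (auto intro!: Bochner_Integration.integral_mono' simp: abs_mult set_integrable_abs[OF fi, unfolded set_integrable_def])
  also have "\<dots> \<le> (LBINT s:A. c * (exp (- (\<delta> * s)) * (1 + (x s)\<^sup>2)))"
    by (rule set_integral_mono[OF set_integrable_abs[OF fi] i f])
  also have "\<dots> \<le> c * B" using growth_le_B(2)[OF A Am] c by (simp add: set_integral_mult_right mult_left_mono)
  finally show "\<bar>LBINT s:A. f s\<bar> \<le> c * B" .
qed

lemma abs_le_growth: "\<bar>y\<bar> \<le> 1 + y\<^sup>2" for y :: real
proof -
  have "0 \<le> (\<bar>y\<bar> - 1)\<^sup>2" by simp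
  then have "2 * \<bar>y\<bar> \<le> 1 + y\<^sup>2" by (simp add: power2_eq_square algebra_simps)
  then show ?thesis using abs_ge_zero[of y] by linarith
qed

lemma continuous_set_measurable:
  fixes f :: "real \<Rightarrow> real"
  assumes "continuous_on {0..} f" "A \<subseteq> {0..}" "A \<in> sets borel"
  shows "set_borel_measurable lborel A f"
proof -
  have "continuous_on A f" using assms by (auto intro: continuous_on_subset)
  from borel_measurable_continuous_on_indicator[OF assms(3) this] show ?thesis
    by (simp add: set_borel_measurable_def)
qed

text \<open>exp(-\<theta> s) splits into exp(-(\<theta>-\<delta>) s), small beyond t, and the growth
  weight exp(-\<delta> s), which absorbs |x| \<le> 1 + x^2.\<close>

lemma eta_tail:
  assumes "0 \<le> t"
  shows "\<bar>eta t - eta_inf\<bar> \<le> exp (- ((\<theta> - \<delta>) * t)) * B"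
proof -
  \<comment> \<open>Holds for an arbitrary left end: t = 0 gives integrability on the initial piece,
    the given t the estimate of the tail.\<close>
  have bd: "\<bar>exp (- \<theta> * s) * x s\<bar> \<le> exp (- ((\<theta> - \<delta>) * t)) * (exp (- (\<delta> * s)) * (1 + (x s)\<^sup>2))" if "t \<le> s" for s t
  proof -
    have "(\<theta> - \<delta>) * t \<le> (\<theta> - \<delta>) * s" using that \<delta> by (intro mult_left_mono) auto
    then have "exp (- \<theta> * s) \<le> exp (- ((\<theta> - \<delta>) * t)) * exp (- (\<delta> * s))"
      by (subst exp_add[symmetric]) (simp add: algebra_simps)
    then have "exp (- \<theta> * s) * \<bar>x s\<bar> \<le> (exp (- ((\<theta> - \<delta>) * t)) * exp (- (\<delta> * s))) * (1 + (x s)\<^sup>2)"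
      by (intro mult_mono abs_le_growth) auto
    then show ?thesis by (simp add: abs_mult mult_ac)
  qed
  have m: "set_borel_measurable lborel A (\<lambda>s. exp (- \<theta> * s) * x s)" if "A \<subseteq> {0..}" "A \<in> sets borel" for A
    by (rule continuous_set_measurable[OF ex_cont that])
  have i1: "set_integrable lborel {0..t} (\<lambda>s. exp (- \<theta> * s) * x s)"
    by (rule weighted_integral_bound(1)[OF _ _ _ m bd[where t=0]]) auto
  have i2: "set_integrable lborel {t<..} (\<lambda>s. exp (- \<theta> * s) * x s)"
    by (rule weighted_integral_bound(1)[OF _ _ _ m bd[where t=t]]) (use assms in auto)
  have "eta_inf = (LBINT s:{0..t} \<union> {t<..}. exp (- \<theta> * s) * x s)"
    unfolding eta_inf_def using assms by (intro arg_cong[where f="\<lambda>A. LBINT s:A. exp (- \<theta> * s) * x s"]) auto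
  also have "\<dots> = eta t + (LBINT s:{t<..}. exp (- \<theta> * s) * x s)"
    unfolding eta_def by (rule set_integral_Un[OF _ i1 i2]) auto
  finally have "\<bar>eta t - eta_inf\<bar> = \<bar>LBINT s:{t<..}. exp (- \<theta> * s) * x s\<bar>" by simp
  also have "\<dots> \<le> exp (- ((\<theta> - \<delta>) * t)) * B"
    by (rule weighted_integral_bound(2)[OF _ _ _ m bd[where t=t]]) (use assms in auto)
  finally show ?thesis .
qed

lemma eta_tendsto: "(eta \<longlongrightarrow> eta_inf) at_top"
proof (rule LIM_zero_cancel, rule Lim_null_comparison)
  show "\<forall>\<^sub>F t in at_top. norm (eta t - eta_inf) \<le> exp (- ((\<theta> - \<delta>) * t)) * B"
    using eventually_ge_at_top[of 0] by eventually_elim (use eta_tail in simp)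
  have "((\<lambda>t. exp (- ((\<theta> - \<delta>) * t))) \<longlongrightarrow> 0) at_top"
    using \<delta> \<theta> by (intro filterlim_compose[OF exp_at_bot] filterlim_compose[OF filterlim_uminus_at_bot_at_top] filterlim_tendsto_pos_mult_at_top[OF tendsto_const _ filterlim_ident]) auto
  from tendsto_mult_right[OF this, of B]
  show "((\<lambda>t. exp (- ((\<theta> - \<delta>) * t)) * B) \<longlongrightarrow> 0) at_top" by simp
qed

text \<open>On [0, T] one has exp(\<theta> s) \<le> exp((\<theta>+\<delta>) T) exp(-\<delta> s); the
  prefactor exp(-\<theta> T) then leaves exp(\<delta> T).\<close>

lemma U_bound:
  assumes "0 \<le> T"
  shows "\<bar>U T\<bar> \<le> \<bar>x T\<bar> + \<theta> * B * exp (\<delta> * T)"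
proof -
  have "\<bar>LBINT s:{0..T}. exp (\<theta> * s) * x s\<bar> \<le> exp ((\<theta> + \<delta>) * T) * B"
  proof (rule weighted_integral_bound(2))
    fix s assume s: "s \<in> {0..T}"
    have "(\<theta> + \<delta>) * s \<le> (\<theta> + \<delta>) * T" using s \<theta> \<delta> by (intro mult_left_mono) auto
    then have "exp (\<theta> * s) \<le> exp ((\<theta> + \<delta>) * T) * exp (- (\<delta> * s))"
      by (subst exp_add[symmetric]) (simp add: algebra_simps)
    then have "exp (\<theta> * s) * \<bar>x s\<bar> \<le> (exp ((\<theta> + \<delta>) * T) * exp (- (\<delta> * s))) * (1 + (x s)\<^sup>2)"
      by (intro mult_mono abs_le_growth) auto
    then show "\<bar>exp (\<theta> * s) * x s\<bar> \<le> exp ((\<theta> + \<delta>) * T) * (exp (- (\<delta> * s)) * (1 + (x s)\<^sup>2))"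
      by (simp add: abs_mult mult_ac)
  qed (auto intro!: continuous_set_measurable ex_cont)
  then have "\<theta> * exp (- \<theta> * T) * \<bar>LBINT s:{0..T}. exp (\<theta> * s) * x s\<bar> \<le> \<theta> * exp (- \<theta> * T) * (exp ((\<theta> + \<delta>) * T) * B)"
    using \<theta> by (intro mult_left_mono) auto
  also have "\<dots> = \<theta> * B * (exp (- \<theta> * T) * exp ((\<theta> + \<delta>) * T))" by (simp add: mult_ac)
  also have "exp (- \<theta> * T) * exp ((\<theta> + \<delta>) * T) = exp (\<delta> * T)"
    by (subst exp_add[symmetric]) (simp add: algebra_simps)
  finally have "\<bar>\<theta> * exp (- \<theta> * T) * (LBINT s:{0..T}. exp (\<theta> * s) * x s)\<bar> \<le> \<theta> * B * exp (\<delta> * T)"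
    using \<theta> by (simp add: abs_mult)
  then show ?thesis unfolding U_def by linarith
qed

definition N :: "real \<Rightarrow> real" where
  "N T = (z T)\<^sup>2 - 2 * \<theta> * (LBINT s:{0..T}. (z s)\<^sup>2)"

lemma eta_cont: "continuous_on {0..} eta"
proof -
  have "continuous_on {0..} (\<lambda>t. exp (- \<theta> * t) * V t)" by (intro continuous_intros V_cont)
  moreover have "exp (- \<theta> * t) * V t = eta t" if "t \<in> {0..}" for t
    using V_eta[of t] that by (simp add: exp_minus)
  ultimately show ?thesis by (rule continuous_on_eq)
qed

text \<open>In V(s) = exp(\<theta> s) eta(s) the factor eta(s) is replaced by its limit. The part of
  the integral carrying eta_inf combines with the boundary term containing V(T) x(T) into 2 \<theta>
  eta_inf U(T); each of the four remainders is of order exp(-(\<theta>-2\<delta>) T), and the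
  constant is the sum of their four constants.\<close>

lemma N_bound:
  assumes T: "0 \<le> T" and xT: "\<bar>x T\<bar> \<le> exp (\<delta> * T)"
  shows "\<bar>exp (- \<theta> * T) * N T - 2 * \<theta> * eta_inf * U T\<bar> \<le> (4 * \<theta> * B + 1 + 2 * \<theta>\<^sup>2 * B\<^sup>2) * exp (- ((\<theta> - 2 * \<delta>) * T))"
proof -
  define I1 where "I1 = (LBINT s:{0..T}. exp (\<theta> * s) * (eta s - eta_inf) * x s)"
  define I2 where "I2 = (LBINT s:{0..T}. (x s)\<^sup>2)"
  have c1: "continuous_on {0..} (\<lambda>s. exp (\<theta> * s) * (eta s - eta_inf) * x s)"
    by (intro continuous_intros eta_cont x_cont)
  have bI1: "\<bar>I1\<bar> \<le> (B * exp (2 * \<delta> * T)) * B"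
    unfolding I1_def
  proof (rule weighted_integral_bound(2))
    fix s assume s: "s \<in> {0..T}"
    have "\<bar>exp (\<theta> * s) * (eta s - eta_inf) * x s\<bar> = exp (\<theta> * s) * \<bar>eta s - eta_inf\<bar> * \<bar>x s\<bar>"
      by (simp add: abs_mult)
    also have "\<dots> \<le> exp (\<theta> * s) * (exp (- ((\<theta> - \<delta>) * s)) * B) * (1 + (x s)\<^sup>2)"
      using s by (intro mult_mono mult_left_mono eta_tail abs_le_growth) (auto simp: B_nonneg)
    also have "\<dots> = B * ((exp (\<theta> * s) * exp (- ((\<theta> - \<delta>) * s))) * (1 + (x s)\<^sup>2))" by (simp add: mult_ac)
    also have "exp (\<theta> * s) * exp (- ((\<theta> - \<delta>) * s)) = exp (2 * \<delta> * s) * exp (- (\<delta> * s))"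
      by (simp only: exp_add[symmetric]) (simp add: algebra_simps)
    also have "B * (exp (2 * \<delta> * s) * exp (- (\<delta> * s)) * (1 + (x s)\<^sup>2)) \<le> B * (exp (2 * \<delta> * T) * exp (- (\<delta> * s)) * (1 + (x s)\<^sup>2))"
      using s \<delta> by (intro mult_left_mono mult_right_mono) (auto simp: B_nonneg)
    finally show "\<bar>exp (\<theta> * s) * (eta s - eta_inf) * x s\<bar> \<le> (B * exp (2 * \<delta> * T)) * (exp (- (\<delta> * s)) * (1 + (x s)\<^sup>2))"
      by (simp add: mult_ac)
  qed (auto intro!: continuous_set_measurable c1 simp: B_nonneg)
  have bI2: "\<bar>I2\<bar> \<le> exp (\<delta> * T) * B"
    unfolding I2_def
  proof (rule weighted_integral_bound(2))
    fix s assume s: "s \<in> {0..T}"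
    have "1 \<le> exp (\<delta> * T) * exp (- (\<delta> * s))" using s \<delta> by (subst exp_add[symmetric]) simp
    then have "1 * (1 + (x s)\<^sup>2) \<le> (exp (\<delta> * T) * exp (- (\<delta> * s))) * (1 + (x s)\<^sup>2)" by (intro mult_right_mono) auto
    then show "\<bar>(x s)\<^sup>2\<bar> \<le> exp (\<delta> * T) * (exp (- (\<delta> * s)) * (1 + (x s)\<^sup>2))" by (simp add: mult_ac)
  qed (auto intro!: continuous_set_measurable continuous_intros x_cont)
  \<comment> \<open>Separates the fluctuation eta(s) - eta_inf, whose decay compensates the factor
    exp(\<theta> s) up to exp(\<delta> s).\<close>
  have split: "(LBINT s:{0..T}. V s * x s) = I1 + eta_inf * (LBINT s:{0..T}. exp (\<theta> * s) * x s)"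
  proof -
    have "(LBINT s:{0..T}. V s * x s) = (LBINT s:{0..T}. exp (\<theta> * s) * (eta s - eta_inf) * x s + eta_inf * (exp (\<theta> * s) * x s))"
      by (rule set_lebesgue_integral_cong) (auto simp: V_eta algebra_simps)
    also have "\<dots> = I1 + eta_inf * (LBINT s:{0..T}. exp (\<theta> * s) * x s)"
      unfolding I1_def
      by (subst set_integral_add) (auto intro!: continuous_on_set_integrable c1 ex_cont set_integrable_mult_right simp: set_integral_mult_right)
    finally show ?thesis .
  qed
  have ee: "exp (- \<theta> * T) * exp (\<theta> * T) = 1" by (subst exp_add[symmetric]) simp
  define J where "J = (LBINT s:{0..T}. exp (\<theta> * s) * x s)"
  have "exp (- \<theta> * T) * N T = 2 * \<theta> * (exp (- \<theta> * T) * V T) * x T + exp (- \<theta> * T) * (x T)\<^sup>2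
      - 2 * \<theta>\<^sup>2 * exp (- \<theta> * T) * (I1 + eta_inf * J) - 2 * \<theta> * exp (- \<theta> * T) * I2"
    unfolding N_def numerator_eq[OF T] split[folded J_def] I2_def[symmetric] by (simp add: algebra_simps)
  also have "exp (- \<theta> * T) * V T = eta T" using ee T by (simp add: V_eta)
  finally have "exp (- \<theta> * T) * N T - 2 * \<theta> * eta_inf * U T
      = 2 * \<theta> * (eta T - eta_inf) * x T + exp (- \<theta> * T) * (x T)\<^sup>2 - 2 * \<theta>\<^sup>2 * exp (- \<theta> * T) * I1 - 2 * \<theta> * exp (- \<theta> * T) * I2"
    unfolding U_def J_def[symmetric] by (simp add: power2_eq_square algebra_simps)
  moreover have "\<bar>2 * \<theta> * (eta T - eta_inf) * x T\<bar> \<le> 2 * \<theta> * B * exp (- ((\<theta> - 2 * \<delta>) * T))"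
  proof -
    have "\<bar>2 * \<theta> * (eta T - eta_inf) * x T\<bar> = 2 * \<theta> * (\<bar>eta T - eta_inf\<bar> * \<bar>x T\<bar>)" using \<theta> by (simp add: abs_mult)
    also have "\<dots> \<le> 2 * \<theta> * ((exp (- ((\<theta> - \<delta>) * T)) * B) * exp (\<delta> * T))"
      using \<theta> by (intro mult_left_mono mult_mono eta_tail T xT) (auto simp: B_nonneg)
    also have "\<dots> = 2 * \<theta> * B * (exp (- ((\<theta> - \<delta>) * T)) * exp (\<delta> * T))" by (simp add: mult_ac)
    also have "exp (- ((\<theta> - \<delta>) * T)) * exp (\<delta> * T) = exp (- ((\<theta> - 2 * \<delta>) * T))"
      by (subst exp_add[symmetric]) (simp add: algebra_simps)
    finally show ?thesis .
  qed
  moreover have "\<bar>exp (- \<theta> * T) * (x T)\<^sup>2\<bar> \<le> exp (- ((\<theta> - 2 * \<delta>) * T))"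
  proof -
    have "(x T)\<^sup>2 \<le> (exp (\<delta> * T))\<^sup>2" using xT by (subst abs_le_square_iff[symmetric]) simp
    also have "\<dots> = exp (2 * \<delta> * T)" by (simp add: power2_eq_square exp_add[symmetric])
    finally have "exp (- \<theta> * T) * (x T)\<^sup>2 \<le> exp (- \<theta> * T) * exp (2 * \<delta> * T)" by (intro mult_left_mono) auto
    also have "\<dots> = exp (- ((\<theta> - 2 * \<delta>) * T))" by (subst exp_add[symmetric]) (simp add: algebra_simps)
    finally show ?thesis by simp
  qed
  moreover have "\<bar>2 * \<theta>\<^sup>2 * exp (- \<theta> * T) * I1\<bar> \<le> 2 * \<theta>\<^sup>2 * B\<^sup>2 * exp (- ((\<theta> - 2 * \<delta>) * T))"
  proof -
    have "\<bar>2 * \<theta>\<^sup>2 * exp (- \<theta> * T) * I1\<bar> = 2 * \<theta>\<^sup>2 * exp (- \<theta> * T) * \<bar>I1\<bar>" by (simp add: abs_mult)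
    also have "\<dots> \<le> 2 * \<theta>\<^sup>2 * exp (- \<theta> * T) * ((B * exp (2 * \<delta> * T)) * B)" by (intro mult_left_mono bI1) auto
    also have "\<dots> = 2 * \<theta>\<^sup>2 * B\<^sup>2 * (exp (- \<theta> * T) * exp (2 * \<delta> * T))" by (simp add: power2_eq_square mult_ac)
    also have "exp (- \<theta> * T) * exp (2 * \<delta> * T) = exp (- ((\<theta> - 2 * \<delta>) * T))" by (subst exp_add[symmetric]) (simp add: algebra_simps)
    finally show ?thesis .
  qed
  moreover have "\<bar>2 * \<theta> * exp (- \<theta> * T) * I2\<bar> \<le> 2 * \<theta> * B * exp (- ((\<theta> - 2 * \<delta>) * T))"
  proof -
    have "\<bar>2 * \<theta> * exp (- \<theta> * T) * I2\<bar> = 2 * \<theta> * exp (- \<theta> * T) * \<bar>I2\<bar>" using \<theta> by (simp add: abs_mult)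
    also have "\<dots> \<le> 2 * \<theta> * exp (- \<theta> * T) * (exp (\<delta> * T) * B)" using \<theta> by (intro mult_left_mono bI2) auto
    also have "\<dots> = 2 * \<theta> * B * (exp (- \<theta> * T) * exp (\<delta> * T))" by (simp add: mult_ac)
    also have "exp (- \<theta> * T) * exp (\<delta> * T) = exp (- ((\<theta> - \<delta>) * T))" by (subst exp_add[symmetric]) (simp add: algebra_simps)
    also have "2 * \<theta> * B * exp (- ((\<theta> - \<delta>) * T)) \<le> 2 * \<theta> * B * exp (- ((\<theta> - 2 * \<delta>) * T))"
      using \<theta> \<delta> T B_nonneg by (intro mult_left_mono) (auto intro!: mult_right_mono)
    finally show ?thesis .
  qed
  moreover have "(4 * \<theta> * B + 1 + 2 * \<theta>\<^sup>2 * B\<^sup>2) * exp (- ((\<theta> - 2 * \<delta>) * T))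
      = 2 * \<theta> * B * exp (- ((\<theta> - 2 * \<delta>) * T)) + exp (- ((\<theta> - 2 * \<delta>) * T)) + 2 * \<theta>\<^sup>2 * B\<^sup>2 * exp (- ((\<theta> - 2 * \<delta>) * T)) + 2 * \<theta> * B * exp (- ((\<theta> - 2 * \<delta>) * T))"
    by (simp add: algebra_simps)
  ultimately show ?thesis by linarith
qed

text \<open>Put E = exp(\<theta> t), y = z/E, m = N/E and d = y^2 - m/E. The denominator of the
  estimator is E^2 d / \<theta>, so its error is \<theta> m / (E d), where m is 2 \<theta> eta_inf U
  up to a small term and d tends to (\<theta> eta_inf)^2. As p U may grow like exp(2\<delta> t), the
  convergence of d is needed with a rate.\<close>

lemma estimator_error_limit:
  assumes t: "filterlim t at_top sequentially" and t0: "\<And>n. 0 \<le> t n"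
    and xt: "\<And>n. \<bar>x (t n)\<bar> \<le> exp (\<delta> * t n)"
    and p: "\<And>n. 0 \<le> p n \<and> p n \<le> exp (\<delta> * t n)" and eta: "eta_inf \<noteq> 0"
  shows "(\<lambda>n. p n * exp (\<theta> * t n) * ((z (t n))\<^sup>2 / (2 * (LBINT s:{0..t n}. (z s)\<^sup>2)) - \<theta>) - 2 * p n * U (t n) / eta_inf) \<longlonglongrightarrow> 0"
proof -
  have decay: "(\<lambda>n. C * exp (- (c * t n))) \<longlonglongrightarrow> 0" if "c > 0" for c C
  proof -
    have "((\<lambda>s. exp (- (c * s))) \<longlongrightarrow> 0) at_top"
      using that by (intro filterlim_compose[OF exp_at_bot] filterlim_compose[OF filterlim_uminus_at_bot_at_top] filterlim_tendsto_pos_mult_at_top[OF tendsto_const _ filterlim_ident]) auto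
    from tendsto_mult_left[OF filterlim_compose[OF this t], of C] show ?thesis by simp
  qed
  define y where "y n = exp (- \<theta> * t n) * z (t n)" for n
  define m where "m n = exp (- \<theta> * t n) * N (t n)" for n
  define e where "e n = m n - 2 * \<theta> * eta_inf * U (t n)" for n
  define C where "C = 4 * \<theta> * B + 1 + 2 * \<theta>\<^sup>2 * B\<^sup>2"
  have C0: "C \<ge> 0" using \<theta> B_nonneg by (simp add: C_def)
  have e: "\<bar>e n\<bar> \<le> C * exp (- ((\<theta> - 2 * \<delta>) * t n))" for n
    unfolding e_def m_def C_def by (rule N_bound[OF t0 xt])
  have Ub: "\<bar>U (t n)\<bar> \<le> (1 + \<theta> * B) * exp (\<delta> * t n)" for n
    using U_bound[OF t0, of n] xt[of n] by (simp add: algebra_simps)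
  \<comment> \<open>The factor exp(3\<delta> t) is chosen to beat the growth exp(2\<delta> t) of p
    U.\<close>
  have f1: "(\<lambda>n. exp (3 * \<delta> * t n) * (y n - \<theta> * eta_inf)) \<longlonglongrightarrow> 0"
  proof (rule Lim_null_comparison)
    show "\<forall>\<^sub>F n in sequentially. norm (exp (3 * \<delta> * t n) * (y n - \<theta> * eta_inf)) \<le> (\<theta> * B + 1) * exp (- ((\<theta> - 4 * \<delta>) * t n))"
    proof (intro always_eventually allI)
      fix n
      have "y n = \<theta> * eta (t n) + exp (- \<theta> * t n) * x (t n)"
        unfolding y_def using z_V[OF t0, of n] V_eta[OF t0, of n] by (simp add: algebra_simps exp_add[symmetric])
      then have "y n - \<theta> * eta_inf = \<theta> * (eta (t n) - eta_inf) + exp (- \<theta> * t n) * x (t n)"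
        by (simp add: algebra_simps)
      then have "\<bar>y n - \<theta> * eta_inf\<bar> \<le> \<bar>\<theta> * (eta (t n) - eta_inf)\<bar> + \<bar>exp (- \<theta> * t n) * x (t n)\<bar>"
        by (simp only: abs_triangle_ineq)
      then have "\<bar>y n - \<theta> * eta_inf\<bar> \<le> \<theta> * \<bar>eta (t n) - eta_inf\<bar> + exp (- \<theta> * t n) * \<bar>x (t n)\<bar>"
        using \<theta> by (simp only: abs_mult abs_exp_cancel abs_of_pos)
      also have "\<dots> \<le> \<theta> * (exp (- ((\<theta> - \<delta>) * t n)) * B) + exp (- \<theta> * t n) * exp (\<delta> * t n)"
        using \<theta> by (intro add_mono mult_left_mono eta_tail t0 xt) auto
      also have "\<dots> = (\<theta> * B + 1) * exp (- ((\<theta> - \<delta>) * t n))"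
        by (simp add: exp_add[symmetric] algebra_simps)
      finally have "exp (3 * \<delta> * t n) * \<bar>y n - \<theta> * eta_inf\<bar> \<le> exp (3 * \<delta> * t n) * ((\<theta> * B + 1) * exp (- ((\<theta> - \<delta>) * t n)))"
        by (intro mult_left_mono) auto
      also have "\<dots> = (\<theta> * B + 1) * (exp (3 * \<delta> * t n) * exp (- ((\<theta> - \<delta>) * t n)))" by (simp add: mult_ac)
      also have "exp (3 * \<delta> * t n) * exp (- ((\<theta> - \<delta>) * t n)) = exp (- ((\<theta> - 4 * \<delta>) * t n))"
        by (subst exp_add[symmetric]) (simp add: algebra_simps)
      finally show "norm (exp (3 * \<delta> * t n) * (y n - \<theta> * eta_inf)) \<le> (\<theta> * B + 1) * exp (- ((\<theta> - 4 * \<delta>) * t n))"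
        by (simp add: abs_mult)
    qed
    show "(\<lambda>n. (\<theta> * B + 1) * exp (- ((\<theta> - 4 * \<delta>) * t n))) \<longlonglongrightarrow> 0" by (rule decay) (use \<delta> in linarith)
  qed
  have f2: "(\<lambda>n. exp (3 * \<delta> * t n) * (exp (- \<theta> * t n) * m n)) \<longlonglongrightarrow> 0"
  proof (rule Lim_null_comparison)
    show "\<forall>\<^sub>F n in sequentially. norm (exp (3 * \<delta> * t n) * (exp (- \<theta> * t n) * m n)) \<le> (C + 2 * \<theta> * \<bar>eta_inf\<bar> * (1 + \<theta> * B)) * exp (- ((\<theta> - 4 * \<delta>) * t n))"
    proof (intro always_eventually allI)
      fix n
      have "\<bar>m n\<bar> \<le> \<bar>e n\<bar> + 2 * \<theta> * \<bar>eta_inf\<bar> * \<bar>U (t n)\<bar>"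
        using abs_triangle_ineq[of "e n" "2 * \<theta> * eta_inf * U (t n)"] \<theta> by (simp add: e_def abs_mult)
      also have "\<dots> \<le> C * exp (- ((\<theta> - 2 * \<delta>) * t n)) + 2 * \<theta> * \<bar>eta_inf\<bar> * ((1 + \<theta> * B) * exp (\<delta> * t n))"
        using \<theta> by (intro add_mono e mult_left_mono Ub) auto
      also have "\<dots> \<le> C * exp (\<delta> * t n) + 2 * \<theta> * \<bar>eta_inf\<bar> * ((1 + \<theta> * B) * exp (\<delta> * t n))"
      proof -
        have "- ((\<theta> - 2 * \<delta>) * t n) \<le> 0" using t0[of n] \<delta> by simp
        also have "0 \<le> \<delta> * t n" using t0[of n] \<delta> by simp
        finally show ?thesis using C0 \<theta> B_nonneg by (intro add_mono mult_left_mono) auto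
      qed
      finally have mb: "\<bar>m n\<bar> \<le> (C + 2 * \<theta> * \<bar>eta_inf\<bar> * (1 + \<theta> * B)) * exp (\<delta> * t n)" by (simp add: algebra_simps)
      have "norm (exp (3 * \<delta> * t n) * (exp (- \<theta> * t n) * m n)) = exp (3 * \<delta> * t n) * exp (- \<theta> * t n) * \<bar>m n\<bar>"
        by (simp add: abs_mult)
      also have "\<dots> \<le> exp (3 * \<delta> * t n) * exp (- \<theta> * t n) * ((C + 2 * \<theta> * \<bar>eta_inf\<bar> * (1 + \<theta> * B)) * exp (\<delta> * t n))"
        by (intro mult_left_mono mb) auto
      also have "\<dots> = (C + 2 * \<theta> * \<bar>eta_inf\<bar> * (1 + \<theta> * B)) * (exp (3 * \<delta> * t n) * exp (- \<theta> * t n) * exp (\<delta> * t n))"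
        by (simp add: mult_ac)
      also have "exp (3 * \<delta> * t n) * exp (- \<theta> * t n) * exp (\<delta> * t n) = exp (- ((\<theta> - 4 * \<delta>) * t n))"
        unfolding exp_add[symmetric] by (simp add: algebra_simps)
      finally show "norm (exp (3 * \<delta> * t n) * (exp (- \<theta> * t n) * m n)) \<le> (C + 2 * \<theta> * \<bar>eta_inf\<bar> * (1 + \<theta> * B)) * exp (- ((\<theta> - 4 * \<delta>) * t n))" .
    qed
    show "(\<lambda>n. (C + 2 * \<theta> * \<bar>eta_inf\<bar> * (1 + \<theta> * B)) * exp (- ((\<theta> - 4 * \<delta>) * t n))) \<longlonglongrightarrow> 0" by (rule decay) (use \<delta> in linarith)
  qed
  have f3: "(\<lambda>n. p n * e n) \<longlonglongrightarrow> 0"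
  proof (rule Lim_null_comparison)
    show "\<forall>\<^sub>F n in sequentially. norm (p n * e n) \<le> C * exp (- ((\<theta> - 3 * \<delta>) * t n))"
    proof (intro always_eventually allI)
      fix n
      have "norm (p n * e n) \<le> exp (\<delta> * t n) * (C * exp (- ((\<theta> - 2 * \<delta>) * t n)))"
        using p[of n] e[of n] by (auto simp: abs_mult intro!: mult_mono)
      also have "\<dots> = C * (exp (\<delta> * t n) * exp (- ((\<theta> - 2 * \<delta>) * t n)))" by simp
      also have "exp (\<delta> * t n) * exp (- ((\<theta> - 2 * \<delta>) * t n)) = exp (- ((\<theta> - 3 * \<delta>) * t n))"
        by (subst exp_add[symmetric]) (simp add: algebra_simps)
      finally show "norm (p n * e n) \<le> C * exp (- ((\<theta> - 3 * \<delta>) * t n))" .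
    qed
    show "(\<lambda>n. C * exp (- ((\<theta> - 3 * \<delta>) * t n))) \<longlonglongrightarrow> 0" by (rule decay) (use \<delta> in linarith)
  qed
  have f4: "(\<lambda>n. exp (- (3 * \<delta> * t n)) * (p n * U (t n))) \<longlonglongrightarrow> 0"
  proof (rule Lim_null_comparison)
    show "\<forall>\<^sub>F n in sequentially. norm (exp (- (3 * \<delta> * t n)) * (p n * U (t n))) \<le> (1 + \<theta> * B) * exp (- (\<delta> * t n))"
    proof (intro always_eventually allI)
      fix n
      have "norm (exp (- (3 * \<delta> * t n)) * (p n * U (t n))) \<le> exp (- (3 * \<delta> * t n)) * (exp (\<delta> * t n) * ((1 + \<theta> * B) * exp (\<delta> * t n)))"
        using p[of n] Ub[of n] by (auto simp: abs_mult intro!: mult_mono)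
      also have "\<dots> = (1 + \<theta> * B) * (exp (- (3 * \<delta> * t n)) * exp (\<delta> * t n) * exp (\<delta> * t n))" by (simp add: mult_ac)
      also have "exp (- (3 * \<delta> * t n)) * exp (\<delta> * t n) * exp (\<delta> * t n) = exp (- (\<delta> * t n))"
        unfolding exp_add[symmetric] by (simp add: algebra_simps)
      finally show "norm (exp (- (3 * \<delta> * t n)) * (p n * U (t n))) \<le> (1 + \<theta> * B) * exp (- (\<delta> * t n))" .
    qed
    show "(\<lambda>n. (1 + \<theta> * B) * exp (- (\<delta> * t n))) \<longlonglongrightarrow> 0" by (rule decay) (use \<delta> in linarith)
  qed
  have ey: "y \<longlonglongrightarrow> \<theta> * eta_inf"
  proof -
    have "(\<lambda>n. 1 * exp (- (3 * \<delta> * t n)) * (exp (3 * \<delta> * t n) * (y n - \<theta> * eta_inf))) \<longlonglongrightarrow> 0 * 0"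
      by (intro tendsto_mult f1 decay) (use \<delta> in linarith)
    then have "(\<lambda>n. y n - \<theta> * eta_inf) \<longlonglongrightarrow> 0"
      by (simp add: mult.assoc[symmetric] exp_add[symmetric])
    then show ?thesis by (rule LIM_zero_cancel)
  qed
  \<comment> \<open>Rescaled denominator; its limit is nonzero because eta_inf \<noteq> 0.\<close>
  define d where "d n = (y n)\<^sup>2 - exp (- \<theta> * t n) * m n" for n
  have em: "(\<lambda>n. exp (- \<theta> * t n) * m n) \<longlonglongrightarrow> 0"
  proof -
    have "(\<lambda>n. 1 * exp (- (3 * \<delta> * t n)) * (exp (3 * \<delta> * t n) * (exp (- \<theta> * t n) * m n))) \<longlonglongrightarrow> 0 * 0"
      by (intro tendsto_mult f2 decay) (use \<delta> in linarith)
    then show ?thesis by (simp add: mult.assoc[symmetric] exp_add[symmetric])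
  qed
  have dl: "d \<longlonglongrightarrow> (\<theta> * eta_inf)\<^sup>2 - 0"
    unfolding d_def by (intro tendsto_intros ey em)
  have d0: "(\<theta> * eta_inf)\<^sup>2 - 0 \<noteq> 0" using \<theta> eta by simp
  \<comment> \<open>Rate of d against the growth of p U: the mutually inverse powers exp(3\<delta>
    t) and exp(-3\<delta> t) are inserted and distributed over the factors.\<close>
  have gap: "(\<lambda>n. p n * U (t n) * ((\<theta> * eta_inf)\<^sup>2 - d n)) \<longlonglongrightarrow> 0"
  proof -
    have lim: "(\<lambda>n. exp (- (3 * \<delta> * t n)) * (p n * U (t n)) * (exp (3 * \<delta> * t n) * (exp (- \<theta> * t n) * m n) - exp (3 * \<delta> * t n) * (y n - \<theta> * eta_inf) * (y n + \<theta> * eta_inf)))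
        \<longlonglongrightarrow> 0 * (0 - 0 * (\<theta> * eta_inf + \<theta> * eta_inf))"
      by (intro tendsto_intros f1 f2 f4 ey)
    have eq: "exp (- (3 * \<delta> * t n)) * (p n * U (t n)) * (exp (3 * \<delta> * t n) * (exp (- \<theta> * t n) * m n) - exp (3 * \<delta> * t n) * (y n - \<theta> * eta_inf) * (y n + \<theta> * eta_inf))
        = p n * U (t n) * ((\<theta> * eta_inf)\<^sup>2 - d n)" for n
    proof -
      have 1: "exp (- (3 * \<delta> * t n)) * exp (3 * \<delta> * t n) = 1" by (subst exp_add[symmetric]) simp
      have "exp (- (3 * \<delta> * t n)) * (p n * U (t n)) * (exp (3 * \<delta> * t n) * (exp (- \<theta> * t n) * m n) - exp (3 * \<delta> * t n) * (y n - \<theta> * eta_inf) * (y n + \<theta> * eta_inf))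
         = (exp (- (3 * \<delta> * t n)) * exp (3 * \<delta> * t n)) * (p n * U (t n) * ((exp (- \<theta> * t n) * m n) - (y n - \<theta> * eta_inf) * (y n + \<theta> * eta_inf)))"
        by (simp add: algebra_simps)
      also have "\<dots> = p n * U (t n) * ((\<theta> * eta_inf)\<^sup>2 - d n)"
        unfolding 1 by (simp add: d_def power2_eq_square algebra_simps)
      finally show ?thesis .
    qed
    show ?thesis using lim unfolding eq by simp
  qed
  \<comment> \<open>Exact decomposition of the difference: m is replaced by its leading term, then d
    by its limit.\<close>
  have main: "(\<lambda>n. \<theta> * (p n * e n) / d n + 2 * (p n * U (t n) * ((\<theta> * eta_inf)\<^sup>2 - d n)) / (eta_inf * d n)) \<longlonglongrightarrow> \<theta> * 0 / ((\<theta> * eta_inf)\<^sup>2 - 0) + 2 * 0 / (eta_inf * ((\<theta> * eta_inf)\<^sup>2 - 0))"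
    using d0 eta by (intro tendsto_intros f3 gap dl) auto
  have "\<forall>\<^sub>F n in sequentially. d n \<noteq> 0" using tendsto_imp_eventually_ne[OF dl d0] .
  then have "\<forall>\<^sub>F n in sequentially. \<theta> * (p n * e n) / d n + 2 * (p n * U (t n) * ((\<theta> * eta_inf)\<^sup>2 - d n)) / (eta_inf * d n)
      = p n * exp (\<theta> * t n) * ((z (t n))\<^sup>2 / (2 * (LBINT s:{0..t n}. (z s)\<^sup>2)) - \<theta>) - 2 * p n * U (t n) / eta_inf"
  proof eventually_elim
    case (elim n)
    define E where "E = exp (\<theta> * t n)"
    have E: "E > 0" "exp (- \<theta> * t n) = 1 / E" by (simp_all add: E_def exp_minus field_simps)
    have zy: "z (t n) = E * y n" and Nm: "N (t n) = E * m n" using E by (simp_all add: y_def m_def)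
    have zz: "2 * (LBINT s:{0..t n}. (z s)\<^sup>2) = E\<^sup>2 * d n / \<theta>"
    proof -
      have "2 * \<theta> * (LBINT s:{0..t n}. (z s)\<^sup>2) = (z (t n))\<^sup>2 - N (t n)" by (simp add: N_def)
      also have "\<dots> = E\<^sup>2 * d n" unfolding zy Nm d_def E(2) using E(1) by (simp add: field_simps power2_eq_square)
      finally show ?thesis using \<theta> by (simp add: field_simps)
    qed
    have dE: "(y n)\<^sup>2 = d n + m n / E" using E by (simp add: d_def)
    have "(z (t n))\<^sup>2 / (2 * (LBINT s:{0..t n}. (z s)\<^sup>2)) - \<theta> = \<theta> * (y n)\<^sup>2 / d n - \<theta>"
      unfolding zz zy using E(1) \<theta> by (simp add: power_mult_distrib)
    also have "\<dots> = \<theta> * m n / (E * d n)" unfolding dE using elim E(1) by (simp add: field_simps)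
    finally have F: "p n * exp (\<theta> * t n) * ((z (t n))\<^sup>2 / (2 * (LBINT s:{0..t n}. (z s)\<^sup>2)) - \<theta>) = p n * \<theta> * m n / d n"
      using E(1) unfolding E_def[symmetric] by simp
    have me: "m n = e n + 2 * \<theta> * eta_inf * U (t n)" by (simp add: e_def)
    show ?case unfolding F me using elim eta by (simp add: field_simps power2_eq_square)
  qed
  from Lim_transform_eventually[OF main this] show ?thesis by simp
qed

end

section \<open>Joint normality\<close>

text \<open>Left-end sums are integrals of step functions that converge pointwise and share a bound
  of |f|. With n + 1 cells the mesh is defined for every n.\<close>

lemma riemann_sum_tendsto:
  fixes f :: "real \<Rightarrow> real"
  assumes f: "continuous_on {0..A} f" and A: "0 \<le> A"
  shows "(\<lambda>n. A / real (Suc n) * (\<Sum>i<Suc n. f (real i * (A / real (Suc n))))) \<longlonglongrightarrow> (LBINT s:{0..A}. f s)"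
proof (cases "A = 0")
  case True
  then show ?thesis by (simp add: set_integral_singleton)
next
  case False
  then have A0: "A > 0" using A by simp
  define d where "d n = A / real (Suc n)" for n
  have d0: "d n > 0" for n using A0 by (simp add: d_def)
  define g where "g n s = (\<Sum>i<Suc n. f (real i * d n) * indicator {real i * d n..<real (Suc i) * d n} s)" for n s
  obtain C where C: "\<And>s. s \<in> {0..A} \<Longrightarrow> \<bar>f s\<bar> \<le> C"
    using compact_imp_bounded[OF compact_continuous_image[OF f compact_Icc]] unfolding bounded_iff by fastforce
  have C0: "C \<ge> 0" using C[of 0] A by (meson abs_ge_zero atLeastAtMost_iff order_refl order_trans)
  \<comment> \<open>The floor is the index of the cell containing s; only that summand of g
    survives.\<close>
  have g_val: "g n s = f (real (nat \<lfloor>s / d n\<rfloor>) * d n)" and g_ix: "real (nat \<lfloor>s / d n\<rfloor>) * d n \<le> s" "s - d n \<le> real (nat \<lfloor>s / d n\<rfloor>) * d n"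
    if s: "0 \<le> s" "s < A" for n s
  proof -
    define k where "k = nat \<lfloor>s / d n\<rfloor>"
    have q: "0 \<le> s / d n" using s d0[of n] by simp
    then have k: "real k \<le> s / d n" "s / d n < real k + 1" unfolding k_def by (auto simp: of_nat_nat)
    have k1: "real k * d n \<le> s" "s < real (Suc k) * d n" using k d0[of n] by (auto simp: field_simps)
    have "s / d n < A / d n" using s d0[of n] by (intro divide_strict_right_mono) auto
    also have "A / d n = real (Suc n)" using A0 by (simp add: d_def)
    finally have "s / d n < real (Suc n)" .
    then have kn: "k < Suc n" using k(1) by linarith
    have "g n s = (\<Sum>i<Suc n. if i = k then f (real k * d n) else 0)"
      unfolding g_def
    proof (intro sum.cong refl)
      fix i
      have "indicator {real i * d n..<real (Suc i) * d n} s = (0::real)" if "i \<noteq> k"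
      proof (cases "i < k")
        case True
        then have "real (Suc i) * d n \<le> real k * d n" using d0[of n] by (intro mult_right_mono) auto
        then show ?thesis using k1(1) by (auto simp: indicator_def)
      next
        case False
        then have "real (Suc k) * d n \<le> real i * d n" using that d0[of n] by (intro mult_right_mono) auto
        then show ?thesis using k1(2) by (auto simp: indicator_def)
      qed
      then show "f (real i * d n) * indicator {real i * d n..<real (Suc i) * d n} s = (if i = k then f (real k * d n) else 0)"
        using k1 by (auto simp: indicator_def)
    qed
    then show "g n s = f (real (nat \<lfloor>s / d n\<rfloor>) * d n)" using kn by (simp add: k_def)
    show "real (nat \<lfloor>s / d n\<rfloor>) * d n \<le> s" "s - d n \<le> real (nat \<lfloor>s / d n\<rfloor>) * d n"
      using k1 unfolding k_def[symmetric] by (auto simp: algebra_simps)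
  qed
  have g_out: "g n s = 0" if "s < 0 \<or> A \<le> s" for n s
    unfolding g_def
  proof (intro sum.neutral ballI)
    fix i assume "i \<in> {..<Suc n}"
    then have "real (Suc i) * d n \<le> real (Suc n) * d n" using d0[of n] by (intro mult_right_mono) auto
    also have "\<dots> = A" by (simp add: d_def)
    finally have "real (Suc i) * d n \<le> A" .
    moreover have "0 \<le> real i * d n" using d0[of n] by simp
    ultimately show "f (real i * d n) * indicator {real i * d n..<real (Suc i) * d n} s = 0"
      using that by (auto simp: indicator_def)
  qed
  have int_g: "(\<integral>s. g n s \<partial>lborel) = d n * (\<Sum>i<Suc n. f (real i * d n))" for n
  proof -
    have "(\<integral>s. g n s \<partial>lborel) = (\<Sum>i<Suc n. f (real i * d n) * (real (Suc i) * d n - real i * d n))"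
      unfolding g_def using d0[of n]
      by (subst Bochner_Integration.integral_sum) (auto simp: mult_right_mono simp del: sum_mult_indicator of_nat_Suc)
    also have "\<dots> = d n * (\<Sum>i<Suc n. f (real i * d n))"
      unfolding sum_distrib_left by (intro sum.cong refl) (simp add: algebra_simps)
    finally show ?thesis .
  qed
  have "(\<lambda>n. \<integral>s. g n s \<partial>lborel) \<longlonglongrightarrow> (\<integral>s. indicator {0..<A} s * f s \<partial>lborel)"
  proof (rule integral_dominated_convergence[where w="\<lambda>s. C * indicator {0..A} s"])
    have "set_borel_measurable borel {0..<A} f"
      unfolding set_borel_measurable_def
      by (rule borel_measurable_continuous_on_indicator) (auto intro: continuous_on_subset[OF f])
    then show "(\<lambda>s. indicator {0..<A} s * f s) \<in> borel_measurable lborel" by (simp add: set_borel_measurable_def)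
    show "g n \<in> borel_measurable lborel" for n unfolding g_def by (intro borel_measurable_sum) simp
    show "integrable lborel (\<lambda>s. C * indicator {0..A} s)"
      using A by (intro integrable_mult_right integrable_real_indicator) auto
    show "AE s in lborel. norm (g n s) \<le> C * indicator {0..A} s" for n
    proof (rule AE_I2)
      fix s
      show "norm (g n s) \<le> C * indicator {0..A} s"
      proof (cases "0 \<le> s \<and> s < A")
        case True
        have "real (nat \<lfloor>s / d n\<rfloor>) * d n \<in> {0..A}" using g_ix(1)[of s n] True d0[of n] by auto
        then show ?thesis using C True by (simp add: g_val)
      next
        case False
        then show ?thesis using g_out[of s n] C0 by auto
      qed
    qed
    show "AE s in lborel. (\<lambda>n. g n s) \<longlonglongrightarrow> indicator {0..<A} s * f s"
    proof (rule AE_I2)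
      fix s
      show "(\<lambda>n. g n s) \<longlonglongrightarrow> indicator {0..<A} s * f s"
      proof (cases "0 \<le> s \<and> s < A")
        case True
        have "(\<lambda>n. A * (1 / real (Suc n))) \<longlonglongrightarrow> A * 0" by (intro tendsto_intros LIMSEQ_Suc lim_1_over_n)
        then have "d \<longlonglongrightarrow> 0" by (simp add: d_def[abs_def])
        then have "(\<lambda>n. s - d n) \<longlonglongrightarrow> s - 0" by (intro tendsto_intros)
        then have dl: "(\<lambda>n. s - d n) \<longlonglongrightarrow> s" by simp
        have ix: "real (nat \<lfloor>s / d n\<rfloor>) * d n \<le> s" "s - d n \<le> real (nat \<lfloor>s / d n\<rfloor>) * d n" for n
          using g_ix True by blast+
        have l: "(\<lambda>n. real (nat \<lfloor>s / d n\<rfloor>) * d n) \<longlonglongrightarrow> s"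
          by (rule tendsto_sandwich[OF always_eventually always_eventually dl tendsto_const]) (use ix in blast)+
        have "(\<lambda>n. f (real (nat \<lfloor>s / d n\<rfloor>) * d n)) \<longlonglongrightarrow> f s"
        proof (rule continuous_on_tendsto_compose[OF f l])
          show "s \<in> {0..A}" using True by simp
          have "real (nat \<lfloor>s / d n\<rfloor>) * d n \<in> {0..A}" for n
            using ix(1)[of n] True d0[of n] by (auto intro: order_trans)
          then show "\<forall>\<^sub>F n in sequentially. real (nat \<lfloor>s / d n\<rfloor>) * d n \<in> {0..A}" by simp
        qed
        then show ?thesis using True by (simp add: g_val)
      next
        case False
        then show ?thesis using g_out[of s] by auto
      qed
    qed
  qed
  moreover have "(\<integral>s. indicator {0..<A} s * f s \<partial>lborel) = (LBINT s:{0..A}. f s)"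
    unfolding set_lebesgue_integral_def
  proof (rule integral_cong_AE)
    have "set_borel_measurable borel {0..<A} f" "set_borel_measurable borel {0..A} f"
      unfolding set_borel_measurable_def
      by (rule borel_measurable_continuous_on_indicator; auto intro: continuous_on_subset[OF f])+
    then show "(\<lambda>s. indicator {0..<A} s * f s) \<in> borel_measurable lborel" "(\<lambda>s. indicator {0..A} s *\<^sub>R f s) \<in> borel_measurable lborel"
      by (simp_all add: set_borel_measurable_def)
    show "AE s in lborel. indicator {0..<A} s * f s = indicator {0..A} s *\<^sub>R f s"
      using AE_lborel_singleton[of A] by eventually_elim (auto simp: indicator_def)
  qed
  ultimately show ?thesis unfolding int_g by (simp only: d_def)
qed

text \<open>Only countably many times occur on the right, which makes the event of convergence measurable.\<close>
lemma at_top_convergent_iff: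
  fixes f :: "real \<Rightarrow> real"
  assumes f: "continuous_on {0..} f"
  shows "(\<exists>l. (f \<longlongrightarrow> l) at_top) \<longleftrightarrow>
    (\<forall>k::nat. \<exists>n::nat. \<forall>p q::rat. real n \<le> of_rat p \<and> real n \<le> of_rat q \<longrightarrow> \<bar>f (of_rat p) - f (of_rat q)\<bar> \<le> 1 / real (Suc k))"
proof
  assume "\<exists>l. (f \<longlongrightarrow> l) at_top"
  then obtain l where l: "(f \<longlongrightarrow> l) at_top" by blast
  show "\<forall>k::nat. \<exists>n::nat. \<forall>p q::rat. real n \<le> of_rat p \<and> real n \<le> of_rat q \<longrightarrow> \<bar>f (of_rat p) - f (of_rat q)\<bar> \<le> 1 / real (Suc k)"
  proof
    fix k :: nat
    have "\<forall>\<^sub>F t in at_top. dist (f t) l < 1 / (2 * real (Suc k))" by (rule tendstoD[OF l]) simp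
    then obtain b where b: "\<And>t. t \<ge> b \<Longrightarrow> dist (f t) l < 1 / (2 * real (Suc k))" by (auto simp: eventually_at_top_linorder)
    show "\<exists>n::nat. \<forall>p q::rat. real n \<le> of_rat p \<and> real n \<le> of_rat q \<longrightarrow> \<bar>f (of_rat p) - f (of_rat q)\<bar> \<le> 1 / real (Suc k)"
    proof (intro exI[of _ "nat \<lceil>b\<rceil>"] allI impI)
      fix p q :: rat assume "real (nat \<lceil>b\<rceil>) \<le> of_rat p \<and> real (nat \<lceil>b\<rceil>) \<le> of_rat q"
      moreover have "b \<le> real (nat \<lceil>b\<rceil>)" by linarith
      ultimately have "dist (f (of_rat p)) l < 1 / (2 * real (Suc k))" "dist (f (of_rat q)) l < 1 / (2 * real (Suc k))"
        using b by (meson order_trans)+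
      then have "dist (f (of_rat p)) (f (of_rat q)) < 1 / (2 * real (Suc k)) + 1 / (2 * real (Suc k))"
        by (rule dist_triangle_less_add)
      also have "\<dots> = 1 / real (Suc k)" by (simp add: field_simps)
      finally show "\<bar>f (of_rat p) - f (of_rat q)\<bar> \<le> 1 / real (Suc k)" by (simp add: dist_real_def)
    qed
  qed
next
  assume R: "\<forall>k::nat. \<exists>n::nat. \<forall>p q::rat. real n \<le> of_rat p \<and> real n \<le> of_rat q \<longrightarrow> \<bar>f (of_rat p) - f (of_rat q)\<bar> \<le> 1 / real (Suc k)"
  have all: "\<exists>n::nat. \<forall>s t. real n < s \<and> real n < t \<longrightarrow> \<bar>f s - f t\<bar> \<le> 1 / real (Suc k)" for k
  proof -
    obtain n :: nat where n: "\<And>p q::rat. real n \<le> of_rat p \<Longrightarrow> real n \<le> of_rat q \<Longrightarrow> \<bar>f (of_rat p) - f (of_rat q)\<bar> \<le> 1 / real (Suc k)"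
      using R by blast
    \<comment> \<open>The rationals approach s from the right, so they stay above n.\<close>
    have approx: "\<exists>p::nat \<Rightarrow> rat. (\<forall>j. real n \<le> of_rat (p j)) \<and> (\<lambda>j. f (of_rat (p j))) \<longlonglongrightarrow> f s" if "real n < s" for s
    proof -
      have "\<exists>r::rat. s < of_rat r \<and> of_rat r < s + 1 / real (Suc j)" for j
        using of_rat_dense[of s "s + 1 / real (Suc j)"] by simp
      then obtain p where p: "\<And>j. s < of_rat (p j) \<and> of_rat (p j) < s + 1 / real (Suc j)" by metis
      have "(\<lambda>j. s + 1 / real (Suc j)) \<longlonglongrightarrow> s + 0" by (intro tendsto_intros LIMSEQ_Suc lim_1_over_n)
      then have u: "(\<lambda>j. s + 1 / real (Suc j)) \<longlonglongrightarrow> s" by simp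
      have ps: "(\<lambda>j. of_rat (p j) :: real) \<longlonglongrightarrow> s"
        by (rule tendsto_sandwich[OF always_eventually always_eventually tendsto_const u]) (use p less_imp_le in blast)+
      have "isCont f s"
      proof -
        have "continuous_on {real n<..} f" using f by (rule continuous_on_subset) auto
        then show ?thesis using that by (simp add: continuous_on_eq_continuous_at)
      qed
      then have "(\<lambda>j. f (of_rat (p j))) \<longlonglongrightarrow> f s" using ps by (rule isCont_tendsto_compose)
      moreover have "real n \<le> of_rat (p j)" for j using p[of j] that by linarith
      ultimately show ?thesis by blast
    qed
    show ?thesis
    proof (intro exI[of _ n] allI impI)
      fix s t assume "real n < s \<and> real n < t"
      then obtain p q :: "nat \<Rightarrow> rat" where pq: "\<And>j. real n \<le> of_rat (p j)" "(\<lambda>j. f (of_rat (p j))) \<longlonglongrightarrow> f s"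
        "\<And>j. real n \<le> of_rat (q j)" "(\<lambda>j. f (of_rat (q j))) \<longlonglongrightarrow> f t"
        using approx by meson
      have "(\<lambda>j. \<bar>f (of_rat (p j)) - f (of_rat (q j))\<bar>) \<longlonglongrightarrow> \<bar>f s - f t\<bar>" by (intro tendsto_intros pq)
      then show "\<bar>f s - f t\<bar> \<le> 1 / real (Suc k)" by (rule LIMSEQ_le_const2) (use n pq in auto)
    qed
  qed
  have small: "\<exists>k::nat. 1 / real (Suc k) < e" if "e > 0" for e :: real
    using reals_Archimedean[OF that] by (simp add: inverse_eq_divide)
  \<comment> \<open>Convergence along the integers gives the candidate limit; the oscillation bound
    then extends it to all real times.\<close>
  have "Cauchy (\<lambda>j::nat. f (real j))"
  proof (rule metric_CauchyI)
    fix e :: real assume "e > 0"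
    then obtain k where k: "1 / real (Suc k) < e" using small by blast
    obtain n :: nat where n: "\<And>s t. real n < s \<Longrightarrow> real n < t \<Longrightarrow> \<bar>f s - f t\<bar> \<le> 1 / real (Suc k)" using all by blast
    show "\<exists>M. \<forall>m\<ge>M. \<forall>j\<ge>M. dist (f (real m)) (f (real j)) < e"
    proof (intro exI[of _ "Suc n"] allI impI)
      fix m j assume "Suc n \<le> m" "Suc n \<le> j"
      then have "\<bar>f (real m) - f (real j)\<bar> \<le> 1 / real (Suc k)" by (intro n) auto
      then show "dist (f (real m)) (f (real j)) < e" using k by (simp only: dist_real_def)
    qed
  qed
  then obtain l where l: "(\<lambda>j::nat. f (real j)) \<longlonglongrightarrow> l" using Cauchy_convergent convergent_def by blast
  have "(f \<longlongrightarrow> l) at_top"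
  proof (rule tendstoI)
    fix e :: real assume "e > 0"
    then obtain k where k: "1 / real (Suc k) < e / 2" using small[of "e / 2"] by auto
    obtain n :: nat where n: "\<And>s t. real n < s \<Longrightarrow> real n < t \<Longrightarrow> \<bar>f s - f t\<bar> \<le> 1 / real (Suc k)" using all by blast
    have "\<bar>f t - l\<bar> \<le> 1 / real (Suc k)" if "real n < t" for t
    proof -
      have "(\<lambda>j. \<bar>f t - f (real j)\<bar>) \<longlonglongrightarrow> \<bar>f t - l\<bar>" by (intro tendsto_intros l)
      moreover have "\<forall>j\<ge>Suc n. \<bar>f t - f (real j)\<bar> \<le> 1 / real (Suc k)" using n that by simp
      ultimately show ?thesis by (intro LIMSEQ_le_const2) blast+
    qed
    then have lt: "dist (f t) l < e" if "real n < t" for t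
      using k \<open>e > 0\<close> that unfolding dist_real_def by fastforce
    show "\<forall>\<^sub>F t in at_top. dist (f t) l < e"
      using eventually_gt_at_top[of "real n"] by (rule eventually_mono) (rule lt)
  qed
  then show "\<exists>l. (f \<longlongrightarrow> l) at_top" ..
qed

text \<open>The Bochner integral of a function that is not measurable is 0 by convention, so
  \<open>eta_infinity\<close> has to be measurable also across divergent paths. There
  \<open>Lim\<close> has one fixed value, and the set of such paths is measurable by the countable
  criterion.\<close>

lemma measurable_Lim_at_top:
  fixes f :: "real \<Rightarrow> 'a \<Rightarrow> real"
  assumes m[measurable]: "\<And>t. f t \<in> borel_measurable M" and c: "\<And>\<omega>. \<omega> \<in> space M \<Longrightarrow> continuous_on {0..} (\<lambda>t. f t \<omega>)"
  shows "(\<lambda>\<omega>. Lim at_top (\<lambda>t. f t \<omega>)) \<in> borel_measurable M"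
proof -
  define P where "P \<omega> \<longleftrightarrow> (\<forall>k::nat. \<exists>n::nat. \<forall>p q::rat. real n \<le> of_rat p \<and> real n \<le> of_rat q \<longrightarrow> \<bar>f (of_rat p) \<omega> - f (of_rat q) \<omega>\<bar> \<le> 1 / real (Suc k))" for \<omega>
  have [measurable]: "Measurable.pred M P" unfolding P_def by measurable
  \<comment> \<open>\<open>THE x. False\<close> is the value of \<open>Lim\<close> on divergent paths.\<close>
  have eq: "Lim at_top (\<lambda>t. f t \<omega>) = (if P \<omega> then lim (\<lambda>n. f (real n) \<omega>) else (THE x. False))" if "\<omega> \<in> space M" for \<omega>
  proof (cases "P \<omega>")
    case True
    have "\<exists>l. ((\<lambda>t. f t \<omega>) \<longlongrightarrow> l) at_top"
      using True at_top_convergent_iff[OF c[OF that]] unfolding P_def by blast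
    then obtain l where l: "((\<lambda>t. f t \<omega>) \<longlongrightarrow> l) at_top" by blast
    have "(\<lambda>n. f (real n) \<omega>) \<longlonglongrightarrow> l" by (rule filterlim_compose[OF l filterlim_real_sequentially])
    then have "lim (\<lambda>n. f (real n) \<omega>) = l" by (rule limI)
    moreover have "Lim at_top (\<lambda>t. f t \<omega>) = l" by (rule tendsto_Lim[OF _ l]) simp
    ultimately show ?thesis using True by simp
  next
    case False
    then have "((\<lambda>t. f t \<omega>) \<longlongrightarrow> x) at_top \<longleftrightarrow> False" for x
      using at_top_convergent_iff[OF c[OF that]] unfolding P_def by blast
    then show ?thesis using False by (simp add: t2_space_class.Lim_def)
  qed
  have "(\<lambda>\<omega>. if P \<omega> then lim (\<lambda>n. f (real n) \<omega>) else (THE x. False)) \<in> borel_measurable M"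
    by (intro measurable_If borel_measurable_lim_metric m) auto
  then show ?thesis by (subst measurable_cong[OF eq])
qed

section \<open>Linear functionals of the path\<close>

context volterra_drift begin

text \<open>Lists admit repeated times and concatenation, which suits sums of several Riemann
  sums.\<close>

definition lin :: "(real \<times> real) list \<Rightarrow> 'a \<Rightarrow> real" where
  "lin L \<omega> = (\<Sum>(w, t)\<leftarrow>L. w * X t \<omega>)"

lemma lin_append: "lin (L @ L') \<omega> = lin L \<omega> + lin L' \<omega>"
  by (simp add: lin_def)

lemma lin_normal:
  assumes "\<And>w t. (w, t) \<in> set L \<Longrightarrow> t \<ge> 0"
  shows "\<exists>v. centered_normal M v (lin L)"
proof -
  have "lin L = (\<lambda>\<omega>. \<Sum>i\<in>{..<length L}. fst (L ! i) * X (snd (L ! i)) \<omega>)"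
    by (auto simp: lin_def sum_list_sum_nth atLeast0LessThan case_prod_beta fun_eq_iff)
  moreover have "snd (L ! i) \<ge> 0" if "i < length L" for i
    using assms[of "fst (L ! i)" "snd (L ! i)"] that by simp
  ultimately show ?thesis
    using lincomb_normal(1)[of "{..<length L}" "\<lambda>i. snd (L ! i)" "\<lambda>i. fst (L ! i)"] by auto
qed

lemma X_exp_cont:
  assumes "\<omega> \<in> space M"
  shows "continuous_on {0..} (\<lambda>s. exp (c * s) * X s \<omega>)"
  using X_continuous[OF assms] by (intro continuous_intros)

definition etaT :: "real \<Rightarrow> 'a \<Rightarrow> real" where
  "etaT t \<omega> = (LBINT s:{0..t}. exp (- \<theta> * s) * X s \<omega>)"

lemma set_integral_X':
  assumes "A \<subseteq> {0..}" "A \<in> sets borel"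
  shows "(LBINT s:A. f s * X s \<omega>) = (\<integral>s. indicator A s * (f s * X' s \<omega>) \<partial>lborel)"
  unfolding set_lebesgue_integral_def using assms(1)
  by (intro Bochner_Integration.integral_cong) (auto simp: indicator_def X'_def max_absorb2)

lemma etaT_measurable[measurable]: "etaT t \<in> borel_measurable M"
proof -
  have "(\<lambda>\<omega>. \<integral>s. indicator {0..t} s * (exp (- \<theta> * s) * X' s \<omega>) \<partial>lborel) \<in> borel_measurable M"
    by measurable
  then show ?thesis unfolding etaT_def[abs_def] by (subst set_integral_X') auto
qed

lemma expo_integral:
  assumes [measurable]: "f \<in> borel_measurable borel"
  shows "(\<integral>s. f s \<partial>expo) = (LBINT s:{0..}. \<theta> * exp (- \<theta> * s) * f s)"
  unfolding expo_def set_lebesgue_integral_def using \<theta>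
  by (subst integral_density) (auto simp: exponential_density_nonneg exponential_density_def indicator_def mult.commute intro!: Bochner_Integration.integral_cong)

lemma X'_borel:
  assumes "\<omega> \<in> space M"
  shows "(\<lambda>s. X' s \<omega>) \<in> borel_measurable borel"
  using assms by measurable

lemma mean_X_eq:
  assumes "\<omega> \<in> space M"
  shows "mean_X \<omega> = \<theta> * (LBINT s:{0..}. exp (- \<theta> * s) * X s \<omega>)"
proof -
  have "mean_X \<omega> = (LBINT s:{0..}. \<theta> * exp (- \<theta> * s) * X' s \<omega>)"
    unfolding mean_X_def by (rule expo_integral[OF X'_borel[OF assms]])
  also have "\<dots> = (LBINT s:{0..}. \<theta> * (exp (- \<theta> * s) * X s \<omega>))"
    by (rule set_lebesgue_integral_cong) (auto simp: X'_def max_absorb2)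
  finally show ?thesis by (simp add: set_integral_mult_right)
qed

text \<open>Reflection s = T - v; lags beyond T contribute nothing because the extended path is 0
  before time 0.\<close>

lemma innov_eq:
  assumes \<omega>: "\<omega> \<in> space M" and T: "T \<ge> 0"
  shows "innov T \<omega> = X T \<omega> - \<theta> * exp (- \<theta> * T) * (LBINT s:{0..T}. exp (\<theta> * s) * X s \<omega>)"
proof -
  note [measurable] = X'_borel[OF \<omega>]
  have "compact ((\<lambda>t. X' t \<omega>) ` {0..T})"
    by (intro compact_continuous_image X'_continuous \<omega>) simp
  then obtain C where C: "\<And>s. s \<in> {0..T} \<Longrightarrow> \<bar>X' s \<omega>\<bar> \<le> C"
    using compact_imp_bounded by (force simp: bounded_iff)
  define h where "h v = X' (T - max 0 v) \<omega>" for v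
  have hm[measurable]: "h \<in> borel_measurable borel" unfolding h_def by measurable
  have "\<bar>h v\<bar> \<le> max 0 C" for v
  proof (cases "max 0 v \<le> T")
    case True
    then show ?thesis using C[of "T - max 0 v"] by (auto simp: h_def)
  next
    case False
    then have "max 0 (T - max 0 v) = 0" by linarith
    then have "h v = X 0 \<omega>" by (simp only: h_def X'_def)
    then show ?thesis using X_0[OF \<omega>] by simp
  qed
  then have ih: "integrable expo h" by (intro expo.integrable_const_bound[of _ "max 0 C"]) auto
  have "innov T \<omega> = (\<integral>v. X T \<omega> - h v \<partial>expo)"
    unfolding innov_def using T by (intro Bochner_Integration.integral_cong) (auto simp: lag_incr_def h_def X'_def)
  also have "\<dots> = X T \<omega> - (\<integral>v. h v \<partial>expo)"
    using ih expo.prob_space by simp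
  also have "(\<integral>v. h v \<partial>expo) = (\<integral>v. indicator {0..} v * (\<theta> * exp (- \<theta> * v) * h v) \<partial>lborel)"
    by (subst expo_integral) (auto simp: set_lebesgue_integral_def)
  also have "\<dots> = \<bar>-1\<bar> * (\<integral>s. indicator {0..} (T + (-1) * s) * (\<theta> * exp (- \<theta> * (T + (-1) * s)) * h (T + (-1) * s)) \<partial>lborel)"
    by (subst lborel_integral_real_affine[where c="-1" and t=T]) auto
  also have "\<dots> = (\<integral>s. \<theta> * exp (- \<theta> * T) * (indicator {0..T} s * (exp (\<theta> * s) * X' s \<omega>)) \<partial>lborel)"
  proof -
    have "indicator {0..} (T + (-1) * s) * (\<theta> * exp (- \<theta> * (T + (-1) * s)) * h (T + (-1) * s))
        = \<theta> * exp (- \<theta> * T) * (indicator {0..T} s * (exp (\<theta> * s) * X' s \<omega>))" for s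
    proof (cases "0 \<le> s \<and> s \<le> T")
      case True
      have "exp (- \<theta> * (T + (-1) * s)) = exp (- \<theta> * T) * exp (\<theta> * s)"
        by (subst exp_add[symmetric]) (simp add: algebra_simps)
      then show ?thesis using True by (simp add: h_def indicator_def)
    next
      case False
      show ?thesis
      proof (cases "s > T")
        case True
        then show ?thesis by (auto simp: indicator_def)
      next
        case neg: False
        then have s: "s < 0" using False by auto
        have "h (T + (-1) * s) = 0" using s X_0[OF \<omega>] T by (simp add: h_def X'_def)
        then show ?thesis using s by (simp add: indicator_def)
      qed
    qed
    then show ?thesis by (simp only: abs_minus_cancel abs_one mult_1)
  qed
  also have "\<dots> = \<theta> * exp (- \<theta> * T) * (\<integral>s. indicator {0..T} s * (exp (\<theta> * s) * X' s \<omega>) \<partial>lborel)"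
    by (rule integral_mult_right_zero)
  also have "\<dots> = \<theta> * exp (- \<theta> * T) * (LBINT s:{0..T}. exp (\<theta> * s) * X s \<omega>)"
    by (subst set_integral_X') auto
  finally show ?thesis .
qed

text \<open>By Tonelli the path integral of exp(-\<delta> s) X(s)^2 has finite expectation, hence is
  finite almost surely.\<close>

lemma growth_AE:
  assumes \<delta>: "\<delta> > 0"
  shows "AE \<omega> in M. set_integrable lborel {0..} (\<lambda>s. exp (- (\<delta> * s)) * (1 + (X s \<omega>)\<^sup>2))"
proof -
  interpret P: pair_sigma_finite lborel M ..
  define w where "w s = (if 0 < s then ennreal (exp (- (\<delta> * s))) else 0)" for s
  have [measurable]: "w \<in> borel_measurable borel" unfolding w_def by measurable
  have "(\<integral>\<^sup>+\<omega>. \<integral>\<^sup>+s. w s * ennreal ((X' s \<omega>)\<^sup>2) \<partial>lborel \<partial>M) = (\<integral>\<^sup>+s. \<integral>\<^sup>+\<omega>. w s * ennreal ((X' s \<omega>)\<^sup>2) \<partial>M \<partial>lborel)"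
    by (rule P.Fubini') measurable
  also have "\<dots> = (\<integral>\<^sup>+s. w s * (\<integral>\<^sup>+\<omega>. ennreal ((X' s \<omega>)\<^sup>2) \<partial>M) \<partial>lborel)"
    by (intro nn_integral_cong nn_integral_cmult) measurable
  also have "\<dots> < \<infinity>" unfolding w_def by (rule X'_exp_second_moment[OF \<delta>])
  finally have "AE \<omega> in M. (\<integral>\<^sup>+s. w s * ennreal ((X' s \<omega>)\<^sup>2) \<partial>lborel) \<noteq> \<infinity>"
    by (intro nn_integral_PInf_AE) auto
  from AE_space this show ?thesis
  proof (eventually_elim, goal_cases)
    case (1 \<omega>)
      note [measurable] = X'_borel[OF 1(1)]
      have "(\<integral>\<^sup>+s. ennreal (indicator {0..} s * (exp (- (\<delta> * s)) * (1 + (X' s \<omega>)\<^sup>2))) \<partial>lborel)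
          = (\<integral>\<^sup>+s. w s + w s * ennreal ((X' s \<omega>)\<^sup>2) \<partial>lborel)"
      proof (rule nn_integral_cong_AE, use AE_lborel_singleton[of 0] in eventually_elim)
        case (elim s)
        have "ennreal (exp (- (\<delta> * s)) * (1 + (X' s \<omega>)\<^sup>2)) = ennreal (exp (- (\<delta> * s))) + ennreal (exp (- (\<delta> * s))) * ennreal ((X' s \<omega>)\<^sup>2)"
          by (simp add: ennreal_mult[symmetric] ennreal_plus[symmetric] distrib_left del: ennreal_plus)
        then show ?case using elim by (simp add: w_def indicator_def)
      qed
      also have "\<dots> = (\<integral>\<^sup>+s. w s \<partial>lborel) + (\<integral>\<^sup>+s. w s * ennreal ((X' s \<omega>)\<^sup>2) \<partial>lborel)"
        by (rule nn_integral_add) measurable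
      also have "\<dots> < \<infinity>"
        using 1 nn_integral_exp_decay[OF \<delta>] by (simp add: w_def less_top)
      finally have "integrable lborel (\<lambda>s. indicator {0..} s * (exp (- (\<delta> * s)) * (1 + (X' s \<omega>)\<^sup>2)))"
        by (intro integrableI_nonneg) (auto simp: indicator_def)
      also have "(\<lambda>s. indicator {0..} s * (exp (- (\<delta> * s)) * (1 + (X' s \<omega>)\<^sup>2))) = (\<lambda>s. indicator {0..} s *\<^sub>R (exp (- (\<delta> * s)) * (1 + (X s \<omega>)\<^sup>2)))"
        by (auto simp: indicator_def X'_def max_absorb2)
      finally show ?case by (simp add: set_integrable_def)
  qed
qed

end

locale volterra_langevin = volterra_drift +
  fixes Z :: "real \<Rightarrow> 'a \<Rightarrow> real"
  assumes Z: "langevin_solution M \<theta> X Z"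
begin

abbreviation \<delta> :: real where "\<delta> \<equiv> \<theta> / 16"

abbreviation w :: real where "w \<equiv> \<integral>\<omega>. (mean_X \<omega>)\<^sup>2 \<partial>M"

lemma langevin_paths: "\<omega> \<in> space M \<Longrightarrow> langevin_path (\<lambda>t. X t \<omega>) (\<lambda>t. Z t \<omega>) \<theta>"
  using Z X_continuous \<theta> by (auto simp: langevin_path_def langevin_solution_def)

lemma AE_langevin_path_growth: "AE \<omega> in M. langevin_path_growth (\<lambda>t. X t \<omega>) (\<lambda>t. Z t \<omega>) \<theta> \<delta>"
  using AE_space growth_AE[of \<delta>] \<theta>
  by (auto intro: langevin_paths simp: langevin_path_growth_def langevin_path_growth_axioms_def elim!: AE_mp intro!: AE_I2)

lemma etaT_limit: "AE \<omega> in M. ((\<lambda>t. etaT t \<omega>) \<longlongrightarrow> mean_X \<omega> / \<theta>) at_top"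
  using AE_space AE_langevin_path_growth
proof eventually_elim
  case (elim \<omega>)
  interpret L: langevin_path_growth "\<lambda>t. X t \<omega>" "\<lambda>t. Z t \<omega>" \<theta> \<delta> by (rule elim)
  have "L.eta = (\<lambda>t. etaT t \<omega>)" by (simp add: L.eta_def[abs_def] etaT_def)
  moreover have "L.eta_inf = mean_X \<omega> / \<theta>" using \<theta> by (simp add: L.eta_inf_def mean_X_eq[OF elim(1)])
  ultimately show ?case using L.eta_tendsto by simp
qed

lemma innov_measurable[measurable]: "innov T \<in> borel_measurable M"
  unfolding innov_def[abs_def] lag_incr_def by measurable

lemma mean_X_measurable[measurable]: "mean_X \<in> borel_measurable M"
  unfolding mean_X_def[abs_def] by measurable

text \<open>\<open>lin\<close> of this list is the left Riemann sum of k times the integral of exp(c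
  s) X(s) over [0, A].\<close>

definition riemann :: "real \<Rightarrow> real \<Rightarrow> real \<Rightarrow> nat \<Rightarrow> (real \<times> real) list" where
  "riemann k c A n = map (\<lambda>i. (k * (A / real (Suc n)) * exp (c * (real i * (A / real (Suc n)))), real i * (A / real (Suc n)))) [0..<Suc n]"

lemma riemann_times: "(r, t) \<in> set (riemann k c A n) \<Longrightarrow> 0 \<le> A \<Longrightarrow> 0 \<le> t"
  by (auto simp: riemann_def)

lemma lin_riemann_tendsto:
  assumes "\<omega> \<in> space M" "0 \<le> A"
  shows "(\<lambda>n. lin (riemann k c A n) \<omega>) \<longlonglongrightarrow> k * (LBINT s:{0..A}. exp (c * s) * X s \<omega>)"
proof -
  have "lin (riemann k c A n) \<omega> = k * (A / real (Suc n) * (\<Sum>i<Suc n. exp (c * (real i * (A / real (Suc n)))) * X (real i * (A / real (Suc n))) \<omega>))" for n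
    unfolding lin_def riemann_def sum_distrib_left interv_sum_list_conv_sum_set_nat[symmetric] atLeast0LessThan[symmetric] atLeastLessThan_upt[symmetric]
    by (simp add: sum_list_distinct_conv_sum_set comp_def mult.assoc atLeast0LessThan del: upt_Suc)
  then show ?thesis
    by (simp only:) (intro tendsto_mult tendsto_const riemann_sum_tendsto[OF continuous_on_subset[OF X_exp_cont[OF assms(1)]] assms(2)], auto)
qed

text \<open>Finite linear combinations of values of X are normal; the Riemann sums converge on every
  path, and normality passes to the limit.\<close>

lemma innov_etaT_normal:
  assumes T: "T \<ge> 0" "S \<ge> 0"
  shows "\<exists>v. centered_normal M v (\<lambda>\<omega>. a * innov T \<omega> + b * etaT S \<omega>)"
proof -
  \<comment> \<open>The three pieces approximate a X(T), the integral part of a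
    \<open>innov T\<close>, and b \<open>etaT S\<close>.\<close>
  define L where "L n = [(a, T)] @ riemann (- a * \<theta> * exp (- \<theta> * T)) \<theta> T n @ riemann b (- \<theta>) S n" for n
  have "\<exists>v. centered_normal M v (lin (L n))" for n
    by (rule lin_normal) (use T in \<open>auto simp: L_def dest: riemann_times\<close>)
  then obtain v where "\<And>n. centered_normal M (v n) (lin (L n))" by metis
  then show ?thesis
  proof (rule centered_normal_AE_limit)
    show "AE \<omega> in M. (\<lambda>n. lin (L n) \<omega>) \<longlonglongrightarrow> a * innov T \<omega> + b * etaT S \<omega>"
    proof (rule AE_I2)
      fix \<omega> assume \<omega>: "\<omega> \<in> space M"
      have "(\<lambda>n. a * X T \<omega> + (lin (riemann (- a * \<theta> * exp (- \<theta> * T)) \<theta> T n) \<omega> + lin (riemann b (- \<theta>) S n) \<omega>))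
        \<longlonglongrightarrow> a * X T \<omega> + ((- a * \<theta> * exp (- \<theta> * T)) * (LBINT s:{0..T}. exp (\<theta> * s) * X s \<omega>) + b * (LBINT s:{0..S}. exp (- \<theta> * s) * X s \<omega>))"
        by (intro tendsto_add tendsto_const lin_riemann_tendsto \<omega> T)
      moreover have "lin (L n) \<omega> = a * X T \<omega> + (lin (riemann (- a * \<theta> * exp (- \<theta> * T)) \<theta> T n) \<omega> + lin (riemann b (- \<theta>) S n) \<omega>)" for n
        unfolding L_def lin_append by (simp add: lin_def)
      ultimately show "(\<lambda>n. lin (L n) \<omega>) \<longlonglongrightarrow> a * innov T \<omega> + b * etaT S \<omega>"
        by (simp add: innov_eq[OF \<omega> T(1)] etaT_def algebra_simps)
    qed
  qed measurable
qed

text \<open>The second horizon is sent to infinity along the integers; the factor \<theta> converts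
  the limit of \<open>etaT\<close> into \<open>mean_X\<close>.\<close>

lemma innov_mean_X_normal:
  assumes T: "T \<ge> 0"
  shows "\<exists>v. centered_normal M v (\<lambda>\<omega>. a * innov T \<omega> + b * mean_X \<omega>)"
proof -
  have "\<exists>v. centered_normal M v (\<lambda>\<omega>. a * innov T \<omega> + (b * \<theta>) * etaT (real n) \<omega>)" for n
    by (rule innov_etaT_normal) (use T in auto)
  then obtain v where "\<And>n. centered_normal M (v n) (\<lambda>\<omega>. a * innov T \<omega> + (b * \<theta>) * etaT (real n) \<omega>)" by metis
  then show ?thesis
  proof (rule centered_normal_AE_limit)
    show "AE \<omega> in M. (\<lambda>n. a * innov T \<omega> + (b * \<theta>) * etaT (real n) \<omega>) \<longlonglongrightarrow> a * innov T \<omega> + b * mean_X \<omega>"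
      using etaT_limit
    proof eventually_elim
      case (elim \<omega>)
      have "(\<lambda>n. a * innov T \<omega> + (b * \<theta>) * etaT (real n) \<omega>) \<longlonglongrightarrow> a * innov T \<omega> + (b * \<theta>) * (mean_X \<omega> / \<theta>)"
        by (intro tendsto_intros filterlim_compose[OF elim filterlim_real_sequentially])
      then show ?case using \<theta> by simp
    qed
  qed measurable
qed

lemma innov_square_integrable: "T \<ge> 0 \<Longrightarrow> integrable M (\<lambda>\<omega>. (innov T \<omega>)\<^sup>2)"
  and mean_X_square_integrable: "integrable M (\<lambda>\<omega>. (mean_X \<omega>)\<^sup>2)"
  using innov_mean_X_normal[of T 1 0] innov_mean_X_normal[of 0 0 1] by (auto dest: centered_normal_moment(1))

lemma innov_mean_X_variance:
  assumes T: "T \<ge> 0"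
  shows "centered_normal M (a\<^sup>2 * (\<integral>\<omega>. (innov T \<omega>)\<^sup>2 \<partial>M) + 2 * a * b * (\<integral>\<omega>. innov T \<omega> * mean_X \<omega> \<partial>M) + b\<^sup>2 * w)
    (\<lambda>\<omega>. a * innov T \<omega> + b * mean_X \<omega>)"
proof -
  obtain v where v: "centered_normal M v (\<lambda>\<omega>. a * innov T \<omega> + b * mean_X \<omega>)" using innov_mean_X_normal[OF T] by blast
  note [simp] = innov_square_integrable[OF T] mean_X_square_integrable innov_mean_X_cov(1)[OF T]
  have "v = (\<integral>\<omega>. (a * innov T \<omega> + b * mean_X \<omega>)\<^sup>2 \<partial>M)" by (rule centered_normal_moment(2)[OF v, symmetric])
  also have "\<dots> = (\<integral>\<omega>. a\<^sup>2 * (innov T \<omega>)\<^sup>2 + 2 * a * b * (innov T \<omega> * mean_X \<omega>) + b\<^sup>2 * (mean_X \<omega>)\<^sup>2 \<partial>M)"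
    by (intro Bochner_Integration.integral_cong refl) (simp add: power2_eq_square algebra_simps)
  also have "\<dots> = a\<^sup>2 * (\<integral>\<omega>. (innov T \<omega>)\<^sup>2 \<partial>M) + 2 * a * b * (\<integral>\<omega>. innov T \<omega> * mean_X \<omega> \<partial>M) + b\<^sup>2 * w"
    by simp
  finally show ?thesis using v by simp
qed

text \<open>For jointly normal variables, subtracting the projection of \<open>p innov T\<close> on \<open>mean_X\<close> leaves
  a variable independent of \<open>mean_X\<close>, so the ratio is exactly Cauchy for every \<open>T\<close>.\<close>
lemma decorrelated_ratio_law:
  assumes T: "T \<ge> 0" and \<rho>: "\<rho> = p * (\<integral>\<omega>. innov T \<omega> * mean_X \<omega> \<partial>M) / w"
    and v: "v = p\<^sup>2 * (\<integral>\<omega>. (innov T \<omega>)\<^sup>2 \<partial>M) - \<rho>\<^sup>2 * w" "v > 0"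
  shows "distr M borel (\<lambda>\<omega>. (p * innov T \<omega> - \<rho> * mean_X \<omega>) / mean_X \<omega>) = cauchy_law (sqrt (v / w))"
proof (rule jointly_normal_ratio[OF _ v(2) mean_X_variance_pos])
  fix a b
  have c: "p * (\<integral>\<omega>. innov T \<omega> * mean_X \<omega> \<partial>M) = \<rho> * w" using mean_X_variance_pos by (simp add: \<rho>)
  have "(a * p)\<^sup>2 * (\<integral>\<omega>. (innov T \<omega>)\<^sup>2 \<partial>M) + 2 * (a * p) * (b - a * \<rho>) * (\<integral>\<omega>. innov T \<omega> * mean_X \<omega> \<partial>M) + (b - a * \<rho>)\<^sup>2 * w
      = a\<^sup>2 * (p\<^sup>2 * (\<integral>\<omega>. (innov T \<omega>)\<^sup>2 \<partial>M)) + 2 * a * (b - a * \<rho>) * (p * (\<integral>\<omega>. innov T \<omega> * mean_X \<omega> \<partial>M)) + (b - a * \<rho>)\<^sup>2 * w"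
    by (simp add: power_mult_distrib)
  also have "\<dots> = a\<^sup>2 * v + b\<^sup>2 * w" unfolding c v(1) by (simp add: power2_eq_square algebra_simps)
  finally have "centered_normal M (a\<^sup>2 * v + b\<^sup>2 * w) (\<lambda>\<omega>. (a * p) * innov T \<omega> + (b - a * \<rho>) * mean_X \<omega>)"
    using innov_mean_X_variance[OF T, of "a * p" "b - a * \<rho>"] by simp
  also have "(\<lambda>\<omega>. (a * p) * innov T \<omega> + (b - a * \<rho>) * mean_X \<omega>) = (\<lambda>\<omega>. a * (p * innov T \<omega> - \<rho> * mean_X \<omega>) + b * mean_X \<omega>)"
    by (simp add: algebra_simps)
  finally show "centered_normal M (a\<^sup>2 * v + b\<^sup>2 * w) (\<lambda>\<omega>. a * (p * innov T \<omega> - \<rho> * mean_X \<omega>) + b * mean_X \<omega>)" .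
qed

lemma mean_X_nonzero: "AE \<omega> in M. mean_X \<omega> \<noteq> 0"
proof -
  have "centered_normal M w mean_X" using innov_mean_X_variance[of 0 0 1] by simp
  from centered_normal_law[OF this mean_X_variance_pos]
  have d: "distr M lborel mean_X = density lborel (normal_density 0 (sqrt w))" by (simp add: distributed_def)
  have "AE x in density lborel (normal_density 0 (sqrt w)). x \<noteq> 0"
    by (subst AE_density) (use AE_lborel_singleton[of "0::real"] in auto)
  then have "AE x in distr M lborel mean_X. x \<noteq> 0" unfolding d .
  then show ?thesis by (subst (asm) AE_distr_iff) auto
qed

section \<open>Measurability of the solution and of the estimator\<close>

lemma Z_eq:
  assumes "\<omega> \<in> space M" "t \<ge> 0"
  shows "Z t \<omega> = \<theta> * exp (\<theta> * t) * etaT t \<omega> + X t \<omega>"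
proof -
  interpret L: langevin_path "\<lambda>t. X t \<omega>" "\<lambda>t. Z t \<omega>" \<theta> by (rule langevin_paths[OF assms(1)])
  show ?thesis using L.z_V[OF assms(2)] L.V_eta[OF assms(2)] by (simp add: L.eta_def etaT_def)
qed

text \<open>Measurability at a fixed time comes from the explicit solution in terms of X, joint
  measurability from the continuity of the paths.\<close>

lemma Z_measurable: "(\<lambda>(t, \<omega>). Z (max 0 t) \<omega>) \<in> borel_measurable (borel \<Otimes>\<^sub>M M)"
proof (rule measurable_continuous_process)
  fix t :: real
  have [measurable]: "X (max 0 t) \<in> borel_measurable M" by (rule X_measurable) simp
  have "(\<lambda>\<omega>. \<theta> * exp (\<theta> * max 0 t) * etaT (max 0 t) \<omega> + X (max 0 t) \<omega>) \<in> borel_measurable M" by measurable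
  then show "Z (max 0 t) \<in> borel_measurable M" by (subst measurable_cong[OF Z_eq]) auto
next
  fix \<omega> assume "\<omega> \<in> space M"
  then interpret L: langevin_path "\<lambda>t. X t \<omega>" "\<lambda>t. Z t \<omega>" \<theta> by (rule langevin_paths)
  show "continuous_on UNIV (\<lambda>t. Z (max 0 t) \<omega>)"
    by (rule continuous_on_compose2[OF L.z_cont, where f="\<lambda>t. max 0 t"]) (auto intro!: continuous_intros)
qed

lemma Z_measurable_compose:
  assumes "f \<in> borel_measurable N" "g \<in> measurable N M"
  shows "(\<lambda>x. Z (max 0 (f x)) (g x)) \<in> borel_measurable N"
  using measurable_compose[OF measurable_Pair[OF assms] Z_measurable] by simp

lemma theta_hat_measurable[measurable]: "theta_hat Z T \<in> borel_measurable M"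
proof (cases "T \<ge> 0")
  case True
  note [measurable (raw)] = Z_measurable_compose
  have "(LBINT s:{0..T}. (Z s \<omega>)\<^sup>2) = (\<integral>s. indicator {0..T} s * (Z (max 0 s) \<omega>)\<^sup>2 \<partial>lborel)" for \<omega>
    unfolding set_lebesgue_integral_def by (intro Bochner_Integration.integral_cong) (auto simp: indicator_def max_absorb2)
  then have "theta_hat Z T = (\<lambda>\<omega>. (Z (max 0 T) \<omega>)\<^sup>2 / (2 * (\<integral>s. indicator {0..T} s * (Z (max 0 s) \<omega>)\<^sup>2 \<partial>lborel)))"
    using True by (auto simp: theta_hat_def max_absorb2)
  also have "\<dots> \<in> borel_measurable M" by measurable
  finally show ?thesis .
next
  \<comment> \<open>A sequence tending to infinity may start with negative times. For T < 0 the
    denominator is an integral over the empty set, and division by 0 yields 0.\<close>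
  case False
  then have "theta_hat Z T = (\<lambda>_. 0)" by (auto simp: theta_hat_def set_lebesgue_integral_def)
  then show ?thesis by simp
qed

text \<open>\<open>eta_infinity\<close> agrees almost surely with \<open>mean_X\<close> / \<theta>,
  which ties the scale of the limit law to w.\<close>

lemma eta_infinity_second_moment: "(\<integral>\<omega>. (eta_infinity \<theta> X \<omega>)\<^sup>2 \<partial>M) = w / \<theta>\<^sup>2"
proof -
  have e: "eta_infinity \<theta> X = (\<lambda>\<omega>. Lim at_top (\<lambda>t. etaT t \<omega>))" by (simp add: eta_infinity_def[abs_def] etaT_def)
  have "eta_infinity \<theta> X \<in> borel_measurable M"
    unfolding e
  proof (rule measurable_Lim_at_top)
    fix \<omega> assume \<omega>: "\<omega> \<in> space M"
    interpret L: langevin_path "\<lambda>t. X t \<omega>" "\<lambda>t. Z t \<omega>" \<theta> by (rule langevin_paths[OF \<omega>])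
    have "continuous_on {0..} (\<lambda>t. exp (- \<theta> * t) * L.V t)" by (intro continuous_intros L.V_cont)
    then show "continuous_on {0..} (\<lambda>t. etaT t \<omega>)"
      by (rule continuous_on_eq) (simp add: L.V_eta L.eta_def etaT_def exp_minus)
  qed measurable
  moreover have "AE \<omega> in M. eta_infinity \<theta> X \<omega> = mean_X \<omega> / \<theta>"
    using etaT_limit by eventually_elim (simp add: e tendsto_Lim)
  ultimately have "(\<integral>\<omega>. (eta_infinity \<theta> X \<omega>)\<^sup>2 \<partial>M) = (\<integral>\<omega>. (mean_X \<omega> / \<theta>)\<^sup>2 \<partial>M)"
    by (intro integral_cong_AE) auto
  then show ?thesis by (simp add: power_divide)
qed

end

section \<open>The limit theorem\<close>

lemma sqrt_powr_double: "0 < x \<Longrightarrow> sqrt (x powr (2 * a)) = x powr a"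
  for x a :: real
  by (rule real_sqrt_unique) (simp_all add: power2_eq_square powr_add[symmetric])

text \<open>Meant for differences of characteristic functions, whose almost sure ingredients are
  controlled only along subsequences.\<close>

lemma LIMSEQ_by_subsubseq:
  fixes D :: "nat \<Rightarrow> 'b :: real_normed_vector"
  assumes "\<And>r :: nat \<Rightarrow> nat. strict_mono r \<Longrightarrow> \<exists>r' :: nat \<Rightarrow> nat. strict_mono r' \<and> (\<lambda>n. D (r (r' n))) \<longlonglongrightarrow> 0"
  shows "D \<longlonglongrightarrow> 0"
proof (rule ccontr)
  assume "\<not> D \<longlonglongrightarrow> 0"
  then obtain e where e: "e > 0" "\<not> eventually (\<lambda>n. norm (D n) < e) sequentially"
    by (auto simp: tendsto_iff)
  then have "infinite {n. norm (D n) \<ge> e}"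
    unfolding infinite_nat_iff_unbounded_le eventually_sequentially by (force simp: not_less)
  then obtain r :: "nat \<Rightarrow> nat" where r: "strict_mono r" "\<And>n. norm (D (r n)) \<ge> e"
    using infinite_enumerate by blast
  obtain r' where "(\<lambda>n. D (r (r' n))) \<longlonglongrightarrow> 0" using assms[OF r(1)] by blast
  from order_tendstoD(2)[OF tendsto_norm_zero[OF this] e(1)] show False
    using r(2) by (auto simp: eventually_sequentially not_less[symmetric])
qed

section \<open>Convergence of characteristic functions\<close>

context volterra_langevin begin

text \<open>The ratio is the constant \<rho> plus an exactly Cauchy variable of scale sqrt (v/w).
  Its characteristic function is therefore a phase times that of the standard Cauchy law at a scaled
  argument; \<rho> tends to 0, v tends to c^2, and the function is continuous.\<close>

lemma char_innov_ratio_tendsto: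
  assumes \<tau>: "\<forall>\<^sub>F n in sequentially. \<tau> n \<ge> 0"
    and var: "(\<lambda>n. (p n)\<^sup>2 * (\<integral>\<omega>. (innov (\<tau> n) \<omega>)\<^sup>2 \<partial>M)) \<longlonglongrightarrow> c\<^sup>2" and c: "c > 0"
    and cov: "(\<lambda>n. p n * (\<integral>\<omega>. innov (\<tau> n) \<omega> * mean_X \<omega> \<partial>M)) \<longlonglongrightarrow> 0"
  shows "(\<lambda>n. char (distr M borel (\<lambda>\<omega>. k * (p n * innov (\<tau> n) \<omega> / mean_X \<omega>))) u) \<longlonglongrightarrow> char (cauchy_law (k * (c / sqrt w))) u"
proof -
  interpret C: real_distribution "cauchy_law 1" by (rule real_distribution_cauchy_law)
  define \<rho> where "\<rho> n = p n * (\<integral>\<omega>. innov (\<tau> n) \<omega> * mean_X \<omega> \<partial>M) / w" for n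
  define v where "v n = (p n)\<^sup>2 * (\<integral>\<omega>. (innov (\<tau> n) \<omega>)\<^sup>2 \<partial>M) - (\<rho> n)\<^sup>2 * w" for n
  have \<rho>: "\<rho> \<longlonglongrightarrow> 0" using tendsto_divide[OF cov tendsto_const[of w]] mean_X_variance_pos by (simp add: \<rho>_def[abs_def])
  have "v \<longlonglongrightarrow> c\<^sup>2 - 0\<^sup>2 * w" unfolding v_def by (intro tendsto_intros var \<rho>)
  then have v: "v \<longlonglongrightarrow> c\<^sup>2" by simp
  have "(\<lambda>n. sqrt (v n / w)) \<longlonglongrightarrow> sqrt (c\<^sup>2 / w)"
    using mean_X_variance_pos by (intro tendsto_intros v) auto
  then have s: "(\<lambda>n. sqrt (v n / w) * (u * k)) \<longlonglongrightarrow> c / sqrt w * (u * k)"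
    using c by (intro tendsto_intros) (simp add: real_sqrt_divide)
  have eq: "char (distr M borel (\<lambda>\<omega>. k * (p n * innov (\<tau> n) \<omega> / mean_X \<omega>))) u
      = iexp (u * k * \<rho> n) * char (cauchy_law 1) (sqrt (v n / w) * (u * k))" if n: "\<tau> n \<ge> 0" "v n > 0" for n
  proof -
    have "char (distr M borel (\<lambda>\<omega>. k * (p n * innov (\<tau> n) \<omega> / mean_X \<omega>))) u = (CLINT \<omega>|M. iexp (u * (k * (p n * innov (\<tau> n) \<omega> / mean_X \<omega>))))"
      by (rule char_distr) measurable
    also have "\<dots> = (CLINT \<omega>|M. iexp (u * k * \<rho> n) * iexp ((u * k) * ((p n * innov (\<tau> n) \<omega> - \<rho> n * mean_X \<omega>) / mean_X \<omega>)))"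
    proof (rule integral_cong_AE)
      show "AE \<omega> in M. iexp (u * (k * (p n * innov (\<tau> n) \<omega> / mean_X \<omega>))) = iexp (u * k * \<rho> n) * iexp ((u * k) * ((p n * innov (\<tau> n) \<omega> - \<rho> n * mean_X \<omega>) / mean_X \<omega>))"
        using mean_X_nonzero
      proof eventually_elim
        case (elim \<omega>)
        then have "u * (k * (p n * innov (\<tau> n) \<omega> / mean_X \<omega>)) = u * k * \<rho> n + (u * k) * ((p n * innov (\<tau> n) \<omega> - \<rho> n * mean_X \<omega>) / mean_X \<omega>)"
          by (simp add: field_simps)
        then show ?case by (simp only: of_real_add distrib_left exp_add)
      qed
    qed measurable
    also have "\<dots> = iexp (u * k * \<rho> n) * (CLINT \<omega>|M. iexp ((u * k) * ((p n * innov (\<tau> n) \<omega> - \<rho> n * mean_X \<omega>) / mean_X \<omega>)))"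
      by (rule integral_mult_right_zero)
    also have "(CLINT \<omega>|M. iexp ((u * k) * ((p n * innov (\<tau> n) \<omega> - \<rho> n * mean_X \<omega>) / mean_X \<omega>)))
        = char (distr M borel (\<lambda>\<omega>. (p n * innov (\<tau> n) \<omega> - \<rho> n * mean_X \<omega>) / mean_X \<omega>)) (u * k)"
      by (rule char_distr[symmetric]) measurable
    also have "distr M borel (\<lambda>\<omega>. (p n * innov (\<tau> n) \<omega> - \<rho> n * mean_X \<omega>) / mean_X \<omega>) = cauchy_law (sqrt (v n / w))"
      by (rule decorrelated_ratio_law[OF n(1) \<rho>_def v_def n(2)])
    also have "char (cauchy_law (sqrt (v n / w))) (u * k) = char (cauchy_law 1) (sqrt (v n / w) * (u * k))"
      by (rule char_cauchy_law)
    finally show ?thesis .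
  qed
  have "(\<lambda>n. iexp (u * k * \<rho> n) * char (cauchy_law 1) (sqrt (v n / w) * (u * k))) \<longlonglongrightarrow> iexp (u * k * 0) * char (cauchy_law 1) (c / sqrt w * (u * k))"
    by (intro tendsto_intros \<rho> isCont_tendsto_compose[OF C.isCont_char s])
  \<comment> \<open>v n is eventually positive because its limit c^2 is.\<close>
  moreover have "\<forall>\<^sub>F n in sequentially. iexp (u * k * \<rho> n) * char (cauchy_law 1) (sqrt (v n / w) * (u * k)) = char (distr M borel (\<lambda>\<omega>. k * (p n * innov (\<tau> n) \<omega> / mean_X \<omega>))) u"
    using \<tau> order_tendstoD(1)[OF v zero_less_power[OF c]]
    by eventually_elim (rule eq[symmetric])
  ultimately have "(\<lambda>n. char (distr M borel (\<lambda>\<omega>. k * (p n * innov (\<tau> n) \<omega> / mean_X \<omega>))) u) \<longlonglongrightarrow> iexp (u * k * 0) * char (cauchy_law 1) (c / sqrt w * (u * k))"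
    by (rule Lim_transform_eventually)
  then show ?thesis by (subst char_cauchy_law) (simp add: mult_ac)
qed

text \<open>exp(-\<delta> t) X(t) tends to 0 in mean square since the second moment is a power of t;
  a subsequence tends to 0 almost surely and is eventually at most 1 in absolute value.\<close>

lemma X_subexponential_subseq:
  assumes \<tau>: "filterlim \<tau> at_top sequentially"
  shows "\<exists>r::nat \<Rightarrow> nat. strict_mono r \<and> (AE \<omega> in M. \<forall>\<^sub>F n in sequentially. \<bar>X' (\<tau> (r n)) \<omega>\<bar> \<le> exp (\<delta> * \<tau> (r n)))"
proof -
  have "\<exists>r::nat \<Rightarrow> nat. strict_mono r \<and> (AE \<omega> in M. (\<lambda>n. (exp (- (\<delta> * \<tau> (r n))) * X' (\<tau> (r n)) \<omega>)\<^sup>2) \<longlonglongrightarrow> 0)"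
  proof (rule tendsto_L1_AE_subseq)
    have i: "integrable M (\<lambda>\<omega>. (X' t \<omega>)\<^sup>2)" for t unfolding X'_def by (rule X_square_integrable) simp
    then show "integrable M (\<lambda>\<omega>. (exp (- (\<delta> * \<tau> n)) * X' (\<tau> n) \<omega>)\<^sup>2)" for n
      by (simp add: power_mult_distrib)
    have "(\<lambda>n. R1 * (exp (- (2 * \<delta> * \<tau> n)) * \<tau> n powr var_exp)) \<longlonglongrightarrow> R1 * 0"
      using \<theta> by (intro tendsto_mult tendsto_const filterlim_compose[OF exp_powr_decay \<tau>]) auto
    moreover have "\<forall>\<^sub>F n in sequentially. \<tau> n \<ge> 0" using \<tau> by (simp add: filterlim_at_top)
    then have "\<forall>\<^sub>F n in sequentially. R1 * (exp (- (2 * \<delta> * \<tau> n)) * \<tau> n powr var_exp) = (\<integral>\<omega>. norm ((exp (- (\<delta> * \<tau> n)) * X' (\<tau> n) \<omega>)\<^sup>2) \<partial>M)"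
    proof eventually_elim
      case (elim n)
      have "(\<integral>\<omega>. norm ((exp (- (\<delta> * \<tau> n)) * X' (\<tau> n) \<omega>)\<^sup>2) \<partial>M) = (exp (- (\<delta> * \<tau> n)))\<^sup>2 * (\<integral>\<omega>. (X' (\<tau> n) \<omega>)\<^sup>2 \<partial>M)"
        by (simp add: power_mult_distrib)
      also have "(\<integral>\<omega>. (X' (\<tau> n) \<omega>)\<^sup>2 \<partial>M) = \<tau> n powr var_exp * R1"
        using X_second_moment[OF elim] elim by (simp add: X'_def max_absorb2)
      also have "(exp (- (\<delta> * \<tau> n)))\<^sup>2 = exp (- (2 * \<delta> * \<tau> n))" by (simp add: exp_double[symmetric])
      finally show ?case by (simp add: mult_ac)
    qed
    ultimately have "(\<lambda>n. \<integral>\<omega>. norm ((exp (- (\<delta> * \<tau> n)) * X' (\<tau> n) \<omega>)\<^sup>2) \<partial>M) \<longlonglongrightarrow> R1 * 0"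
      by (rule Lim_transform_eventually)
    then show "(\<lambda>n. \<integral>\<omega>. norm ((exp (- (\<delta> * \<tau> n)) * X' (\<tau> n) \<omega>)\<^sup>2) \<partial>M) \<longlonglongrightarrow> 0" by simp
  qed
  then obtain r :: "nat \<Rightarrow> nat" where r: "strict_mono r" "AE \<omega> in M. (\<lambda>n. (exp (- (\<delta> * \<tau> (r n))) * X' (\<tau> (r n)) \<omega>)\<^sup>2) \<longlonglongrightarrow> 0"
    by blast
  have "AE \<omega> in M. \<forall>\<^sub>F n in sequentially. \<bar>X' (\<tau> (r n)) \<omega>\<bar> \<le> exp (\<delta> * \<tau> (r n))"
    using r(2)
  proof eventually_elim
    case (elim \<omega>)
    have "\<forall>\<^sub>F n in sequentially. (exp (- (\<delta> * \<tau> (r n))) * X' (\<tau> (r n)) \<omega>)\<^sup>2 < 1"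
      by (rule order_tendstoD(2)[OF elim]) simp
    then show ?case
    proof eventually_elim
      case (elim n)
      then have "\<bar>exp (- (\<delta> * \<tau> (r n))) * X' (\<tau> (r n)) \<omega>\<bar> \<le> 1" by (simp add: abs_square_less_1 less_imp_le)
      then show ?case by (simp add: abs_mult exp_minus field_simps)
    qed
  qed
  with r(1) show ?thesis by blast
qed

text \<open>The deterministic expansion on almost every path; 2 / eta_inf becomes 2 \<theta> /
  \<open>mean_X\<close>.\<close>

lemma estimator_error_AE_limit:
  assumes \<tau>: "filterlim \<tau> at_top sequentially"
    and X: "AE \<omega> in M. \<forall>\<^sub>F n in sequentially. \<bar>X' (\<tau> n) \<omega>\<bar> \<le> exp (\<delta> * \<tau> n)"
    and p: "\<forall>\<^sub>F n in sequentially. 0 \<le> p n \<and> p n \<le> exp (\<delta> * \<tau> n)"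
  shows "AE \<omega> in M. (\<lambda>n. p n * exp (\<theta> * \<tau> n) * (theta_hat Z (\<tau> n) \<omega> - \<theta>) - 2 * \<theta> * (p n * innov (\<tau> n) \<omega> / mean_X \<omega>)) \<longlonglongrightarrow> 0"
  using AE_space AE_langevin_path_growth mean_X_nonzero X
proof eventually_elim
  case (elim \<omega>)
  interpret L: langevin_path_growth "\<lambda>t. X t \<omega>" "\<lambda>t. Z t \<omega>" \<theta> \<delta> by (rule elim)
  have eta: "L.eta_inf = mean_X \<omega> / \<theta>" using \<theta> by (simp add: L.eta_inf_def mean_X_eq[OF elim(1)])
  have "\<forall>\<^sub>F n in sequentially. \<tau> n \<ge> 0" using \<tau> by (simp add: filterlim_at_top)
  then have "\<forall>\<^sub>F n in sequentially. 0 \<le> \<tau> n \<and> \<bar>X (\<tau> n) \<omega>\<bar> \<le> exp (\<delta> * \<tau> n) \<and> 0 \<le> p n \<and> p n \<le> exp (\<delta> * \<tau> n)"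
    using elim(4) p by eventually_elim (auto simp: X'_def max_absorb2)
  then obtain N where N: "\<And>n. 0 \<le> \<tau> (n + N) \<and> \<bar>X (\<tau> (n + N)) \<omega>\<bar> \<le> exp (\<delta> * \<tau> (n + N)) \<and> 0 \<le> p (n + N) \<and> p (n + N) \<le> exp (\<delta> * \<tau> (n + N))"
    unfolding eventually_sequentially by (meson le_add2)
  \<comment> \<open>The deterministic statement asks for its bounds at every index, so the sequence
    is shifted by N, which depends on the path.\<close>
  have "(\<lambda>n. p (n + N) * exp (\<theta> * \<tau> (n + N)) * ((Z (\<tau> (n + N)) \<omega>)\<^sup>2 / (2 * (LBINT s:{0..\<tau> (n + N)}. (Z s \<omega>)\<^sup>2)) - \<theta>)
      - 2 * p (n + N) * L.U (\<tau> (n + N)) / L.eta_inf) \<longlonglongrightarrow> 0"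
    by (rule L.estimator_error_limit[of "\<lambda>n. \<tau> (n + N)" "\<lambda>n. p (n + N)"])
       (use N elim(3) \<theta> eta in \<open>auto intro!: filterlim_compose[OF \<tau> filterlim_add_const_nat_at_top]\<close>)
  moreover have "L.U (\<tau> (n + N)) = innov (\<tau> (n + N)) \<omega>" for n
    using innov_eq[OF elim(1), of "\<tau> (n + N)"] N[of n] by (simp add: L.U_def)
  ultimately have "(\<lambda>n. p (n + N) * exp (\<theta> * \<tau> (n + N)) * (theta_hat Z (\<tau> (n + N)) \<omega> - \<theta>)
      - 2 * \<theta> * (p (n + N) * innov (\<tau> (n + N)) \<omega> / mean_X \<omega>)) \<longlonglongrightarrow> 0"
    unfolding eta theta_hat_def by (simp add: mult_ac)
  then show ?case by (rule LIMSEQ_offset)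
qed

text \<open>Levy continuity. The characteristic functions of the estimator and of the limiting ratio
  differ by \<open>D n\<close>, which tends to 0: every subsequence has a further one along which
  the two variables approach each other almost surely, and bounded convergence applies.\<close>

lemma estimator_weak_limit:
  assumes \<tau>: "filterlim \<tau> at_top sequentially"
    and p: "\<forall>\<^sub>F n in sequentially. 0 \<le> p n \<and> p n \<le> exp (\<delta> * \<tau> n)"
    and var: "(\<lambda>n. (p n)\<^sup>2 * (\<integral>\<omega>. (innov (\<tau> n) \<omega>)\<^sup>2 \<partial>M)) \<longlonglongrightarrow> c\<^sup>2" and c: "c > 0"
    and cov: "(\<lambda>n. p n * (\<integral>\<omega>. innov (\<tau> n) \<omega> * mean_X \<omega> \<partial>M)) \<longlonglongrightarrow> 0"
  shows "weak_conv_m (\<lambda>n. distr M borel (\<lambda>\<omega>. p n * exp (\<theta> * \<tau> n) * (theta_hat Z (\<tau> n) \<omega> - \<theta>)))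
    (cauchy_law (2 * c / sqrt (\<integral>\<omega>. (eta_infinity \<theta> X \<omega>)\<^sup>2 \<partial>M)))"
proof (rule levy_continuity)
  define Y where "Y n \<omega> = p n * exp (\<theta> * \<tau> n) * (theta_hat Z (\<tau> n) \<omega> - \<theta>)" for n \<omega>
  define R where "R n \<omega> = 2 * \<theta> * (p n * innov (\<tau> n) \<omega> / mean_X \<omega>)" for n \<omega>
  have [measurable]: "Y n \<in> borel_measurable M" "R n \<in> borel_measurable M" for n
    unfolding Y_def[abs_def] R_def[abs_def] by measurable
  show "real_distribution (distr M borel (\<lambda>\<omega>. p n * exp (\<theta> * \<tau> n) * (theta_hat Z (\<tau> n) \<omega> - \<theta>)))" for n
    by (rule real_distribution_distr) measurable
  show "real_distribution (cauchy_law (2 * c / sqrt (\<integral>\<omega>. (eta_infinity \<theta> X \<omega>)\<^sup>2 \<partial>M)))"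
    by (rule real_distribution_cauchy_law)
  fix u
  \<comment> \<open>The second moment of \<open>eta_infinity\<close> is w / \<theta>^2, so its root
    brings a factor \<theta> into the numerator.\<close>
  have k: "2 * c / sqrt (\<integral>\<omega>. (eta_infinity \<theta> X \<omega>)\<^sup>2 \<partial>M) = 2 * \<theta> * (c / sqrt w)"
    using \<theta> by (simp add: eta_infinity_second_moment real_sqrt_divide)
  have "\<forall>\<^sub>F n in sequentially. \<tau> n \<ge> 0" using \<tau> by (simp add: filterlim_at_top)
  from char_innov_ratio_tendsto[OF this var c cov, of "2 * \<theta>" u]
  have lim: "(\<lambda>n. char (distr M borel (R n)) u) \<longlonglongrightarrow> char (cauchy_law (2 * \<theta> * (c / sqrt w))) u"
    by (simp add: R_def[abs_def])
  define D where "D n = (CLINT \<omega>|M. iexp (u * Y n \<omega>) - iexp (u * R n \<omega>))" for n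
  have int: "integrable M (\<lambda>\<omega>. iexp (f \<omega>))" if "f \<in> borel_measurable M" for f
    using that by (intro integrable_const_bound[of _ 1]) auto
  have D: "D n = char (distr M borel (Y n)) u - char (distr M borel (R n)) u" for n
    unfolding D_def by (subst Bochner_Integration.integral_diff[OF int int]) (simp_all add: char_distr)
  have "D \<longlonglongrightarrow> 0"
  proof (rule LIMSEQ_by_subsubseq)
    fix r :: "nat \<Rightarrow> nat" assume r: "strict_mono r"
    have "filterlim (\<lambda>n. \<tau> (r n)) at_top sequentially"
      by (rule filterlim_compose[OF \<tau> filterlim_subseq[OF r]])
    then obtain r' :: "nat \<Rightarrow> nat" where r': "strict_mono r'"
      and X: "AE \<omega> in M. \<forall>\<^sub>F n in sequentially. \<bar>X' (\<tau> (r (r' n))) \<omega>\<bar> \<le> exp (\<delta> * \<tau> (r (r' n)))"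
      using X_subexponential_subseq by blast
    have s: "filterlim (\<lambda>n. r (r' n)) sequentially sequentially"
      by (rule filterlim_compose[OF filterlim_subseq[OF r] filterlim_subseq[OF r']])
    have "AE \<omega> in M. (\<lambda>n. Y (r (r' n)) \<omega> - R (r (r' n)) \<omega>) \<longlonglongrightarrow> 0"
      unfolding Y_def R_def
      by (rule estimator_error_AE_limit[OF filterlim_compose[OF \<tau> s] X eventually_compose_filterlim[OF p s]])
    then have "AE \<omega> in M. (\<lambda>n. iexp (u * Y (r (r' n)) \<omega>) - iexp (u * R (r (r' n)) \<omega>)) \<longlonglongrightarrow> 0"
    proof eventually_elim
      case (elim \<omega>)
      show ?case
      proof (rule Lim_null_comparison)
        show "\<forall>\<^sub>F n in sequentially. cmod (iexp (u * Y (r (r' n)) \<omega>) - iexp (u * R (r (r' n)) \<omega>)) \<le> \<bar>u\<bar> * \<bar>Y (r (r' n)) \<omega> - R (r (r' n)) \<omega>\<bar>"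
          by (intro always_eventually allI order_trans[OF norm_iexp_diff_le]) (simp add: abs_mult right_diff_distrib[symmetric])
        show "(\<lambda>n. \<bar>u\<bar> * \<bar>Y (r (r' n)) \<omega> - R (r (r' n)) \<omega>\<bar>) \<longlonglongrightarrow> 0"
          using tendsto_mult_right_zero[OF tendsto_rabs_zero[OF elim]] by simp
      qed
    qed
    then have "(\<lambda>n. D (r (r' n))) \<longlonglongrightarrow> (CLINT \<omega>|M. 0)"
      unfolding D_def
    proof (rule integral_dominated_convergence[where w="\<lambda>_. 2", rotated 3])
      show "AE \<omega> in M. cmod (iexp (u * Y (r (r' n)) \<omega>) - iexp (u * R (r (r' n)) \<omega>)) \<le> 2" for n
        by (intro AE_I2 order_trans[OF norm_triangle_ineq4]) simp
    qed auto
    then show "\<exists>r'. strict_mono r' \<and> (\<lambda>n. D (r (r' n))) \<longlonglongrightarrow> 0" using r' by auto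
  qed
  from tendsto_add[OF this lim] have "(\<lambda>n. char (distr M borel (Y n)) u) \<longlonglongrightarrow> char (cauchy_law (2 * \<theta> * (c / sqrt w))) u"
    by (simp add: D)
  then show "(\<lambda>n. char (distr M borel (\<lambda>\<omega>. p n * exp (\<theta> * \<tau> n) * (theta_hat Z (\<tau> n) \<omega> - \<theta>))) u)
      \<longlonglongrightarrow> char (cauchy_law (2 * c / sqrt (\<integral>\<omega>. (eta_infinity \<theta> X \<omega>)\<^sup>2 \<partial>M))) u"
    unfolding k Y_def .
qed

text \<open>The three cases differ only in the factor h of the variance. The normalisation p is the
  inverse square root of the variance order; h \<ge> 1 bounds it by a power of T, hence eventually
  by exp(\<delta> T), as the pathwise expansion requires.\<close>

lemma estimator_conv_in_distr:
  assumes h: "\<And>T. T \<ge> T\<^sub>0 \<Longrightarrow> h T \<ge> 1" and T\<^sub>0: "T\<^sub>0 \<ge> 1"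
    and var: "\<And>\<tau>. filterlim \<tau> at_top sequentially \<Longrightarrow> (\<And>n. \<tau> n \<ge> T\<^sub>0) \<Longrightarrow>
      (\<lambda>n. (\<integral>\<omega>. (innov (\<tau> n) \<omega>)\<^sup>2 \<partial>M) / (\<tau> n powr (2 * \<beta> + \<kappa>) * h (\<tau> n))) \<longlonglongrightarrow> c\<^sup>2"
    and c: "c > 0" and p: "\<And>T. T \<ge> T\<^sub>0 \<Longrightarrow> p T = 1 / sqrt (T powr (2 * \<beta> + \<kappa>) * h T)"
  shows "conv_in_distr_at_top M (\<lambda>T \<omega>. p T * exp (\<theta> * T) * (theta_hat Z T \<omega> - \<theta>))
    (cauchy_law (2 * c / sqrt (\<integral>\<omega>. (eta_infinity \<theta> X \<omega>)\<^sup>2 \<partial>M)))"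
  unfolding conv_in_distr_at_top_def
proof (intro allI impI)
  fix \<tau> :: "nat \<Rightarrow> real" assume \<tau>: "filterlim \<tau> at_top sequentially"
  then have "\<forall>\<^sub>F n in sequentially. \<tau> n \<ge> T\<^sub>0" by (simp add: filterlim_at_top)
  \<comment> \<open>Finitely many early times may lie below \<open>T\<^sub>0\<close>; limits are
    taken for the shifted sequence and carried back.\<close>
  then obtain N where N: "\<And>n. \<tau> (n + N) \<ge> T\<^sub>0" unfolding eventually_sequentially by (meson le_add2)
  have \<tau>N: "filterlim (\<lambda>n. \<tau> (n + N)) at_top sequentially"
    by (rule filterlim_compose[OF \<tau> filterlim_add_const_nat_at_top])
  define S where "S T = T powr (2 * \<beta> + \<kappa>) * h T" for T
  have S: "S T \<ge> T powr (2 * \<beta> + \<kappa>)" "S T > 0" if "T \<ge> T\<^sub>0" for T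
  proof -
    have "T powr (2 * \<beta> + \<kappa>) * 1 \<le> S T" unfolding S_def using h[OF that] by (intro mult_left_mono) auto
    then show "S T \<ge> T powr (2 * \<beta> + \<kappa>)" by simp
    moreover have "T powr (2 * \<beta> + \<kappa>) > 0" using that T\<^sub>0 by simp
    ultimately show "S T > 0" by linarith
  qed
  show "weak_conv_m (\<lambda>n. distr M borel (\<lambda>\<omega>. p (\<tau> n) * exp (\<theta> * \<tau> n) * (theta_hat Z (\<tau> n) \<omega> - \<theta>)))
    (cauchy_law (2 * c / sqrt (\<integral>\<omega>. (eta_infinity \<theta> X \<omega>)\<^sup>2 \<partial>M)))"
  proof (rule estimator_weak_limit[OF \<tau> _ _ c])
    have "((\<lambda>T. exp (- (\<delta> * T)) * T powr (- ((2 * \<beta> + \<kappa>) / 2))) \<longlongrightarrow> 0) at_top"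
      using \<theta> by (intro exp_powr_decay) simp
    from order_tendstoD(2)[OF filterlim_compose[OF this \<tau>], of 1]
    have "\<forall>\<^sub>F n in sequentially. exp (- (\<delta> * \<tau> n)) * \<tau> n powr (- ((2 * \<beta> + \<kappa>) / 2)) < 1" by simp
    then show "\<forall>\<^sub>F n in sequentially. 0 \<le> p (\<tau> n) \<and> p (\<tau> n) \<le> exp (\<delta> * \<tau> n)"
      using \<open>\<forall>\<^sub>F n in sequentially. \<tau> n \<ge> T\<^sub>0\<close>
    proof eventually_elim
      case (elim n)
      have t: "\<tau> n > 0" using elim T\<^sub>0 by linarith
      have "p (\<tau> n) = 1 / sqrt (S (\<tau> n))" by (simp add: p elim S_def)
      also have "\<dots> \<le> 1 / sqrt (\<tau> n powr (2 * \<beta> + \<kappa>))"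
        using S[OF elim(2)] t by (intro divide_left_mono) auto
      also have "sqrt (\<tau> n powr (2 * \<beta> + \<kappa>)) = \<tau> n powr ((2 * \<beta> + \<kappa>) / 2)"
        using t by (simp add: powr_half_sqrt[symmetric] powr_powr)
      also have "1 / \<tau> n powr ((2 * \<beta> + \<kappa>) / 2) = \<tau> n powr (- ((2 * \<beta> + \<kappa>) / 2))"
        by (simp only: powr_minus_divide)
      also have "\<dots> \<le> exp (\<delta> * \<tau> n)" using elim(1) by (simp add: exp_minus field_simps)
      finally have "p (\<tau> n) \<le> exp (\<delta> * \<tau> n)" .
      moreover have "0 \<le> p (\<tau> n)" using S[OF elim(2)] by (simp add: p[OF elim(2)] S_def)
      ultimately show ?case by blast
    qed
    have "(\<lambda>n. (p (\<tau> (n + N)))\<^sup>2 * (\<integral>\<omega>. (innov (\<tau> (n + N)) \<omega>)\<^sup>2 \<partial>M)) \<longlonglongrightarrow> c\<^sup>2"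
    proof -
      have "(p (\<tau> (n + N)))\<^sup>2 = 1 / S (\<tau> (n + N))" for n
        using S[OF N[of n]] by (simp add: p[OF N] S_def power_divide)
      then show ?thesis using var[OF \<tau>N N] by (simp add: S_def)
    qed
    then show "(\<lambda>n. (p (\<tau> n))\<^sup>2 * (\<integral>\<omega>. (innov (\<tau> n) \<omega>)\<^sup>2 \<partial>M)) \<longlonglongrightarrow> c\<^sup>2" by (rule LIMSEQ_offset)
    have "(\<lambda>n. p (\<tau> (n + N)) * (\<integral>\<omega>. innov (\<tau> (n + N)) \<omega> * mean_X \<omega> \<partial>M)) \<longlonglongrightarrow> 0"
      using innov_mean_X_cov_limit[OF \<tau>N order_trans[OF T\<^sub>0 N] S(1)[OF N]] by (simp add: p[OF N] S_def)
    then show "(\<lambda>n. p (\<tau> n) * (\<integral>\<omega>. innov (\<tau> n) \<omega> * mean_X \<omega> \<partial>M)) \<longlonglongrightarrow> 0" by (rule LIMSEQ_offset)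
  qed
qed

section \<open>The three normalisations\<close>

lemma sigma_const_pos: "\<gamma> < - 1/2 \<Longrightarrow> sigma_const \<gamma> > 0"
  unfolding sigma_const_def using \<gamma> by (auto intro!: divide_pos_pos mult_pos_pos Gamma_real_pos)

lemma varsigma_const_pos: "\<gamma> > - 1/2 \<Longrightarrow> varsigma_const \<alpha> \<gamma> > 0"
  unfolding varsigma_const_def using \<alpha> by (auto intro!: divide_pos_pos mult_pos_pos Gamma_real_pos)

text \<open>With h(T) = T^(-(2\<gamma>+1)) the exponent 2\<beta> + \<kappa> becomes
  2(\<alpha>+\<beta>), and c^2 = \<sigma>^2 \<theta>^(-(2\<gamma>+3)) explains the power \<gamma> +
  3/2 of \<theta>.\<close>

lemma conv_singular:
  assumes g: "\<gamma> < - 1/2"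
  shows "conv_in_distr_at_top M (\<lambda>T \<omega>. exp (\<theta> * T) / T powr (\<alpha> + \<beta>) * (theta_hat Z T \<omega> - \<theta>))
    (cauchy_law (2 * sigma_const \<gamma> / (\<theta> powr (\<gamma> + 3/2) * sqrt (\<integral>\<omega>. (eta_infinity \<theta> X \<omega>)\<^sup>2 \<partial>M))))"
proof -
  define c where "c = sigma_const \<gamma> / \<theta> powr (\<gamma> + 3/2)"
  have "conv_in_distr_at_top M (\<lambda>T \<omega>. 1 / T powr (\<alpha> + \<beta>) * exp (\<theta> * T) * (theta_hat Z T \<omega> - \<theta>))
    (cauchy_law (2 * c / sqrt (\<integral>\<omega>. (eta_infinity \<theta> X \<omega>)\<^sup>2 \<partial>M)))"
  proof (rule estimator_conv_in_distr[where h="\<lambda>T. T powr (- (2 * \<gamma> + 1))" and T\<^sub>0=1])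
    show "1 \<le> T powr (- (2 * \<gamma> + 1))" if "1 \<le> T" for T using that g by (intro ge_one_powr_ge_zero) auto
    show "c > 0" using sigma_const_pos[OF g] \<theta> by (simp add: c_def)
    have "(\<theta> powr (\<gamma> + 3/2))\<^sup>2 = \<theta> powr (2 * \<gamma> + 2 + 1)"
      using \<theta> by (simp add: power2_eq_square powr_add[symmetric] add_ac)
    also have "\<dots> = \<theta> powr (2 * \<gamma> + 2) * \<theta>" using \<theta> by (subst powr_add) simp
    finally have "c\<^sup>2 = (sigma_const \<gamma>)\<^sup>2 * \<theta> powr (- (2 * \<gamma> + 2)) / \<theta>"
      by (simp only: c_def power_divide powr_minus_divide) simp
    then show "(\<lambda>n. (\<integral>\<omega>. (innov (\<tau> n) \<omega>)\<^sup>2 \<partial>M) / (\<tau> n powr (2 * \<beta> + \<kappa>) * \<tau> n powr (- (2 * \<gamma> + 1)))) \<longlonglongrightarrow> c\<^sup>2"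
      if "filterlim \<tau> at_top sequentially" "\<And>n. 1 \<le> \<tau> n" for \<tau>
      using innov_variance_singular[OF g that] by (simp only:)
    fix T :: real assume "1 \<le> T"
    then have "sqrt (T powr (2 * \<beta> + \<kappa>) * T powr (- (2 * \<gamma> + 1))) = sqrt (T powr (2 * (\<alpha> + \<beta>)))"
      by (simp add: powr_add[symmetric] algebra_simps)
    also have "\<dots> = T powr (\<alpha> + \<beta>)" using \<open>1 \<le> T\<close> by (intro sqrt_powr_double) simp
    finally show "1 / T powr (\<alpha> + \<beta>) = 1 / sqrt (T powr (2 * \<beta> + \<kappa>) * T powr (- (2 * \<gamma> + 1)))" by simp
  qed simp
  then show ?thesis by (simp add: c_def)
qed

text \<open>For \<gamma> = -1/2 the degree \<kappa> equals 2\<alpha>, so the power is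
  2(\<alpha>+\<beta>) and the logarithm is the only extra factor.\<close>

lemma conv_log:
  assumes g: "\<gamma> = - 1/2"
  shows "conv_in_distr_at_top M (\<lambda>T \<omega>. exp (\<theta> * T) / (T powr (\<alpha> + \<beta>) * sqrt (ln T)) * (theta_hat Z T \<omega> - \<theta>))
    (cauchy_law (2 / (\<theta> * sqrt (\<integral>\<omega>. (eta_infinity \<theta> X \<omega>)\<^sup>2 \<partial>M))))"
proof -
  have "conv_in_distr_at_top M (\<lambda>T \<omega>. 1 / (T powr (\<alpha> + \<beta>) * sqrt (ln T)) * exp (\<theta> * T) * (theta_hat Z T \<omega> - \<theta>))
    (cauchy_law (2 * (1 / \<theta>) / sqrt (\<integral>\<omega>. (eta_infinity \<theta> X \<omega>)\<^sup>2 \<partial>M)))"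
  proof (rule estimator_conv_in_distr[where h=ln and T\<^sub>0="exp 1"])
    show "1 \<le> ln T" if "exp 1 \<le> T" for T :: real using that by (subst ln_ge_iff) (auto intro: less_le_trans[OF exp_gt_zero])
    show "1 / \<theta> > 0" using \<theta> by simp
    show "(\<lambda>n. (\<integral>\<omega>. (innov (\<tau> n) \<omega>)\<^sup>2 \<partial>M) / (\<tau> n powr (2 * \<beta> + \<kappa>) * ln (\<tau> n))) \<longlonglongrightarrow> (1 / \<theta>)\<^sup>2"
      if "filterlim \<tau> at_top sequentially" "\<And>n. exp 1 \<le> \<tau> n" for \<tau>
      using innov_variance_log[OF g that] by (simp only: power2_eq_square times_divide_times_eq mult_1 divide_divide_eq_left)
    fix T :: real assume "exp 1 \<le> T"
    then have T: "T > 0" by (auto intro: less_le_trans[OF exp_gt_zero])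
    have "sqrt (T powr (2 * \<beta> + \<kappa>) * ln T) = sqrt (T powr (2 * (\<alpha> + \<beta>))) * sqrt (ln T)"
      using g by (simp add: real_sqrt_mult algebra_simps)
    also have "sqrt (T powr (2 * (\<alpha> + \<beta>))) = T powr (\<alpha> + \<beta>)" by (rule sqrt_powr_double[OF T])
    finally show "1 / (T powr (\<alpha> + \<beta>) * sqrt (ln T)) = 1 / sqrt (T powr (2 * \<beta> + \<kappa>) * ln T)" by simp
  qed simp
  then show ?thesis by simp
qed

text \<open>No extra factor: half of 2\<beta> + \<kappa> is \<alpha> + \<beta> + \<gamma> + 1/2, and
  the two factors 1/\<theta> of the variance become one under the root.\<close>

lemma conv_smooth:
  assumes g: "\<gamma> > - 1/2"
  shows "conv_in_distr_at_top M (\<lambda>T \<omega>. exp (\<theta> * T) / T powr (\<alpha> + \<beta> + \<gamma> + 1/2) * (theta_hat Z T \<omega> - \<theta>))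
    (cauchy_law (2 * varsigma_const \<alpha> \<gamma> / (\<theta> * sqrt (\<integral>\<omega>. (eta_infinity \<theta> X \<omega>)\<^sup>2 \<partial>M))))"
proof -
  have "conv_in_distr_at_top M (\<lambda>T \<omega>. 1 / T powr (\<alpha> + \<beta> + \<gamma> + 1/2) * exp (\<theta> * T) * (theta_hat Z T \<omega> - \<theta>))
    (cauchy_law (2 * (varsigma_const \<alpha> \<gamma> / \<theta>) / sqrt (\<integral>\<omega>. (eta_infinity \<theta> X \<omega>)\<^sup>2 \<partial>M)))"
  proof (rule estimator_conv_in_distr[where h="\<lambda>_. 1" and T\<^sub>0=1])
    show "varsigma_const \<alpha> \<gamma> / \<theta> > 0" using \<theta> varsigma_const_pos[OF g] by simp
    show "(\<lambda>n. (\<integral>\<omega>. (innov (\<tau> n) \<omega>)\<^sup>2 \<partial>M) / (\<tau> n powr (2 * \<beta> + \<kappa>) * 1)) \<longlonglongrightarrow> (varsigma_const \<alpha> \<gamma> / \<theta>)\<^sup>2"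
      if "filterlim \<tau> at_top sequentially" "\<And>n. 1 \<le> \<tau> n" for \<tau>
      using innov_variance_smooth[OF g that] by (simp only: power2_eq_square times_divide_times_eq divide_divide_eq_left)
    fix T :: real assume "1 \<le> T"
    then have "T powr (\<alpha> + \<beta> + \<gamma> + 1/2) = sqrt (T powr (2 * \<beta> + \<kappa>) * 1)"
      by (simp add: powr_half_sqrt[symmetric] powr_powr add_divide_distrib algebra_simps)
    then show "1 / T powr (\<alpha> + \<beta> + \<gamma> + 1/2) = 1 / sqrt (T powr (2 * \<beta> + \<kappa>) * 1)" by simp
  qed simp_all
  then show ?thesis by simp
qed

end

theorem theorem4p3:
  fixes M :: "'a measure"
    and W X Z :: "real \<Rightarrow> 'a \<Rightarrow> real"
    and \<alpha> \<beta> \<gamma> \<theta> :: real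
  assumes "\<alpha> > - 1/2" and "\<gamma> > - 1" and "\<alpha> + \<beta> + \<gamma> > - 3/2" and "\<theta> > 0"
    and "standard_wiener M W"
    and "continuous_volterra_process M W \<alpha> \<beta> \<gamma> X"
    and "langevin_solution M \<theta> X Z"
  shows "(\<gamma> \<in> {- 1<..<- 1/2} \<longrightarrow>
            conv_in_distr_at_top M
              (\<lambda>T \<omega>. exp (\<theta> * T) / T powr (\<alpha> + \<beta>) * (theta_hat Z T \<omega> - \<theta>))
              (cauchy_law (2 * sigma_const \<gamma> /
                 (\<theta> powr (\<gamma> + 3/2) * sqrt (\<integral>\<omega>. (eta_infinity \<theta> X \<omega>)\<^sup>2 \<partial>M)))))
       \<and> (\<gamma> = - 1/2 \<longrightarrow>
            conv_in_distr_at_top M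
              (\<lambda>T \<omega>. exp (\<theta> * T) / (T powr (\<alpha> + \<beta>) * sqrt (ln T)) * (theta_hat Z T \<omega> - \<theta>))
              (cauchy_law (2 / (\<theta> * sqrt (\<integral>\<omega>. (eta_infinity \<theta> X \<omega>)\<^sup>2 \<partial>M)))))
       \<and> (\<gamma> > - 1/2 \<longrightarrow>
            conv_in_distr_at_top M
              (\<lambda>T \<omega>. exp (\<theta> * T) / T powr (\<alpha> + \<beta> + \<gamma> + 1/2) * (theta_hat Z T \<omega> - \<theta>))
              (cauchy_law (2 * varsigma_const \<alpha> \<gamma> /
                 (\<theta> * sqrt (\<integral>\<omega>. (eta_infinity \<theta> X \<omega>)\<^sup>2 \<partial>M)))))"
proof -
  interpret volterra_langevin \<alpha> \<beta> \<gamma> M W X \<theta> Z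
    using assms by unfold_locales auto
  show ?thesis using conv_singular conv_log conv_smooth by auto
qed

end
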